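(* For every complex manifold $U$ and every $k\ge 0$, the assignment $\mathbf{Ch}(U)_k:\mathbf{HVB}(U)_k\to\mathbf{\Omega}(U)_k$ described in the context is well defined (i.e. it really produces chain maps $N(\mathbb Z\Delta^k)\to \Omega^\bullet_{hol}(U)[u]^{\bullet\le 0}$), and these assignments give a map of simplicial presheaves $\mathbf{Ch}:\mathbf{HVB}\to\mathbf{\Omega}$, i.e. a natural transformation of functors from $\mathbb{C}\mathcal{M}an^{op}$ to (large) simplicial sets.
   Context: $\mathbb{C}\mathcal{M}an$ is the category of complex manifolds and holomorphic maps. $\mathbf{HVB}$: for a complex manifold $U$, $\mathcal{HVB}^\nabla(U)$ is the groupoid whose objects are finite rank holomorphic vector bundles $E\to U$ with a holomorphic connection $\nabla_E$, and whose morphisms $E_0\to E_1$ are all holomorphic bundle isomorphisms (over $\mathrm{id}_U$), not required to respect the connections. Pullback along holomorphic maps makes this a contravariant functor (pullbacks are treated as strictly functorial). $\mathbf{HVB}(U)$ is the nerve of $\mathcal{HVB}^\nabla(U)$. $\mathbf{\Omega}$: $\Omega^\bullet_{hol}(U)$ is the graded algebra of holomorphic differential forms, viewed as a cochain complex with zero differential. Let $u$ be a formal variable of degree $-2$; $\Omega^\bullet_{hol}(U)[u]^{\bullet\le0}$ is the quotient of $\Omega^\bullet_{hol}(U)\otimes\mathbb Z[u]$ by all elements of positive degree (a non-positively graded complex with zero differential). $N(\mathbb Z\Delta^k)$ is the normalized chain complex of the standard simplex, placed in non-positive degrees: in degree $-\ell$ it is free abelian on generators $e_{i_0,\dots,i_\ell}$,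 $0\le i_0<\dots<i_\ell\le k$, with $d(e_{i_0,\dots,i_\ell})=\sum_{j=0}^\ell(-1)^je_{i_0,\dots,\widehat{i_j},\dots,i_\ell}$. For a non-positively graded cochain complex $C$, the Dold-Kan simplicial set $\underline{DK}(C)$ has as $k$-simplices the chain maps $N(\mathbb Z\Delta^k)\to C$, with simplicial structure by precomposition. Put $\mathbf{\Omega}(U)=\underline{DK}(\Omega^\bullet_{hol}(U)[u]^{\bullet\le0})$; it is contravariant in $U$ by pullback of forms. $\mathbf{Ch}$: a $k$-simplex of $\mathbf{HVB}(U)$ is a sequence $E_0\xrightarrow{f_1}E_1\to\dots\xrightarrow{f_k}E_k$ of bundles with connections $\nabla_{E_i}$ and isomorphisms. For $p<q$ let $\tilde f_{q,p}=f_q\circ\dots\circ f_{p+1}:E_p\to E_q$, and let $\nabla_{q,p}$ be the connection on $Hom(E_p,E_q)$ induced by $\nabla_{E_p},\nabla_{E_q}$. $\mathbf{Ch}(U)_k$ sends this simplex to the map with $e_i\mapsto\dim(E_i)$ (fiber dimension, as a $0$-form) and, for $\ell>0$, $$e_{i_0,\dots,i_\ell}\mapsto \mathrm{tr}\Big(\tilde f_{i_\ell,i_0}^{-1}\circ\nabla_{i_\ell,i_{\ell-1}}(\tilde f_{i_\ell,i_{\ell-1}})\circ\dots\circ\nabla_{i_1,i_0}(\tilde f_{i_1,i_0})\Big)\cdot u^\ell .$$ *)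

theory Defs
  imports
    "HOL-Analysis.Analysis"
    "HOL-Algebra.Free_Abelian_Groups"
    "HOL-Algebra.Module"
    "HOL-Combinatorics.Permutations"
begin

section \<open>Holomorphic functions on open subsets of complex n-space\<close>

text \<open>Complex n-space is the set of sequences supported below n. The product topology of
  \<^typ>\<open>nat \<Rightarrow> complex\<close> induces the Euclidean topology on it. This also covers n = 0 and lets
  n vary from chart to chart.\<close>

definition Cn :: "nat \<Rightarrow> (nat \<Rightarrow> complex) set" where
  "Cn n = {z. \<forall>i\<ge>n. z i = 0}"

definition unit_vec :: "nat \<Rightarrow> nat \<Rightarrow> complex" where
  "unit_vec j = (\<lambda>i. if i = j then 1 else 0)"

text \<open>Meant for S open in Cn n: holomorphic means continuous and holomorphic in each variable.\<close>

definition holo_on :: "nat \<Rightarrow> (nat \<Rightarrow> complex) set \<Rightarrow> ((nat \<Rightarrow> complex) \<Rightarrow> complex) \<Rightarrow> bool" where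
  "holo_on n S f \<longleftrightarrow>
     continuous_on S f \<and>
     (\<forall>z\<in>S. \<forall>i<n. (\<lambda>\<zeta>. f (z(i := \<zeta>))) field_differentiable at (z i))"

definition partial_deriv :: "nat \<Rightarrow> ((nat \<Rightarrow> complex) \<Rightarrow> complex) \<Rightarrow> (nat \<Rightarrow> complex) \<Rightarrow> complex" where
  "partial_deriv i f z = deriv (\<lambda>\<zeta>. f (z(i := \<zeta>))) (z i)"


section \<open>Complex manifolds and holomorphic maps\<close>

text \<open>A chart consists of its dimension, its domain and the coordinate map.\<close>

type_synonym 'a chart = "nat \<times> 'a set \<times> ('a \<Rightarrow> nat \<Rightarrow> complex)"

record 'a cman =
  mtop :: "'a topology"
  atlas :: "'a chart set"

definition points :: "'a cman \<Rightarrow> 'a set" where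
  "points U = topspace (mtop U)"

definition complex_manifold :: "'a cman \<Rightarrow> bool" where
  "complex_manifold U \<longleftrightarrow>
     Hausdorff_space (mtop U) \<and> second_countable (mtop U) \<and>
     (\<forall>(n, D, \<phi>) \<in> atlas U.
        openin (mtop U) D \<and>
        openin (top_of_set (Cn n)) (\<phi> ` D) \<and>
        homeomorphic_map (subtopology (mtop U) D) (top_of_set (\<phi> ` D)) \<phi>) \<and>
     (\<Union>(n, D, \<phi>) \<in> atlas U. D) = points U \<and>
     (\<forall>(n, D, \<phi>) \<in> atlas U. \<forall>(m, D', \<psi>) \<in> atlas U. \<forall>j<m.
        holo_on n (\<phi> ` (D \<inter> D')) (\<lambda>z. \<psi> (inv_into D \<phi> z) j))"

text \<open>Morphisms are extensional functions, so that the identity of U is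
  \<open>restrict id (points U)\<close> and composition is \<^const>\<open>compose\<close>.\<close>

definition hol_maps :: "'a cman \<Rightarrow> 'b cman \<Rightarrow> ('a \<Rightarrow> 'b) set" where
  "hol_maps U V = {g \<in> extensional (points U).
     continuous_map (mtop U) (mtop V) g \<and>
     (\<forall>(n, D, \<phi>) \<in> atlas U. \<forall>(m, D', \<psi>) \<in> atlas V. \<forall>j<m.
        holo_on n (\<phi> ` {x \<in> D. g x \<in> D'}) (\<lambda>z. \<psi> (g (inv_into D \<phi> z)) j))}"

text \<open>Holomorphic functions on an open subset W of U.\<close>

definition hol_fun :: "'a cman \<Rightarrow> 'a set \<Rightarrow> ('a \<Rightarrow> complex) \<Rightarrow> bool" where
  "hol_fun U W h \<longleftrightarrow>
     (\<forall>(n, D, \<phi>) \<in> atlas U. holo_on n (\<phi> ` (D \<inter> W)) (\<lambda>z. h (inv_into D \<phi> z)))"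

definition hol_near :: "'a cman \<Rightarrow> 'a \<Rightarrow> ('a \<Rightarrow> complex) \<Rightarrow> bool" where
  "hol_near U x h \<longleftrightarrow> (\<exists>W. openin (mtop U) W \<and> x \<in> W \<and> hol_fun U W h)"


section \<open>Holomorphic tangent vectors and holomorphic forms\<close>

text \<open>The holomorphic tangent space at x is spanned by the coordinate derivations at x, acting on
  functions that are holomorphic near x (value 0 on all other functions).\<close>

type_synonym 'a tvec = "('a \<Rightarrow> complex) \<Rightarrow> complex"

fun coord_vec :: "'a cman \<Rightarrow> 'a chart \<Rightarrow> 'a \<Rightarrow> nat \<Rightarrow> 'a tvec" where
  "coord_vec U (n, D, \<phi>) x i =
     (\<lambda>h. if hol_near U x h then partial_deriv i (\<lambda>z. h (inv_into D \<phi> z)) (\<phi> x) else 0)"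

definition tangent :: "'a cman \<Rightarrow> 'a \<Rightarrow> 'a tvec set" where
  "tangent U x =
     {v. \<exists>(n, D, \<phi>) \<in> atlas U. x \<in> D \<and>
           (\<exists>c. v = (\<lambda>h. \<Sum>i<n. c i * coord_vec U (n, D, \<phi>) x i h))}"

definition tlin :: "complex \<Rightarrow> 'a tvec \<Rightarrow> complex \<Rightarrow> 'a tvec \<Rightarrow> 'a tvec" where
  "tlin a v b w = (\<lambda>h. a * v h + b * w h)"

text \<open>The differential of g at x.\<close>

definition push :: "'b cman \<Rightarrow> ('a \<Rightarrow> 'b) \<Rightarrow> 'a \<Rightarrow> 'a tvec \<Rightarrow> 'b tvec" where
  "push V g x v = (\<lambda>h. if hol_near V (g x) h then v (\<lambda>y. h (g y)) else 0)"

text \<open>A p-form assigns to each point x an alternating multilinear function of p tangent vectors at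
  x; it is 0 on lists that are not lists of p tangent vectors at x.\<close>

type_synonym 'a form = "'a \<Rightarrow> 'a tvec list \<Rightarrow> complex"

definition hol_forms :: "'a cman \<Rightarrow> nat \<Rightarrow> 'a form set" where
  "hol_forms U p = {\<omega>.
     (\<forall>x vs. \<not> (x \<in> points U \<and> length vs = p \<and> set vs \<subseteq> tangent U x) \<longrightarrow> \<omega> x vs = 0) \<and>
     (\<forall>x \<in> points U. \<forall>vs. length vs = p \<and> set vs \<subseteq> tangent U x \<longrightarrow>
        (\<forall>i<p. \<forall>v \<in> tangent U x. \<forall>w \<in> tangent U x. \<forall>a b.
           \<omega> x (vs[i := tlin a v b w]) = a * \<omega> x (vs[i := v]) + b * \<omega> x (vs[i := w])) \<and>
        (\<forall>i<p. \<forall>j<p. i \<noteq> j \<and> vs ! i = vs ! j \<longrightarrow> \<omega> x vs = 0)) \<and>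
     (\<forall>(n, D, \<phi>) \<in> atlas U. \<forall>is. length is = p \<and> set is \<subseteq> {..<n} \<longrightarrow>
        holo_on n (\<phi> ` D)
          (\<lambda>z. let x = inv_into D \<phi> z in \<omega> x (map (coord_vec U (n, D, \<phi>) x) is)))}"

definition pull_form :: "'a cman \<Rightarrow> 'b cman \<Rightarrow> ('a \<Rightarrow> 'b) \<Rightarrow> 'b form \<Rightarrow> 'a form" where
  "pull_form U V g \<omega> =
     (\<lambda>x vs. if x \<in> points U \<and> set vs \<subseteq> tangent U x then \<omega> (g x) (map (push V g x) vs) else 0)"


section \<open>Finite-dimensional complex vector spaces\<close>

definition complex_ring :: "complex ring" where
  "complex_ring = \<lparr>carrier = UNIV, monoid.mult = (*), one = 1, zero = 0, add = (+)\<rparr>"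

definition Cn_module :: "nat \<Rightarrow> (complex, nat \<Rightarrow> complex) module" where
  "Cn_module n = \<lparr>carrier = Cn n, monoid.mult = undefined, one = undefined,
     zero = (\<lambda>i. 0), add = (\<lambda>a b i. a i + b i), smult = (\<lambda>c a i. c * a i)\<rparr>"

definition lin_maps :: "(complex, 'v) module \<Rightarrow> (complex, 'w) module \<Rightarrow> ('v \<Rightarrow> 'w) set" where
  "lin_maps M N = {L \<in> carrier M \<rightarrow>\<^sub>E carrier N.
     (\<forall>a\<in>carrier M. \<forall>b\<in>carrier M. L (a \<oplus>\<^bsub>M\<^esub> b) = L a \<oplus>\<^bsub>N\<^esub> L b) \<and>
     (\<forall>c. \<forall>a\<in>carrier M. L (c \<odot>\<^bsub>M\<^esub> a) = c \<odot>\<^bsub>N\<^esub> L a)}"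

definition coord_iso :: "(complex, 'v) module \<Rightarrow> nat \<Rightarrow> ('v \<Rightarrow> nat \<Rightarrow> complex) \<Rightarrow> bool" where
  "coord_iso M r t \<longleftrightarrow> t \<in> lin_maps M (Cn_module r) \<and> bij_betw t (carrier M) (Cn r)"

definition vdim :: "(complex, 'v) module \<Rightarrow> nat" where
  "vdim M = (THE r. \<exists>t. coord_iso M r t)"

definition vtrace :: "(complex, 'v) module \<Rightarrow> ('v \<Rightarrow> 'v) \<Rightarrow> complex" where
  "vtrace M L = (THE c. \<forall>r t. coord_iso M r t \<longrightarrow>
     c = (\<Sum>j<r. t (L (inv_into (carrier M) t (unit_vec j))) j))"


section \<open>Holomorphic vector bundles\<close>

text \<open>A bundle is a family of vector spaces with an atlas of local trivialisations
  (domain, rank, fibrewise linear coordinates) whose transition matrices are holomorphic.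
  The rank may vary between connected components. As the fibres are given as a function of the
  point, pullback is precomposition and is strictly functorial.\<close>

type_synonym ('a, 'v) trivialisation = "'a set \<times> nat \<times> ('a \<Rightarrow> 'v \<Rightarrow> nat \<Rightarrow> complex)"

record ('a, 'v) vbundle =
  fibre :: "'a \<Rightarrow> (complex, 'v) module"
  trivs :: "('a, 'v) trivialisation set"

fun frame :: "('a, 'v) vbundle \<Rightarrow> ('a, 'v) trivialisation \<Rightarrow> nat \<Rightarrow> 'a \<Rightarrow> 'v" where
  "frame E (D, r, t) j = (\<lambda>x\<in>D. inv_into (carrier (fibre E x)) (t x) (unit_vec j))"

definition hol_bundle :: "'a cman \<Rightarrow> ('a, 'v) vbundle \<Rightarrow> bool" where
  "hol_bundle U E \<longleftrightarrow>
     fibre E \<in> extensional (points U) \<and>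
     (\<forall>x \<in> points U. module complex_ring (fibre E x)) \<and>
     (\<forall>(D, r, t) \<in> trivs E. openin (mtop U) D \<and> t \<in> extensional D \<and>
        (\<forall>x\<in>D. coord_iso (fibre E x) r (t x))) \<and>
     (\<Union>(D, r, t) \<in> trivs E. D) = points U \<and>
     (\<forall>(D, r, t) \<in> trivs E. \<forall>(D', r', t') \<in> trivs E. \<forall>j<r. \<forall>i<r'.
        hol_fun U (D \<inter> D') (\<lambda>x. t' x (frame E (D, r, t) j x) i))"

definition sections :: "'a cman \<Rightarrow> ('a, 'v) vbundle \<Rightarrow> 'a set \<Rightarrow> ('a \<Rightarrow> 'v) set" where
  "sections U E W = {s \<in> extensional W.
     (\<forall>x\<in>W. s x \<in> carrier (fibre E x)) \<and>
     (\<forall>(D, r, t) \<in> trivs E. \<forall>i<r. hol_fun U (D \<inter> W) (\<lambda>x. t x (s x) i))}"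

text \<open>Holomorphic 1-forms on W with values in E.\<close>

definition bundle_forms1 :: "'a cman \<Rightarrow> ('a, 'v) vbundle \<Rightarrow> 'a set \<Rightarrow> ('a \<Rightarrow> 'a tvec \<Rightarrow> 'v) set" where
  "bundle_forms1 U E W = {\<alpha>.
     (\<forall>x\<in>W. \<forall>v \<in> tangent U x. \<alpha> x v \<in> carrier (fibre E x)) \<and>
     (\<forall>x\<in>W. \<forall>v \<in> tangent U x. \<forall>w \<in> tangent U x. \<forall>a b.
        \<alpha> x (tlin a v b w) = a \<odot>\<^bsub>fibre E x\<^esub> \<alpha> x v \<oplus>\<^bsub>fibre E x\<^esub> b \<odot>\<^bsub>fibre E x\<^esub> \<alpha> x w) \<and>
     (\<forall>(n, D, \<phi>) \<in> atlas U. \<forall>(D', r, t) \<in> trivs E. \<forall>i<n. \<forall>j<r.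
        holo_on n (\<phi> ` (D \<inter> D' \<inter> W))
          (\<lambda>z. let x = inv_into D \<phi> z in t x (\<alpha> x (coord_vec U (n, D, \<phi>) x i)) j))}"

text \<open>A connection is a map of sheaves from sections of E to 1-forms with values in E which satisfies
  the Leibniz rule. The value of \<open>nab\<close> on the section s over W, at the point x and the tangent vector
  v, is \<open>nab W s x v\<close>; note that \<open>v h\<close> is dh(v).\<close>

type_synonym ('a, 'v) connection = "'a set \<Rightarrow> ('a \<Rightarrow> 'v) \<Rightarrow> 'a \<Rightarrow> 'a tvec \<Rightarrow> 'v"

definition hol_connection :: "'a cman \<Rightarrow> ('a, 'v) vbundle \<Rightarrow> ('a, 'v) connection \<Rightarrow> bool" where
  "hol_connection U E nab \<longleftrightarrow>
     (\<forall>W s x v. \<not> (openin (mtop U) W \<and> s \<in> sections U E W \<and> x \<in> W \<and> v \<in> tangent U x) \<longrightarrow>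
        nab W s x v = undefined) \<and>
     (\<forall>W. openin (mtop U) W \<longrightarrow>
       (\<forall>s \<in> sections U E W. nab W s \<in> bundle_forms1 U E W) \<and>
       (\<forall>s \<in> sections U E W. \<forall>W' x v. openin (mtop U) W' \<and> W' \<subseteq> W \<and> x \<in> W' \<and> v \<in> tangent U x \<longrightarrow>
          nab W' (restrict s W') x v = nab W s x v) \<and>
       (\<forall>s \<in> sections U E W. \<forall>s' \<in> sections U E W. \<forall>x\<in>W. \<forall>v \<in> tangent U x.
          nab W (\<lambda>y\<in>W. s y \<oplus>\<^bsub>fibre E y\<^esub> s' y) x v = nab W s x v \<oplus>\<^bsub>fibre E x\<^esub> nab W s' x v) \<and>
       (\<forall>h. \<forall>s \<in> sections U E W. hol_fun U W h \<longrightarrow> (\<forall>x\<in>W. \<forall>v \<in> tangent U x.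
          nab W (\<lambda>y\<in>W. h y \<odot>\<^bsub>fibre E y\<^esub> s y) x v =
            v h \<odot>\<^bsub>fibre E x\<^esub> s x \<oplus>\<^bsub>fibre E x\<^esub> h x \<odot>\<^bsub>fibre E x\<^esub> nab W s x v)))"

definition pull_bundle :: "'a cman \<Rightarrow> 'b cman \<Rightarrow> ('a \<Rightarrow> 'b) \<Rightarrow> ('b, 'v) vbundle \<Rightarrow> ('a, 'v) vbundle" where
  "pull_bundle U V g E =
     \<lparr>fibre = (\<lambda>x \<in> points U. fibre E (g x)),
      trivs = (\<lambda>(D, r, t). ({x \<in> points U. g x \<in> D}, r, \<lambda>x \<in> {x \<in> points U. g x \<in> D}. t (g x)))
                ` trivs E\<rparr>"

text \<open>The pullback connection is the one with \<open>(g\<^sup>*\<nabla>)(g\<^sup>*s) = g\<^sup>*(\<nabla>s)\<close>. Writing a section s of the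
  pullback locally as the sum of the \<open>c\<^sub>i g\<^sup>*e\<^sub>i\<close> for a frame e of E, the Leibniz rule forces
  its derivative to be the sum of the \<open>dc\<^sub>i g\<^sup>*e\<^sub>i + c\<^sub>i g\<^sup>*(\<nabla>e\<^sub>i)\<close>, for every choice of the frame.\<close>

definition pull_connection ::
  "'a cman \<Rightarrow> 'b cman \<Rightarrow> ('a \<Rightarrow> 'b) \<Rightarrow> ('b, 'v) vbundle \<Rightarrow> ('b, 'v) connection \<Rightarrow> ('a, 'v) connection" where
  "pull_connection U V g E nab = (\<lambda>W s x v.
     if openin (mtop U) W \<and> s \<in> sections U (pull_bundle U V g E) W \<and> x \<in> W \<and> v \<in> tangent U x
     then (THE w. \<forall>(D, r, t) \<in> trivs E. g x \<in> D \<longrightarrow>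
             w = (\<Oplus>\<^bsub>fibre E (g x)\<^esub>i\<in>{..<r}.
                    v (\<lambda>y. t (g y) (s y) i) \<odot>\<^bsub>fibre E (g x)\<^esub> frame E (D, r, t) i (g x)
                    \<oplus>\<^bsub>fibre E (g x)\<^esub>
                    t (g x) (s x) i \<odot>\<^bsub>fibre E (g x)\<^esub> nab D (frame E (D, r, t) i) (g x) (push V g x v)))
     else undefined)"


section \<open>Bundle maps\<close>

type_synonym ('a, 'v) bundle_map = "'a \<Rightarrow> 'v \<Rightarrow> 'v"

definition hol_bundle_maps ::
  "'a cman \<Rightarrow> ('a, 'v) vbundle \<Rightarrow> ('a, 'v) vbundle \<Rightarrow> ('a, 'v) bundle_map set" where
  "hol_bundle_maps U E F = {f \<in> extensional (points U).
     (\<forall>x \<in> points U. f x \<in> lin_maps (fibre E x) (fibre F x)) \<and>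
     (\<forall>(D, r, t) \<in> trivs E. \<forall>(D', r', t') \<in> trivs F. \<forall>j<r. \<forall>i<r'.
        hol_fun U (D \<inter> D') (\<lambda>x. t' x (f x (frame E (D, r, t) j x)) i))}"

definition bundle_id :: "'a cman \<Rightarrow> ('a, 'v) vbundle \<Rightarrow> ('a, 'v) bundle_map" where
  "bundle_id U E = (\<lambda>x \<in> points U. \<lambda>e \<in> carrier (fibre E x). e)"

text \<open>The composite g after f, where f has source E.\<close>

definition bundle_comp ::
  "'a cman \<Rightarrow> ('a, 'v) vbundle \<Rightarrow> ('a, 'v) bundle_map \<Rightarrow> ('a, 'v) bundle_map \<Rightarrow> ('a, 'v) bundle_map" where
  "bundle_comp U E g f = (\<lambda>x \<in> points U. compose (carrier (fibre E x)) (g x) (f x))"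

definition hol_bundle_isos ::
  "'a cman \<Rightarrow> ('a, 'v) vbundle \<Rightarrow> ('a, 'v) vbundle \<Rightarrow> ('a, 'v) bundle_map set" where
  "hol_bundle_isos U E F = {f \<in> hol_bundle_maps U E F.
     \<exists>g \<in> hol_bundle_maps U F E.
       bundle_comp U E g f = bundle_id U E \<and> bundle_comp U F f g = bundle_id U F}"

text \<open>The derivative of a bundle map f from E to F under the induced connection on Hom(E, F), that is
  \<open>(\<nabla>f)(s) = \<nabla>\<^sub>F(f s) - f(\<nabla>\<^sub>E s)\<close>, at the point x, the tangent vector v and the element e of the
  fibre of E: the value is computed with any local section s through e.\<close>

definition hom_connection ::
  "'a cman \<Rightarrow> ('a, 'v) vbundle \<times> ('a, 'v) connection \<Rightarrow> ('a, 'v) vbundle \<times> ('a, 'v) connection \<Rightarrow>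
     ('a, 'v) bundle_map \<Rightarrow> 'a \<Rightarrow> 'a tvec \<Rightarrow> 'v \<Rightarrow> 'v" where
  "hom_connection U = (\<lambda>(E, DE) (F, DF) f x v e.
     THE w. \<forall>W s. openin (mtop U) W \<and> x \<in> W \<and> s \<in> sections U E W \<and> s x = e \<longrightarrow>
       w = DF W (\<lambda>y\<in>W. f y (s y)) x v \<ominus>\<^bsub>fibre F x\<^esub> f x (DE W s x v))"


section \<open>Simplicial sets and simplicial presheaves on complex manifolds\<close>

definition ord_maps :: "nat \<Rightarrow> nat \<Rightarrow> (nat \<Rightarrow> nat) set" where
  "ord_maps k m = {\<theta> \<in> {..k} \<rightarrow>\<^sub>E {..m}. mono_on {..k} \<theta>}"

text \<open>\<open>sact X k m \<theta>\<close> is the map from m-simplices to k-simplices induced by an order-preserving map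
  \<open>\<theta>\<close> from {0..k} to {0..m}.\<close>

record 's simplicial =
  simplices :: "nat \<Rightarrow> 's set"
  sact :: "nat \<Rightarrow> nat \<Rightarrow> (nat \<Rightarrow> nat) \<Rightarrow> 's \<Rightarrow> 's"

definition simplicial_set :: "'s simplicial \<Rightarrow> bool" where
  "simplicial_set X \<longleftrightarrow>
     (\<forall>k m. \<forall>\<theta> \<in> ord_maps k m. sact X k m \<theta> \<in> simplices X m \<rightarrow> simplices X k) \<and>
     (\<forall>k. \<forall>\<sigma> \<in> simplices X k. sact X k k (restrict id {..k}) \<sigma> = \<sigma>) \<and>
     (\<forall>k m n. \<forall>\<theta> \<in> ord_maps k m. \<forall>\<eta> \<in> ord_maps m n. \<forall>\<sigma> \<in> simplices X n.
        sact X k n (compose {..k} \<eta> \<theta>) \<sigma> = sact X k m \<theta> (sact X m n \<eta> \<sigma>))"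

definition simplicial_map :: "'s simplicial \<Rightarrow> 't simplicial \<Rightarrow> (nat \<Rightarrow> 's \<Rightarrow> 't) \<Rightarrow> bool" where
  "simplicial_map X Y f \<longleftrightarrow>
     (\<forall>k. f k \<in> simplices X k \<rightarrow> simplices Y k) \<and>
     (\<forall>k m. \<forall>\<theta> \<in> ord_maps k m. \<forall>\<sigma> \<in> simplices X m. f k (sact X k m \<theta> \<sigma>) = sact Y k m \<theta> (f m \<sigma>))"

text \<open>All manifolds of the category have their points in one type; any two manifolds can be
  moved into a common such type.\<close>

record ('a, 's) presheaf =
  pobj :: "'a cman \<Rightarrow> 's simplicial"
  pmap :: "'a cman \<Rightarrow> 'a cman \<Rightarrow> ('a \<Rightarrow> 'a) \<Rightarrow> nat \<Rightarrow> 's \<Rightarrow> 's"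

definition simplicial_presheaf :: "('a, 's) presheaf \<Rightarrow> bool" where
  "simplicial_presheaf F \<longleftrightarrow>
     (\<forall>U. complex_manifold U \<longrightarrow> simplicial_set (pobj F U)) \<and>
     (\<forall>U V. \<forall>g \<in> hol_maps U V. complex_manifold U \<and> complex_manifold V \<longrightarrow>
        simplicial_map (pobj F V) (pobj F U) (pmap F U V g)) \<and>
     (\<forall>U k. \<forall>\<sigma> \<in> simplices (pobj F U) k. complex_manifold U \<longrightarrow>
        pmap F U U (restrict id (points U)) k \<sigma> = \<sigma>) \<and>
     (\<forall>U V W k. \<forall>g \<in> hol_maps U V. \<forall>h \<in> hol_maps V W. \<forall>\<sigma> \<in> simplices (pobj F W) k.
        complex_manifold U \<and> complex_manifold V \<and> complex_manifold W \<longrightarrow>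
        pmap F U W (compose (points U) h g) k \<sigma> = pmap F U V g k (pmap F V W h k \<sigma>))"

definition simplicial_presheaf_map ::
  "('a, 's) presheaf \<Rightarrow> ('a, 't) presheaf \<Rightarrow> ('a cman \<Rightarrow> nat \<Rightarrow> 's \<Rightarrow> 't) \<Rightarrow> bool" where
  "simplicial_presheaf_map F G \<eta> \<longleftrightarrow>
     simplicial_presheaf F \<and> simplicial_presheaf G \<and>
     (\<forall>U. complex_manifold U \<longrightarrow> simplicial_map (pobj F U) (pobj G U) (\<eta> U)) \<and>
     (\<forall>U V k. \<forall>g \<in> hol_maps U V. \<forall>\<sigma> \<in> simplices (pobj F V) k.
        complex_manifold U \<and> complex_manifold V \<longrightarrow>
        \<eta> U k (pmap F U V g k \<sigma>) = pmap G U V g k (\<eta> V k \<sigma>))"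


section \<open>Nerves and the presheaf HVB\<close>

record ('o, 'm) category =
  Obj :: "'o set"
  Hom :: "'o \<Rightarrow> 'o \<Rightarrow> 'm set"
  Idt :: "'o \<Rightarrow> 'm"
  Comp :: "'o \<Rightarrow> 'o \<Rightarrow> 'o \<Rightarrow> 'm \<Rightarrow> 'm \<Rightarrow> 'm"

text \<open>A k-simplex of the nerve is the list of its objects \<open>E\<^sub>0, \<dots>, E\<^sub>k\<close> together with the list of
  its morphisms, whose entry number i (from 0) goes from \<open>E\<^sub>i\<close> to the next object.
  \<open>nerve_path C \<sigma> p d\<close> is the composite from object p to object p + d.\<close>

fun nerve_path :: "('o, 'm) category \<Rightarrow> 'o list \<times> 'm list \<Rightarrow> nat \<Rightarrow> nat \<Rightarrow> 'm" where
  "nerve_path C (Es, fs) p 0 = Idt C (Es ! p)"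
| "nerve_path C (Es, fs) p (Suc d) =
     Comp C (Es ! p) (Es ! (p + d)) (Es ! (p + Suc d)) (fs ! (p + d)) (nerve_path C (Es, fs) p d)"

definition nerve :: "('o, 'm) category \<Rightarrow> ('o list \<times> 'm list) simplicial" where
  "nerve C =
     \<lparr>simplices = (\<lambda>k. {(Es, fs). length Es = Suc k \<and> length fs = k \<and> set Es \<subseteq> Obj C \<and>
                          (\<forall>i<k. fs ! i \<in> Hom C (Es ! i) (Es ! Suc i))}),
      sact = (\<lambda>k m \<theta> \<sigma>. (map (\<lambda>j. fst \<sigma> ! \<theta> j) [0..<Suc k],
                         map (\<lambda>j. nerve_path C \<sigma> (\<theta> j) (\<theta> (Suc j) - \<theta> j)) [0..<k]))\<rparr>"

type_synonym ('a, 'v) hvb_object = "('a, 'v) vbundle \<times> ('a, 'v) connection"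

type_synonym ('a, 'v) hvb_simplex = "('a, 'v) hvb_object list \<times> ('a, 'v) bundle_map list"

definition hvb_groupoid :: "'a cman \<Rightarrow> (('a, 'v) hvb_object, ('a, 'v) bundle_map) category" where
  "hvb_groupoid U =
     \<lparr>Obj = {(E, nab). hol_bundle U E \<and> hol_connection U E nab},
      Hom = (\<lambda>E F. hol_bundle_isos U (fst E) (fst F)),
      Idt = (\<lambda>E. bundle_id U (fst E)),
      Comp = (\<lambda>E F G g f. bundle_comp U (fst E) g f)\<rparr>"

definition HVB :: "('a, ('a, 'v) hvb_simplex) presheaf" where
  "HVB =
     \<lparr>pobj = (\<lambda>U. nerve (hvb_groupoid U)),
      pmap = (\<lambda>U V g k (Es, fs).
        (map (\<lambda>(E, nab). (pull_bundle U V g E, pull_connection U V g E nab)) Es,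
         map (\<lambda>f. \<lambda>x \<in> points U. f (g x)) fs))\<rparr>"


section \<open>The Dold-Kan construction and the presheaf Omega\<close>

text \<open>Non-positively graded cochain complexes: \<open>cgrp C l\<close> is the group in degree -l (written
  multiplicatively) and \<open>cdiff C l\<close> is the differential from degree -(l+1) to
  degree -l.\<close>

record 'c cochain_complex =
  cgrp :: "nat \<Rightarrow> 'c monoid"
  cdiff :: "nat \<Rightarrow> 'c \<Rightarrow> 'c"

definition chain_maps :: "'b cochain_complex \<Rightarrow> 'c cochain_complex \<Rightarrow> (nat \<Rightarrow> 'b \<Rightarrow> 'c) set" where
  "chain_maps B C = {\<phi>.
     (\<forall>l. \<phi> l \<in> hom (cgrp B l) (cgrp C l) \<inter> extensional (carrier (cgrp B l))) \<and>
     (\<forall>l. \<forall>c \<in> carrier (cgrp B (Suc l)). \<phi> l (cdiff B l c) = cdiff C l (\<phi> (Suc l) c))}"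

text \<open>The generator with indices \<open>i\<^sub>0 < \<dots> < i\<^sub>l \<le> k\<close> is the list of its indices.\<close>

definition simplex_gens :: "nat \<Rightarrow> nat \<Rightarrow> nat list set" where
  "simplex_gens k l = {I. length I = Suc l \<and> sorted_wrt (<) I \<and> set I \<subseteq> {..k}}"

definition simplex_complex :: "nat \<Rightarrow> (nat list \<Rightarrow>\<^sub>0 int) cochain_complex" where
  "simplex_complex k =
     \<lparr>cgrp = (\<lambda>l. free_Abelian_group (simplex_gens k l)),
      cdiff = (\<lambda>l. frag_extend (\<lambda>I. \<Sum>j\<le>Suc l.
                 frag_cmul ((-1) ^ j) (frag_of (take j I @ drop (Suc j) I))))\<rparr>"

definition simplex_complex_map :: "(nat \<Rightarrow> nat) \<Rightarrow> (nat list \<Rightarrow>\<^sub>0 int) \<Rightarrow> (nat list \<Rightarrow>\<^sub>0 int)" where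
  "simplex_complex_map \<theta> =
     frag_extend (\<lambda>I. if distinct (map \<theta> I) then frag_of (map \<theta> I) else 0)"

definition DK :: "'c cochain_complex \<Rightarrow> (nat \<Rightarrow> (nat list \<Rightarrow>\<^sub>0 int) \<Rightarrow> 'c) simplicial" where
  "DK C =
     \<lparr>simplices = (\<lambda>k. chain_maps (simplex_complex k) C),
      sact = (\<lambda>k m \<theta> \<phi> l. \<lambda>c \<in> carrier (cgrp (simplex_complex k) l).
                \<phi> l (simplex_complex_map \<theta> c))\<rparr>"

text \<open>An element \<open>a\<close> of the tensor product of the algebra of forms with the polynomials in u has
  the component \<open>a q p\<close> in p-forms times \<open>u\<^sup>q\<close>, which has degree p - 2q.\<close>

type_synonym 'a uform = "nat \<Rightarrow> nat \<Rightarrow> 'a form"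

definition uforms :: "'a cman \<Rightarrow> int \<Rightarrow> 'a uform set" where
  "uforms U d = {a.
     (\<forall>q p. a q p \<in> hol_forms U p) \<and>
     finite {(q, p). a q p \<noteq> (\<lambda>x vs. 0)} \<and>
     (\<forall>q p. int p - 2 * int q \<noteq> d \<longrightarrow> a q p = (\<lambda>x vs. 0))}"

definition uform_complex :: "'a cman \<Rightarrow> 'a uform cochain_complex" where
  "uform_complex U =
     \<lparr>cgrp = (\<lambda>l. \<lparr>carrier = uforms U (- int l),
                    monoid.mult = (\<lambda>a b q p x vs. a q p x vs + b q p x vs),
                    one = (\<lambda>q p x vs. 0)\<rparr>),
      cdiff = (\<lambda>l a q p x vs. 0)\<rparr>"

definition Omega :: "('a, nat \<Rightarrow> (nat list \<Rightarrow>\<^sub>0 int) \<Rightarrow> 'a uform) presheaf" where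
  "Omega =
     \<lparr>pobj = (\<lambda>U. DK (uform_complex U)),
      pmap = (\<lambda>U V g k \<phi> l. \<lambda>c \<in> carrier (cgrp (simplex_complex k) l).
                (\<lambda>q p. pull_form U V g (\<phi> l c q p)))\<rparr>"


section \<open>The Chern character map\<close>

text \<open>The value at x of the form attached to the indices \<open>I = [i\<^sub>0, \<dots>, i\<^sub>l]\<close>. The composite of
  Hom-valued 1-forms is their wedge product, with the convention
  \<open>(\<alpha> \<and> \<beta>)(v, w) = \<alpha>(v) \<beta>(w) - \<alpha>(w) \<beta>(v)\<close>. The factors are applied from right to left; the j-th
  factor from the right (j = 1, \<dots>, l) goes from the bundle with index \<open>i\<^sub>j\<^sub>-\<^sub>1\<close> to the one
  with index \<open>i\<^sub>j\<close> and takes the vector in position l - j of the permuted list.\<close>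

definition ch_trace ::
  "'a cman \<Rightarrow> ('a, 'v) hvb_simplex \<Rightarrow> nat list \<Rightarrow> 'a \<Rightarrow> 'a tvec list \<Rightarrow> complex" where
  "ch_trace U \<sigma> I x vs =
     (let l = length I - 1;
          E = (\<lambda>i. fst \<sigma> ! i);
          F = (\<lambda>i. fibre (fst (E i)) x);
          f = (\<lambda>q p. nerve_path (hvb_groupoid U) \<sigma> p (q - p));
          factor = (\<lambda>j. hom_connection U (E (I ! (j - 1))) (E (I ! j)) (f (I ! j) (I ! (j - 1))) x)
      in \<Sum>\<pi> | \<pi> permutes {..<l}. of_int (sign \<pi>) *
           vtrace (F (I ! 0))
             (\<lambda>e. inv_into (carrier (F (I ! 0))) (f (I ! l) (I ! 0) x)
                    (fold (\<lambda>j. factor j (vs ! \<pi> (l - j))) [1..<Suc l] e)))"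

definition ch_form :: "'a cman \<Rightarrow> ('a, 'v) hvb_simplex \<Rightarrow> nat list \<Rightarrow> 'a form" where
  "ch_form U \<sigma> I = (\<lambda>x vs.
     if x \<in> points U \<and> length vs = length I - 1 \<and> set vs \<subseteq> tangent U x
     then if length I = 1 then of_nat (vdim (fibre (fst (fst \<sigma> ! hd I)) x))
          else ch_trace U \<sigma> I x vs
     else 0)"

text \<open>In degree -l, the additive extension of sending the generator I to \<open>ch_form U \<sigma> I\<close> times
  \<open>u\<^sup>l\<close>, where \<open>ch_form U \<sigma> I\<close> is an l-form.\<close>

definition Ch :: "'a cman \<Rightarrow> nat \<Rightarrow> ('a, 'v) hvb_simplex \<Rightarrow> nat \<Rightarrow> (nat list \<Rightarrow>\<^sub>0 int) \<Rightarrow> 'a uform" where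
  "Ch U k \<sigma> = (\<lambda>l. \<lambda>c \<in> carrier (cgrp (simplex_complex k) l).
     (\<lambda>q p x vs. \<Sum>I \<in> Poly_Mapping.keys c.
        of_int (Poly_Mapping.lookup c I) * (if q = l \<and> p = l then ch_form U \<sigma> I x vs else 0)))"

end

theory Submission
  imports
    Defs
    "HOL-Complex_Analysis.Cauchy_Integral_Formula"
    "HOL-Real_Asymp.Real_Asymp"
begin

text \<open>All local questions are settled in charts and local frames. Osgood's lemma, in the form that the partial
  derivatives of a continuous separately holomorphic function are again of this kind, yields the chain rule
  for holomorphic maps, hence the functoriality of tangent vectors and the holomorphy of pulled back forms. The
  Leibniz rule expresses a connection in a frame; this gives the pulled back connection, and shows that
  \<open>\<nabla>\<^sub>F(f s) - f(\<nabla>\<^sub>E s)\<close> at a point depends only on the value of s there.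

  For a path of bundles with isomorphisms \<open>f\<^sub>1, \<dots>, f\<^sub>l\<^sub>+\<^sub>1\<close>, let \<open>T\<^sub>j\<close> be the trace in
  which all \<open>f\<^sub>i\<close> except \<open>f\<^sub>j\<close> are derived. By the product rule
  \<open>\<nabla>(g f) = (\<nabla>g) f + g (\<nabla>f)\<close> the inner face number j of the path contributes \<open>T\<^sub>j + T\<^sub>j\<^sub>+\<^sub>1\<close>;
  the outer faces contribute \<open>T\<^sub>1\<close>, after conjugation by \<open>f\<^sub>1\<close>, and \<open>T\<^sub>l\<^sub>+\<^sub>1\<close>. The alternating sum
  telescopes to 0, for each permutation of the tangent vectors separately. Degenerate simplices
  contain the derivative of an identity, which vanishes.\<close>

section \<open>Separately holomorphic continuous functions\<close>

text \<open>\<open>holo_on\<close> provides only continuity and holomorphy in each variable.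
  Continuity is what makes Osgood's lemma elementary: it gives local bounds, and Cauchy's inequality
  turns them into uniform convergence of difference quotients. Several objects are given by
  descriptions: \<open>vdim\<close>, \<open>vtrace\<close>, \<open>hom_connection\<close>,
  \<open>pull_connection\<close>. They can be evaluated only after existence and uniqueness are
  known, and both come from coordinates; hence most identities between elements of a fibre are
  proved as identities of complex coordinates, through \<open>coord_eqI\<close>. Tangent vectors are
  functionals on all complex functions, with default value 0 on those that are not holomorphic near
  the point; each use of the rules for sums and products has to supply this holomorphy. In the trace
  formula the inverse isomorphism occurs once and underived, so the boundary relation needs the
  product rule but no derivative of an inverse. Since the differential of the target is zero, being
  a chain map means that boundaries are sent to 0.\<close>

definition polydisc :: "nat \<Rightarrow> (nat \<Rightarrow> complex) \<Rightarrow> real \<Rightarrow> (nat \<Rightarrow> complex) set" where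
  "polydisc n z d = {w \<in> Cn n. \<forall>i<n. dist (w i) (z i) < d}"

abbreviation open_Cn :: "nat \<Rightarrow> (nat \<Rightarrow> complex) set \<Rightarrow> bool" where
  "open_Cn n \<equiv> openin (top_of_set (Cn n))"

text \<open>The conditions are inherited by smaller radii, so a minimum of finitely many radii
  serves all indices. For \<open>n = 0\<close> nothing constrains the radius and 1 is taken.\<close>

lemma finite_common_radius:
  fixes n :: nat and P :: "nat \<Rightarrow> real \<Rightarrow> bool"
  assumes "\<And>i. i < n \<Longrightarrow> \<exists>d>0. P i d" "\<And>i d e. P i d \<Longrightarrow> 0 < e \<Longrightarrow> e \<le> d \<Longrightarrow> P i e"
  shows "\<exists>d>0. \<forall>i<n. P i d"
  using assms(1)
proof (induction n)
  case 0
  then show ?case by (auto intro: exI[of _ 1])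
next
  case (Suc n)
  then obtain d where d: "d > 0" "\<forall>i<n. P i d" by auto
  from Suc.prems obtain e where e: "e > 0" "P n e" by blast
  show ?case
    by (rule exI[of _ "min d e"]) (use d e assms(2) in \<open>auto simp: less_Suc_eq\<close>)
qed

lemma polydisc_mono: "d \<le> e \<Longrightarrow> polydisc n z d \<subseteq> polydisc n z e"
  by (auto simp: polydisc_def)

text \<open>Estimates are made on polydiscs, whereas \<open>Cn n\<close> carries the topology
  induced from an infinite product. A basic open set of the product restricts each coordinate below
  \<open>n\<close> to an open set, which contains a disc; the other coordinates of points of
  \<open>Cn n\<close> are all 0 and impose nothing.\<close>

lemma open_Cn_iff:
  "open_Cn n S \<longleftrightarrow> S \<subseteq> Cn n \<and> (\<forall>z\<in>S. \<exists>d>0. polydisc n z d \<subseteq> S)"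
proof safe
  fix z assume op: "open_Cn n S" and z: "z \<in> S"
  then obtain T where T: "open T" "S = Cn n \<inter> T"
    by (auto simp: openin_open)
  have "openin (product_topology (\<lambda>i. euclidean) UNIV) T"
    using T by (simp add: euclidean_product_topology)
  then obtain A where A: "\<And>i. open (A i)" "z \<in> Pi\<^sub>E UNIV A" "Pi\<^sub>E UNIV A \<subseteq> T"
    using z T unfolding openin_product_topology_alt by (auto, meson)
  have "\<exists>d>0. \<forall>i<n. ball (z i) d \<subseteq> A i"
  proof (rule finite_common_radius)
    show "\<exists>d>0. ball (z i) d \<subseteq> A i" for i
      using A(1)[of i] A(2) by (auto simp: PiE_iff open_contains_ball)
    show "ball (z i) e \<subseteq> A i" if "ball (z i) d \<subseteq> A i" "e \<le> d" for i d e
      using that subset_ball by blast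
  qed
  then obtain d where d: "d > 0" "\<And>i. i < n \<Longrightarrow> ball (z i) d \<subseteq> A i" by blast
  have "polydisc n z d \<subseteq> S"
  proof
    fix w assume w: "w \<in> polydisc n z d"
    have "w i \<in> A i" for i
    proof (cases "i < n")
      case True
      then show ?thesis using d(2)[of i] w by (auto simp: polydisc_def dist_commute)
    next
      case False
      then have "w i = z i" using w z T by (auto simp: polydisc_def Cn_def)
      then show ?thesis using A(2) by (auto simp: PiE_iff)
    qed
    then show "w \<in> S" using A(3) w T by (auto simp: PiE_iff polydisc_def)
  qed
  then show "\<exists>d>0. polydisc n z d \<subseteq> S" using d by blast
next
  show "z \<in> Cn n" if "open_Cn n S" "z \<in> S" for z
    using that openin_imp_subset by blast
next
  assume S: "S \<subseteq> Cn n" and "\<forall>z\<in>S. \<exists>d>0. polydisc n z d \<subseteq> S"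
  then obtain d where d: "\<And>z. z \<in> S \<Longrightarrow> d z > 0" "\<And>z. z \<in> S \<Longrightarrow> polydisc n z (d z) \<subseteq> S"
    by metis
  have op: "open (\<Inter>i<n. {w. dist (w i) (z i) < d z})" for z :: "nat \<Rightarrow> complex"
    by (intro open_INT ballI open_Collect_less continuous_intros
          continuous_on_product_coordinates) auto
  define T where "T = (\<Union>z\<in>S. \<Inter>i<n. {w. dist (w i) (z i) < d z})"
  have "S = Cn n \<inter> T"
  proof
    show "S \<subseteq> Cn n \<inter> T" using S d(1) by (auto simp: T_def)
    show "Cn n \<inter> T \<subseteq> S"
    proof
      fix w assume "w \<in> Cn n \<inter> T"
      then obtain z where "z \<in> S" "w \<in> polydisc n z (d z)" by (auto simp: polydisc_def T_def)
      then show "w \<in> S" using d(2) by blast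
    qed
  qed
  moreover have "open T" unfolding T_def by (intro open_UN ballI op)
  ultimately show "open_Cn n S" using openin_open_Int[of T "Cn n"] by simp
qed

lemma open_Cn_polydisc: "open_Cn n (polydisc n z d)"
proof -
  have "open (\<Inter>i<n. {w. dist (w i) (z i) < d})"
    by (intro open_INT ballI open_Collect_less continuous_intros
          continuous_on_product_coordinates) auto
  moreover have "polydisc n z d = Cn n \<inter> (\<Inter>i<n. {w. dist (w i) (z i) < d})"
    by (auto simp: polydisc_def)
  ultimately show ?thesis unfolding openin_open by blast
qed

lemma fun_upd_Cn: "z \<in> Cn n \<Longrightarrow> i < n \<Longrightarrow> z(i := \<zeta>) \<in> Cn n"
  by (auto simp: Cn_def)

text \<open>Derivatives in one variable at points of \<open>S\<close> therefore see only values on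
  \<open>S\<close>; this makes holomorphy and partial derivatives local notions.\<close>

lemma open_Cn_line:
  assumes "open_Cn n S" "z \<in> S" "i < n"
  shows "\<forall>\<^sub>F \<zeta> in nhds (z i). z(i := \<zeta>) \<in> S"
proof -
  obtain d where d: "d > 0" "polydisc n z d \<subseteq> S" using assms open_Cn_iff by meson
  have "z \<in> Cn n" using assms open_Cn_iff by blast
  have "\<forall>\<^sub>F \<zeta> in nhds (z i). dist \<zeta> (z i) < d"
    using d(1) by (auto simp: eventually_nhds_metric)
  then show ?thesis
    by eventually_elim (use d assms \<open>z \<in> Cn n\<close> in \<open>auto simp: polydisc_def fun_upd_Cn subset_iff\<close>)
qed

text \<open>Continuity at a point with polydiscs in the role of balls, the form in which the
  estimates use it.\<close>

lemma continuous_on_Cn_bound: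
  assumes "open_Cn n S" "continuous_on S f" "z \<in> S" "e > (0::real)"
  obtains d where "d > 0" "polydisc n z d \<subseteq> S" "\<And>w. w \<in> polydisc n z d \<Longrightarrow> dist (f w) (f z :: complex) < e"
proof -
  have "openin (top_of_set S) (S \<inter> f -` ball (f z) e)"
    using assms continuous_openin_preimage_gen by blast
  then have "open_Cn n (S \<inter> f -` ball (f z) e)"
    using assms(1) openin_trans by blast
  moreover have "z \<in> S \<inter> f -` ball (f z) e" using assms by auto
  ultimately obtain d where "d > 0" "polydisc n z d \<subseteq> S \<inter> f -` ball (f z) e"
    using open_Cn_iff by meson
  then show ?thesis using that[of d] by (auto simp: dist_commute subset_iff)
qed

lemma holo_on_subset: "holo_on n S f \<Longrightarrow> T \<subseteq> S \<Longrightarrow> holo_on n T f"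
  by (auto simp: holo_on_def intro: continuous_on_subset)

text \<open>The sets \<open>T\<close> are open in \<open>Cn n\<close>, so neighbourhoods within
  \<open>T\<close> and within \<open>Cn n\<close> agree near \<open>z\<close>, and continuity passes
  on to \<open>S\<close>. Here \<open>S\<close> may be any subset of \<open>Cn n\<close>.\<close>

lemma holo_on_local:
  assumes "S \<subseteq> Cn n"
    and "\<And>z. z \<in> S \<Longrightarrow> \<exists>T. open_Cn n T \<and> z \<in> T \<and> holo_on n T f"
  shows "holo_on n S f"
  unfolding holo_on_def
proof (intro conjI ballI allI impI)
  show "continuous_on S f"
    unfolding continuous_on_eq_continuous_within
  proof
    fix z assume z: "z \<in> S"
    then obtain T where T: "open_Cn n T" "z \<in> T" "holo_on n T f" using assms by blast
    then obtain T' where T': "open T'" "T = Cn n \<inter> T'" by (auto simp: openin_open)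
    have "continuous (at z within T) f"
      using T by (auto simp: holo_on_def continuous_on_eq_continuous_within)
    moreover have "at z within T = at z within Cn n"
      by (rule at_within_nhd[of _ T']) (use T' T in auto)
    ultimately show "continuous (at z within S) f"
      using assms(1) by (auto intro: continuous_within_subset)
  qed
next
  fix z i assume "z \<in> S" "i < n"
  then show "(\<lambda>\<zeta>. f (z(i := \<zeta>))) field_differentiable at (z i)"
    using assms(2) unfolding holo_on_def by blast
qed

text \<open>Openness matters because the derivative at a point of \<open>S\<close> is taken along a
  full line: the two functions must agree on a neighbourhood in that line, not just at the
  point.\<close>

lemma holo_on_cong:
  assumes "open_Cn n S" "\<And>z. z \<in> S \<Longrightarrow> f z = g z"
  shows "holo_on n S f \<longleftrightarrow> holo_on n S g"
proof -
  have *: "holo_on n S g" if h: "holo_on n S f" "\<And>z. z \<in> S \<Longrightarrow> f z = g z" for f g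
    unfolding holo_on_def
  proof (intro conjI ballI allI impI)
    show "continuous_on S g"
      using h continuous_on_cong unfolding holo_on_def by metis
    fix z i assume z: "z \<in> S" "i < n"
    have ev: "\<forall>\<^sub>F \<zeta> in nhds (z i). f (z(i := \<zeta>)) = g (z(i := \<zeta>))"
      using open_Cn_line[OF assms(1) z] by eventually_elim (use h in auto)
    obtain D where "((\<lambda>\<zeta>. f (z(i := \<zeta>))) has_field_derivative D) (at (z i))"
      using h z unfolding holo_on_def field_differentiable_def by blast
    then have "((\<lambda>\<zeta>. g (z(i := \<zeta>))) has_field_derivative D) (at (z i))"
      using DERIV_cong_ev[OF refl ev refl] by simp
    then show "(\<lambda>\<zeta>. g (z(i := \<zeta>))) field_differentiable at (z i)"
      unfolding field_differentiable_def by blast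
  qed
  show ?thesis using *[of f g] *[of g f] assms(2) by auto
qed

lemma partial_deriv_cong:
  assumes "open_Cn n S" "z \<in> S" "i < n" "\<And>z. z \<in> S \<Longrightarrow> f z = g z"
  shows "partial_deriv i f z = partial_deriv i g z"
  unfolding partial_deriv_def
  by (rule deriv_cong_ev[OF _ refl])
    (use open_Cn_line[OF assms(1-3)] in \<open>eventually_elim, use assms(4) in auto\<close>)

section \<open>Algebra of holomorphic functions\<close>

lemma holo_on_const: "holo_on n S (\<lambda>z. c)"
  by (auto simp: holo_on_def)

lemma holo_on_add: "holo_on n S f \<Longrightarrow> holo_on n S g \<Longrightarrow> holo_on n S (\<lambda>z. f z + g z)"
  by (auto simp: holo_on_def intro!: continuous_intros field_differentiable_add)

lemma holo_on_diff: "holo_on n S f \<Longrightarrow> holo_on n S g \<Longrightarrow> holo_on n S (\<lambda>z. f z - g z)"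
  by (auto simp: holo_on_def intro!: continuous_intros field_differentiable_diff)

lemma holo_on_mult: "holo_on n S f \<Longrightarrow> holo_on n S g \<Longrightarrow> holo_on n S (\<lambda>z. f z * g z)"
  by (auto simp: holo_on_def intro!: continuous_intros field_differentiable_mult)

lemma holo_on_sum:
  "(\<And>i. i \<in> I \<Longrightarrow> holo_on n S (f i)) \<Longrightarrow> holo_on n S (\<lambda>z. \<Sum>i\<in>I. f i z)"
  by (induction I rule: infinite_finite_induct) (auto intro: holo_on_const holo_on_add)

section \<open>Coordinate lines and Osgood's lemma\<close>

lemma holo_on_has_deriv:
  assumes "holo_on n S f" "z(i := \<zeta>) \<in> S" "i < n"
  shows "((\<lambda>\<zeta>. f (z(i := \<zeta>))) has_field_derivative partial_deriv i f (z(i := \<zeta>))) (at \<zeta>)"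
proof -
  have "(\<lambda>\<xi>. f ((z(i := \<zeta>))(i := \<xi>))) field_differentiable at ((z(i := \<zeta>)) i)"
    using assms unfolding holo_on_def by blast
  then show ?thesis
    by (simp add: partial_deriv_def field_differentiable_derivI)
qed

lemma holo_on_has_deriv':
  assumes "holo_on n S f" "z \<in> S" "i < n"
  shows "((\<lambda>\<zeta>. f (z(i := \<zeta>))) has_field_derivative partial_deriv i f z) (at (z i))"
  using holo_on_has_deriv[of n S f z i "z i"] assms by simp

text \<open>A Taylor estimate along a coordinate line. The radius is \<open>3 * d\<close> because
  \<open>w\<close> lies within \<open>d\<close> of \<open>z\<close>, the increment \<open>h\<close>
  is shorter than \<open>d\<close>, and around every point in between a Cauchy circle of radius
  \<open>d\<close> must still fit.\<close>

lemma difference_quotient_bound: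
  assumes f: "holo_on n (polydisc n z (3 * d)) f" "\<And>w. w \<in> polydisc n z (3 * d) \<Longrightarrow> cmod (f w) \<le> B"
    and w: "w \<in> polydisc n z d" and d: "d > 0" and i: "i < n" and h: "cmod h < d"
  shows "cmod (f (w(i := w i + h)) - f w - h * partial_deriv i f w) \<le> 2 * B / d\<^sup>2 * (cmod h)\<^sup>2"
proof -
  define g where "g = (\<lambda>\<zeta>. f (w(i := \<zeta>)))"
  have wC: "w \<in> Cn n" using w by (auto simp: polydisc_def)
  have in3: "w(i := \<zeta>) \<in> polydisc n z (3 * d)" if "\<zeta> \<in> ball (w i) (2 * d)" for \<zeta>
  proof -
    have "dist \<zeta> (w i) < 2 * d" using that by (auto simp: dist_commute)
    moreover have "dist (w i) (z i) < d" using w i by (auto simp: polydisc_def)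
    ultimately have "dist \<zeta> (z i) < 3 * d" using dist_triangle[of \<zeta> "z i" "w i"] by linarith
    moreover have "\<forall>j<n. dist (w j) (z j) < 3 * d" using w d by (auto simp: polydisc_def intro: less_trans)
    ultimately show ?thesis using fun_upd_Cn[OF wC i] by (auto simp: polydisc_def)
  qed
  have hol: "g holomorphic_on ball (w i) (2 * d)"
    unfolding holomorphic_on_open[OF open_ball] g_def
    using holo_on_has_deriv[OF f(1) in3 i] by blast
  have bound: "cmod (g \<zeta>) \<le> B" if "\<zeta> \<in> ball (w i) (2 * d)" for \<zeta>
    using f(2) in3[OF that] by (auto simp: g_def)
  \<comment> \<open>The remainder estimate \<open>field_Taylor\<close> divides by
    \<open>fact 1\<close>, not by \<open>fact 2\<close>, so the Cauchy bound
    \<open>fact 2 * B / d ^ 2\<close> for the second derivative enters in full.\<close>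
  have "cmod ((deriv ^^ 0) g (w i + h) - (\<Sum>k\<le>1. (deriv ^^ k) g (w i) * ((w i + h) - w i) ^ k / fact k))
      \<le> (2 * B / d\<^sup>2) * cmod ((w i + h) - w i) ^ Suc 1 / fact 1"
  proof (rule field_Taylor[where S = "ball (w i) d"])
    fix k x assume x: "x \<in> ball (w i) d"
    then have "x \<in> ball (w i) (2 * d)" using d by auto
    then show "((deriv ^^ k) g has_field_derivative (deriv ^^ Suc k) g x) (at x within ball (w i) d)"
      using has_field_derivative_higher_deriv[OF hol open_ball] DERIV_subset by blast
  next
    fix x assume x: "x \<in> ball (w i) d"
    have sub: "cball x d \<subseteq> ball (w i) (2 * d)"
    proof
      fix y assume "y \<in> cball x d"
      then show "y \<in> ball (w i) (2 * d)" using x dist_triangle[of "w i" y x] by auto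
    qed
    have "cmod ((deriv ^^ 2) g x) \<le> fact 2 * B / d ^ 2"
    proof (rule Cauchy_inequality[OF _ _ d])
      show "g holomorphic_on ball x d"
        using hol sub ball_subset_cball holomorphic_on_subset by blast
      show "continuous_on (cball x d) g"
        using hol sub holomorphic_on_imp_continuous_on holomorphic_on_subset by blast
      show "cmod (g y) \<le> B" if "cmod (x - y) = d" for y
        using bound[of y] sub that by (auto simp: dist_norm subset_iff)
    qed
    then show "cmod ((deriv ^^ Suc 1) g x) \<le> 2 * B / d\<^sup>2"
      by (simp add: numeral_2_eq_2)
  qed (use d h in \<open>auto simp: dist_norm\<close>)
  moreover have "deriv g (w i) = partial_deriv i f w" by (simp add: g_def partial_deriv_def)
  ultimately show ?thesis by (simp add: g_def algebra_simps power2_eq_square)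
qed

text \<open>Difference quotients with a fixed increment are themselves continuous and holomorphic in
  each variable, including those other than \<open>i\<close>. By
  \<open>difference_quotient_bound\<close> they converge uniformly on a small polydisc, and uniform
  limits keep both properties.\<close>

lemma holo_on_partial_deriv:
  assumes S: "open_Cn n S" and f: "holo_on n S f" and i: "i < n"
  shows "holo_on n S (partial_deriv i f)"
proof (rule holo_on_local)
  show "S \<subseteq> Cn n" using S open_Cn_iff by blast
  fix z assume z: "z \<in> S"
  have "continuous_on S f" using f by (auto simp: holo_on_def)
  then obtain d0 where d0: "d0 > 0" "polydisc n z d0 \<subseteq> S" "\<And>w. w \<in> polydisc n z d0 \<Longrightarrow> dist (f w) (f z) < 1"
    using continuous_on_Cn_bound[OF S _ z zero_less_one] by metis
  \<comment> \<open>A third of \<open>d0\<close>, so that the polydisc of radius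
    \<open>3 * d\<close> required by \<open>difference_quotient_bound\<close> is the one on which
    continuity bounds \<open>f\<close>.\<close>
  define d where "d = d0 / 3"
  define B where "B = cmod (f z) + 1"
  have d: "d > 0" "polydisc n z (3 * d) \<subseteq> S" using d0 by (auto simp: d_def)
  have B: "cmod (f w) \<le> B" if "w \<in> polydisc n z (3 * d)" for w
    using d0(3)[of w] that norm_triangle_sub[of "f w" "f z"] by (auto simp: d_def B_def dist_norm)
  have "B > 0" by (simp add: B_def add_nonneg_pos)
  have f3: "holo_on n (polydisc n z (3 * d)) f" using f d(2) holo_on_subset by blast
  define P where "P = polydisc n z d"
  have zC: "z \<in> Cn n" using z S open_Cn_iff by blast
  have zP: "z \<in> P" using d(1) zC by (auto simp: P_def polydisc_def)
  \<comment> \<open>Any null sequence of nonzero increments would do; the summand 2 keeps even the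
    first one strictly below \<open>d\<close>.\<close>
  define h where "h = (\<lambda>m. complex_of_real (d / (real m + 2)))"
  have h: "cmod (h m) < d" "h m \<noteq> 0" for m
  proof -
    have "cmod (h m) = d / (real m + 2)"
      unfolding h_def norm_of_real using d(1) by simp
    also have "\<dots> < d / 1"
      by (rule divide_strict_left_mono) (use d(1) in auto)
    finally show "cmod (h m) < d" by simp
    have "d / (real m + 2) \<noteq> 0" using d(1) by simp
    then show "h m \<noteq> 0" unfolding h_def of_real_eq_0_iff .
  qed
  define Q where "Q = (\<lambda>m w. (f (w(i := w i + h m)) - f w) / h m)"
  have in3: "w(i := w i + h m) \<in> polydisc n z (3 * d)" if "w \<in> P" for w m
  proof -
    have "dist (w i + h m) (z i) \<le> dist (w i) (z i) + cmod (h m)"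
      by (metis add.commute add_diff_eq dist_norm norm_triangle_ineq)
    then have "dist (w i + h m) (z i) < 3 * d" using h(1)[of m] that i d(1) by (fastforce simp: P_def polydisc_def)
    moreover have "\<forall>j<n. dist (w j) (z j) < 3 * d"
      using that d(1) by (auto simp: P_def polydisc_def intro: less_trans)
    ultimately show ?thesis using fun_upd_Cn[of w n i] that i by (auto simp: P_def polydisc_def)
  qed
  have P3: "P \<subseteq> polydisc n z (3 * d)" unfolding P_def using d(1) polydisc_mono by auto
  have Qholo: "holo_on n P (Q m)" for m
    unfolding holo_on_def
  proof (intro conjI ballI allI impI)
    have c: "continuous_on P (\<lambda>w. w(i := w i + h m))"
    proof (rule continuous_on_coordinatewise_then_product)
      have "continuous_on P (\<lambda>w. w j)" for j
        by (rule continuous_on_subset[OF continuous_on_product_coordinates]) auto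
      then show "continuous_on P (\<lambda>w. (w(i := w i + h m)) j)" for j
        by (cases "j = i") (auto intro!: continuous_intros)
    qed
    have "continuous_on (polydisc n z (3 * d)) f" using f3 by (auto simp: holo_on_def)
    then have "continuous_on P (\<lambda>w. f (w(i := w i + h m)))"
      using continuous_on_compose2[OF _ c] in3 by blast
    moreover have "continuous_on P f"
      using f3 P3 continuous_on_subset unfolding holo_on_def by blast
    ultimately show "continuous_on P (Q m)"
      unfolding Q_def using h by (intro continuous_intros) auto
  next
    fix w k assume w: "w \<in> P" and k: "k < n"
    \<comment> \<open>In the direction \<open>i\<close> itself the shifted term is a translate of
      the restriction of \<open>f\<close> to the line; in any other direction the two updates
      commute.\<close>
    have "(\<lambda>\<zeta>. f ((w(k := \<zeta>))(i := (w(k := \<zeta>)) i + h m))) field_differentiable at (w k)"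
    proof (cases "k = i")
      case True
      have "((\<lambda>\<zeta>. f (w(i := \<zeta>))) has_field_derivative partial_deriv i f (w(i := w i + h m))) (at (w i + h m))"
        by (rule holo_on_has_deriv[OF f3 in3[OF w] i])
      then have "((\<lambda>\<zeta>. f (w(i := \<zeta> + h m))) has_field_derivative partial_deriv i f (w(i := w i + h m))) (at (w i))"
        by (simp add: DERIV_shift)
      then show ?thesis using True by (auto simp: field_differentiable_def)
    next
      case False
      have "(\<lambda>\<zeta>. f ((w(i := w i + h m))(k := \<zeta>))) field_differentiable at ((w(i := w i + h m)) k)"
        using in3[OF w] f3 k unfolding holo_on_def by blast
      then show ?thesis using False by (simp add: fun_upd_twist)
    qed
    moreover have "(\<lambda>\<zeta>. f (w(k := \<zeta>))) field_differentiable at (w k)"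
      using w P3 f3 k unfolding holo_on_def by blast
    ultimately show "(\<lambda>\<zeta>. Q m (w(k := \<zeta>))) field_differentiable at (w k)"
      unfolding Q_def using h by (intro field_differentiable_divide field_differentiable_diff) auto
  qed
  have h0: "(\<lambda>m. 2 * B / d\<^sup>2 * cmod (h m)) \<longlonglongrightarrow> 0"
  proof -
    have "(\<lambda>m. d / (real m + 2)) \<longlonglongrightarrow> 0" by real_asymp
    from tendsto_of_real[OF this] have "h \<longlonglongrightarrow> 0" unfolding h_def of_real_0 .
    then show ?thesis using tendsto_mult_right_zero tendsto_norm_zero by blast
  qed
  have unif: "uniform_limit P Q (partial_deriv i f) sequentially"
  proof (rule uniform_limitI)
    fix e :: real assume "e > 0"
    then have "\<forall>\<^sub>F m in sequentially. 2 * B / d\<^sup>2 * cmod (h m) < e"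
      using h0 order_tendstoD(2) by blast
    then show "\<forall>\<^sub>F m in sequentially. \<forall>w\<in>P. dist (Q m w) (partial_deriv i f w) < e"
    proof eventually_elim
      case (elim m)
      show ?case
      proof
        fix w assume w: "w \<in> P"
        have "cmod (f (w(i := w i + h m)) - f w - h m * partial_deriv i f w) \<le> 2 * B / d\<^sup>2 * (cmod (h m))\<^sup>2"
          by (rule difference_quotient_bound[OF f3 B _ d(1) i h(1)]) (use w P_def in auto)
        moreover have "h m * Q m w = f (w(i := w i + h m)) - f w"
          using h(2)[of m] by (simp add: Q_def)
        then have "f (w(i := w i + h m)) - f w - h m * partial_deriv i f w = h m * (Q m w - partial_deriv i f w)"
          by (simp only: right_diff_distrib)
        ultimately have "cmod (h m) * dist (Q m w) (partial_deriv i f w) \<le> cmod (h m) * (2 * B / d\<^sup>2 * cmod (h m))"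
          by (simp only: dist_norm norm_mult power2_eq_square mult_ac)
        moreover have "cmod (h m) > 0" using h(2) by simp
        ultimately have "dist (Q m w) (partial_deriv i f w) \<le> 2 * B / d\<^sup>2 * cmod (h m)"
          using mult_le_cancel_left_pos by blast
        then show "dist (Q m w) (partial_deriv i f w) < e" using elim by simp
      qed
    qed
  qed
  have "holo_on n P (partial_deriv i f)"
    unfolding holo_on_def
  proof (intro conjI ballI allI impI)
    show "continuous_on P (partial_deriv i f)"
      by (rule uniform_limit_theorem[OF _ unif]) (use Qholo in \<open>auto simp: holo_on_def\<close>)
    fix w k assume w: "w \<in> P" and k: "k < n"
    \<comment> \<open>Half of the remaining distance, so that a closed disc stays inside
      \<open>P\<close>: the theorem on uniform limits of holomorphic functions wants continuity on
      closed discs.\<close>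
    define r where "r = (d - dist (w k) (z k)) / 2"
    have r: "r > 0" using w k by (auto simp: r_def P_def polydisc_def)
    have inP: "w(k := \<zeta>) \<in> P" if "\<zeta> \<in> cball (w k) r" for \<zeta>
    proof -
      have "dist \<zeta> (z k) \<le> dist (w k) \<zeta> + dist (w k) (z k)" by (rule dist_triangle3)
      moreover have "dist (w k) \<zeta> \<le> r" using that by simp
      ultimately have "dist \<zeta> (z k) < d" using r r_def by argo
      then show ?thesis using w k fun_upd_Cn by (auto simp: P_def polydisc_def)
    qed
    have hol: "(\<lambda>\<zeta>. Q m (w(k := \<zeta>))) field_differentiable at \<zeta>" if "\<zeta> \<in> cball (w k) r" for m \<zeta>
      using holo_on_has_deriv[OF Qholo inP[OF that] k] by (auto simp: field_differentiable_def)
    have ul: "uniform_limit (cball (w k) r) (\<lambda>m \<zeta>. Q m (w(k := \<zeta>))) (\<lambda>\<zeta>. partial_deriv i f (w(k := \<zeta>))) sequentially"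
      unfolding uniform_limit_iff
    proof (intro allI impI)
      fix e :: real assume "e > 0"
      then have "\<forall>\<^sub>F m in sequentially. \<forall>x\<in>P. dist (Q m x) (partial_deriv i f x) < e"
        using unif unfolding uniform_limit_iff by blast
      then show "\<forall>\<^sub>F m in sequentially. \<forall>\<zeta>\<in>cball (w k) r.
          dist (Q m (w(k := \<zeta>))) (partial_deriv i f (w(k := \<zeta>))) < e"
        by eventually_elim (use inP in auto)
    qed
    have "continuous_on (cball (w k) r) (\<lambda>\<zeta>. Q m (w(k := \<zeta>)))
        \<and> (\<lambda>\<zeta>. Q m (w(k := \<zeta>))) holomorphic_on ball (w k) r" for m
    proof
      show "continuous_on (cball (w k) r) (\<lambda>\<zeta>. Q m (w(k := \<zeta>)))"
        by (intro continuous_at_imp_continuous_on ballI field_differentiable_imp_continuous_at hol)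
      show "(\<lambda>\<zeta>. Q m (w(k := \<zeta>))) holomorphic_on ball (w k) r"
        unfolding holomorphic_on_def
        by (rule ballI, rule field_differentiable_at_within, rule hol) auto
    qed
    then have ev: "\<forall>\<^sub>F m in sequentially. continuous_on (cball (w k) r) (\<lambda>\<zeta>. Q m (w(k := \<zeta>)))
        \<and> (\<lambda>\<zeta>. Q m (w(k := \<zeta>))) holomorphic_on ball (w k) r"
      by (intro always_eventually allI)
    have "(\<lambda>\<zeta>. partial_deriv i f (w(k := \<zeta>))) holomorphic_on ball (w k) r"
      by (rule holomorphic_uniform_limit[OF ev ul trivial_limit_sequentially])
    then show "(\<lambda>\<zeta>. partial_deriv i f (w(k := \<zeta>))) field_differentiable at (w k)"
      by (rule holomorphic_on_imp_differentiable_at) (use r in auto)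
  qed
  then show "\<exists>T. open_Cn n T \<and> z \<in> T \<and> holo_on n T (partial_deriv i f)"
    using zP open_Cn_polydisc P_def by blast
qed

text \<open>Continuity of the partial derivatives, which is Osgood's lemma, upgrades separate to
  total differentiability: one moves from \<open>z\<close> to \<open>w\<close> one coordinate at a
  time and bounds each increment, after subtracting its linear part, by a mean value
  estimate.\<close>

lemma holo_on_total_derivative:
  assumes S: "open_Cn n S" and f: "holo_on n S f" and z: "z \<in> S" and e: "e > 0"
  obtains d where "d > 0" "polydisc n z d \<subseteq> S"
    "\<And>w. w \<in> polydisc n z d \<Longrightarrow>
       cmod (f w - f z - (\<Sum>i<n. partial_deriv i f z * (w i - z i))) \<le> e * (\<Sum>i<n. cmod (w i - z i))"
proof -
  have "\<exists>d>0. \<forall>i<n. polydisc n z d \<subseteq> S \<and>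
      (\<forall>w \<in> polydisc n z d. dist (partial_deriv i f w) (partial_deriv i f z) < e)"
  proof (rule finite_common_radius)
    fix i assume "i < n"
    then have "continuous_on S (partial_deriv i f)"
      using holo_on_partial_deriv[OF S f] by (auto simp: holo_on_def)
    then show "\<exists>d>0. polydisc n z d \<subseteq> S \<and>
      (\<forall>w \<in> polydisc n z d. dist (partial_deriv i f w) (partial_deriv i f z) < e)"
      using continuous_on_Cn_bound[OF S _ z e] by metis
  next
    fix i and d d' :: real assume "d' \<le> d"
    then have "polydisc n z d' \<subseteq> polydisc n z d" by (rule polydisc_mono)
    then show "polydisc n z d \<subseteq> S \<and>
      (\<forall>w \<in> polydisc n z d. dist (partial_deriv i f w) (partial_deriv i f z) < e) \<Longrightarrow> polydisc n z d' \<subseteq> S \<and>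
      (\<forall>w \<in> polydisc n z d'. dist (partial_deriv i f w) (partial_deriv i f z) < e)" by blast
  qed
  moreover obtain d1 where d1: "d1 > 0" "polydisc n z d1 \<subseteq> S" using S z open_Cn_iff by meson
  ultimately obtain d2 where d2: "d2 > 0" "\<And>i w. i < n \<Longrightarrow> w \<in> polydisc n z d2 \<Longrightarrow>
     dist (partial_deriv i f w) (partial_deriv i f z) < e" by blast
  define d where "d = min d1 d2"
  have d: "d > 0" "polydisc n z d \<subseteq> S" "\<And>i w. i < n \<Longrightarrow> w \<in> polydisc n z d \<Longrightarrow>
     dist (partial_deriv i f w) (partial_deriv i f z) < e"
    using d1 d2 polydisc_mono[of d d1 n z] polydisc_mono[of d d2 n z] by (auto simp: d_def)
  have zC: "z \<in> Cn n" using z S open_Cn_iff by blast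
  show ?thesis
  proof (rule that[OF d(1,2)])
    fix w assume w: "w \<in> polydisc n z d"
    \<comment> \<open>The path from \<open>z\<close> to \<open>w\<close>: the first \<open>k\<close>
      coordinates are already those of \<open>w\<close>. It stays in the polydisc because each of
      its coordinates belongs to \<open>z\<close> or to \<open>w\<close>.\<close>
    define m where "m = (\<lambda>k i. if i < k then w i else z i)"
    have wz: "w i = z i" if "\<not> i < n" for i using that w zC by (auto simp: polydisc_def Cn_def)
    have mP: "(m k)(k := \<zeta>) \<in> polydisc n z d" if "k < n" "\<zeta> \<in> ball (z k) d" for k \<zeta>
      using that w zC d(1) by (auto simp: m_def polydisc_def Cn_def dist_commute)
    have "cmod (f (m k) - f z - (\<Sum>i<k. partial_deriv i f z * (w i - z i))) \<le> e * (\<Sum>i<k. cmod (w i - z i))"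
      if "k \<le> n" for k
      using that
    proof (induction k)
      case 0
      then show ?case by (simp add: m_def)
    next
      case (Suc k)
      then have k: "k < n" by simp
      \<comment> \<open>Subtracting the linear part leaves a function of one variable whose
        derivative is at most \<open>e\<close> in modulus.\<close>
      define g where "g = (\<lambda>\<zeta>. f ((m k)(k := \<zeta>)) - partial_deriv k f z * \<zeta>)"
      have "cmod (g (w k) - g (z k)) \<le> e * cmod (w k - z k)"
      proof (rule field_differentiable_bound[where S = "ball (z k) d"])
        fix \<zeta> assume z: "\<zeta> \<in> ball (z k) d"
        have "(m k)(k := \<zeta>) \<in> S" using mP[OF k z] d(2) by blast
        then show "(g has_field_derivative (partial_deriv k f ((m k)(k := \<zeta>)) - partial_deriv k f z)) (at \<zeta> within ball (z k) d)"
          unfolding g_def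
          by (auto intro!: derivative_eq_intros DERIV_subset[OF holo_on_has_deriv[OF f _ k]])
        show "cmod (partial_deriv k f ((m k)(k := \<zeta>)) - partial_deriv k f z) \<le> e"
          using d(3)[OF k mP[OF k z]] by (simp add: dist_norm)
      qed (use d(1) w k in \<open>auto simp: polydisc_def dist_commute\<close>)
      moreover have "(m k)(k := w k) = m (Suc k)" "(m k)(k := z k) = m k"
        by (auto simp: m_def fun_eq_iff less_Suc_eq)
      ultimately have "cmod (f (m (Suc k)) - f (m k) - partial_deriv k f z * (w k - z k)) \<le> e * cmod (w k - z k)"
        by (simp add: g_def algebra_simps)
      moreover have "f (m (Suc k)) - f z - (\<Sum>i<Suc k. partial_deriv i f z * (w i - z i)) =
          (f (m k) - f z - (\<Sum>i<k. partial_deriv i f z * (w i - z i))) +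
          (f (m (Suc k)) - f (m k) - partial_deriv k f z * (w k - z k))" by simp
      moreover have "e * (\<Sum>i<Suc k. cmod (w i - z i)) = e * (\<Sum>i<k. cmod (w i - z i)) + e * cmod (w k - z k)"
        by (simp add: algebra_simps)
      moreover have "cmod (f (m k) - f z - (\<Sum>i<k. partial_deriv i f z * (w i - z i))) \<le> e * (\<Sum>i<k. cmod (w i - z i))"
        using Suc.IH k by simp
      ultimately show ?case by (simp only: norm_triangle_mono)
    qed
    note this[of n]
    moreover have "m n = w" using wz by (auto simp: m_def)
    ultimately show "cmod (f w - f z - (\<Sum>i<n. partial_deriv i f z * (w i - z i))) \<le> e * (\<Sum>i<n. cmod (w i - z i))"
      by simp
  qed
qed

text \<open>The total derivative of \<open>f\<close> is applied to the chord from
  \<open>\<gamma> a\<close> to \<open>\<gamma> \<zeta>\<close>; \<open>R\<close> is the difference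
  between the quotient of the composite and the expected combination of the quotients
  \<open>q i\<close>. The curve is required to be differentiable only at the one point
  \<open>a\<close>.\<close>

lemma holo_on_chain_rule:
  assumes S: "open_Cn n S" and f: "holo_on n S f" and a: "\<gamma> a \<in> S"
    and C: "\<forall>\<^sub>F \<zeta> in nhds a. \<gamma> \<zeta> \<in> Cn n"
    and \<gamma>: "\<And>i. i < n \<Longrightarrow> ((\<lambda>\<zeta>. \<gamma> \<zeta> i) has_field_derivative \<gamma>' i) (at a)"
  shows "((\<lambda>\<zeta>. f (\<gamma> \<zeta>)) has_field_derivative (\<Sum>i<n. \<gamma>' i * partial_deriv i f (\<gamma> a))) (at a)"
proof -
  define q where "q = (\<lambda>i \<zeta>. (\<gamma> \<zeta> i - \<gamma> a i) / (\<zeta> - a))"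
  define R where "R = (\<lambda>\<zeta>. (f (\<gamma> \<zeta>) - f (\<gamma> a)) / (\<zeta> - a) - (\<Sum>i<n. q i \<zeta> * partial_deriv i f (\<gamma> a)))"
  \<comment> \<open>A bound near \<open>a\<close> for the sum of the
    \<open>cmod (q i \<zeta>)\<close>: it exceeds their limit by 1, which also makes it positive for
    the division below.\<close>
  define M where "M = (\<Sum>i<n. cmod (\<gamma>' i)) + 1"
  have M: "M > 0" by (simp add: M_def sum_nonneg add_nonneg_pos)
  have q: "(q i \<longlongrightarrow> \<gamma>' i) (at a)" if "i < n" for i
    using \<gamma>[OF that] by (simp add: q_def has_field_derivative_iff)
  have evM: "\<forall>\<^sub>F \<zeta> in at a. (\<Sum>i<n. cmod (q i \<zeta>)) < M"
  proof -
    have "((\<lambda>\<zeta>. \<Sum>i<n. cmod (q i \<zeta>)) \<longlongrightarrow> (\<Sum>i<n. cmod (\<gamma>' i))) (at a)"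
      by (intro tendsto_sum tendsto_norm q) auto
    then show ?thesis using order_tendstoD(2)[of _ _ "at a" M] by (simp add: M_def)
  qed
  have R0: "(R \<longlongrightarrow> 0) (at a)"
  proof (rule tendstoI)
    fix e :: real assume e: "e > 0"
    \<comment> \<open>The factor 2 in the denominator makes the final estimate strict.\<close>
    define e' where "e' = e / (2 * M)"
    have e': "e' > 0" using e M by (simp add: e'_def)
    obtain d where d: "d > 0" "polydisc n (\<gamma> a) d \<subseteq> S" "\<And>w. w \<in> polydisc n (\<gamma> a) d \<Longrightarrow>
       cmod (f w - f (\<gamma> a) - (\<Sum>i<n. partial_deriv i f (\<gamma> a) * (w i - \<gamma> a i))) \<le> e' * (\<Sum>i<n. cmod (w i - \<gamma> a i))"
      by (rule holo_on_total_derivative[OF S f a e']) (rule that, assumption+)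
    have "\<forall>\<^sub>F \<zeta> in at a. \<forall>i\<in>{..<n}. dist (\<gamma> \<zeta> i) (\<gamma> a i) < d"
    proof (rule eventually_ball_finite)
      show "\<forall>i\<in>{..<n}. \<forall>\<^sub>F \<zeta> in at a. dist (\<gamma> \<zeta> i) (\<gamma> a i) < d"
        using \<gamma> d(1) DERIV_isCont isContD tendstoD by blast
    qed auto
    moreover have "\<forall>\<^sub>F \<zeta> in at a. \<gamma> \<zeta> \<in> Cn n"
      using C by (simp add: eventually_nhds_conv_at)
    moreover have "\<forall>\<^sub>F \<zeta> in at a. \<zeta> \<noteq> a" by (simp add: eventually_at_filter)
    ultimately show "\<forall>\<^sub>F \<zeta> in at a. dist (R \<zeta>) 0 < e" using evM
    proof eventually_elim
      case (elim \<zeta>)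
      then have "\<gamma> \<zeta> \<in> polydisc n (\<gamma> a) d" by (auto simp: polydisc_def)
      then have "cmod (f (\<gamma> \<zeta>) - f (\<gamma> a) - (\<Sum>i<n. partial_deriv i f (\<gamma> a) * (\<gamma> \<zeta> i - \<gamma> a i))) / cmod (\<zeta> - a)
          \<le> e' * (\<Sum>i<n. cmod (\<gamma> \<zeta> i - \<gamma> a i)) / cmod (\<zeta> - a)"
        by (intro divide_right_mono d(3)) auto
      also have "\<dots> = e' * (\<Sum>i<n. cmod (q i \<zeta>))"
        by (simp add: q_def norm_divide flip: sum_divide_distrib)
      also have "\<dots> \<le> e' * M" using elim e' by (intro mult_left_mono) auto
      also have "\<dots> < e" using e M by (simp add: e'_def)
      also have "cmod (f (\<gamma> \<zeta>) - f (\<gamma> a) - (\<Sum>i<n. partial_deriv i f (\<gamma> a) * (\<gamma> \<zeta> i - \<gamma> a i))) / cmod (\<zeta> - a) = cmod (R \<zeta>)"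
        unfolding R_def q_def norm_divide[symmetric]
        by (subst diff_divide_distrib) (simp add: sum_divide_distrib mult.commute)
      finally show ?case by simp
    qed
  qed
  have "((\<lambda>\<zeta>. R \<zeta> + (\<Sum>i<n. q i \<zeta> * partial_deriv i f (\<gamma> a))) \<longlongrightarrow> 0 + (\<Sum>i<n. \<gamma>' i * partial_deriv i f (\<gamma> a))) (at a)"
    by (intro tendsto_add R0 tendsto_sum tendsto_mult q) auto
  then show ?thesis by (simp add: has_field_derivative_iff R_def)
qed

lemma partial_deriv_compose:
  assumes S: "open_Cn n S" and f: "holo_on n S f"
    and T: "open_Cn m T" and G: "\<And>j. j < n \<Longrightarrow> holo_on m T (\<lambda>z. G z j)" "G ` T \<subseteq> S"
    and z: "z \<in> T" and i: "i < m"
  shows "((\<lambda>\<zeta>. f (G (z(i := \<zeta>)))) has_field_derivative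
           (\<Sum>j<n. partial_deriv i (\<lambda>z. G z j) z * partial_deriv j f (G z))) (at (z i))"
proof -
  have "((\<lambda>\<zeta>. f (G (z(i := \<zeta>)))) has_field_derivative
     (\<Sum>j<n. partial_deriv i (\<lambda>z. G z j) z * partial_deriv j f (G (z(i := z i))))) (at (z i))"
  proof (rule holo_on_chain_rule[OF S f])
    show "G (z(i := z i)) \<in> S" using z G by auto
    show "\<forall>\<^sub>F \<zeta> in nhds (z i). G (z(i := \<zeta>)) \<in> Cn n"
      using open_Cn_line[OF T z i]
    proof eventually_elim
      case (elim \<zeta>)
      then show ?case using G(2) openin_imp_subset[OF S] by auto
    qed
    show "((\<lambda>\<zeta>. G (z(i := \<zeta>)) j) has_field_derivative partial_deriv i (\<lambda>z. G z j) z) (at (z i))" if "j < n" for j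
      by (rule holo_on_has_deriv'[OF G(1)[OF that] z i])
  qed
  then show ?thesis by simp
qed

lemma holo_on_compose:
  assumes S: "open_Cn n S" and f: "holo_on n S f"
    and T: "open_Cn m T" and G: "\<And>j. j < n \<Longrightarrow> holo_on m T (\<lambda>z. G z j)" "G ` T \<subseteq> S"
  shows "holo_on m T (\<lambda>z. f (G z))"
  unfolding holo_on_def
proof (intro conjI ballI allI impI)
  have "continuous_on T G"
  proof (rule continuous_on_coordinatewise_then_product)
    fix j
    show "continuous_on T (\<lambda>z. G z j)"
    proof (cases "j < n")
      case True
      then show ?thesis using G by (auto simp: holo_on_def)
    next
      \<comment> \<open>Continuity in the product topology concerns all coordinates, also those from
        \<open>n\<close> on; these vanish because \<open>G\<close> maps into
        \<open>Cn n\<close>.\<close>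
      case False
      have "G z j = 0" if "z \<in> T" for z
      proof -
        have "G z \<in> Cn n" using G(2) openin_imp_subset[OF S] that by blast
        then show ?thesis using False by (auto simp: Cn_def)
      qed
      then show ?thesis using continuous_on_cong[of T T "\<lambda>z. G z j" "\<lambda>_. 0"] by simp
    qed
  qed
  then show "continuous_on T (\<lambda>z. f (G z))"
    using f G(2) continuous_on_compose2 unfolding holo_on_def by blast
  fix z i assume "z \<in> T" "i < m"
  then show "(\<lambda>\<zeta>. f (G (z(i := \<zeta>)))) field_differentiable at (z i)"
    using partial_deriv_compose[OF S f T G] unfolding field_differentiable_def by blast
qed

section \<open>Holomorphic functions and tangent vectors on a manifold\<close>

lemma partial_deriv_add:
  assumes "holo_on n S f" "holo_on n S g" "z \<in> S" "i < n"
  shows "partial_deriv i (\<lambda>z. f z + g z) z = partial_deriv i f z + partial_deriv i g z"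
  using assms unfolding partial_deriv_def holo_on_def by (intro deriv_add) auto

lemma partial_deriv_mult:
  assumes "holo_on n S f" "holo_on n S g" "z \<in> S" "i < n"
  shows "partial_deriv i (\<lambda>z. f z * g z) z = partial_deriv i f z * g z + f z * partial_deriv i g z"
proof -
  have "deriv (\<lambda>\<zeta>. f (z(i := \<zeta>)) * g (z(i := \<zeta>))) (z i) =
     f (z(i := z i)) * deriv (\<lambda>\<zeta>. g (z(i := \<zeta>))) (z i) + deriv (\<lambda>\<zeta>. f (z(i := \<zeta>))) (z i) * g (z(i := z i))"
    using assms unfolding holo_on_def by (intro deriv_mult) auto
  then show ?thesis by (simp add: partial_deriv_def)
qed

lemma partial_deriv_const: "partial_deriv i (\<lambda>z. c) z = 0"
  by (simp add: partial_deriv_def)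

lemma hol_fun_subset: "hol_fun U W h \<Longrightarrow> W' \<subseteq> W \<Longrightarrow> hol_fun U W' h"
  unfolding hol_fun_def by (fastforce elim!: holo_on_subset)

lemma hol_fun_const: "hol_fun U W (\<lambda>x. c)"
  by (auto simp: hol_fun_def holo_on_const)

lemma hol_fun_add: "hol_fun U W f \<Longrightarrow> hol_fun U W g \<Longrightarrow> hol_fun U W (\<lambda>x. f x + g x)"
  by (fastforce simp: hol_fun_def intro: holo_on_add)

lemma hol_fun_mult: "hol_fun U W f \<Longrightarrow> hol_fun U W g \<Longrightarrow> hol_fun U W (\<lambda>x. f x * g x)"
  by (fastforce simp: hol_fun_def intro: holo_on_mult)

lemma hol_fun_sum:
  "(\<And>i. i \<in> I \<Longrightarrow> hol_fun U W (f i)) \<Longrightarrow> hol_fun U W (\<lambda>x. \<Sum>i\<in>I. f i x)"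
  by (induction I rule: infinite_finite_induct) (auto intro: hol_fun_const hol_fun_add)

locale cmanifold =
  fixes U :: "'a cman"
  assumes cman: "complex_manifold U"
begin

lemma chart:
  assumes "(n, D, \<phi>) \<in> atlas U"
  shows chart_open: "openin (mtop U) D"
    and chart_image_open: "open_Cn n (\<phi> ` D)"
    and chart_homeomorphic: "homeomorphic_map (subtopology (mtop U) D) (top_of_set (\<phi> ` D)) \<phi>"
  using cman assms unfolding complex_manifold_def by fast+

lemma chart_transition:
  assumes "(n, D, \<phi>) \<in> atlas U" "(m, D', \<psi>) \<in> atlas U" "j < m"
  shows "holo_on n (\<phi> ` (D \<inter> D')) (\<lambda>z. \<psi> (inv_into D \<phi> z) j)"
proof -
  have "\<forall>(n, D, \<phi>) \<in> atlas U. \<forall>(m, D', \<psi>) \<in> atlas U. \<forall>j<m.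
      holo_on n (\<phi> ` (D \<inter> D')) (\<lambda>z. \<psi> (inv_into D \<phi> z) j)"
    using cman unfolding complex_manifold_def by (elim conjE)
  from bspec[OF this assms(1), unfolded case_prod_conv]
  have "\<forall>(m, D', \<psi>) \<in> atlas U. \<forall>j<m. holo_on n (\<phi> ` (D \<inter> D')) (\<lambda>z. \<psi> (inv_into D \<phi> z) j)" .
  from bspec[OF this assms(2), unfolded case_prod_conv] assms(3) show ?thesis by blast
qed

lemma points_chart:
  assumes "x \<in> points U"
  obtains n D \<phi> where "(n, D, \<phi>) \<in> atlas U" "x \<in> D"
proof -
  have "(\<Union>(n, D, \<phi>) \<in> atlas U. D) = points U"
    using cman unfolding complex_manifold_def by (elim conjE)
  with assms have "x \<in> (\<Union>(n, D, \<phi>) \<in> atlas U. D)" by simp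
  then show ?thesis by (auto intro: that)
qed

lemma open_subset_points: "openin (mtop U) W \<Longrightarrow> W \<subseteq> points U"
  unfolding points_def by (rule openin_subset)

lemma open_points: "openin (mtop U) (points U)"
  by (simp add: points_def)

lemma chart_inj:
  assumes "(n, D, \<phi>) \<in> atlas U"
  shows "inj_on \<phi> D"
proof -
  have "topspace (subtopology (mtop U) D) = D"
    using openin_subset[OF chart_open[OF assms]] by auto
  then show ?thesis
    using chart_homeomorphic[OF assms] homeomorphic_imp_injective_map by fastforce
qed

lemma chart_inv [simp]:
  assumes "(n, D, \<phi>) \<in> atlas U" "x \<in> D"
  shows "inv_into D \<phi> (\<phi> x) = x"
  using chart_inj[OF assms(1)] assms(2) by simp

text \<open>A chart is an open map onto its image, and the image is open in \<open>Cn n\<close>.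
  Coordinate images of open sets are thus legitimate domains for \<open>holo_on\<close>.\<close>

lemma chart_open_image:
  assumes "(n, D, \<phi>) \<in> atlas U" "openin (mtop U) W"
  shows "open_Cn n (\<phi> ` (D \<inter> W))"
proof -
  have "openin (subtopology (mtop U) D) (D \<inter> W)"
    using assms(2) openin_subtopology_Int2 by blast
  then have "openin (top_of_set (\<phi> ` D)) (\<phi> ` (D \<inter> W))"
    using homeomorphic_imp_open_map[OF chart_homeomorphic[OF assms(1)]] open_map_def by blast
  then show ?thesis using chart_image_open[OF assms(1)] openin_trans by blast
qed

lemma chart_hol_fun:
  assumes "(n, D, \<phi>) \<in> atlas U" "j < n"
  shows "hol_fun U D (\<lambda>x. \<phi> x j)"
  unfolding hol_fun_def using chart_transition[OF _ assms] by auto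

lemma hol_fun_chart: "hol_fun U W h \<Longrightarrow> (n, D, \<phi>) \<in> atlas U \<Longrightarrow>
    holo_on n (\<phi> ` (D \<inter> W)) (\<lambda>z. h (inv_into D \<phi> z))"
  unfolding hol_fun_def by fast

lemma hol_fun_cong:
  assumes W: "openin (mtop U) W" and eq: "\<And>x. x \<in> W \<Longrightarrow> f x = g x" and f: "hol_fun U W f"
  shows "hol_fun U W g"
  unfolding hol_fun_def
proof clarify
  fix n D \<phi> assume c: "(n, D, \<phi>) \<in> atlas U"
  have "holo_on n (\<phi> ` (D \<inter> W)) (\<lambda>z. f (inv_into D \<phi> z)) \<longleftrightarrow> holo_on n (\<phi> ` (D \<inter> W)) (\<lambda>z. g (inv_into D \<phi> z))"
    by (rule holo_on_cong[OF chart_open_image[OF c W]]) (use c eq in auto)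
  then show "holo_on n (\<phi> ` (D \<inter> W)) (\<lambda>z. g (inv_into D \<phi> z))"
    using hol_fun_chart[OF f c] by blast
qed

lemma hol_fun_local:
  assumes "\<And>x. x \<in> W \<Longrightarrow> \<exists>W'. openin (mtop U) W' \<and> x \<in> W' \<and> hol_fun U W' h"
  shows "hol_fun U W h"
  unfolding hol_fun_def
proof clarify
  fix n D \<phi> assume c: "(n, D, \<phi>) \<in> atlas U"
  show "holo_on n (\<phi> ` (D \<inter> W)) (\<lambda>z. h (inv_into D \<phi> z))"
  proof (rule holo_on_local)
    show "\<phi> ` (D \<inter> W) \<subseteq> Cn n" using openin_imp_subset[OF chart_image_open[OF c]] by blast
    fix z assume "z \<in> \<phi> ` (D \<inter> W)"
    then obtain x where x: "z = \<phi> x" "x \<in> D" "x \<in> W" by blast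
    then obtain W' where W': "openin (mtop U) W'" "x \<in> W'" "hol_fun U W' h" using assms by blast
    have "open_Cn n (\<phi> ` (D \<inter> W'))" "z \<in> \<phi> ` (D \<inter> W')" "holo_on n (\<phi> ` (D \<inter> W')) (\<lambda>z. h (inv_into D \<phi> z))"
      using chart_open_image[OF c W'(1)] x W'(2) hol_fun_chart[OF W'(3) c] by auto
    then show "\<exists>T. open_Cn n T \<and> z \<in> T \<and> holo_on n T (\<lambda>z. h (inv_into D \<phi> z))" by blast
  qed
qed

text \<open>In another chart the function is the given coordinate expression composed with a
  transition map, so \<open>holo_on_compose\<close> applies. Holomorphy therefore needs to be
  verified in a single chart only.\<close>

lemma hol_fun_chartI:
  assumes c: "(n, D, \<phi>) \<in> atlas U" and W: "openin (mtop U) W"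
    and h: "holo_on n (\<phi> ` (D \<inter> W)) (\<lambda>z. h (inv_into D \<phi> z))"
  shows "hol_fun U (D \<inter> W) h"
  unfolding hol_fun_def
proof clarify
  fix m D' \<psi> assume c': "(m, D', \<psi>) \<in> atlas U"
  have op: "open_Cn m (\<psi> ` (D' \<inter> (D \<inter> W)))"
    by (rule chart_open_image[OF c' openin_Int[OF chart_open[OF c] W]])
  have "holo_on m (\<psi> ` (D' \<inter> (D \<inter> W))) (\<lambda>z. h (inv_into D \<phi> (\<phi> (inv_into D' \<psi> z))))"
  proof (rule holo_on_compose[OF chart_open_image[OF c W] h op])
    show "holo_on m (\<psi> ` (D' \<inter> (D \<inter> W))) (\<lambda>z. \<phi> (inv_into D' \<psi> z) j)" if "j < n" for j
      by (rule holo_on_subset[OF chart_transition[OF c' c that]]) auto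
    show "(\<lambda>z. \<phi> (inv_into D' \<psi> z)) ` \<psi> ` (D' \<inter> (D \<inter> W)) \<subseteq> \<phi> ` (D \<inter> W)"
      using c' by (auto simp: image_iff)
  qed
  then show "holo_on m (\<psi> ` (D' \<inter> (D \<inter> W))) (\<lambda>z. h (inv_into D' \<psi> z))"
    using c c' by (subst (asm) holo_on_cong[OF op, where g = "\<lambda>z. h (inv_into D' \<psi> z)"]) auto
qed

lemma hol_near_common:
  assumes "hol_near U x f" "hol_near U x g"
  obtains W where "openin (mtop U) W" "x \<in> W" "hol_fun U W f" "hol_fun U W g"
proof -
  obtain A B where "openin (mtop U) A" "x \<in> A" "hol_fun U A f" "openin (mtop U) B" "x \<in> B" "hol_fun U B g"
    using assms unfolding hol_near_def by blast
  then show ?thesis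
    by (intro that[of "A \<inter> B"]) (auto intro: hol_fun_subset)
qed

lemma hol_nearI: "openin (mtop U) W \<Longrightarrow> x \<in> W \<Longrightarrow> hol_fun U W h \<Longrightarrow> hol_near U x h"
  unfolding hol_near_def by blast

lemma hol_near_add:
  assumes "hol_near U x f" "hol_near U x g"
  shows "hol_near U x (\<lambda>y. f y + g y)"
proof -
  obtain W where W: "openin (mtop U) W" "x \<in> W" "hol_fun U W f" "hol_fun U W g"
    using hol_near_common[OF assms] .
  show ?thesis by (rule hol_nearI[OF W(1,2) hol_fun_add[OF W(3,4)]])
qed

lemma hol_near_mult:
  assumes "hol_near U x f" "hol_near U x g"
  shows "hol_near U x (\<lambda>y. f y * g y)"
proof -
  obtain W where W: "openin (mtop U) W" "x \<in> W" "hol_fun U W f" "hol_fun U W g"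
    using hol_near_common[OF assms] .
  show ?thesis by (rule hol_nearI[OF W(1,2) hol_fun_mult[OF W(3,4)]])
qed

lemma hol_near_const:
  assumes "x \<in> points U"
  shows "hol_near U x (\<lambda>y. c)"
  by (rule hol_nearI[OF open_points assms hol_fun_const])

lemma hol_near_sum:
  assumes "x \<in> points U" "\<And>i. i \<in> I \<Longrightarrow> hol_near U x (f i)"
  shows "hol_near U x (\<lambda>y. \<Sum>i\<in>I. f i y)"
  using assms by (induction I rule: infinite_finite_induct) (auto intro: hol_near_const hol_near_add)

lemma hol_near_cong:
  assumes W: "openin (mtop U) W" "x \<in> W" and eq: "\<And>y. y \<in> W \<Longrightarrow> f y = g y"
  shows "hol_near U x f \<longleftrightarrow> hol_near U x g"
proof -
  have "hol_near U x g" if h: "hol_near U x f" and eq: "\<And>y. y \<in> W \<Longrightarrow> f y = g y" for f g :: "'a \<Rightarrow> complex"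
  proof -
    obtain W' where W': "openin (mtop U) W'" "x \<in> W'" "hol_fun U W' f" using h unfolding hol_near_def by blast
    have "hol_fun U (W \<inter> W') g"
    proof (rule hol_fun_cong)
      show "hol_fun U (W \<inter> W') f" by (rule hol_fun_subset[OF W'(3)]) auto
    qed (use W W' eq in auto)
    then show ?thesis unfolding hol_near_def using W W' by blast
  qed
  then show ?thesis using eq by metis
qed

text \<open>Coordinate derivations depend only on germs. Besides the derivative, the case
  distinction on \<open>hol_near\<close> in their definition has to be invariant.\<close>

lemma coord_vec_cong:
  assumes c: "(n, D, \<phi>) \<in> atlas U" and x: "x \<in> D" and i: "i < n"
    and W: "openin (mtop U) W" "x \<in> W" and eq: "\<And>y. y \<in> W \<Longrightarrow> f y = g y"
  shows "coord_vec U (n, D, \<phi>) x i f = coord_vec U (n, D, \<phi>) x i g"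
proof -
  have "partial_deriv i (\<lambda>z. f (inv_into D \<phi> z)) (\<phi> x) = partial_deriv i (\<lambda>z. g (inv_into D \<phi> z)) (\<phi> x)"
    by (rule partial_deriv_cong[OF chart_open_image[OF c W(1)] _ i]) (use c x W eq in auto)
  then show ?thesis using hol_near_cong[OF W eq] by simp
qed

lemma coord_vec_add:
  assumes c: "(n, D, \<phi>) \<in> atlas U" and x: "x \<in> D" and i: "i < n"
    and f: "hol_near U x f" and g: "hol_near U x g"
  shows "coord_vec U (n, D, \<phi>) x i (\<lambda>y. f y + g y) = coord_vec U (n, D, \<phi>) x i f + coord_vec U (n, D, \<phi>) x i g"
proof -
  obtain W where W: "openin (mtop U) W" "x \<in> W" "hol_fun U W f" "hol_fun U W g"
    using hol_near_common[OF f g] .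
  have "\<phi> x \<in> \<phi> ` (D \<inter> W)" using x W by blast
  from partial_deriv_add[OF hol_fun_chart[OF W(3) c] hol_fun_chart[OF W(4) c] this i]
  show ?thesis using f g hol_near_add[OF f g] by simp
qed

lemma coord_vec_mult:
  assumes c: "(n, D, \<phi>) \<in> atlas U" and x: "x \<in> D" and i: "i < n"
    and f: "hol_near U x f" and g: "hol_near U x g"
  shows "coord_vec U (n, D, \<phi>) x i (\<lambda>y. f y * g y) =
    coord_vec U (n, D, \<phi>) x i f * g x + f x * coord_vec U (n, D, \<phi>) x i g"
proof -
  obtain W where W: "openin (mtop U) W" "x \<in> W" "hol_fun U W f" "hol_fun U W g"
    using hol_near_common[OF f g] .
  have "\<phi> x \<in> \<phi> ` (D \<inter> W)" using x W by blast
  from partial_deriv_mult[OF hol_fun_chart[OF W(3) c] hol_fun_chart[OF W(4) c] this i]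
  show ?thesis using f g hol_near_mult[OF f g] c x by simp
qed

lemma coord_vec_const: "coord_vec U (n, D, \<phi>) x i (\<lambda>y. c) = 0"
  by (simp add: partial_deriv_const)

lemma tangentE:
  assumes "v \<in> tangent U x"
  obtains n D \<phi> c where "(n, D, \<phi>) \<in> atlas U" "x \<in> D" "v = (\<lambda>h. \<Sum>i<n. c i * coord_vec U (n, D, \<phi>) x i h)"
  using assms unfolding tangent_def by blast

lemma tangentI:
  assumes "(n, D, \<phi>) \<in> atlas U" "x \<in> D"
  shows "(\<lambda>h. \<Sum>i<n. c i * coord_vec U (n, D, \<phi>) x i h) \<in> tangent U x"
  unfolding tangent_def mem_Collect_eq
  by (rule bexI[OF _ assms(1)], rule case_prodI2) (use assms(2) in auto)

lemma tangent_point: "v \<in> tangent U x \<Longrightarrow> x \<in> points U"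
  by (erule tangentE) (use chart_open open_subset_points in blast)

lemma tangent_not_near: "v \<in> tangent U x \<Longrightarrow> \<not> hol_near U x h \<Longrightarrow> v h = 0"
  by (erule tangentE) simp

lemma tangent_cong:
  assumes "v \<in> tangent U x" "openin (mtop U) W" "x \<in> W" "\<And>y. y \<in> W \<Longrightarrow> f y = g y"
  shows "v f = v g"
  using assms(1)
proof (rule tangentE)
  fix n D \<phi> c assume *: "(n, D, \<phi>) \<in> atlas U" "x \<in> D" "v = (\<lambda>h. \<Sum>i<n. c i * coord_vec U (n, D, \<phi>) x i h)"
  have "coord_vec U (n, D, \<phi>) x i f = coord_vec U (n, D, \<phi>) x i g" if "i < n" for i
    by (rule coord_vec_cong[OF *(1,2) that assms(2,3)]) (rule assms(4))
  then show ?thesis unfolding *(3) by (intro sum.cong[OF refl]) (simp only: lessThan_iff)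
qed

lemma tangent_add:
  assumes "v \<in> tangent U x" "hol_near U x f" "hol_near U x g"
  shows "v (\<lambda>y. f y + g y) = v f + v g"
  using assms(1)
proof (rule tangentE)
  fix n D \<phi> c assume *: "(n, D, \<phi>) \<in> atlas U" "x \<in> D" "v = (\<lambda>h. \<Sum>i<n. c i * coord_vec U (n, D, \<phi>) x i h)"
  show ?thesis unfolding *(3) sum.distrib[symmetric]
    by (rule sum.cong[OF refl]) (simp only: coord_vec_add[OF *(1,2) _ assms(2-3)] lessThan_iff distrib_left)
qed

lemma tangent_mult:
  assumes "v \<in> tangent U x" "hol_near U x f" "hol_near U x g"
  shows "v (\<lambda>y. f y * g y) = v f * g x + f x * v g"
  using assms(1)
proof (rule tangentE)
  fix n D \<phi> c assume *: "(n, D, \<phi>) \<in> atlas U" "x \<in> D" "v = (\<lambda>h. \<Sum>i<n. c i * coord_vec U (n, D, \<phi>) x i h)"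
  show ?thesis unfolding *(3) sum_distrib_left sum_distrib_right sum.distrib[symmetric]
    by (rule sum.cong[OF refl]) (simp only: coord_vec_mult[OF *(1,2) _ assms(2-3)] lessThan_iff algebra_simps)
qed

lemma tangent_const: "v \<in> tangent U x \<Longrightarrow> v (\<lambda>y. c) = 0"
  by (erule tangentE) (simp only: coord_vec_const mult_zero_right sum.neutral_const)

lemma tangent_sum:
  assumes "v \<in> tangent U x" "\<And>i. i \<in> I \<Longrightarrow> hol_near U x (f i)"
  shows "v (\<lambda>y. \<Sum>i\<in>I. f i y) = (\<Sum>i\<in>I. v (f i))"
  using assms(2)
proof (induction I rule: infinite_finite_induct)
  case (insert i I)
  have "v (\<lambda>y. \<Sum>i\<in>insert i I. f i y) = v (\<lambda>y. f i y + (\<Sum>i\<in>I. f i y))"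
    using insert by simp
  also have "\<dots> = v (f i) + v (\<lambda>y. \<Sum>i\<in>I. f i y)"
    by (rule tangent_add[OF assms(1)]) (use insert tangent_point[OF assms(1)] in \<open>auto intro: hol_near_sum\<close>)
  finally show ?case using insert by simp
qed (auto simp: tangent_const[OF assms(1)])

lemma coord_vec_tangent:
  assumes c: "(n, D, \<phi>) \<in> atlas U" and x: "x \<in> D" and i: "i < n"
  shows "coord_vec U (n, D, \<phi>) x i \<in> tangent U x"
proof -
  have "coord_vec U (n, D, \<phi>) x i = (\<lambda>h. \<Sum>k<n. (if k = i then 1 else 0) * coord_vec U (n, D, \<phi>) x k h)"
    using i by (simp add: sum.delta' if_distrib[of "\<lambda>a. a * _"] cong: if_cong)
  with tangentI[OF c x, of "\<lambda>k. if k = i then 1 else 0"] show ?thesis by metis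
qed

text \<open>At every point of \<open>W\<close> the test \<open>hol_near\<close> succeeds, so the
  coordinate derivation is the plain partial derivative of \<open>h\<close> in the chart, and
  Osgood's lemma makes it holomorphic.\<close>

lemma coord_vec_holo:
  assumes c: "(n, D, \<phi>) \<in> atlas U" and i: "i < n"
    and W: "openin (mtop U) W" and h: "hol_fun U W h"
  shows "holo_on n (\<phi> ` (D \<inter> W)) (\<lambda>z. coord_vec U (n, D, \<phi>) (inv_into D \<phi> z) i h)"
proof -
  note op = chart_open_image[OF c W]
  have "holo_on n (\<phi> ` (D \<inter> W)) (partial_deriv i (\<lambda>z. h (inv_into D \<phi> z)))"
    by (rule holo_on_partial_deriv[OF op hol_fun_chart[OF h c] i])
  moreover have "partial_deriv i (\<lambda>z. h (inv_into D \<phi> z)) z = coord_vec U (n, D, \<phi>) (inv_into D \<phi> z) i h"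
    if "z \<in> \<phi> ` (D \<inter> W)" for z
    using that c hol_nearI[OF W _ h] by auto
  ultimately show ?thesis using holo_on_cong[OF op, of "partial_deriv i (\<lambda>z. h (inv_into D \<phi> z))"] by simp
qed

end

section \<open>Holomorphic maps and their differentials\<close>

locale cman_map = U: cmanifold U + V: cmanifold V for U :: "'a cman" and V :: "'b cman" +
  fixes g :: "'a \<Rightarrow> 'b"
  assumes g: "g \<in> hol_maps U V"
begin

lemma g_continuous: "continuous_map (mtop U) (mtop V) g"
  using g by (simp add: hol_maps_def)

lemma g_points: "x \<in> points U \<Longrightarrow> g x \<in> points V"
  using g_continuous by (auto simp: points_def continuous_map_def)

lemma preimage_open: "openin (mtop V) W \<Longrightarrow> openin (mtop U) {x \<in> points U. g x \<in> W}"
  using g_continuous by (auto simp: points_def continuous_map_def)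

lemma g_charts:
  assumes "(n, D, \<phi>) \<in> atlas U" "(m, D', \<psi>) \<in> atlas V" "j < m"
  shows "holo_on n (\<phi> ` (D \<inter> {x \<in> points U. g x \<in> D'})) (\<lambda>z. \<psi> (g (inv_into D \<phi> z)) j)"
proof -
  have "holo_on n (\<phi> ` {x \<in> D. g x \<in> D'}) (\<lambda>z. \<psi> (g (inv_into D \<phi> z)) j)"
    using g assms unfolding hol_maps_def by fast
  then show ?thesis by (rule holo_on_subset) auto
qed

text \<open>Near a point both \<open>g\<close> and \<open>h\<close> are read in charts. Membership
  in \<open>hol_maps\<close> gives the holomorphy of \<open>g\<close> in just this form, and what
  remains is a composition of coordinate expressions.\<close>

lemma hol_fun_pull:
  assumes W: "openin (mtop V) W" and h: "hol_fun V W h"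
  shows "hol_fun U {x \<in> points U. g x \<in> W} (\<lambda>x. h (g x))"
proof (rule U.hol_fun_local)
  fix x assume "x \<in> {x \<in> points U. g x \<in> W}"
  then have x: "x \<in> points U" "g x \<in> W" by auto
  obtain n D \<phi> where c: "(n, D, \<phi>) \<in> atlas U" "x \<in> D" using U.points_chart[OF x(1)] .
  obtain m D' \<psi> where c': "(m, D', \<psi>) \<in> atlas V" "g x \<in> D'" using V.points_chart[OF g_points[OF x(1)]] .
  define A where "A = {x \<in> points U. g x \<in> D' \<inter> W}"
  have A: "openin (mtop U) A"
    unfolding A_def by (rule preimage_open[OF openin_Int[OF V.chart_open[OF c'(1)] W]])
  have op: "open_Cn n (\<phi> ` (D \<inter> A))" by (rule U.chart_open_image[OF c(1) A])
  have "holo_on n (\<phi> ` (D \<inter> A)) (\<lambda>z. h (inv_into D' \<psi> (\<psi> (g (inv_into D \<phi> z)))))"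
  proof (rule holo_on_compose[OF V.chart_open_image[OF c'(1) W] V.hol_fun_chart[OF h c'(1)] op])
    show "holo_on n (\<phi> ` (D \<inter> A)) (\<lambda>z. \<psi> (g (inv_into D \<phi> z)) j)" if "j < m" for j
      by (rule holo_on_subset[OF g_charts[OF c(1) c'(1) that]]) (auto simp: A_def)
    show "(\<lambda>z. \<psi> (g (inv_into D \<phi> z))) ` \<phi> ` (D \<inter> A) \<subseteq> \<psi> ` (D' \<inter> W)"
      using c by (auto simp: A_def image_iff)
  qed
  then have "holo_on n (\<phi> ` (D \<inter> A)) (\<lambda>z. h (g (inv_into D \<phi> z)))"
    using c(1) c'(1)
    by (subst (asm) holo_on_cong[OF op, where g = "\<lambda>z. h (g (inv_into D \<phi> z))"]) (auto simp: A_def)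
  then have "hol_fun U (D \<inter> A) (\<lambda>x. h (g x))" by (rule U.hol_fun_chartI[OF c(1) A])
  moreover have "openin (mtop U) (D \<inter> A)" "x \<in> D \<inter> A"
    using A U.chart_open[OF c(1)] x c c' by (auto simp: A_def)
  ultimately show "\<exists>W'. openin (mtop U) W' \<and> x \<in> W' \<and> hol_fun U W' (\<lambda>x. h (g x))" by blast
qed

lemma hol_near_pull:
  assumes "x \<in> points U" "hol_near V (g x) h"
  shows "hol_near U x (\<lambda>y. h (g y))"
proof -
  obtain W where W: "openin (mtop V) W" "g x \<in> W" "hol_fun V W h"
    using assms(2) unfolding hol_near_def by blast
  show ?thesis
    by (rule U.hol_nearI[OF preimage_open[OF W(1)] _ hol_fun_pull[OF W(1,3)]]) (use assms(1) W(2) in auto)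
qed

lemma coord_vec_chain_rule:
  assumes c: "(n, D, \<phi>) \<in> atlas U" "x \<in> D" and i: "i < n"
    and c': "(m, D', \<psi>) \<in> atlas V" "g x \<in> D'" and h: "hol_near V (g x) h"
  shows "coord_vec U (n, D, \<phi>) x i (\<lambda>y. h (g y)) =
    (\<Sum>j<m. coord_vec U (n, D, \<phi>) x i (\<lambda>y. \<psi> (g y) j) * coord_vec V (m, D', \<psi>) (g x) j h)"
proof -
  have x: "x \<in> points U" using U.open_subset_points[OF U.chart_open[OF c(1)]] c(2) by blast
  obtain W where W: "openin (mtop V) W" "g x \<in> W" "hol_fun V W h"
    using h unfolding hol_near_def by blast
  define A where "A = {x \<in> points U. g x \<in> D' \<inter> W}"
  have A: "openin (mtop U) A"
    unfolding A_def by (rule preimage_open[OF openin_Int[OF V.chart_open[OF c'(1)] W(1)]])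
  have op: "open_Cn n (\<phi> ` (D \<inter> A))" by (rule U.chart_open_image[OF c(1) A])
  have in_image: "\<phi> x \<in> \<phi> ` (D \<inter> A)" using x c c' W by (auto simp: A_def)
  define G where "G = (\<lambda>z. \<psi> (g (inv_into D \<phi> z)))"
  have "((\<lambda>\<zeta>. h (inv_into D' \<psi> (G ((\<phi> x)(i := \<zeta>))))) has_field_derivative
      (\<Sum>j<m. partial_deriv i (\<lambda>z. G z j) (\<phi> x) * partial_deriv j (\<lambda>w. h (inv_into D' \<psi> w)) (G (\<phi> x)))) (at (\<phi> x i))"
  proof (rule partial_deriv_compose[OF V.chart_open_image[OF c'(1) W(1)] V.hol_fun_chart[OF W(3) c'(1)] op _ _ in_image i])
    show "holo_on n (\<phi> ` (D \<inter> A)) (\<lambda>z. G z j)" if "j < m" for j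
      unfolding G_def by (rule holo_on_subset[OF g_charts[OF c(1) c'(1) that]]) (auto simp: A_def)
    show "G ` \<phi> ` (D \<inter> A) \<subseteq> \<psi> ` (D' \<inter> W)"
      unfolding G_def using c by (auto simp: A_def image_iff)
  qed
  then have "partial_deriv i (\<lambda>z. h (inv_into D' \<psi> (G z))) (\<phi> x) =
      (\<Sum>j<m. partial_deriv i (\<lambda>z. G z j) (\<phi> x) * partial_deriv j (\<lambda>w. h (inv_into D' \<psi> w)) (G (\<phi> x)))"
    unfolding partial_deriv_def[of i "\<lambda>z. h (inv_into D' \<psi> (G z))"] by (rule DERIV_imp_deriv)
  moreover have "partial_deriv i (\<lambda>z. h (inv_into D' \<psi> (G z))) (\<phi> x) = partial_deriv i (\<lambda>z. h (g (inv_into D \<phi> z))) (\<phi> x)"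
    by (rule partial_deriv_cong[OF op in_image i]) (use c(1) c'(1) in \<open>auto simp: A_def G_def\<close>)
  moreover have "G (\<phi> x) = \<psi> (g x)" using c by (simp add: G_def)
  moreover have "hol_near U x (\<lambda>y. h (g y))" by (rule hol_near_pull[OF x h])
  moreover have "hol_near U x (\<lambda>y. \<psi> (g y) j)" if "j < m" for j
    by (rule hol_near_pull[OF x V.hol_nearI[OF V.chart_open[OF c'(1)] c'(2) V.chart_hol_fun[OF c'(1) that]]])
  ultimately show ?thesis using h by (simp add: G_def)
qed

lemma tangent_chain_rule:
  assumes v: "v \<in> tangent U x" and c': "(m, D', \<psi>) \<in> atlas V" "g x \<in> D'" and h: "hol_near V (g x) h"
  shows "v (\<lambda>y. h (g y)) = (\<Sum>j<m. v (\<lambda>y. \<psi> (g y) j) * coord_vec V (m, D', \<psi>) (g x) j h)"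
  using v
proof (rule U.tangentE)
  fix n D \<phi> c assume *: "(n, D, \<phi>) \<in> atlas U" "x \<in> D" "v = (\<lambda>h. \<Sum>i<n. c i * coord_vec U (n, D, \<phi>) x i h)"
  have "(\<Sum>i<n. c i * coord_vec U (n, D, \<phi>) x i (\<lambda>y. h (g y))) =
      (\<Sum>i<n. c i * (\<Sum>j<m. coord_vec U (n, D, \<phi>) x i (\<lambda>y. \<psi> (g y) j) * coord_vec V (m, D', \<psi>) (g x) j h))"
    by (rule sum.cong[OF refl]) (simp only: coord_vec_chain_rule[OF *(1,2) _ c' h] lessThan_iff)
  also have "\<dots> = (\<Sum>i<n. \<Sum>j<m. c i * coord_vec U (n, D, \<phi>) x i (\<lambda>y. \<psi> (g y) j) * coord_vec V (m, D', \<psi>) (g x) j h)"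
    by (simp only: sum_distrib_left mult.assoc)
  also have "\<dots> = (\<Sum>j<m. \<Sum>i<n. c i * coord_vec U (n, D, \<phi>) x i (\<lambda>y. \<psi> (g y) j) * coord_vec V (m, D', \<psi>) (g x) j h)"
    by (rule sum.swap)
  finally show ?thesis unfolding *(3) by (simp only: sum_distrib_right)
qed

text \<open>On germs of holomorphic functions this is the chain rule; on all other functions both
  sides have the default value 0. The image of a tangent vector is thereby seen to lie in the span
  of the coordinate vectors at \<open>g x\<close>.\<close>

lemma push_coords:
  assumes v: "v \<in> tangent U x" and c': "(m, D', \<psi>) \<in> atlas V" "g x \<in> D'"
  shows "push V g x v = (\<lambda>h. \<Sum>j<m. v (\<lambda>y. \<psi> (g y) j) * coord_vec V (m, D', \<psi>) (g x) j h)"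
proof
  fix h
  show "push V g x v h = (\<Sum>j<m. v (\<lambda>y. \<psi> (g y) j) * coord_vec V (m, D', \<psi>) (g x) j h)"
    using tangent_chain_rule[OF v c'] by (cases "hol_near V (g x) h") (simp_all add: push_def)
qed

lemma push_tangent:
  assumes v: "v \<in> tangent U x"
  shows "push V g x v \<in> tangent V (g x)"
proof -
  obtain m D' \<psi> where c': "(m, D', \<psi>) \<in> atlas V" "g x \<in> D'"
    using V.points_chart[OF g_points[OF U.tangent_point[OF v]]] .
  show ?thesis
    unfolding push_coords[OF v c'] by (rule V.tangentI[OF c'])
qed

lemma push_eval: "hol_near V (g x) h \<Longrightarrow> push V g x v h = v (\<lambda>y. h (g y))"
  by (simp add: push_def)

end

lemma push_tlin: "push V g x (tlin a v b w) = tlin a (push V g x v) b (push V g x w)"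
  by (auto simp: push_def tlin_def)

section \<open>Identity and composition of holomorphic maps\<close>

context cmanifold
begin

lemma id_hol_map: "restrict id (points U) \<in> hol_maps U U"
proof -
  have "continuous_map (mtop U) (mtop U) (restrict id (points U))"
    by (rule continuous_map_eq[OF continuous_map_id]) (auto simp: points_def)
  moreover have hol: "holo_on n (\<phi> ` {x \<in> D. restrict id (points U) x \<in> D'}) (\<lambda>z. \<psi> (restrict id (points U) (inv_into D \<phi> z)) j)"
    if c: "(n, D, \<phi>) \<in> atlas U" and c': "(m, D', \<psi>) \<in> atlas U" "j < m" for n D \<phi> m D' \<psi> j
  proof -
    have D: "D \<subseteq> points U" by (rule open_subset_points[OF chart_open[OF c]])
    then have "{x \<in> D. restrict id (points U) x \<in> D'} = D \<inter> D'" by auto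
    moreover have "holo_on n (\<phi> ` (D \<inter> D')) (\<lambda>z. \<psi> (restrict id (points U) (inv_into D \<phi> z)) j)
      \<longleftrightarrow> holo_on n (\<phi> ` (D \<inter> D')) (\<lambda>z. \<psi> (inv_into D \<phi> z) j)"
      by (rule holo_on_cong[OF chart_open_image[OF c chart_open[OF c'(1)]]]) (use D c in auto)
    ultimately show ?thesis using chart_transition[OF c c'] by simp
  qed
  ultimately show ?thesis unfolding hol_maps_def
    by (intro CollectI conjI restrict_extensional) (assumption, clarify, rule hol)
qed

lemma push_id:
  assumes "v \<in> tangent U x"
  shows "push U (restrict id (points U)) x v = v"
proof
  fix h
  have x: "x \<in> points U" using tangent_point[OF assms] .
  have "v (\<lambda>y. h (restrict id (points U) y)) = v h"
    by (rule tangent_cong[OF assms open_points x]) auto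
  then show "push U (restrict id (points U)) x v h = v h"
    using x tangent_not_near[OF assms] by (simp add: push_def)
qed

text \<open>The case of the identity map in \<open>push_coords\<close>. A tangent vector may be
  given through any chart; here it acquires coordinates in every chart around \<open>x\<close>,
  namely its values on the coordinate functions, and so vectors given through different charts can
  be added.\<close>

lemma tangent_coords:
  assumes v: "v \<in> tangent U x" and c: "(n, D, \<phi>) \<in> atlas U" "x \<in> D"
  shows "v = (\<lambda>h. \<Sum>i<n. v (\<lambda>y. \<phi> y i) * coord_vec U (n, D, \<phi>) x i h)"
proof -
  interpret I: cman_map U U "restrict id (points U)"
    by unfold_locales (rule id_hol_map)
  have x: "x \<in> points U" using tangent_point[OF v] .
  have "v (\<lambda>y. \<phi> (restrict id (points U) y) i) = v (\<lambda>y. \<phi> y i)" for i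
    by (rule tangent_cong[OF v open_points x]) auto
  then show ?thesis using I.push_coords[OF v c(1)] x c(2) push_id[OF v] by simp
qed

lemma tangent_tlin:
  assumes v: "v \<in> tangent U x" and w: "w \<in> tangent U x"
  shows "tlin a v b w \<in> tangent U x"
proof -
  obtain n D \<phi> where c: "(n, D, \<phi>) \<in> atlas U" "x \<in> D" using points_chart[OF tangent_point[OF v]] .
  have "tlin a v b w = (\<lambda>h. \<Sum>i<n. (a * v (\<lambda>y. \<phi> y i) + b * w (\<lambda>y. \<phi> y i)) * coord_vec U (n, D, \<phi>) x i h)"
    unfolding tlin_def
    by (subst tangent_coords[OF v c], subst tangent_coords[OF w c])
       (simp only: sum_distrib_left sum.distrib[symmetric] distrib_right mult.assoc)
  then show ?thesis using tangentI[OF c] by simp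
qed

lemma tangent_zero:
  assumes "x \<in> points U"
  shows "(\<lambda>h. 0) \<in> tangent U x"
proof -
  obtain n D \<phi> where c: "(n, D, \<phi>) \<in> atlas U" "x \<in> D" using points_chart[OF assms] .
  from tangentI[OF c, of "\<lambda>i. 0"] show ?thesis by simp
qed

end

lemma hol_maps_compose:
  assumes "cman_map U V g" "cman_map V W h"
  shows "cman_map U W (compose (points U) h g)"
proof -
  interpret G: cman_map U V g by fact
  interpret H: cman_map V W h by fact
  have "continuous_map (mtop U) (mtop W) (compose (points U) h g)"
    by (rule continuous_map_eq[OF continuous_map_compose[OF G.g_continuous H.g_continuous]])
      (auto simp: compose_def points_def)
  moreover have hol: "holo_on n (\<phi> ` {x \<in> D. compose (points U) h g x \<in> D'}) (\<lambda>z. \<psi> (compose (points U) h g (inv_into D \<phi> z)) j)"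
    if c: "(n, D, \<phi>) \<in> atlas U" and c': "(m, D', \<psi>) \<in> atlas W" "j < m" for n D \<phi> m D' \<psi> j
  proof -
    have D: "D \<subseteq> points U" by (rule G.U.open_subset_points[OF G.U.chart_open[OF c]])
    define A where "A = {x \<in> points U. g x \<in> {y \<in> points V. h y \<in> D'}}"
    have eq: "{x \<in> D. compose (points U) h g x \<in> D'} = D \<inter> A"
      using D G.g_points by (auto simp: compose_def A_def)
    have A: "openin (mtop U) A"
      unfolding A_def by (intro G.preimage_open H.preimage_open H.V.chart_open[OF c'(1)])
    have "hol_fun U A (\<lambda>x. \<psi> (h (g x)) j)"
      unfolding A_def
      by (rule G.hol_fun_pull[OF H.preimage_open H.hol_fun_pull])
        (rule H.V.chart_open[OF c'(1)] H.V.chart_hol_fun[OF c'])+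
    from G.U.hol_fun_chart[OF this c]
    have "holo_on n (\<phi> ` (D \<inter> A)) (\<lambda>z. \<psi> (h (g (inv_into D \<phi> z))) j)" .
    moreover have "holo_on n (\<phi> ` (D \<inter> A)) (\<lambda>z. \<psi> (compose (points U) h g (inv_into D \<phi> z)) j)
      \<longleftrightarrow> holo_on n (\<phi> ` (D \<inter> A)) (\<lambda>z. \<psi> (h (g (inv_into D \<phi> z))) j)"
      by (rule holo_on_cong[OF G.U.chart_open_image[OF c A]]) (use D c in \<open>auto simp: compose_def\<close>)
    ultimately show ?thesis using eq by simp
  qed
  ultimately have "compose (points U) h g \<in> hol_maps U W"
    unfolding hol_maps_def
    by (intro CollectI conjI compose_extensional) (assumption, clarify, rule hol)
  then show ?thesis by unfold_locales
qed

text \<open>The default values are consistent: if \<open>k\<close> is holomorphic near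
  \<open>h (g x)\<close>, then its pullback is holomorphic near \<open>g x\<close>, so the inner
  test succeeds whenever the outer one does.\<close>

lemma push_compose:
  assumes "cman_map U V g" "cman_map V W h" "v \<in> tangent U x"
  shows "push W (compose (points U) h g) x v = push W h (g x) (push V g x v)"
proof
  interpret G: cman_map U V g by fact
  interpret H: cman_map V W h by fact
  have x: "x \<in> points U" using G.U.tangent_point[OF assms(3)] .
  fix k
  have "v (\<lambda>y. k (compose (points U) h g y)) = v (\<lambda>y. k (h (g y)))"
    by (rule G.U.tangent_cong[OF assms(3) G.U.open_points x]) (auto simp: compose_def)
  then show "push W (compose (points U) h g) x v k = push W h (g x) (push V g x v) k"
    using x H.hol_near_pull[OF G.g_points[OF x], of k] by (auto simp: push_def compose_def)
qed

section \<open>Holomorphic forms and their pullback\<close>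

declare coord_vec.simps [simp del]

lemma hol_formsI:
  assumes "\<And>x vs. \<not> (x \<in> points U \<and> length vs = p \<and> set vs \<subseteq> tangent U x) \<Longrightarrow> \<omega> x vs = 0"
    and "\<And>x vs i v w a b. x \<in> points U \<Longrightarrow> length vs = p \<Longrightarrow> set vs \<subseteq> tangent U x \<Longrightarrow> i < p \<Longrightarrow>
       v \<in> tangent U x \<Longrightarrow> w \<in> tangent U x \<Longrightarrow>
       \<omega> x (vs[i := tlin a v b w]) = a * \<omega> x (vs[i := v]) + b * \<omega> x (vs[i := w])"
    and "\<And>x vs i j. x \<in> points U \<Longrightarrow> length vs = p \<Longrightarrow> set vs \<subseteq> tangent U x \<Longrightarrow> i < p \<Longrightarrow> j < p \<Longrightarrow>
       i \<noteq> j \<Longrightarrow> vs ! i = vs ! j \<Longrightarrow> \<omega> x vs = 0"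
    and "\<And>n D \<phi> is. (n, D, \<phi>) \<in> atlas U \<Longrightarrow> length is = p \<Longrightarrow> set is \<subseteq> {..<n} \<Longrightarrow>
       holo_on n (\<phi> ` D) (\<lambda>z. \<omega> (inv_into D \<phi> z) (map (coord_vec U (n, D, \<phi>) (inv_into D \<phi> z)) is))"
  shows "\<omega> \<in> hol_forms U p"
  unfolding hol_forms_def mem_Collect_eq Let_def
proof (intro conjI allI impI ballI)
  fix c assume "c \<in> atlas U"
  moreover obtain n D \<phi> where "c = (n, D, \<phi>)" by (cases c)
  ultimately show "case c of (n, D, \<phi>) \<Rightarrow> \<forall>is. length is = p \<and> set is \<subseteq> {..<n} \<longrightarrow>
     holo_on n (\<phi> ` D) (\<lambda>z. \<omega> (inv_into D \<phi> z) (map (coord_vec U (n, D, \<phi>) (inv_into D \<phi> z)) is))"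
    using assms(4) by (simp only: case_prod_conv) blast
qed (use assms(1-3) in \<open>auto simp only:\<close>)

lemma hol_forms_outside:
  "\<omega> \<in> hol_forms U p \<Longrightarrow> \<not> (x \<in> points U \<and> length vs = p \<and> set vs \<subseteq> tangent U x) \<Longrightarrow> \<omega> x vs = 0"
  unfolding hol_forms_def mem_Collect_eq by (elim conjE) simp

lemma hol_forms_linear:
  assumes "\<omega> \<in> hol_forms U p" "x \<in> points U" "length vs = p" "set vs \<subseteq> tangent U x" "i < p"
    "v \<in> tangent U x" "w \<in> tangent U x"
  shows "\<omega> x (vs[i := tlin a v b w]) = a * \<omega> x (vs[i := v]) + b * \<omega> x (vs[i := w])"
  using assms unfolding hol_forms_def mem_Collect_eq by (elim conjE) simp

lemma hol_forms_alternating: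
  assumes "\<omega> \<in> hol_forms U p" "i < length vs" "j < length vs" "i \<noteq> j" "vs ! i = vs ! j"
  shows "\<omega> x vs = 0"
proof (cases "x \<in> points U \<and> length vs = p \<and> set vs \<subseteq> tangent U x")
  case True
  then have "\<forall>i<p. \<forall>j<p. i \<noteq> j \<and> vs ! i = vs ! j \<longrightarrow> \<omega> x vs = 0"
    using assms(1) unfolding hol_forms_def mem_Collect_eq by (elim conjE) simp
  then show ?thesis using assms True by blast
next
  case False
  then show ?thesis using hol_forms_outside[OF assms(1)] by blast
qed

lemma hol_forms_holo:
  assumes "\<omega> \<in> hol_forms U p" "(n, D, \<phi>) \<in> atlas U" "length is = p" "set is \<subseteq> {..<n}"
  shows "holo_on n (\<phi> ` D) (\<lambda>z. \<omega> (inv_into D \<phi> z) (map (coord_vec U (n, D, \<phi>) (inv_into D \<phi> z)) is))"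
proof -
  have "\<forall>(n, D, \<phi>) \<in> atlas U. \<forall>is. length is = p \<and> set is \<subseteq> {..<n} \<longrightarrow>
     holo_on n (\<phi> ` D) (\<lambda>z. \<omega> (inv_into D \<phi> z) (map (coord_vec U (n, D, \<phi>) (inv_into D \<phi> z)) is))"
    using assms(1) unfolding hol_forms_def mem_Collect_eq Let_def by (elim conjE)
  from bspec[OF this assms(2), unfolded case_prod_conv] show ?thesis using assms(3,4) by simp
qed

lemma hol_forms_zero: "(\<lambda>x vs. 0) \<in> hol_forms U p"
  by (rule hol_formsI) (auto intro: holo_on_const)

lemma hol_forms_add:
  assumes "\<omega> \<in> hol_forms U p" "\<eta> \<in> hol_forms U p"
  shows "(\<lambda>x vs. \<omega> x vs + \<eta> x vs) \<in> hol_forms U p"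
proof (rule hol_formsI)
  show "\<omega> x vs + \<eta> x vs = 0" if "\<not> (x \<in> points U \<and> length vs = p \<and> set vs \<subseteq> tangent U x)" for x vs
    using that assms[THEN hol_forms_outside] by simp
  show "\<omega> x vs + \<eta> x vs = 0" if "length vs = p" "i < p" "j < p" "i \<noteq> j" "vs ! i = vs ! j" for x vs i j
    using that assms[THEN hol_forms_alternating] by simp
qed (simp_all add: assms[THEN hol_forms_linear] assms[THEN hol_forms_holo] holo_on_add algebra_simps)

lemma hol_forms_scale:
  assumes "\<omega> \<in> hol_forms U p"
  shows "(\<lambda>x vs. c * \<omega> x vs) \<in> hol_forms U p"
proof (rule hol_formsI)
  show "c * \<omega> x vs = 0" if "\<not> (x \<in> points U \<and> length vs = p \<and> set vs \<subseteq> tangent U x)" for x vs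
    using that assms[THEN hol_forms_outside] by simp
  show "c * \<omega> x vs = 0" if "length vs = p" "i < p" "j < p" "i \<noteq> j" "vs ! i = vs ! j" for x vs i j
    using that assms[THEN hol_forms_alternating] by simp
qed (simp_all add: assms[THEN hol_forms_linear] assms[THEN hol_forms_holo] holo_on_mult holo_on_const algebra_simps)

lemma hol_forms_sum:
  "(\<And>i. i \<in> I \<Longrightarrow> \<omega> i \<in> hol_forms U p) \<Longrightarrow> (\<lambda>x vs. \<Sum>i\<in>I. \<omega> i x vs) \<in> hol_forms U p"
  by (induction I rule: infinite_finite_induct) (simp_all add: hol_forms_zero hol_forms_add)

context cmanifold
begin

lemma tangent_lincomb:
  fixes m :: nat
  assumes "x \<in> points U" "\<And>j. j < m \<Longrightarrow> w j \<in> tangent U x"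
  shows "(\<lambda>h. \<Sum>j<m. c j * w j h) \<in> tangent U x"
  using assms(2)
proof (induction m)
  case 0
  then show ?case using tangent_zero[OF assms(1)] by simp
next
  case (Suc m)
  have "(\<lambda>h. \<Sum>j<Suc m. c j * w j h) = tlin 1 (\<lambda>h. \<Sum>j<m. c j * w j h) (c m) (w m)"
    by (simp add: tlin_def)
  then show ?case using Suc by (simp add: tangent_tlin)
qed

lemma hol_forms_lincomb:
  fixes m :: nat
  assumes \<omega>: "\<omega> \<in> hol_forms U p" and x: "x \<in> points U" and vs: "length vs = p" "set vs \<subseteq> tangent U x"
    and k: "k < p" and w: "\<And>j. j < m \<Longrightarrow> w j \<in> tangent U x"
  shows "\<omega> x (vs[k := \<lambda>h. \<Sum>j<m. c j * w j h]) = (\<Sum>j<m. c j * \<omega> x (vs[k := w j]))"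
  using w
proof (induction m)
  case 0
  have v: "vs ! k \<in> tangent U x" using vs k by auto
  \<comment> \<open>Linearity of forms is stated only through \<open>tlin\<close>, so the zero
    vector is written as a trivial combination.\<close>
  have "(\<lambda>h. 0) = tlin 0 (vs ! k) 0 (vs ! k)" by (simp add: tlin_def)
  then show ?case using hol_forms_linear[OF \<omega> x vs k v v, of 0 0] by simp
next
  case (Suc m)
  have "(\<lambda>h. \<Sum>j<Suc m. c j * w j h) = tlin 1 (\<lambda>h. \<Sum>j<m. c j * w j h) (c m) (w m)"
    by (simp add: tlin_def)
  then show ?case
    using hol_forms_linear[OF \<omega> x vs k tangent_lincomb[OF x], of m w "w m" 1 c "c m"] Suc by simp
qed

end

context cman_map
begin

text \<open>These are the entries of the Jacobian matrix of \<open>g\<close> in the two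
  charts.\<close>

lemma push_coord_vec_holo:
  assumes c: "(n, D, \<phi>) \<in> atlas U" and c': "(m, D', \<psi>) \<in> atlas V" and "j < m" "i < n"
  shows "holo_on n (\<phi> ` (D \<inter> {x \<in> points U. g x \<in> D'}))
     (\<lambda>z. coord_vec U (n, D, \<phi>) (inv_into D \<phi> z) i (\<lambda>y. \<psi> (g y) j))"
  by (rule U.coord_vec_holo[OF c \<open>i < n\<close> preimage_open hol_fun_pull])
    (rule V.chart_open[OF c'] V.chart_hol_fun[OF c' \<open>j < m\<close>])+

text \<open>The coordinate vectors in the slots are replaced one after the other by the images of
  coordinate vectors, which are combinations of coordinate vectors with holomorphic coefficients.\<close>

lemma form_on_pushed_vectors_holo:
  assumes \<omega>: "\<omega> \<in> hol_forms V p"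
    and c: "(n, D, \<phi>) \<in> atlas U" and c': "(m, D', \<psi>) \<in> atlas V"
    and "is": "length is = p" "set is \<subseteq> {..<n}" and k: "k \<le> p"
    and js: "length js = p" "set (drop k js) \<subseteq> {..<m}"
  shows "holo_on n (\<phi> ` (D \<inter> {x \<in> points U. g x \<in> D'}))
     (\<lambda>z. \<omega> (g (inv_into D \<phi> z))
       (map (\<lambda>i. push V g (inv_into D \<phi> z) (coord_vec U (n, D, \<phi>) (inv_into D \<phi> z) i)) (take k is)
        @ map (coord_vec V (m, D', \<psi>) (g (inv_into D \<phi> z))) (drop k js)))"
    (is "holo_on n ?T (\<lambda>z. \<omega> (g (?x z)) (?P z k @ ?C z k js))")
  using k js
proof (induction k arbitrary: js)
  have opA: "openin (mtop U) {x \<in> points U. g x \<in> D'}"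
    by (rule preimage_open[OF V.chart_open[OF c']])
  have op: "open_Cn n ?T" by (rule U.chart_open_image[OF c opA])
  {
    case 0
    have "holo_on n ?T (\<lambda>z. \<omega> (inv_into D' \<psi> (\<psi> (g (?x z)))) (map (coord_vec V (m, D', \<psi>) (inv_into D' \<psi> (\<psi> (g (?x z))))) js))"
    proof (rule holo_on_compose[OF V.chart_image_open[OF c'] hol_forms_holo[OF \<omega> c' 0(2) 0(3)[unfolded drop_0]] op])
      show "holo_on n ?T (\<lambda>z. \<psi> (g (?x z)) j)" if "j < m" for j by (rule g_charts[OF c c' that])
      show "(\<lambda>z. \<psi> (g (?x z))) ` ?T \<subseteq> \<psi> ` D'" using c by (auto simp: image_iff)
    qed
    then show ?case
      using c c' by (subst (asm) holo_on_cong[OF op, where g = "\<lambda>z. \<omega> (g (?x z)) (map (coord_vec V (m, D', \<psi>) (g (?x z))) js)"]) auto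
  next
    case (Suc k)
    have k: "k < p" "is ! k < n" using Suc.prems "is" by (auto simp: subset_iff)
    have dr: "drop k js = js ! k # drop (Suc k) js" using Suc.prems by (simp add: Cons_nth_drop_Suc)
    have drop_upd: "drop k (js[k := j]) = j # drop (Suc k) js" for j
      using Suc.prems by (simp add: drop_update_swap dr)
    have IH: "holo_on n ?T (\<lambda>z. \<omega> (g (?x z)) (?P z k @ ?C z k (js[k := j])))" if "j < m" for j
      by (rule Suc.IH) (use Suc.prems that drop_upd in auto)
    define a where "a = (\<lambda>z j. coord_vec U (n, D, \<phi>) (?x z) (is ! k) (\<lambda>y. \<psi> (g y) j))"
    have "holo_on n ?T (\<lambda>z. \<Sum>j<m. a z j * \<omega> (g (?x z)) (?P z k @ ?C z k (js[k := j])))"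
      unfolding a_def
      by (intro holo_on_sum holo_on_mult IH push_coord_vec_holo[OF c c'] k(2)) auto
    moreover have "(\<Sum>j<m. a z j * \<omega> (g (?x z)) (?P z k @ ?C z k (js[k := j]))) = \<omega> (g (?x z)) (?P z (Suc k) @ ?C z (Suc k) js)"
      if "z \<in> ?T" for z
    proof -
      define x where "x = ?x z"
      have x: "x \<in> D" "x \<in> points U" "g x \<in> D'" using that c by (auto simp: x_def)
      \<comment> \<open>The zero vector in slot \<open>k\<close> is a placeholder: the form is
        evaluated only after this slot has been updated.\<close>
      define vs where "vs = ?P z k @ (\<lambda>h. 0) # ?C z (Suc k) js"
      have v: "coord_vec U (n, D, \<phi>) x i \<in> tangent U x" if "i < n" for i
        by (rule U.coord_vec_tangent[OF c x(1) that])
      have w: "coord_vec V (m, D', \<psi>) (g x) j \<in> tangent V (g x)" if "j < m" for j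
        by (rule V.coord_vec_tangent[OF c' x(3) that])
      have vs: "length vs = p" "set vs \<subseteq> tangent V (g x)"
        using Suc.prems "is" V.tangent_zero[OF g_points[OF x(2)]]
        by (auto simp: vs_def x_def[symmetric] min_def subset_iff
            dest!: in_set_takeD intro!: push_tangent v w)
      have P: "?P z (Suc k) = ?P z k @ [push V g x (coord_vec U (n, D, \<phi>) x (is ! k))]"
        using k "is" by (simp add: take_Suc_conv_app_nth x_def)
      have len: "length (?P z k) = k" using k "is" by simp
      have upd: "vs[k := u] = ?P z k @ u # ?C z (Suc k) js" for u
        unfolding vs_def using len by (simp add: list_update_append)
      have "\<omega> (g x) (?P z (Suc k) @ ?C z (Suc k) js) =
          \<omega> (g x) (vs[k := push V g x (coord_vec U (n, D, \<phi>) x (is ! k))])"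
        unfolding P upd by simp
      also have "push V g x (coord_vec U (n, D, \<phi>) x (is ! k)) = (\<lambda>h. \<Sum>j<m. a z j * coord_vec V (m, D', \<psi>) (g x) j h)"
        using push_coords[OF v[OF k(2)] c' x(3)] by (simp only: a_def x_def)
      also have "\<omega> (g x) (vs[k := \<dots>]) = (\<Sum>j<m. a z j * \<omega> (g x) (vs[k := coord_vec V (m, D', \<psi>) (g x) j]))"
        by (rule V.hol_forms_lincomb[OF \<omega> g_points[OF x(2)] vs k(1) w])
      also have "\<dots> = (\<Sum>j<m. a z j * \<omega> (g x) (?P z k @ ?C z k (js[k := j])))"
      proof (rule sum.cong[OF refl])
        fix j
        show "a z j * \<omega> (g x) (vs[k := coord_vec V (m, D', \<psi>) (g x) j]) = a z j * \<omega> (g x) (?P z k @ ?C z k (js[k := j]))"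
          unfolding upd by (simp add: x_def drop_upd)
      qed
      finally show ?thesis by (simp add: x_def)
    qed
    ultimately show ?case
      by (subst (asm) holo_on_cong[OF op, where g = "\<lambda>z. \<omega> (g (?x z)) (?P z (Suc k) @ ?C z (Suc k) js)"])
  }
qed

lemma pull_form_hol_forms:
  assumes \<omega>: "\<omega> \<in> hol_forms V p"
  shows "pull_form U V g \<omega> \<in> hol_forms U p"
proof (rule hol_formsI)
  fix x vs assume "\<not> (x \<in> points U \<and> length vs = p \<and> set vs \<subseteq> tangent U x)"
  then show "pull_form U V g \<omega> x vs = 0"
    using hol_forms_outside[OF \<omega>, of "g x" "map (push V g x) vs"] by (auto simp: pull_form_def)
next
  fix x vs i v w a b
  assume x: "x \<in> points U" and vs: "length vs = p" "set vs \<subseteq> tangent U x" and i: "i < p"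
    and v: "v \<in> tangent U x" and w: "w \<in> tangent U x"
  have "set (vs[i := u]) \<subseteq> tangent U x" if "u \<in> tangent U x" for u
    using vs(2) that set_update_subset_insert[of vs i u] by blast
  moreover have "set (map (push V g x) vs) \<subseteq> tangent V (g x)" using vs push_tangent by auto
  ultimately show "pull_form U V g \<omega> x (vs[i := tlin a v b w]) =
      a * pull_form U V g \<omega> x (vs[i := v]) + b * pull_form U V g \<omega> x (vs[i := w])"
    using hol_forms_linear[OF \<omega> g_points[OF x] _ _ i push_tangent[OF v] push_tangent[OF w], of "map (push V g x) vs"]
      x v w vs U.tangent_tlin[OF v w]
    by (simp add: pull_form_def map_update push_tlin)
next
  fix x and vs :: "'a tvec list" and i j
  assume "length vs = p" "i < p" "j < p" "i \<noteq> j" "vs ! i = vs ! j"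
  then show "pull_form U V g \<omega> x vs = 0"
    using hol_forms_alternating[OF \<omega>, of i "map (push V g x) vs" j] by (simp add: pull_form_def)
next
  fix n D \<phi> "is"
  assume c: "(n, D, \<phi>) \<in> atlas U" and "is": "length is = p" "set is \<subseteq> {..<n}"
  show "holo_on n (\<phi> ` D) (\<lambda>z. pull_form U V g \<omega> (inv_into D \<phi> z) (map (coord_vec U (n, D, \<phi>) (inv_into D \<phi> z)) is))"
  proof (rule holo_on_local)
    show "\<phi> ` D \<subseteq> Cn n" by (rule openin_imp_subset[OF U.chart_image_open[OF c]])
    fix z assume "z \<in> \<phi> ` D"
    then obtain x where x: "z = \<phi> x" "x \<in> D" by blast
    then have xU: "x \<in> points U" using U.open_subset_points[OF U.chart_open[OF c]] by blast
    obtain m D' \<psi> where c': "(m, D', \<psi>) \<in> atlas V" "g x \<in> D'" using V.points_chart[OF g_points[OF xU]] .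
    let ?T = "\<phi> ` (D \<inter> {x \<in> points U. g x \<in> D'})"
    have op: "open_Cn n ?T" by (rule U.chart_open_image[OF c preimage_open[OF V.chart_open[OF c'(1)]]])
    have "holo_on n ?T (\<lambda>z. pull_form U V g \<omega> (inv_into D \<phi> z) (map (coord_vec U (n, D, \<phi>) (inv_into D \<phi> z)) is))"
    proof -
      have "holo_on n ?T (\<lambda>z. \<omega> (g (inv_into D \<phi> z))
        (map (\<lambda>i. push V g (inv_into D \<phi> z) (coord_vec U (n, D, \<phi>) (inv_into D \<phi> z) i)) is))"
        \<comment> \<open>For \<open>k = p\<close> every slot carries a pushed vector; the index
          list \<open>replicate p 0\<close> is dropped entirely.\<close>
        using form_on_pushed_vectors_holo[OF \<omega> c c'(1) "is", of p "replicate p 0"] "is" by simp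
      moreover have "\<omega> (g (inv_into D \<phi> z))
        (map (\<lambda>i. push V g (inv_into D \<phi> z) (coord_vec U (n, D, \<phi>) (inv_into D \<phi> z) i)) is) =
        pull_form U V g \<omega> (inv_into D \<phi> z) (map (coord_vec U (n, D, \<phi>) (inv_into D \<phi> z)) is)"
        if zT: "z \<in> ?T" for z
      proof -
        obtain x where x: "z = \<phi> x" "x \<in> D" "x \<in> points U" using zT by blast
        have "coord_vec U (n, D, \<phi>) x i \<in> tangent U x" if "i < n" for i
          by (rule U.coord_vec_tangent[OF c x(2) that])
        then have "set (map (coord_vec U (n, D, \<phi>) x) is) \<subseteq> tangent U x" using "is" by auto
        then show ?thesis using x c by (simp add: pull_form_def comp_def)
      qed
      ultimately show ?thesis
        by (subst (asm) holo_on_cong[OF op])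
    qed
    moreover have "z \<in> ?T" using x xU c' by blast
    ultimately show "\<exists>T. open_Cn n T \<and> z \<in> T \<and> holo_on n T
        (\<lambda>z. pull_form U V g \<omega> (inv_into D \<phi> z) (map (coord_vec U (n, D, \<phi>) (inv_into D \<phi> z)) is))"
      using op by blast
  qed
qed

end

lemma pull_form_add:
  "pull_form U V g (\<lambda>x vs. \<omega> x vs + \<eta> x vs) = (\<lambda>x vs. pull_form U V g \<omega> x vs + pull_form U V g \<eta> x vs)"
  by (auto simp: pull_form_def fun_eq_iff)

lemma pull_form_zero: "pull_form U V g (\<lambda>x vs. 0) = (\<lambda>x vs. 0)"
  by (auto simp: pull_form_def fun_eq_iff)

text \<open>Off tuples of tangent vectors \<open>pull_form\<close> is 0 by its case distinction. A
  form has the same value there by definition, so the equality is strict.\<close>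

lemma (in cmanifold) pull_form_id:
  assumes "\<omega> \<in> hol_forms U p"
  shows "pull_form U U (restrict id (points U)) \<omega> = \<omega>"
proof (intro ext)
  fix x vs
  have "map (push U (restrict id (points U)) x) vs = vs" if "set vs \<subseteq> tangent U x"
    using that push_id by (intro map_idI) auto
  then show "pull_form U U (restrict id (points U)) \<omega> x vs = \<omega> x vs"
    using hol_forms_outside[OF assms, of x vs] by (auto simp: pull_form_def)
qed

lemma pull_form_compose:
  assumes "cman_map U V g" "cman_map V W h"
  shows "pull_form U W (compose (points U) h g) \<omega> = pull_form U V g (pull_form V W h \<omega>)"
proof (intro ext)
  interpret G: cman_map U V g by fact
  fix x vs
  show "pull_form U W (compose (points U) h g) \<omega> x vs = pull_form U V g (pull_form V W h \<omega>) x vs"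
  proof (cases "x \<in> points U \<and> set vs \<subseteq> tangent U x")
    case True
    have "map (push W (compose (points U) h g) x) vs = map (push W h (g x)) (map (push V g x) vs)"
      unfolding map_map
      by (rule map_cong[OF refl]) (use True push_compose[OF assms] in auto)
    moreover have "set (map (push V g x) vs) \<subseteq> tangent V (g x)"
      using True G.push_tangent by auto
    moreover have "compose (points U) h g x = h (g x)" using True by (simp add: compose_def)
    ultimately show ?thesis using True G.g_points by (simp add: pull_form_def del: map_map)
  next
    case False
    then show ?thesis by (auto simp: pull_form_def)
  qed
qed

section \<open>Coordinates and traces on finite-dimensional vector spaces\<close>

text \<open>\<open>lin_maps\<close> without extensionality, so that inverses by
  \<open>inv_into\<close> and composites written as plain lambda terms qualify.\<close>

definition linear_on :: "(complex, 'v) module \<Rightarrow> (complex, 'w) module \<Rightarrow> ('v \<Rightarrow> 'w) \<Rightarrow> bool" where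
  "linear_on M N L \<longleftrightarrow> L \<in> carrier M \<rightarrow> carrier N \<and>
     (\<forall>a\<in>carrier M. \<forall>b\<in>carrier M. L (a \<oplus>\<^bsub>M\<^esub> b) = L a \<oplus>\<^bsub>N\<^esub> L b) \<and>
     (\<forall>c. \<forall>a\<in>carrier M. L (c \<odot>\<^bsub>M\<^esub> a) = c \<odot>\<^bsub>N\<^esub> L a)"

lemma linear_on_closed: "linear_on M N L \<Longrightarrow> a \<in> carrier M \<Longrightarrow> L a \<in> carrier N"
  and linear_on_add: "linear_on M N L \<Longrightarrow> a \<in> carrier M \<Longrightarrow> b \<in> carrier M \<Longrightarrow>
    L (a \<oplus>\<^bsub>M\<^esub> b) = L a \<oplus>\<^bsub>N\<^esub> L b"
  and linear_on_smult: "linear_on M N L \<Longrightarrow> a \<in> carrier M \<Longrightarrow> L (c \<odot>\<^bsub>M\<^esub> a) = c \<odot>\<^bsub>N\<^esub> L a"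
  by (auto simp: linear_on_def)

lemma lin_maps_iff: "L \<in> lin_maps M N \<longleftrightarrow> linear_on M N L \<and> L \<in> extensional (carrier M)"
  by (auto simp: lin_maps_def linear_on_def PiE_def)

lemma linear_on_compose:
  "linear_on M N L \<Longrightarrow> linear_on N K L' \<Longrightarrow> linear_on M K (\<lambda>a. L' (L a))"
  by (simp add: linear_on_def Pi_iff)

lemma linear_on_id: "linear_on M M (\<lambda>a. a)"
  by (simp add: linear_on_def)

lemma linear_on_cong:
  assumes "module complex_ring M" "\<And>a. a \<in> carrier M \<Longrightarrow> L a = L' a"
  shows "linear_on M N L \<longleftrightarrow> linear_on M N L'"
proof -
  interpret module complex_ring M by fact
  have "c \<odot>\<^bsub>M\<^esub> a \<in> carrier M" if "a \<in> carrier M" for c a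
    using smult_closed[of c a] that by (simp add: complex_ring_def)
  then show ?thesis by (simp add: linear_on_def assms(2) Pi_iff)
qed

lemma linear_on_inverse:
  assumes "module complex_ring M" "linear_on M N L" "bij_betw L (carrier M) (carrier N)"
  shows "linear_on N M (inv_into (carrier M) L)"
proof -
  interpret module complex_ring M by fact
  have sm: "c \<odot>\<^bsub>M\<^esub> a \<in> carrier M" if "a \<in> carrier M" for c a
    using smult_closed[of c a] that by (simp add: complex_ring_def)
  let ?K = "inv_into (carrier M) L"
  have K: "?K b \<in> carrier M" "L (?K b) = b" if "b \<in> carrier N" for b
    using that assms(3) by (auto simp: bij_betw_def inv_into_into f_inv_into_f)
  have inj: "a = a'" if "L a = L a'" "a \<in> carrier M" "a' \<in> carrier M" for a a'
    using that assms(3) by (auto simp: bij_betw_def inj_on_def)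
  show ?thesis
    unfolding linear_on_def
  proof (intro conjI ballI allI)
    show "?K \<in> carrier N \<rightarrow> carrier M" using K by auto
    fix a assume a: "a \<in> carrier N"
    have "a \<oplus>\<^bsub>N\<^esub> b = L (?K a \<oplus>\<^bsub>M\<^esub> ?K b)" if "b \<in> carrier N" for b
      using K a that linear_on_add[OF assms(2)] by simp
    then show "?K (a \<oplus>\<^bsub>N\<^esub> b) = ?K a \<oplus>\<^bsub>M\<^esub> ?K b" if "b \<in> carrier N" for b
      using a that K assms(3) by (simp add: bij_betw_def)
    have "c \<odot>\<^bsub>N\<^esub> a = L (c \<odot>\<^bsub>M\<^esub> ?K a)" for c
      using K a linear_on_smult[OF assms(2)] by simp
    then show "?K (c \<odot>\<^bsub>N\<^esub> a) = c \<odot>\<^bsub>M\<^esub> ?K a" for c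
      using a K sm assms(3) by (simp add: bij_betw_def)
  qed
qed

lemma unit_vec_Cn: "j < r \<Longrightarrow> unit_vec j \<in> Cn r"
  by (auto simp: unit_vec_def Cn_def)

lemma coord_iso:
  assumes "coord_iso M r t"
  shows coord_closed: "a \<in> carrier M \<Longrightarrow> t a \<in> Cn r"
    and coord_add: "a \<in> carrier M \<Longrightarrow> b \<in> carrier M \<Longrightarrow> t (a \<oplus>\<^bsub>M\<^esub> b) i = t a i + t b i"
    and coord_smult: "a \<in> carrier M \<Longrightarrow> t (c \<odot>\<^bsub>M\<^esub> a) i = c * t a i"
    and coord_inv_closed: "z \<in> Cn r \<Longrightarrow> inv_into (carrier M) t z \<in> carrier M"
    and coord_inv: "z \<in> Cn r \<Longrightarrow> t (inv_into (carrier M) t z) = z"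
    and inv_coord: "a \<in> carrier M \<Longrightarrow> inv_into (carrier M) t (t a) = a"
  using assms
  by (auto simp: coord_iso_def lin_maps_def Cn_module_def bij_betw_def inv_into_into f_inv_into_f)

text \<open>Coordinates are injective, and those from \<open>r\<close> on vanish in
  \<open>Cn r\<close>. In this form an identity between elements of a fibre becomes finitely many
  identities of complex numbers.\<close>

lemma coord_eqI:
  assumes "coord_iso M r t" "a \<in> carrier M" "b \<in> carrier M" "\<And>i. i < r \<Longrightarrow> t a i = t b i"
  shows "a = b"
proof -
  have "t a i = t b i" for i
    using assms(4) coord_closed[OF assms(1,2)] coord_closed[OF assms(1,3)]
    by (cases "i < r") (auto simp: Cn_def)
  then have "t a = t b" by auto
  then show ?thesis using inv_coord[OF assms(1,2)] inv_coord[OF assms(1,3)] by metis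
qed

abbreviation basis_vec :: "(complex, 'v) module \<Rightarrow> ('v \<Rightarrow> nat \<Rightarrow> complex) \<Rightarrow> nat \<Rightarrow> 'v" where
  "basis_vec M t j \<equiv> inv_into (carrier M) t (unit_vec j)"

lemma basis_vec_closed: "coord_iso M r t \<Longrightarrow> j < r \<Longrightarrow> basis_vec M t j \<in> carrier M"
  by (simp add: coord_inv_closed unit_vec_Cn)

lemma coord_basis_vec: "coord_iso M r t \<Longrightarrow> j < r \<Longrightarrow> t (basis_vec M t j) i = (if i = j then 1 else 0)"
  by (simp add: coord_inv unit_vec_Cn) (simp add: unit_vec_def)

lemma module_smult_closed: "module complex_ring M \<Longrightarrow> a \<in> carrier M \<Longrightarrow> c \<odot>\<^bsub>M\<^esub> a \<in> carrier M"
  using module.smult_closed[of complex_ring M c a] by (simp add: complex_ring_def)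

lemma module_abelian_group: "module complex_ring M \<Longrightarrow> abelian_group M"
  by (simp add: module_def)

lemma module_add_closed:
  "module complex_ring M \<Longrightarrow> a \<in> carrier M \<Longrightarrow> b \<in> carrier M \<Longrightarrow> a \<oplus>\<^bsub>M\<^esub> b \<in> carrier M"
  by (simp add: abelian_group.axioms(1) abelian_monoid.a_closed module_abelian_group)

lemma module_minus_closed:
  "module complex_ring M \<Longrightarrow> a \<in> carrier M \<Longrightarrow> b \<in> carrier M \<Longrightarrow> a \<ominus>\<^bsub>M\<^esub> b \<in> carrier M"
  by (simp add: abelian_group.minus_closed module_abelian_group)

lemma module_zero_closed: "module complex_ring M \<Longrightarrow> \<zero>\<^bsub>M\<^esub> \<in> carrier M"
  by (simp add: abelian_group.axioms(1) abelian_monoid.zero_closed module_abelian_group)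

lemma coord_zero:
  assumes "coord_iso M r t" "module complex_ring M"
  shows "t \<zero>\<^bsub>M\<^esub> i = 0"
proof -
  have "t (\<zero>\<^bsub>M\<^esub> \<oplus>\<^bsub>M\<^esub> \<zero>\<^bsub>M\<^esub>) i = t \<zero>\<^bsub>M\<^esub> i + t \<zero>\<^bsub>M\<^esub> i"
    by (rule coord_add[OF assms(1) module_zero_closed module_zero_closed]) (fact assms(2))+
  moreover have "\<zero>\<^bsub>M\<^esub> \<oplus>\<^bsub>M\<^esub> \<zero>\<^bsub>M\<^esub> = \<zero>\<^bsub>M\<^esub>"
    using module_abelian_group[OF assms(2)] by (simp add: abelian_group.axioms(1) abelian_monoid.l_zero abelian_monoid.zero_closed)
  ultimately show ?thesis by simp
qed

lemma coord_minus:
  assumes "coord_iso M r t" "module complex_ring M" "a \<in> carrier M" "b \<in> carrier M"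
  shows "t (a \<ominus>\<^bsub>M\<^esub> b) i = t a i - t b i"
proof -
  interpret abelian_group M using assms(2) by (rule module_abelian_group)
  have "(a \<ominus>\<^bsub>M\<^esub> b) \<oplus>\<^bsub>M\<^esub> b = a"
    using assms(3,4) by (simp add: a_minus_def a_assoc l_neg)
  moreover have "t ((a \<ominus>\<^bsub>M\<^esub> b) \<oplus>\<^bsub>M\<^esub> b) i = t (a \<ominus>\<^bsub>M\<^esub> b) i + t b i"
    by (rule coord_add[OF assms(1)]) (use assms in auto)
  ultimately show ?thesis by simp
qed

lemma coord_finsum:
  assumes "coord_iso M r t" "module complex_ring M" "\<And>i. i \<in> I \<Longrightarrow> f i \<in> carrier M" "finite I"
  shows "t (\<Oplus>\<^bsub>M\<^esub>i\<in>I. f i) k = (\<Sum>i\<in>I. t (f i) k)"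
proof -
  interpret abelian_group M using assms(2) by (rule module_abelian_group)
  show ?thesis
    using assms(4,3)
  proof (induction I)
    case empty
    then show ?case using coord_zero[OF assms(1,2)] by simp
  next
    case (insert i I)
    then have "(\<Oplus>\<^bsub>M\<^esub>i\<in>insert i I. f i) = f i \<oplus>\<^bsub>M\<^esub> (\<Oplus>\<^bsub>M\<^esub>i\<in>I. f i)" by (simp add: finsum_insert Pi_iff)
    moreover have "(\<Oplus>\<^bsub>M\<^esub>i\<in>I. f i) \<in> carrier M" using insert by (auto intro: finsum_closed)
    ultimately show ?case using insert coord_add[OF assms(1)] by simp
  qed
qed

text \<open>The algebra of the product rule for induced connections: there \<open>a\<close> is the
  derivative of the section \<open>g (f s)\<close>, \<open>b\<close> is \<open>g\<close> applied to
  the derivative of \<open>f s\<close>, and \<open>c\<close> is \<open>g\<close> after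
  \<open>f\<close> applied to the derivative of \<open>s\<close>.\<close>

lemma minus_telescope:
  assumes M: "module complex_ring M" and t: "coord_iso M r t"
    and a: "a \<in> carrier M" and b: "b \<in> carrier M" and c: "c \<in> carrier M" and d: "d \<in> carrier M"
    and eq: "b = d \<oplus>\<^bsub>M\<^esub> c"
  shows "a \<ominus>\<^bsub>M\<^esub> c = (a \<ominus>\<^bsub>M\<^esub> b) \<oplus>\<^bsub>M\<^esub> d"
proof (rule coord_eqI[OF t module_minus_closed[OF M a c] module_add_closed[OF M module_minus_closed[OF M a b] d]])
  fix i
  have "t b i = t d i + t c i" unfolding eq by (rule coord_add[OF t d c])
  then show "t (a \<ominus>\<^bsub>M\<^esub> c) i = t ((a \<ominus>\<^bsub>M\<^esub> b) \<oplus>\<^bsub>M\<^esub> d) i"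
    by (simp only: coord_add[OF t module_minus_closed[OF M a b] d] coord_minus[OF t M a c] coord_minus[OF t M a b]) simp
qed

lemma linear_on_zero:
  assumes "module complex_ring M" "module complex_ring N" "linear_on M N L" "coord_iso N r t"
  shows "L \<zero>\<^bsub>M\<^esub> = \<zero>\<^bsub>N\<^esub>"
proof -
  note z = module_zero_closed[OF assms(1)]
  note Lz = linear_on_closed[OF assms(3) z]
  have "\<zero>\<^bsub>M\<^esub> \<oplus>\<^bsub>M\<^esub> \<zero>\<^bsub>M\<^esub> = \<zero>\<^bsub>M\<^esub>"
    using module_abelian_group[OF assms(1)] z by (simp add: abelian_group.axioms(1) abelian_monoid.l_zero)
  then have "L \<zero>\<^bsub>M\<^esub> = L \<zero>\<^bsub>M\<^esub> \<oplus>\<^bsub>N\<^esub> L \<zero>\<^bsub>M\<^esub>"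
    using linear_on_add[OF assms(3) z z] by simp
  then have "t (L \<zero>\<^bsub>M\<^esub>) i = t (L \<zero>\<^bsub>M\<^esub>) i + t (L \<zero>\<^bsub>M\<^esub>) i" for i
    using coord_add[OF assms(4) Lz Lz] by metis
  then show ?thesis
    by (intro coord_eqI[OF assms(4) Lz module_zero_closed[OF assms(2)]])
      (simp add: coord_zero[OF assms(4,2)])
qed

text \<open>Induction on the truncations \<open>b k\<close>, which keep the first \<open>k\<close>
  coordinates of \<open>a\<close>; each step adds a multiple of one basis vector, so additivity and
  homogeneity of \<open>L\<close> suffice.\<close>

lemma linear_coords:
  assumes M: "module complex_ring M" and L: "linear_on M N L"
    and t: "coord_iso M r t" and t': "coord_iso N r' t'" and a: "a \<in> carrier M"
  shows "t' (L a) i = (\<Sum>j<r. t a j * t' (L (basis_vec M t j)) i)"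
proof -
  define b where "b = (\<lambda>k. inv_into (carrier M) t (\<lambda>i. if i < k then t a i else 0))"
  have b: "b k \<in> carrier M" "t (b k) = (\<lambda>i. if i < k then t a i else 0)" for k
  proof -
    have "(\<lambda>i. if i < k then t a i else 0) \<in> Cn r"
      using coord_closed[OF t a] by (auto simp: Cn_def)
    then show "b k \<in> carrier M" "t (b k) = (\<lambda>i. if i < k then t a i else 0)"
      unfolding b_def using coord_inv[OF t] coord_inv_closed[OF t] by blast+
  qed
  have basis: "t (basis_vec M t j) = (\<lambda>i. if i = j then 1 else 0)" if "j < r" for j
    using coord_basis_vec[OF t that] by auto
  have step: "t' (L (b k)) i = (\<Sum>j<k. t a j * t' (L (basis_vec M t j)) i)" if "k \<le> r" for k
    using that
  proof (induction k)
    case 0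
    \<comment> \<open>The zero element is recognised as 0 times itself, so its image is found from
      homogeneity alone.\<close>
    have "0 \<odot>\<^bsub>M\<^esub> b 0 = b 0"
      by (rule coord_eqI[OF t module_smult_closed[OF M b(1)] b(1)])
        (simp only: coord_smult[OF t b(1)] b(2), simp)
    then have "t' (L (b 0)) i = t' (0 \<odot>\<^bsub>N\<^esub> L (b 0)) i"
      using linear_on_smult[OF L b(1), of 0 0] by simp
    then show ?case using coord_smult[OF t' linear_on_closed[OF L b(1)], of 0] by simp
  next
    case (Suc k)
    have e: "basis_vec M t k \<in> carrier M" using Suc.prems by (simp add: basis_vec_closed[OF t])
    note ke = module_smult_closed[OF M e]
    have "b (Suc k) = b k \<oplus>\<^bsub>M\<^esub> (t a k \<odot>\<^bsub>M\<^esub> basis_vec M t k)"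
      by (rule coord_eqI[OF t b(1) module_add_closed[OF M b(1) ke]])
        (use Suc.prems in \<open>simp add: coord_add[OF t b(1) ke] coord_smult[OF t e] coord_basis_vec[OF t] b(2) less_Suc_eq\<close>)
    then have "L (b (Suc k)) = L (b k) \<oplus>\<^bsub>N\<^esub> (t a k \<odot>\<^bsub>N\<^esub> L (basis_vec M t k))"
      by (simp add: linear_on_add[OF L b(1) ke] linear_on_smult[OF L e])
    moreover have "t a k \<odot>\<^bsub>N\<^esub> L (basis_vec M t k) \<in> carrier N"
      using linear_on_closed[OF L ke] linear_on_smult[OF L e] by simp
    ultimately show ?case
      using Suc coord_add[OF t' linear_on_closed[OF L b(1)]] coord_smult[OF t' linear_on_closed[OF L e]] by simp
  qed
  have "b r = a"
    by (rule coord_eqI[OF t b(1) a]) (simp add: b(2))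
  then show ?thesis using step[of r] by simp
qed

text \<open>Each basis is expanded in the other. The two matrices of the base change are mutually
  inverse, so the sum over \<open>j\<close> leaves a Kronecker delta. The ranks \<open>r\<close> and
  \<open>r'\<close> may still differ at this stage.\<close>

lemma trace_sum_eq:
  assumes M: "module complex_ring M" and t: "coord_iso M r t" and t': "coord_iso M r' t'"
    and L: "linear_on M M L"
  shows "(\<Sum>j<r. t (L (basis_vec M t j)) j) = (\<Sum>j<r'. t' (L (basis_vec M t' j)) j)"
proof -
  note e = basis_vec_closed[OF t] and e' = basis_vec_closed[OF t']
  have "t (L (basis_vec M t j)) j =
      (\<Sum>k<r'. \<Sum>l<r'. t' (L (basis_vec M t' l)) k * (t' (basis_vec M t j) l * t (basis_vec M t' k) j))" if "j < r" for j
  proof -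
    have "t (L (basis_vec M t j)) j = (\<Sum>k<r'. t' (L (basis_vec M t j)) k * t (basis_vec M t' k) j)"
      by (rule linear_coords[OF M linear_on_id t' t linear_on_closed[OF L e[OF that]]])
    also have "\<dots> = (\<Sum>k<r'. (\<Sum>l<r'. t' (basis_vec M t j) l * t' (L (basis_vec M t' l)) k) * t (basis_vec M t' k) j)"
      by (rule sum.cong[OF refl]) (simp only: linear_coords[OF M L t' t' e[OF that]])
    finally show ?thesis by (simp add: sum_distrib_right sum_distrib_left mult_ac)
  qed
  then have "(\<Sum>j<r. t (L (basis_vec M t j)) j) =
      (\<Sum>j<r. \<Sum>k<r'. \<Sum>l<r'. t' (L (basis_vec M t' l)) k * (t' (basis_vec M t j) l * t (basis_vec M t' k) j))"
    by simp
  also have "\<dots> = (\<Sum>k<r'. \<Sum>j<r. \<Sum>l<r'. t' (L (basis_vec M t' l)) k * (t' (basis_vec M t j) l * t (basis_vec M t' k) j))"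
    by (rule sum.swap)
  also have "\<dots> = (\<Sum>k<r'. \<Sum>l<r'. \<Sum>j<r. t' (L (basis_vec M t' l)) k * (t' (basis_vec M t j) l * t (basis_vec M t' k) j))"
    by (rule sum.cong[OF refl]) (rule sum.swap)
  also have "\<dots> = (\<Sum>k<r'. \<Sum>l<r'. t' (L (basis_vec M t' l)) k * (if l = k then 1 else 0))"
  proof (intro sum.cong refl)
    fix k l assume "k \<in> {..<r'}" "l \<in> {..<r'}"
    \<comment> \<open>A basis vector of the second system is expanded through the first:
      \<open>linear_coords\<close> for the identity map says that the two base changes are inverse
      to each other.\<close>
    then have "t' (basis_vec M t' k) l = (\<Sum>j<r. t (basis_vec M t' k) j * t' (basis_vec M t j) l)"
      by (intro linear_coords[OF M linear_on_id t t' e']) auto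
    then have "(\<Sum>j<r. t (basis_vec M t' k) j * t' (basis_vec M t j) l) = (if l = k then 1 else 0)"
      using \<open>k \<in> {..<r'}\<close> by (simp add: coord_basis_vec[OF t'])
    then show "(\<Sum>j<r. t' (L (basis_vec M t' l)) k * (t' (basis_vec M t j) l * t (basis_vec M t' k) j)) =
        t' (L (basis_vec M t' l)) k * (if l = k then 1 else 0)"
      by (simp add: sum_distrib_left[symmetric] mult.commute)
  qed
  also have "\<dots> = (\<Sum>k<r'. t' (L (basis_vec M t' k)) k)"
    by (rule sum.cong[OF refl]) (simp add: if_distrib[of "\<lambda>x. _ * x"] sum.delta cong: if_cong)
  finally show ?thesis .
qed

text \<open>In any coordinates the trace of the identity is the rank.\<close>

lemma coord_iso_rank_unique:
  assumes "module complex_ring M" "coord_iso M r t" "coord_iso M r' t'"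
  shows "r = r'"
proof -
  have "(\<Sum>j<r. t (basis_vec M t j) j) = (\<Sum>j<r'. t' (basis_vec M t' j) j)"
    by (rule trace_sum_eq[OF assms linear_on_id])
  then have "complex_of_nat r = of_nat r'"
    using assms(2,3) by (simp add: coord_basis_vec)
  then show ?thesis by simp
qed

lemma vdim_eq:
  assumes "module complex_ring M" "coord_iso M r t"
  shows "vdim M = r"
  unfolding vdim_def using assms coord_iso_rank_unique by (intro the_equality) blast+

lemma vtrace_eq:
  assumes "module complex_ring M" "coord_iso M r t" "linear_on M M L"
  shows "vtrace M L = (\<Sum>j<r. t (L (basis_vec M t j)) j)"
  unfolding vtrace_def
proof (rule the_equality)
  show "\<forall>r' t'. coord_iso M r' t' \<longrightarrow> (\<Sum>j<r. t (L (basis_vec M t j)) j) = (\<Sum>j<r'. t' (L (basis_vec M t' j)) j)"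
    using trace_sum_eq[OF assms(1,2) _ assms(3)] by blast
  fix c assume "\<forall>r' t'. coord_iso M r' t' \<longrightarrow> c = (\<Sum>j<r'. t' (L (basis_vec M t' j)) j)"
  then show "c = (\<Sum>j<r. t (L (basis_vec M t j)) j)" using assms(2) by blast
qed

lemma vtrace_cong:
  assumes "\<And>a. a \<in> carrier M \<Longrightarrow> L a = L' a"
  shows "vtrace M L = vtrace M L'"
proof -
  have "(\<Sum>j<r. t (L (basis_vec M t j)) j) = (\<Sum>j<r. t (L' (basis_vec M t j)) j)" if "coord_iso M r t" for r t
    using basis_vec_closed[OF that] assms by (intro sum.cong) auto
  then show ?thesis unfolding vtrace_def by (metis (no_types, lifting))
qed

text \<open>The coordinates \<open>t\<close> of \<open>N\<close> are transported to \<open>M\<close>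
  along \<open>f\<close>; with respect to them the two maps have the same matrix.\<close>

lemma vtrace_conjugate:
  assumes M: "module complex_ring M" and N: "module complex_ring N" and t: "coord_iso N r t"
    and f: "linear_on M N f" "bij_betw f (carrier M) (carrier N)" and L: "linear_on N N L"
  shows "vtrace M (\<lambda>a. inv_into (carrier M) f (L (f a))) = vtrace N L"
proof -
  let ?g = "inv_into (carrier M) f"
  have g: "?g b \<in> carrier M" "f (?g b) = b" if "b \<in> carrier N" for b
    using that f(2) by (auto simp: bij_betw_def inv_into_into f_inv_into_f)
  have gf: "?g (f a) = a" if "a \<in> carrier M" for a
    using that f(2) by (auto simp: bij_betw_def)
  note lg = linear_on_inverse[OF M f]
  define t' where "t' = (\<lambda>a\<in>carrier M. t (f a))"
  have "bij_betw (\<lambda>a. t (f a)) (carrier M) (Cn r)"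
    using bij_betw_trans[OF f(2), of t "Cn r"] t by (simp add: coord_iso_def comp_def)
  then have bij: "bij_betw t' (carrier M) (Cn r)"
    by (subst bij_betw_cong[where g = "\<lambda>a. t (f a)"]) (simp_all add: t'_def)
  moreover have "t' \<in> lin_maps M (Cn_module r)"
    using coord_closed[OF t linear_on_closed[OF f(1)]] coord_add[OF t linear_on_closed[OF f(1)] linear_on_closed[OF f(1)]]
      coord_smult[OF t linear_on_closed[OF f(1)]]
    by (auto simp: lin_maps_iff linear_on_def t'_def Cn_module_def module_add_closed[OF M] module_smult_closed[OF M]
        linear_on_add[OF f(1)] linear_on_smult[OF f(1)])
  ultimately have t': "coord_iso M r t'" by (simp add: coord_iso_def)
  have basis: "basis_vec M t' j = ?g (basis_vec N t j)" if "j < r" for j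
  proof -
    have "t' (?g (basis_vec N t j)) = unit_vec j"
      using g[OF basis_vec_closed[OF t that]] by (simp add: t'_def coord_inv[OF t unit_vec_Cn[OF that]])
    then show ?thesis using bij g[OF basis_vec_closed[OF t that]] by (metis bij_betw_imp_inj_on inv_into_f_f)
  qed
  have "linear_on M M (\<lambda>a. ?g (L (f a)))"
    using linear_on_compose[OF linear_on_compose[OF f(1) L] lg] .
  then have "vtrace M (\<lambda>a. ?g (L (f a))) = (\<Sum>j<r. t' (?g (L (f (basis_vec M t' j)))) j)"
    by (rule vtrace_eq[OF M t'])
  also have "\<dots> = (\<Sum>j<r. t (L (basis_vec N t j)) j)"
  proof (rule sum.cong[OF refl])
    fix j assume "j \<in> {..<r}"
    then have j: "j < r" by simp
    note e = basis_vec_closed[OF t j]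
    show "t' (?g (L (f (basis_vec M t' j)))) j = t (L (basis_vec N t j)) j"
      unfolding basis[OF j] g(2)[OF e] using g linear_on_closed[OF L e] by (simp add: t'_def)
  qed
  also have "\<dots> = vtrace N L" by (rule vtrace_eq[OF N t L, symmetric])
  finally show ?thesis .
qed

section \<open>Bundles, sections and connections\<close>

lemma sections_closed: "s \<in> sections U E W \<Longrightarrow> x \<in> W \<Longrightarrow> s x \<in> carrier (fibre E x)"
  and sections_extensional: "s \<in> sections U E W \<Longrightarrow> s \<in> extensional W"
  by (simp_all add: sections_def)

lemma sections_hol_fun:
  assumes "s \<in> sections U E W" "(D, r, t) \<in> trivs E" "i < r"
  shows "hol_fun U (D \<inter> W) (\<lambda>x. t x (s x) i)"
proof -
  have "\<forall>(D, r, t) \<in> trivs E. \<forall>i<r. hol_fun U (D \<inter> W) (\<lambda>x. t x (s x) i)"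
    using assms(1) unfolding sections_def mem_Collect_eq by (elim conjE)
  from bspec[OF this assms(2), unfolded case_prod_conv] assms(3) show ?thesis by simp
qed

lemma sectionsI:
  assumes "s \<in> extensional W" "\<And>x. x \<in> W \<Longrightarrow> s x \<in> carrier (fibre E x)"
    "\<And>D r t i. (D, r, t) \<in> trivs E \<Longrightarrow> i < r \<Longrightarrow> hol_fun U (D \<inter> W) (\<lambda>x. t x (s x) i)"
  shows "s \<in> sections U E W"
  unfolding sections_def mem_Collect_eq
  by (intro conjI ballI assms(1,2)) (auto simp only: split_paired_all case_prod_conv intro!: assms(3))

context cmanifold
begin

lemma holomorphic_bundle:
  assumes "hol_bundle U E"
  shows fibre_extensional: "fibre E \<in> extensional (points U)"
    and fibre_module: "x \<in> points U \<Longrightarrow> module complex_ring (fibre E x)"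
  using assms unfolding hol_bundle_def by auto

lemma triv:
  assumes E: "hol_bundle U E" and T: "(D, r, t) \<in> trivs E"
  shows triv_open: "openin (mtop U) D"
    and triv_extensional: "t \<in> extensional D"
    and triv_iso: "x \<in> D \<Longrightarrow> coord_iso (fibre E x) r (t x)"
proof -
  have "\<forall>(D, r, t) \<in> trivs E. openin (mtop U) D \<and> t \<in> extensional D \<and> (\<forall>x\<in>D. coord_iso (fibre E x) r (t x))"
    using E unfolding hol_bundle_def by (elim conjE)
  from bspec[OF this T, unfolded case_prod_conv]
  show "openin (mtop U) D" "t \<in> extensional D" "x \<in> D \<Longrightarrow> coord_iso (fibre E x) r (t x)" by auto
qed

lemma triv_points: "hol_bundle U E \<Longrightarrow> (D, r, t) \<in> trivs E \<Longrightarrow> x \<in> D \<Longrightarrow> x \<in> points U"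
  using open_subset_points triv_open by blast

lemma points_triv:
  assumes "hol_bundle U E" "x \<in> points U"
  obtains D r t where "(D, r, t) \<in> trivs E" "x \<in> D"
proof -
  have "(\<Union>(D, r, t) \<in> trivs E. D) = points U"
    using assms(1) unfolding hol_bundle_def by (elim conjE)
  with assms(2) have "x \<in> (\<Union>(D, r, t) \<in> trivs E. D)" by simp
  then show ?thesis by (auto intro: that)
qed

lemma triv_transition:
  assumes E: "hol_bundle U E" and T: "(D, r, t) \<in> trivs E" and T': "(D', r', t') \<in> trivs E" and "j < r" "i < r'"
  shows "hol_fun U (D \<inter> D') (\<lambda>x. t' x (frame E (D, r, t) j x) i)"
proof -
  have "\<forall>(D, r, t) \<in> trivs E. \<forall>(D', r', t') \<in> trivs E. \<forall>j<r. \<forall>i<r'.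
        hol_fun U (D \<inter> D') (\<lambda>x. t' x (frame E (D, r, t) j x) i)"
    using E unfolding hol_bundle_def by (elim conjE)
  from bspec[OF bspec[OF this T, unfolded case_prod_conv] T', unfolded case_prod_conv] assms(4,5)
  show ?thesis by simp
qed

lemma frame_eq: "x \<in> D \<Longrightarrow> frame E (D, r, t) j x = basis_vec (fibre E x) (t x) j"
  by simp

lemma frame_closed:
  assumes "hol_bundle U E" "(D, r, t) \<in> trivs E" "x \<in> D" "j < r"
  shows "frame E (D, r, t) j x \<in> carrier (fibre E x)"
  using basis_vec_closed[OF triv_iso[OF assms(1,2,3)] assms(4)] assms(3) by simp

lemma triv_frame:
  assumes "hol_bundle U E" "(D, r, t) \<in> trivs E" "x \<in> D" "j < r"
  shows "t x (frame E (D, r, t) j x) i = (if i = j then 1 else 0)"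
  using coord_basis_vec[OF triv_iso[OF assms(1,2,3)] assms(4)] assms(3) by simp

declare frame.simps [simp del]

lemma triv_change:
  assumes E: "hol_bundle U E" and T: "(D, r, t) \<in> trivs E" and T': "(D', r', t') \<in> trivs E"
    and x: "x \<in> D" "x \<in> D'" and e: "e \<in> carrier (fibre E x)"
  shows "t' x e i = (\<Sum>j<r. t x e j * t' x (frame E (D, r, t) j x) i)"
  using linear_coords[OF fibre_module[OF E triv_points[OF E T x(1)]] linear_on_id triv_iso[OF E T x(1)] triv_iso[OF E T' x(2)] e]
  by (simp add: frame_eq[OF x(1)])

lemma frame_section:
  assumes E: "hol_bundle U E" and T: "(D, r, t) \<in> trivs E" and j: "j < r"
  shows "frame E (D, r, t) j \<in> sections U E D"
proof (rule sectionsI)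
  show "frame E (D, r, t) j \<in> extensional D" by (simp add: frame.simps)
  show "frame E (D, r, t) j x \<in> carrier (fibre E x)" if "x \<in> D" for x by (rule frame_closed[OF E T that j])
  show "hol_fun U (D' \<inter> D) (\<lambda>x. t' x (frame E (D, r, t) j x) i)" if "(D', r', t') \<in> trivs E" "i < r'" for D' r' t' i
    using triv_transition[OF E T that(1) j that(2)] by (simp add: Int_commute)
qed

text \<open>A change of trivialisation multiplies the coordinates by a holomorphic transition
  matrix, so one trivialisation around each point is enough.\<close>

lemma section_localI:
  assumes E: "hol_bundle U E" and ext: "s \<in> extensional W"
    and cl: "\<And>x. x \<in> W \<Longrightarrow> s x \<in> carrier (fibre E x)"
    and loc: "\<And>x. x \<in> W \<Longrightarrow> \<exists>D r t W'. (D, r, t) \<in> trivs E \<and> openin (mtop U) W' \<and> x \<in> D \<and> x \<in> W' \<and> W' \<subseteq> W \<and>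
        (\<forall>i<r. hol_fun U (D \<inter> W') (\<lambda>x. t x (s x) i))"
  shows "s \<in> sections U E W"
proof (rule sectionsI[OF ext cl])
  fix D' r' t' i assume T': "(D', r', t') \<in> trivs E" and i: "i < r'"
  show "hol_fun U (D' \<inter> W) (\<lambda>x. t' x (s x) i)"
  proof (rule hol_fun_local)
    fix x assume x: "x \<in> D' \<inter> W"
    then obtain D r t W' where T: "(D, r, t) \<in> trivs E" and W': "openin (mtop U) W'" "x \<in> D" "x \<in> W'" "W' \<subseteq> W"
      and h: "\<And>i. i < r \<Longrightarrow> hol_fun U (D \<inter> W') (\<lambda>x. t x (s x) i)" using loc[of x] by blast
    define A where "A = D \<inter> D' \<inter> W'"
    have A: "openin (mtop U) A" unfolding A_def
      by (intro openin_Int triv_open[OF E T] triv_open[OF E T'] W'(1))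
    have "hol_fun U A (\<lambda>x. \<Sum>j<r. t x (s x) j * t' x (frame E (D, r, t) j x) i)"
    proof (intro hol_fun_sum hol_fun_mult)
      fix j assume "j \<in> {..<r}"
      then have j: "j < r" by simp
      show "hol_fun U A (\<lambda>x. t x (s x) j)" by (rule hol_fun_subset[OF h[OF j]]) (auto simp: A_def)
      show "hol_fun U A (\<lambda>x. t' x (frame E (D, r, t) j x) i)"
        by (rule hol_fun_subset[OF triv_transition[OF E T T' j i]]) (auto simp: A_def)
    qed
    moreover have "(\<Sum>j<r. t x (s x) j * t' x (frame E (D, r, t) j x) i) = t' x (s x) i" if "x \<in> A" for x
      by (rule triv_change[OF E T T', symmetric]) (use that W' cl in \<open>auto simp: A_def\<close>)
    ultimately have "hol_fun U A (\<lambda>x. t' x (s x) i)" using hol_fun_cong[OF A, of "\<lambda>x. \<Sum>j<r. t x (s x) j * t' x (frame E (D, r, t) j x) i"] by simp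
    then show "\<exists>W'. openin (mtop U) W' \<and> x \<in> W' \<and> hol_fun U W' (\<lambda>x. t' x (s x) i)"
      using A W' x by (intro exI[of _ A]) (auto simp: A_def)
  qed
qed

lemma section_restrict:
  assumes E: "hol_bundle U E" and s: "s \<in> sections U E W" and W': "openin (mtop U) W'" "W' \<subseteq> W"
  shows "restrict s W' \<in> sections U E W'"
proof (rule sectionsI)
  fix D r t i assume T: "(D, r, t) \<in> trivs E" and i: "i < r"
  have "hol_fun U (D \<inter> W') (\<lambda>x. t x (s x) i)"
    by (rule hol_fun_subset[OF sections_hol_fun[OF s T i]]) (use W' in auto)
  then show "hol_fun U (D \<inter> W') (\<lambda>x. t x (restrict s W' x) i)"
    by (rule hol_fun_cong[rotated 2]) (use W' triv_open[OF E T] in auto)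
qed (use sections_closed[OF s] W' in auto)

text \<open>Sections over one trivialisation are prescribed by holomorphic coordinate functions. The
  value 0 from index \<open>r\<close> on puts the coordinate vector in \<open>Cn r\<close>, the
  range of \<open>t x\<close>.\<close>

lemma section_coords:
  assumes E: "hol_bundle U E" and T: "(D, r, t) \<in> trivs E" and W: "openin (mtop U) W" "W \<subseteq> D"
    and c: "\<And>i. i < r \<Longrightarrow> hol_fun U W (c i)"
  defines "s \<equiv> \<lambda>x\<in>W. inv_into (carrier (fibre E x)) (t x) (\<lambda>i. if i < r then c i x else 0)"
  shows "s \<in> sections U E W" "\<And>x i. x \<in> W \<Longrightarrow> i < r \<Longrightarrow> t x (s x) i = c i x"
proof -
  have Cn: "(\<lambda>i. if i < r then c i x else 0) \<in> Cn r" for x by (auto simp: Cn_def)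
  have iso: "coord_iso (fibre E x) r (t x)" if "x \<in> W" for x
    using that W by (intro triv_iso[OF E T]) auto
  show eq: "t x (s x) i = c i x" if "x \<in> W" "i < r" for x i
    using that coord_inv[OF iso[OF that(1)] Cn] by (simp add: s_def)
  show "s \<in> sections U E W"
  proof (rule section_localI[OF E])
    show "s \<in> extensional W" by (simp add: s_def)
    show "s x \<in> carrier (fibre E x)" if "x \<in> W" for x
      using coord_inv_closed[OF iso[OF that] Cn] that by (simp add: s_def)
    fix x assume x: "x \<in> W"
    have "hol_fun U (D \<inter> W) (\<lambda>x. t x (s x) i)" if "i < r" for i
    proof (rule hol_fun_cong)
      show "hol_fun U (D \<inter> W) (c i)" by (rule hol_fun_subset[OF c[OF that]]) auto
    qed (use eq that W triv_open[OF E T] in auto)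
    then show "\<exists>D r t W'. (D, r, t) \<in> trivs E \<and> openin (mtop U) W' \<and> x \<in> D \<and> x \<in> W' \<and> W' \<subseteq> W \<and>
        (\<forall>i<r. hol_fun U (D \<inter> W') (\<lambda>x. t x (s x) i))"
      using T W x by blast
  qed
qed

text \<open>The section whose coordinates in the trivialisation are constant, equal to those of
  \<open>e\<close>.\<close>

lemma section_through:
  assumes E: "hol_bundle U E" and T: "(D, r, t) \<in> trivs E" "x \<in> D" and e: "e \<in> carrier (fibre E x)"
  obtains s where "s \<in> sections U E D" "s x = e"
proof -
  define s where "s = (\<lambda>y\<in>D. inv_into (carrier (fibre E y)) (t y) (\<lambda>i. if i < r then t x e i else 0))"
  have s: "s \<in> sections U E D" "\<And>y i. y \<in> D \<Longrightarrow> i < r \<Longrightarrow> t y (s y) i = t x e i"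
    unfolding s_def by (rule section_coords[OF E T(1) triv_open[OF E T(1)] subset_refl]; simp add: hol_fun_const)+
  have "s x = e"
    by (rule coord_eqI[OF triv_iso[OF E T] sections_closed[OF s(1) T(2)] e s(2)[OF T(2)]])
  then show ?thesis using s that by blast
qed

lemma section_add:
  assumes E: "hol_bundle U E" and W: "openin (mtop U) W" and s: "s \<in> sections U E W" and s': "s' \<in> sections U E W"
  shows "(\<lambda>y\<in>W. s y \<oplus>\<^bsub>fibre E y\<^esub> s' y) \<in> sections U E W"
proof (rule sectionsI)
  fix D r t i assume T: "(D, r, t) \<in> trivs E" and i: "i < r"
  have "hol_fun U (D \<inter> W) (\<lambda>x. t x (s x) i + t x (s' x) i)"
    by (intro hol_fun_add sections_hol_fun[OF s T i] sections_hol_fun[OF s' T i])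
  then show "hol_fun U (D \<inter> W) (\<lambda>x. t x ((\<lambda>y\<in>W. s y \<oplus>\<^bsub>fibre E y\<^esub> s' y) x) i)"
    by (rule hol_fun_cong[rotated 2])
      (use W triv_open[OF E T] coord_add[OF triv_iso[OF E T]] sections_closed[OF s] sections_closed[OF s'] in auto)
next
  fix x assume "x \<in> W"
  then show "(\<lambda>y\<in>W. s y \<oplus>\<^bsub>fibre E y\<^esub> s' y) x \<in> carrier (fibre E x)"
    using module_add_closed[OF fibre_module[OF E]] open_subset_points[OF W] sections_closed[OF s] sections_closed[OF s'] by auto
qed simp

lemma section_smult:
  assumes E: "hol_bundle U E" and W: "openin (mtop U) W" and s: "s \<in> sections U E W" and h: "hol_fun U W h"
  shows "(\<lambda>y\<in>W. h y \<odot>\<^bsub>fibre E y\<^esub> s y) \<in> sections U E W"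
proof (rule sectionsI)
  fix D r t i assume T: "(D, r, t) \<in> trivs E" and i: "i < r"
  have "hol_fun U (D \<inter> W) (\<lambda>x. h x * t x (s x) i)"
    by (intro hol_fun_mult sections_hol_fun[OF s T i] hol_fun_subset[OF h]) auto
  then show "hol_fun U (D \<inter> W) (\<lambda>x. t x ((\<lambda>y\<in>W. h y \<odot>\<^bsub>fibre E y\<^esub> s y) x) i)"
    by (rule hol_fun_cong[rotated 2])
      (use W triv_open[OF E T] coord_smult[OF triv_iso[OF E T]] sections_closed[OF s] in auto)
next
  fix x assume "x \<in> W"
  then show "(\<lambda>y\<in>W. h y \<odot>\<^bsub>fibre E y\<^esub> s y) x \<in> carrier (fibre E x)"
    using module_smult_closed[OF fibre_module[OF E]] open_subset_points[OF W] sections_closed[OF s] by auto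
qed simp

end

section \<open>Bundle maps in local frames\<close>

lemma bundle_maps_linear:
  "f \<in> hol_bundle_maps U E F \<Longrightarrow> x \<in> points U \<Longrightarrow> linear_on (fibre E x) (fibre F x) (f x)"
  and bundle_maps_fibre_extensional:
  "f \<in> hol_bundle_maps U E F \<Longrightarrow> x \<in> points U \<Longrightarrow> f x \<in> extensional (carrier (fibre E x))"
  and bundle_maps_extensional: "f \<in> hol_bundle_maps U E F \<Longrightarrow> f \<in> extensional (points U)"
  by (auto simp: hol_bundle_maps_def lin_maps_iff)

lemma bundle_maps_hol_fun:
  assumes f: "f \<in> hol_bundle_maps U E F" and T: "(D, r, t) \<in> trivs E" and T': "(D', r', t') \<in> trivs F"
    and "j < r" "i < r'"
  shows "hol_fun U (D \<inter> D') (\<lambda>x. t' x (f x (frame E (D, r, t) j x)) i)"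
proof -
  have "\<forall>(D, r, t) \<in> trivs E. \<forall>(D', r', t') \<in> trivs F. \<forall>j<r. \<forall>i<r'.
        hol_fun U (D \<inter> D') (\<lambda>x. t' x (f x (frame E (D, r, t) j x)) i)"
    using f unfolding hol_bundle_maps_def mem_Collect_eq by (elim conjE)
  from bspec[OF bspec[OF this T, unfolded case_prod_conv] T', unfolded case_prod_conv] assms(4,5)
  show ?thesis by simp
qed

lemma bundle_mapsI:
  assumes "f \<in> extensional (points U)"
    "\<And>x. x \<in> points U \<Longrightarrow> linear_on (fibre E x) (fibre F x) (f x)"
    "\<And>x. x \<in> points U \<Longrightarrow> f x \<in> extensional (carrier (fibre E x))"
    "\<And>D r t D' r' t' j i. (D, r, t) \<in> trivs E \<Longrightarrow> (D', r', t') \<in> trivs F \<Longrightarrow> j < r \<Longrightarrow> i < r' \<Longrightarrow>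
        hol_fun U (D \<inter> D') (\<lambda>x. t' x (f x (frame E (D, r, t) j x)) i)"
  shows "f \<in> hol_bundle_maps U E F"
  unfolding hol_bundle_maps_def mem_Collect_eq
  by (intro conjI ballI assms(1)) (auto simp only: split_paired_all case_prod_conv lin_maps_iff intro!: assms(2-4))

context cmanifold
begin

lemma bundle_map_coords:
  assumes E: "hol_bundle U E" and F: "hol_bundle U F" and f: "f \<in> hol_bundle_maps U E F"
    and T: "(D, r, t) \<in> trivs E" and T': "(D', r', t') \<in> trivs F"
    and x: "x \<in> D" "x \<in> D'" and e: "e \<in> carrier (fibre E x)"
  shows "t' x (f x e) i = (\<Sum>j<r. t x e j * t' x (f x (frame E (D, r, t) j x)) i)"
  using linear_coords[OF fibre_module[OF E triv_points[OF E T x(1)]]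
      bundle_maps_linear[OF f triv_points[OF E T x(1)]] triv_iso[OF E T x(1)] triv_iso[OF F T' x(2)] e]
  by (simp add: frame_eq[OF x(1)])

text \<open>In a pair of trivialisations the coordinates of the image are the matrix of
  \<open>f\<close> applied to the coordinates of \<open>s\<close>, that is, sums of products of
  holomorphic functions.\<close>

lemma bundle_map_section:
  assumes E: "hol_bundle U E" and F: "hol_bundle U F" and f: "f \<in> hol_bundle_maps U E F"
    and W: "openin (mtop U) W" and s: "s \<in> sections U E W"
  shows "(\<lambda>y\<in>W. f y (s y)) \<in> sections U F W"
proof (rule sectionsI)
  fix D' r' t' i assume T': "(D', r', t') \<in> trivs F" and i: "i < r'"
  show "hol_fun U (D' \<inter> W) (\<lambda>x. t' x ((\<lambda>y\<in>W. f y (s y)) x) i)"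
  proof (rule hol_fun_local)
    fix x assume x: "x \<in> D' \<inter> W"
    then obtain D r t where T: "(D, r, t) \<in> trivs E" "x \<in> D"
      using points_triv[OF E] triv_points[OF F T'] by blast
    define A where "A = D \<inter> D' \<inter> W"
    have A: "openin (mtop U) A" unfolding A_def
      by (intro openin_Int triv_open[OF E T(1)] triv_open[OF F T'] W)
    have "hol_fun U A (\<lambda>x. \<Sum>j<r. t x (s x) j * t' x (f x (frame E (D, r, t) j x)) i)"
    proof (intro hol_fun_sum hol_fun_mult)
      fix j assume "j \<in> {..<r}"
      then have j: "j < r" by simp
      show "hol_fun U A (\<lambda>x. t x (s x) j)" by (rule hol_fun_subset[OF sections_hol_fun[OF s T(1) j]]) (auto simp: A_def)
      show "hol_fun U A (\<lambda>x. t' x (f x (frame E (D, r, t) j x)) i)"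
        by (rule hol_fun_subset[OF bundle_maps_hol_fun[OF f T(1) T' j i]]) (auto simp: A_def)
    qed
    then have "hol_fun U A (\<lambda>x. t' x ((\<lambda>y\<in>W. f y (s y)) x) i)"
      by (rule hol_fun_cong[OF A, rotated])
        (use bundle_map_coords[OF E F f T(1) T'] sections_closed[OF s] in \<open>auto simp: A_def\<close>)
    then show "\<exists>W'. openin (mtop U) W' \<and> x \<in> W' \<and> hol_fun U W' (\<lambda>x. t' x ((\<lambda>y\<in>W. f y (s y)) x) i)"
      using A T x by (intro exI[of _ A]) (auto simp: A_def)
  qed
next
  fix x assume "x \<in> W"
  then show "(\<lambda>y\<in>W. f y (s y)) x \<in> carrier (fibre F x)"
    using linear_on_closed[OF bundle_maps_linear[OF f]] open_subset_points[OF W] sections_closed[OF s] by auto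
qed simp

section \<open>Connections in local frames\<close>

lemma connection:
  assumes "hol_connection U E nab" "openin (mtop U) W" "s \<in> sections U E W"
  shows connection_forms: "nab W s \<in> bundle_forms1 U E W"
    and connection_restrict: "openin (mtop U) W' \<Longrightarrow> W' \<subseteq> W \<Longrightarrow> x \<in> W' \<Longrightarrow> v \<in> tangent U x \<Longrightarrow>
          nab W' (restrict s W') x v = nab W s x v"
    and connection_add: "s' \<in> sections U E W \<Longrightarrow> x \<in> W \<Longrightarrow> v \<in> tangent U x \<Longrightarrow>
          nab W (\<lambda>y\<in>W. s y \<oplus>\<^bsub>fibre E y\<^esub> s' y) x v = nab W s x v \<oplus>\<^bsub>fibre E x\<^esub> nab W s' x v"
    and connection_leibniz: "hol_fun U W h \<Longrightarrow> x \<in> W \<Longrightarrow> v \<in> tangent U x \<Longrightarrow>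
          nab W (\<lambda>y\<in>W. h y \<odot>\<^bsub>fibre E y\<^esub> s y) x v =
            v h \<odot>\<^bsub>fibre E x\<^esub> s x \<oplus>\<^bsub>fibre E x\<^esub> h x \<odot>\<^bsub>fibre E x\<^esub> nab W s x v"
proof -
  have *: "\<forall>W. openin (mtop U) W \<longrightarrow>
       (\<forall>s \<in> sections U E W. nab W s \<in> bundle_forms1 U E W) \<and>
       (\<forall>s \<in> sections U E W. \<forall>W' x v. openin (mtop U) W' \<and> W' \<subseteq> W \<and> x \<in> W' \<and> v \<in> tangent U x \<longrightarrow>
          nab W' (restrict s W') x v = nab W s x v) \<and>
       (\<forall>s \<in> sections U E W. \<forall>s' \<in> sections U E W. \<forall>x\<in>W. \<forall>v \<in> tangent U x.
          nab W (\<lambda>y\<in>W. s y \<oplus>\<^bsub>fibre E y\<^esub> s' y) x v = nab W s x v \<oplus>\<^bsub>fibre E x\<^esub> nab W s' x v) \<and>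
       (\<forall>h. \<forall>s \<in> sections U E W. hol_fun U W h \<longrightarrow> (\<forall>x\<in>W. \<forall>v \<in> tangent U x.
          nab W (\<lambda>y\<in>W. h y \<odot>\<^bsub>fibre E y\<^esub> s y) x v =
            v h \<odot>\<^bsub>fibre E x\<^esub> s x \<oplus>\<^bsub>fibre E x\<^esub> h x \<odot>\<^bsub>fibre E x\<^esub> nab W s x v))"
    using assms(1) unfolding hol_connection_def by (elim conjE)
  note * = mp[OF spec[OF *, of W] assms(2)]
  show "nab W s \<in> bundle_forms1 U E W" using * assms(3) by (elim conjE) simp
  show "openin (mtop U) W' \<Longrightarrow> W' \<subseteq> W \<Longrightarrow> x \<in> W' \<Longrightarrow> v \<in> tangent U x \<Longrightarrow>
          nab W' (restrict s W') x v = nab W s x v" using * assms(3) by (elim conjE) simp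
  show "s' \<in> sections U E W \<Longrightarrow> x \<in> W \<Longrightarrow> v \<in> tangent U x \<Longrightarrow>
          nab W (\<lambda>y\<in>W. s y \<oplus>\<^bsub>fibre E y\<^esub> s' y) x v = nab W s x v \<oplus>\<^bsub>fibre E x\<^esub> nab W s' x v"
    using * assms(3) by (elim conjE) simp
  show "hol_fun U W h \<Longrightarrow> x \<in> W \<Longrightarrow> v \<in> tangent U x \<Longrightarrow>
          nab W (\<lambda>y\<in>W. h y \<odot>\<^bsub>fibre E y\<^esub> s y) x v =
            v h \<odot>\<^bsub>fibre E x\<^esub> s x \<oplus>\<^bsub>fibre E x\<^esub> h x \<odot>\<^bsub>fibre E x\<^esub> nab W s x v"
    using * assms(3) by (elim conjE) simp
qed

lemma connection_undefined:
  "hol_connection U E nab \<Longrightarrow>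
    \<not> (openin (mtop U) W \<and> s \<in> sections U E W \<and> x \<in> W \<and> v \<in> tangent U x) \<Longrightarrow> nab W s x v = undefined"
  unfolding hol_connection_def by (elim conjE) simp

lemma connection_closed:
  assumes "hol_connection U E nab" "openin (mtop U) W" "s \<in> sections U E W" "x \<in> W" "v \<in> tangent U x"
  shows "nab W s x v \<in> carrier (fibre E x)"
  using connection_forms[OF assms(1-3)] assms(4,5) unfolding bundle_forms1_def by blast

lemma connection_tlin:
  assumes "hol_connection U E nab" "openin (mtop U) W" "s \<in> sections U E W" "x \<in> W" "v \<in> tangent U x" "w \<in> tangent U x"
  shows "nab W s x (tlin a v b w) = a \<odot>\<^bsub>fibre E x\<^esub> nab W s x v \<oplus>\<^bsub>fibre E x\<^esub> b \<odot>\<^bsub>fibre E x\<^esub> nab W s x w"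
  using connection_forms[OF assms(1-3)] assms(4-6) unfolding bundle_forms1_def by blast

lemma connection_holo:
  assumes nab: "hol_connection U E nab" "openin (mtop U) W" "s \<in> sections U E W"
    and c: "(n, D, \<phi>) \<in> atlas U" and T: "(D', r, t) \<in> trivs E" and "i < n" "j < r"
  shows "holo_on n (\<phi> ` (D \<inter> D' \<inter> W))
          (\<lambda>z. t (inv_into D \<phi> z) (nab W s (inv_into D \<phi> z) (coord_vec U (n, D, \<phi>) (inv_into D \<phi> z) i)) j)"
proof -
  have "\<forall>(n, D, \<phi>) \<in> atlas U. \<forall>(D', r, t) \<in> trivs E. \<forall>i<n. \<forall>j<r.
        holo_on n (\<phi> ` (D \<inter> D' \<inter> W))
          (\<lambda>z. t (inv_into D \<phi> z) (nab W s (inv_into D \<phi> z) (coord_vec U (n, D, \<phi>) (inv_into D \<phi> z) i)) j)"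
    using connection_forms[OF nab] unfolding bundle_forms1_def mem_Collect_eq Let_def by (elim conjE)
  from bspec[OF bspec[OF this c, unfolded case_prod_conv] T, unfolded case_prod_conv] assms(6,7)
  show ?thesis by simp
qed

text \<open>Induction on the partial sums of the expansion of s in the frame.\<close>

lemma connection_frame:
  assumes E: "hol_bundle U E" and nab: "hol_connection U E nab"
    and T: "(D, r, t) \<in> trivs E" and T': "(D', r', t') \<in> trivs E"
    and W: "openin (mtop U) W" and s: "s \<in> sections U E W"
    and x: "x \<in> W" "x \<in> D" "x \<in> D'" and v: "v \<in> tangent U x"
  shows "t' x (nab W s x v) k = (\<Sum>i<r. v (\<lambda>y. t y (s y) i) * t' x (frame E (D, r, t) i x) k
     + t x (s x) i * t' x (nab D (frame E (D, r, t) i) x v) k)"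
proof -
  \<comment> \<open>The section lives on \<open>W\<close> and the frame on \<open>D\<close>. Both
    are restricted to the common part, and \<open>connection_restrict\<close> carries the
    derivatives back.\<close>
  define A where "A = W \<inter> D"
  have A: "openin (mtop U) A" "A \<subseteq> D" "A \<subseteq> W" "x \<in> A"
    using W triv_open[OF E T] x by (auto simp: A_def)
  have iso: "coord_iso (fibre E y) r (t y)" if "y \<in> A" for y
    using that A(2) by (intro triv_iso[OF E T]) auto
  have pA: "y \<in> points U" if "y \<in> A" for y using open_subset_points[OF A(1)] that by blast
  define p where "p = (\<lambda>m. \<lambda>y\<in>A. inv_into (carrier (fibre E y)) (t y) (\<lambda>i. if i < r then if i < m then t y (s y) i else 0 else 0))"
  have hol: "hol_fun U A (\<lambda>y. t y (s y) i)" if "i < r" for i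
    by (rule hol_fun_subset[OF sections_hol_fun[OF s T that]]) (use A in auto)
  have hol': "hol_fun U A (\<lambda>y. if i < m then t y (s y) i else 0)" if "i < r" for i and m :: nat
    using hol[OF that] by (cases "i < m") (simp_all add: hol_fun_const)
  have p: "p m \<in> sections U E A" "\<And>y i. y \<in> A \<Longrightarrow> i < r \<Longrightarrow> t y (p m y) i = (if i < m then t y (s y) i else 0)" for m
    unfolding p_def using section_coords[OF E T A(1,2), of "\<lambda>i y. if i < m then t y (s y) i else 0"] hol' by blast+
  have iso': "coord_iso (fibre E x) r' (t' x)" by (rule triv_iso[OF E T' x(3)])
  note M = fibre_module[OF E pA]
  note pc = sections_closed[OF p(1)]
  have "t' x (nab A (p m) x v) k = (\<Sum>i<m. v (\<lambda>y. t y (s y) i) * t' x (frame E (D, r, t) i x) k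
     + t x (s x) i * t' x (nab D (frame E (D, r, t) i) x v) k)" if "m \<le> r" for m
    using that
  proof (induction m)
    case 0
    \<comment> \<open>The zero section is 0 times itself, and the Leibniz rule with a constant
      function 0 makes its derivative vanish.\<close>
    have "p 0 = (\<lambda>y\<in>A. (0::complex) \<odot>\<^bsub>fibre E y\<^esub> p 0 y)"
    proof (rule extensionalityI[OF sections_extensional[OF p(1)]])
      fix y assume y: "y \<in> A"
      have "p 0 y = 0 \<odot>\<^bsub>fibre E y\<^esub> p 0 y"
        by (rule coord_eqI[OF iso[OF y] pc[OF y] module_smult_closed[OF M[OF y] pc[OF y]]])
          (simp add: coord_smult[OF iso[OF y] pc[OF y]] p(2)[OF y])
      then show "p 0 y = (\<lambda>y\<in>A. (0::complex) \<odot>\<^bsub>fibre E y\<^esub> p 0 y) y" using y by simp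
    qed simp
    then have "nab A (p 0) x v = nab A (\<lambda>y\<in>A. (0::complex) \<odot>\<^bsub>fibre E y\<^esub> p 0 y) x v" by simp
    also have "\<dots> = v (\<lambda>y. 0) \<odot>\<^bsub>fibre E x\<^esub> p 0 x \<oplus>\<^bsub>fibre E x\<^esub> 0 \<odot>\<^bsub>fibre E x\<^esub> nab A (p 0) x v"
      by (rule connection_leibniz[OF nab A(1) p(1) hol_fun_const A(4) v])
    finally have "t' x (nab A (p 0) x v) k = t' x (v (\<lambda>y. 0) \<odot>\<^bsub>fibre E x\<^esub> p 0 x \<oplus>\<^bsub>fibre E x\<^esub> 0 \<odot>\<^bsub>fibre E x\<^esub> nab A (p 0) x v) k"
      by simp
    also have "\<dots> = 0"
      using connection_closed[OF nab A(1) p(1) A(4) v] pc[OF A(4)] M[OF A(4)]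
      by (simp add: coord_add[OF iso'] coord_smult[OF iso'] module_smult_closed tangent_const[OF v])
    finally show ?case by simp
  next
    case (Suc m)
    then have m: "m < r" by simp
    let ?e = "restrict (frame E (D, r, t) m) A"
    let ?c = "\<lambda>y. t y (s y) m"
    have e: "?e \<in> sections U E A" by (rule section_restrict[OF E frame_section[OF E T m] A(1,2)])
    let ?ce = "\<lambda>y\<in>A. ?c y \<odot>\<^bsub>fibre E y\<^esub> ?e y"
    have ce: "?ce \<in> sections U E A" by (rule section_smult[OF E A(1) e hol[OF m]])
    have "p (Suc m) = (\<lambda>y\<in>A. p m y \<oplus>\<^bsub>fibre E y\<^esub> ?ce y)"
    proof (rule extensionalityI[OF sections_extensional[OF p(1)]])
      fix y assume y: "y \<in> A"
      have yD: "y \<in> D" using y A by blast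
      have "p (Suc m) y = p m y \<oplus>\<^bsub>fibre E y\<^esub> ?ce y"
        by (rule coord_eqI[OF iso[OF y] pc[OF y] module_add_closed[OF M[OF y] pc[OF y] sections_closed[OF ce y]]],
            subst coord_add[OF iso[OF y] pc[OF y] sections_closed[OF ce y]])
          (use y m frame_closed[OF E T yD m] in \<open>simp add: coord_smult[OF iso[OF y]] p(2)[OF y] triv_frame[OF E T yD m] less_Suc_eq\<close>)
      then show "p (Suc m) y = (\<lambda>y\<in>A. p m y \<oplus>\<^bsub>fibre E y\<^esub> ?ce y) y" using y by simp
    qed simp
    then have "nab A (p (Suc m)) x v = nab A (p m) x v \<oplus>\<^bsub>fibre E x\<^esub> nab A ?ce x v"
      using connection_add[OF nab A(1) p(1) ce A(4) v] by simp
    moreover have "nab A ?ce x v = v ?c \<odot>\<^bsub>fibre E x\<^esub> ?e x \<oplus>\<^bsub>fibre E x\<^esub> ?c x \<odot>\<^bsub>fibre E x\<^esub> nab A ?e x v"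
      by (rule connection_leibniz[OF nab A(1) e hol[OF m] A(4) v])
    moreover have "nab A ?e x v = nab D (frame E (D, r, t) m) x v"
      by (rule connection_restrict[OF nab triv_open[OF E T] frame_section[OF E T m] A(1,2,4) v])
    ultimately have eq: "nab A (p (Suc m)) x v = nab A (p m) x v \<oplus>\<^bsub>fibre E x\<^esub>
        (v ?c \<odot>\<^bsub>fibre E x\<^esub> frame E (D, r, t) m x \<oplus>\<^bsub>fibre E x\<^esub> ?c x \<odot>\<^bsub>fibre E x\<^esub> nab D (frame E (D, r, t) m) x v)"
      using A(4) by simp
    have fc: "frame E (D, r, t) m x \<in> carrier (fibre E x)" by (rule frame_closed[OF E T x(2) m])
    have nc: "nab D (frame E (D, r, t) m) x v \<in> carrier (fibre E x)"
      by (rule connection_closed[OF nab triv_open[OF E T] frame_section[OF E T m] x(2) v])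
    note sm = module_smult_closed[OF M[OF A(4)]] and ac = module_add_closed[OF M[OF A(4)]]
    show ?case
      unfolding eq
      by (simp add: coord_add[OF iso' connection_closed[OF nab A(1) p(1) A(4) v] ac[OF sm[OF fc] sm[OF nc]]]
          coord_add[OF iso' sm[OF fc] sm[OF nc]] coord_smult[OF iso' fc] coord_smult[OF iso' nc] Suc.IH[OF less_imp_le[OF m]])
  qed
  note main = this[OF order_refl]
  have "p r = restrict s A"
  proof (rule extensionalityI[OF sections_extensional[OF p(1)]])
    fix y assume y: "y \<in> A"
    then have "s y \<in> carrier (fibre E y)" using A sections_closed[OF s] by blast
    then have "p r y = s y"
      by (rule coord_eqI[OF iso[OF y] pc[OF y]]) (simp add: p(2)[OF y])
    then show "p r y = restrict s A y" using y by simp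
  qed simp
  then have "nab A (p r) x v = nab W s x v"
    using connection_restrict[OF nab W s A(1,3,4) v] by simp
  then show ?thesis using main by simp
qed

end

section \<open>The induced connection on homomorphisms\<close>

context cmanifold
begin

text \<open>The columns of the composite are sections: \<open>g\<close> applied to \<open>f\<close>
  applied to a frame of \<open>E\<close>. Two uses of \<open>bundle_map_section\<close> give their
  holomorphy without an explicit product of matrices.\<close>

lemma bundle_comp_maps:
  assumes E: "hol_bundle U E" and F: "hol_bundle U F" and G: "hol_bundle U G"
    and f: "f \<in> hol_bundle_maps U E F" and g: "g \<in> hol_bundle_maps U F G"
  shows "bundle_comp U E g f \<in> hol_bundle_maps U E G"
proof (rule bundle_mapsI)
  fix x assume x: "x \<in> points U"
  have "linear_on (fibre E x) (fibre G x) (\<lambda>a. g x (f x a))"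
    by (rule linear_on_compose[OF bundle_maps_linear[OF f x] bundle_maps_linear[OF g x]])
  then show "linear_on (fibre E x) (fibre G x) (bundle_comp U E g f x)"
    by (subst linear_on_cong[OF fibre_module[OF E x], of _ "\<lambda>a. g x (f x a)"]) (simp_all add: bundle_comp_def compose_def x)
  show "bundle_comp U E g f x \<in> extensional (carrier (fibre E x))"
    using x by (simp add: bundle_comp_def)
next
  fix D r t D' r' t' j i
  assume T: "(D, r, t) \<in> trivs E" and T': "(D', r', t') \<in> trivs G" and j: "j < r" and i: "i < r'"
  have D: "openin (mtop U) (D \<inter> D')" by (intro openin_Int triv_open[OF E T] triv_open[OF G T'])
  have "hol_fun U (D' \<inter> D) (\<lambda>x. t' x ((\<lambda>y\<in>D. g y ((\<lambda>y\<in>D. f y (frame E (D, r, t) j y)) y)) x) i)"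
    by (rule sections_hol_fun[OF bundle_map_section[OF F G g triv_open[OF E T]
        bundle_map_section[OF E F f triv_open[OF E T] frame_section[OF E T j]]] T' i])
  then have "hol_fun U (D \<inter> D') (\<lambda>x. t' x ((\<lambda>y\<in>D. g y ((\<lambda>y\<in>D. f y (frame E (D, r, t) j y)) y)) x) i)"
    by (simp add: Int_commute)
  then show "hol_fun U (D \<inter> D') (\<lambda>x. t' x (bundle_comp U E g f x (frame E (D, r, t) j x)) i)"
    by (rule hol_fun_cong[OF D, rotated])
      (use frame_closed[OF E T _ j] triv_points[OF E T] in \<open>auto simp: bundle_comp_def compose_def\<close>)
qed (simp add: bundle_comp_def)

lemma bundle_id_maps:
  assumes E: "hol_bundle U E"
  shows "bundle_id U E \<in> hol_bundle_maps U E E"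
proof (rule bundle_mapsI)
  fix x assume x: "x \<in> points U"
  show "linear_on (fibre E x) (fibre E x) (bundle_id U E x)"
    by (subst linear_on_cong[OF fibre_module[OF E x], of _ "\<lambda>a. a"]) (simp_all add: bundle_id_def x linear_on_id)
  show "bundle_id U E x \<in> extensional (carrier (fibre E x))"
    using x by (simp add: bundle_id_def)
next
  fix D r t D' r' t' j i
  assume T: "(D, r, t) \<in> trivs E" and T': "(D', r', t') \<in> trivs E" and j: "j < r" and i: "i < r'"
  have D: "openin (mtop U) (D \<inter> D')" by (intro openin_Int triv_open[OF E T] triv_open[OF E T'])
  show "hol_fun U (D \<inter> D') (\<lambda>x. t' x (bundle_id U E x (frame E (D, r, t) j x)) i)"
    by (rule hol_fun_cong[OF D _ triv_transition[OF E T T' j i]])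
      (use frame_closed[OF E T _ j] triv_points[OF E T] in \<open>auto simp: bundle_id_def\<close>)
qed (simp add: bundle_id_def)

lemma bundle_comp_apply: "x \<in> points U \<Longrightarrow> e \<in> carrier (fibre E x) \<Longrightarrow> bundle_comp U E g f x e = g x (f x e)"
  by (simp add: bundle_comp_def compose_def)

lemma bundle_id_apply: "x \<in> points U \<Longrightarrow> e \<in> carrier (fibre E x) \<Longrightarrow> bundle_id U E x e = e"
  by (simp add: bundle_id_def)

text \<open>With the same trivialisation on both sides, the first part of
  \<open>connection_frame\<close> collapses by the Kronecker delta. What remains is the familiar
  shape: derivative of the coordinates plus connection matrix, whose entries are the coordinates of
  the derivatives of the frame.\<close>

lemma connection_frame_coord:
  assumes E: "hol_bundle U E" and nab: "hol_connection U E nab"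
    and T: "(D, r, t) \<in> trivs E" and W: "openin (mtop U) W" and s: "s \<in> sections U E W"
    and x: "x \<in> W" "x \<in> D" and v: "v \<in> tangent U x" and k: "k < r"
  shows "t x (nab W s x v) k = v (\<lambda>y. t y (s y) k) +
     (\<Sum>i<r. t x (s x) i * t x (nab D (frame E (D, r, t) i) x v) k)"
proof -
  have "(\<Sum>i<r. v (\<lambda>y. t y (s y) i) * t x (frame E (D, r, t) i x) k) = (\<Sum>i<r. if k = i then v (\<lambda>y. t y (s y) i) else 0)"
    by (rule sum.cong[OF refl]) (simp add: triv_frame[OF E T x(2)])
  also have "\<dots> = v (\<lambda>y. t y (s y) k)" using k by simp
  finally show ?thesis
    by (simp add: connection_frame[OF E nab T T W s x x(2) v] sum.distrib)
qed

text \<open>The point is that the right-hand side contains \<open>s\<close> only through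
  \<open>s x\<close>. Derivatives of the coordinates of \<open>s\<close> arise once from the product
  rule for the coordinates of \<open>f s\<close> and once from the connection on \<open>E\<close>,
  and they cancel in the difference.\<close>

lemma hom_term_coords:
  assumes E: "hol_bundle U E" and F: "hol_bundle U F"
    and DE: "hol_connection U E DE" and DF: "hol_connection U F DF" and f: "f \<in> hol_bundle_maps U E F"
    and T: "(D, r, t) \<in> trivs E" and T': "(D', r', t') \<in> trivs F"
    and W: "openin (mtop U) W" and s: "s \<in> sections U E W"
    and x: "x \<in> W" "x \<in> D" "x \<in> D'" and v: "v \<in> tangent U x" and k: "k < r'"
  shows "t' x (DF W (\<lambda>y\<in>W. f y (s y)) x v \<ominus>\<^bsub>fibre F x\<^esub> f x (DE W s x v)) k =
    (\<Sum>j<r. t x (s x) j * v (\<lambda>y. t' y (f y (frame E (D, r, t) j y)) k))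
    + (\<Sum>i<r'. t' x (f x (s x)) i * t' x (DF D' (frame F (D', r', t') i) x v) k)
    - (\<Sum>j<r. (\<Sum>i<r. t x (s x) i * t x (DE D (frame E (D, r, t) i) x v) j) * t' x (f x (frame E (D, r, t) j x)) k)"
proof -
  let ?fs = "\<lambda>y\<in>W. f y (s y)"
  let ?m = "\<lambda>j y. t' y (f y (frame E (D, r, t) j y)) k"
  have p: "x \<in> points U" using triv_points[OF E T x(2)] .
  have fs: "?fs \<in> sections U F W" by (rule bundle_map_section[OF E F f W s])
  have DEc: "DE W s x v \<in> carrier (fibre E x)" by (rule connection_closed[OF DE W s x(1) v])
  have DFc: "DF W ?fs x v \<in> carrier (fibre F x)" by (rule connection_closed[OF DF W fs x(1) v])
  define A where "A = W \<inter> D \<inter> D'"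
  have A: "openin (mtop U) A" "x \<in> A"
    using W triv_open[OF E T] triv_open[OF F T'] x by (auto simp: A_def)
  have hs: "hol_near U x (\<lambda>y. t y (s y) j)" if "j < r" for j
    by (rule hol_nearI[OF A hol_fun_subset[OF sections_hol_fun[OF s T that]]]) (auto simp: A_def)
  have hm: "hol_near U x (?m j)" if "j < r" for j
    by (rule hol_nearI[OF A hol_fun_subset[OF bundle_maps_hol_fun[OF f T T' that k]]]) (auto simp: A_def)
  have "v (\<lambda>y. t' y (?fs y) k) = v (\<lambda>y. \<Sum>j<r. t y (s y) j * ?m j y)"
    by (rule tangent_cong[OF v A])
      (use bundle_map_coords[OF E F f T T'] sections_closed[OF s] in \<open>auto simp: A_def\<close>)
  also have "\<dots> = (\<Sum>j<r. v (\<lambda>y. t y (s y) j * ?m j y))"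
    by (rule tangent_sum[OF v]) (simp add: hol_near_mult hs hm)
  also have "\<dots> = (\<Sum>j<r. v (\<lambda>y. t y (s y) j) * ?m j x + t x (s x) j * v (?m j))"
    by (rule sum.cong[OF refl]) (rule tangent_mult[OF v], simp_all add: hs hm)
  finally have 1: "v (\<lambda>y. t' y (?fs y) k) = (\<Sum>j<r. v (\<lambda>y. t y (s y) j) * ?m j x) + (\<Sum>j<r. t x (s x) j * v (?m j))"
    by (simp add: sum.distrib)
  have "t' x (f x (DE W s x v)) k = (\<Sum>j<r. t x (DE W s x v) j * ?m j x)"
    by (rule bundle_map_coords[OF E F f T T' x(2,3) DEc])
  also have "\<dots> = (\<Sum>j<r. (v (\<lambda>y. t y (s y) j) + (\<Sum>i<r. t x (s x) i * t x (DE D (frame E (D, r, t) i) x v) j)) * ?m j x)"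
    by (rule sum.cong[OF refl]) (simp add: connection_frame_coord[OF E DE T W s x(1,2) v])
  finally have 2: "t' x (f x (DE W s x v)) k = (\<Sum>j<r. v (\<lambda>y. t y (s y) j) * ?m j x) +
      (\<Sum>j<r. (\<Sum>i<r. t x (s x) i * t x (DE D (frame E (D, r, t) i) x v) j) * ?m j x)"
    by (simp add: distrib_right sum.distrib)
  have 3: "t' x (DF W ?fs x v) k = v (\<lambda>y. t' y (?fs y) k) + (\<Sum>i<r'. t' x (f x (s x)) i * t' x (DF D' (frame F (D', r', t') i) x v) k)"
    using connection_frame_coord[OF F DF T' W fs x(1,3) v k] x(1) by simp
  have 4: "f x (DE W s x v) \<in> carrier (fibre F x)" by (rule linear_on_closed[OF bundle_maps_linear[OF f p] DEc])
  show ?thesis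
    unfolding coord_minus[OF triv_iso[OF F T' x(3)] fibre_module[OF F p] DFc 4] 1 2 3 by simp
qed

end

locale hom_conn = cmanifold U for U :: "'a cman" +
  fixes E F :: "('a, 'v) vbundle" and DE DF :: "('a, 'v) connection" and f :: "('a, 'v) bundle_map"
  assumes E: "hol_bundle U E" and F: "hol_bundle U F"
    and DE: "hol_connection U E DE" and DF: "hol_connection U F DF" and f: "f \<in> hol_bundle_maps U E F"
begin

abbreviation nabla :: "'a \<Rightarrow> 'a tvec \<Rightarrow> 'v \<Rightarrow> 'v" where
  "nabla \<equiv> hom_connection U (E, DE) (F, DF) f"

text \<open>The description in \<open>hom_connection\<close> is satisfied by exactly one element: by
  \<open>hom_term_coords\<close>, two sections with the same value at \<open>x\<close> lead to the
  same coordinates.\<close>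

lemma nabla_section:
  assumes W: "openin (mtop U) W" and s: "s \<in> sections U E W" and x: "x \<in> W" and v: "v \<in> tangent U x"
  shows "nabla x v (s x) = DF W (\<lambda>y\<in>W. f y (s y)) x v \<ominus>\<^bsub>fibre F x\<^esub> f x (DE W s x v)"
proof -
  have p: "x \<in> points U" using open_subset_points[OF W] x by blast
  obtain D r t where T: "(D, r, t) \<in> trivs E" "x \<in> D" using points_triv[OF E p] .
  obtain D' r' t' where T': "(D', r', t') \<in> trivs F" "x \<in> D'" using points_triv[OF F p] .
  have cl: "DF W (\<lambda>y\<in>W. f y (s y)) x v \<ominus>\<^bsub>fibre F x\<^esub> f x (DE W s x v) \<in> carrier (fibre F x)"
    if "openin (mtop U) W" "s \<in> sections U E W" "x \<in> W" for W s
    by (intro module_minus_closed fibre_module[OF F p] linear_on_closed[OF bundle_maps_linear[OF f p]]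
       connection_closed[OF DE that v] connection_closed[OF DF that(1) bundle_map_section[OF E F f that(1,2)] that(3) v])
  have eq: "DF W (\<lambda>y\<in>W. f y (s y)) x v \<ominus>\<^bsub>fibre F x\<^esub> f x (DE W s x v) =
      DF W' (\<lambda>y\<in>W'. f y (s' y)) x v \<ominus>\<^bsub>fibre F x\<^esub> f x (DE W' s' x v)"
    if "openin (mtop U) W'" "s' \<in> sections U E W'" "x \<in> W'" "s' x = s x" for W' s'
    by (rule coord_eqI[OF triv_iso[OF F T'] cl[OF W s x] cl[OF that(1-3)]])
      (simp only: hom_term_coords[OF E F DE DF f T(1) T'(1) W s x T(2) T'(2) v]
        hom_term_coords[OF E F DE DF f T(1) T'(1) that(1,2,3) T(2) T'(2) v] that(4))
  show ?thesis
    unfolding hom_connection_def case_prod_conv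
  proof (rule the_equality)
    show "\<forall>W' s'. openin (mtop U) W' \<and> x \<in> W' \<and> s' \<in> sections U E W' \<and> s' x = s x \<longrightarrow>
      DF W (\<lambda>y\<in>W. f y (s y)) x v \<ominus>\<^bsub>fibre F x\<^esub> f x (DE W s x v) =
      DF W' (\<lambda>y\<in>W'. f y (s' y)) x v \<ominus>\<^bsub>fibre F x\<^esub> f x (DE W' s' x v)"
      using eq by blast
  qed (use W s x in blast)
qed

lemma nabla_closed:
  assumes p: "x \<in> points U" and v: "v \<in> tangent U x" and e: "e \<in> carrier (fibre E x)"
  shows "nabla x v e \<in> carrier (fibre F x)"
proof -
  obtain D r t where T: "(D, r, t) \<in> trivs E" "x \<in> D" using points_triv[OF E p] .
  obtain s where s: "s \<in> sections U E D" "s x = e" using section_through[OF E T e] .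
  have D: "openin (mtop U) D" by (rule triv_open[OF E T(1)])
  have "nabla x v (s x) \<in> carrier (fibre F x)"
    unfolding nabla_section[OF D s(1) T(2) v]
    by (intro module_minus_closed fibre_module[OF F p] linear_on_closed[OF bundle_maps_linear[OF f p]]
       connection_closed[OF DE D s(1) T(2) v] connection_closed[OF DF D bundle_map_section[OF E F f D s(1)] T(2) v])
  then show ?thesis using s(2) by simp
qed

lemma nabla_coords:
  assumes T: "(D, r, t) \<in> trivs E" and T': "(D', r', t') \<in> trivs F"
    and x: "x \<in> D" "x \<in> D'" and v: "v \<in> tangent U x" and e: "e \<in> carrier (fibre E x)" and k: "k < r'"
  shows "t' x (nabla x v e) k =
    (\<Sum>j<r. t x e j * v (\<lambda>y. t' y (f y (frame E (D, r, t) j y)) k))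
    + (\<Sum>i<r'. t' x (f x e) i * t' x (DF D' (frame F (D', r', t') i) x v) k)
    - (\<Sum>j<r. (\<Sum>i<r. t x e i * t x (DE D (frame E (D, r, t) i) x v) j) * t' x (f x (frame E (D, r, t) j x)) k)"
proof -
  obtain s where s: "s \<in> sections U E D" "s x = e" using section_through[OF E T x(1) e] .
  have D: "openin (mtop U) D" by (rule triv_open[OF E T])
  show ?thesis
    using hom_term_coords[OF E F DE DF f T T' D s(1) x(1,1,2) v k]
    by (simp add: nabla_section[OF D s(1) x(1) v, unfolded s(2)] s(2))
qed

text \<open>In \<open>nabla_coords\<close> the argument enters only through its own coordinates and
  those of its image under \<open>f\<close>, each time linearly.\<close>

lemma nabla_linear:
  assumes p: "x \<in> points U" and v: "v \<in> tangent U x"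
  shows "linear_on (fibre E x) (fibre F x) (nabla x v)"
proof -
  obtain D r t where T: "(D, r, t) \<in> trivs E" "x \<in> D" using points_triv[OF E p] .
  obtain D' r' t' where T': "(D', r', t') \<in> trivs F" "x \<in> D'" using points_triv[OF F p] .
  note iso = triv_iso[OF E T] and iso' = triv_iso[OF F T']
  note M = fibre_module[OF E p] and N = fibre_module[OF F p]
  note fl = bundle_maps_linear[OF f p]
  note nc = nabla_closed[OF p v]
  note co = nabla_coords[OF T(1) T'(1) T(2) T'(2) v]
  show ?thesis
    unfolding linear_on_def
  proof (intro conjI ballI allI funcsetI nc)
    fix a b assume a: "a \<in> carrier (fibre E x)" and b: "b \<in> carrier (fibre E x)"
    show "nabla x v (a \<oplus>\<^bsub>fibre E x\<^esub> b) = nabla x v a \<oplus>\<^bsub>fibre F x\<^esub> nabla x v b"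
      by (rule coord_eqI[OF iso' nc[OF module_add_closed[OF M a b]] module_add_closed[OF N nc[OF a] nc[OF b]]])
        (simp add: co a b module_add_closed[OF M] coord_add[OF iso] coord_add[OF iso'] nc
           linear_on_add[OF fl] linear_on_closed[OF fl] distrib_right sum.distrib)
  next
    fix c a assume a: "a \<in> carrier (fibre E x)"
    show "nabla x v (c \<odot>\<^bsub>fibre E x\<^esub> a) = c \<odot>\<^bsub>fibre F x\<^esub> nabla x v a"
      by (rule coord_eqI[OF iso' nc[OF module_smult_closed[OF M a]] module_smult_closed[OF N nc[OF a]]])
        (simp add: co a module_smult_closed[OF M] coord_smult[OF iso] coord_smult[OF iso'] nc
           linear_on_smult[OF fl] linear_on_closed[OF fl] distrib_left right_diff_distrib mult.assoc flip: sum_distrib_left)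
  qed
qed

text \<open>With one fixed section through \<open>e\<close>, linearity in the tangent vector is that
  of the two connections.\<close>

lemma nabla_tlin:
  assumes p: "x \<in> points U" and v: "v \<in> tangent U x" and w: "w \<in> tangent U x" and e: "e \<in> carrier (fibre E x)"
  shows "nabla x (tlin a v b w) e = a \<odot>\<^bsub>fibre F x\<^esub> nabla x v e \<oplus>\<^bsub>fibre F x\<^esub> b \<odot>\<^bsub>fibre F x\<^esub> nabla x w e"
proof -
  obtain D r t where T: "(D, r, t) \<in> trivs E" "x \<in> D" using points_triv[OF E p] .
  obtain D' r' t' where T': "(D', r', t') \<in> trivs F" "x \<in> D'" using points_triv[OF F p] .
  obtain s where s: "s \<in> sections U E D" "s x = e" using section_through[OF E T e] .
  have D: "openin (mtop U) D" by (rule triv_open[OF E T(1)])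
  note fs = bundle_map_section[OF E F f D s(1)]
  note vw = tangent_tlin[OF v w]
  note iso' = triv_iso[OF F T']
  note M = fibre_module[OF E p] and N = fibre_module[OF F p]
  note fl = bundle_maps_linear[OF f p]
  note nE = connection_closed[OF DE D s(1) T(2)] and nF = connection_closed[OF DF D fs T(2)]
  note sec = nabla_section[OF D s(1) T(2), unfolded s(2)]
  note smN = module_smult_closed[OF N] and smM = module_smult_closed[OF M]
  note tF = connection_tlin[OF DF D fs T(2) v w] and tE = connection_tlin[OF DE D s(1) T(2) v w]
  have clF: "f x y \<in> carrier (fibre F x)" if "y \<in> carrier (fibre E x)" for y by (rule linear_on_closed[OF fl that])
  show ?thesis
    by (rule coord_eqI[OF iso' nabla_closed[OF p vw e] module_add_closed[OF N smN[OF nabla_closed[OF p v e]] smN[OF nabla_closed[OF p w e]]]])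
      (simp add: sec[OF vw] sec[OF v] sec[OF w] tF tE nE nF v w linear_on_add[OF fl] linear_on_smult[OF fl]
        coord_minus[OF iso' N] coord_add[OF iso'] coord_smult[OF iso'] clF smN smM
        module_add_closed[OF N] module_minus_closed[OF N] algebra_simps)
qed

text \<open>The frame is inserted as the section. The derivative of its image is holomorphic because
  it comes from the connection on \<open>F\<close>; the other term is \<open>f\<close> applied to a
  vector valued form and is expanded as a product of the matrix of \<open>f\<close> with the
  connection matrix of \<open>E\<close>.\<close>

lemma nabla_holo:
  assumes c: "(n, C, \<phi>) \<in> atlas U" and T: "(D, r, t) \<in> trivs E" and T': "(D', r', t') \<in> trivs F"
    and i: "i < n" and j: "j < r" and k: "k < r'"
  shows "holo_on n (\<phi> ` (C \<inter> (D \<inter> D')))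
    (\<lambda>z. t' (inv_into C \<phi> z) (nabla (inv_into C \<phi> z) (coord_vec U (n, C, \<phi>) (inv_into C \<phi> z) i)
       (frame E (D, r, t) j (inv_into C \<phi> z))) k)"
proof -
  let ?x = "inv_into C \<phi>"
  let ?v = "\<lambda>x. coord_vec U (n, C, \<phi>) x i"
  let ?s = "frame E (D, r, t) j"
  have D: "openin (mtop U) D" "openin (mtop U) (D \<inter> D')"
    using triv_open[OF E T] triv_open[OF F T'] by auto
  have op: "open_Cn n (\<phi> ` (C \<inter> (D \<inter> D')))" by (rule chart_open_image[OF c D(2)])
  have s: "?s \<in> sections U E D" by (rule frame_section[OF E T j])
  note fs = bundle_map_section[OF E F f D(1) s]
  have "holo_on n (\<phi> ` (C \<inter> (D \<inter> D')))
     (\<lambda>z. t' (?x z) (DF D (\<lambda>y\<in>D. f y (?s y)) (?x z) (?v (?x z))) k -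
       (\<Sum>l<r. t (?x z) (DE D ?s (?x z) (?v (?x z))) l * t' (?x z) (f (?x z) (frame E (D, r, t) l (?x z))) k))"
  proof (intro holo_on_diff holo_on_sum holo_on_mult)
    show "holo_on n (\<phi> ` (C \<inter> (D \<inter> D'))) (\<lambda>z. t' (?x z) (DF D (\<lambda>y\<in>D. f y (?s y)) (?x z) (?v (?x z))) k)"
      by (rule holo_on_subset[OF connection_holo[OF DF D(1) fs c T' i k]]) auto
    fix l assume "l \<in> {..<r}"
    then have l: "l < r" by simp
    show "holo_on n (\<phi> ` (C \<inter> (D \<inter> D'))) (\<lambda>z. t (?x z) (DE D ?s (?x z) (?v (?x z))) l)"
      by (rule holo_on_subset[OF connection_holo[OF DE D(1) s c T i l]]) auto
    show "holo_on n (\<phi> ` (C \<inter> (D \<inter> D'))) (\<lambda>z. t' (?x z) (f (?x z) (frame E (D, r, t) l (?x z))) k)"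
      by (rule hol_fun_chart[OF bundle_maps_hol_fun[OF f T T' l k] c])
  qed
  moreover have "t' x (DF D (\<lambda>y\<in>D. f y (?s y)) x (?v x)) k -
       (\<Sum>l<r. t x (DE D ?s x (?v x)) l * t' x (f x (frame E (D, r, t) l x)) k) = t' x (nabla x (?v x) (?s x)) k"
    if x: "x \<in> C" "x \<in> D" "x \<in> D'" for x
  proof -
    have p: "x \<in> points U" by (rule triv_points[OF E T x(2)])
    have v: "?v x \<in> tangent U x" by (rule coord_vec_tangent[OF c x(1) i])
    note nE = connection_closed[OF DE D(1) s x(2) v]
    show ?thesis
      unfolding nabla_section[OF D(1) s x(2) v] bundle_map_coords[OF E F f T T' x(2,3) nE, symmetric]
      by (rule coord_minus[OF triv_iso[OF F T' x(3)] fibre_module[OF F p] connection_closed[OF DF D(1) fs x(2) v]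
            linear_on_closed[OF bundle_maps_linear[OF f p] nE], symmetric])
  qed
  ultimately show ?thesis
    using c by (subst (asm) holo_on_cong[OF op, where g = "\<lambda>z. t' (?x z) (nabla (?x z) (?v (?x z)) (?s (?x z))) k"]) auto
qed

end

context cmanifold
begin

lemma hom_connection_id:
  assumes E: "hol_bundle U E" and DE: "hol_connection U E DE"
    and p: "x \<in> points U" and v: "v \<in> tangent U x" and e: "e \<in> carrier (fibre E x)"
  shows "hom_connection U (E, DE) (E, DE) (bundle_id U E) x v e = \<zero>\<^bsub>fibre E x\<^esub>"
proof -
  interpret hom_conn U E E DE DE "bundle_id U E"
    by unfold_locales (rule E DE bundle_id_maps[OF E])+
  obtain D r t where T: "(D, r, t) \<in> trivs E" "x \<in> D" using points_triv[OF E p] .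
  obtain s where s: "s \<in> sections U E D" "s x = e" using section_through[OF E T e] .
  have D: "openin (mtop U) D" by (rule triv_open[OF E T(1)])
  have "(\<lambda>y\<in>D. bundle_id U E y (s y)) = s"
    by (rule extensionalityI[OF _ sections_extensional[OF s(1)]])
      (use triv_points[OF E T(1)] sections_closed[OF s(1)] in \<open>auto simp: bundle_id_apply\<close>)
  moreover have nc: "DE D s x v \<in> carrier (fibre E x)" by (rule connection_closed[OF DE D s(1) T(2) v])
  moreover have "DE D s x v \<ominus>\<^bsub>fibre E x\<^esub> DE D s x v = \<zero>\<^bsub>fibre E x\<^esub>"
    by (rule coord_eqI[OF triv_iso[OF E T] module_minus_closed[OF fibre_module[OF E p] nc nc] module_zero_closed[OF fibre_module[OF E p]]])
      (simp add: coord_minus[OF triv_iso[OF E T] fibre_module[OF E p] nc nc] coord_zero[OF triv_iso[OF E T] fibre_module[OF E p]])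
  ultimately show ?thesis
    using nabla_section[OF D s(1) T(2) v] s(2) by (simp add: bundle_id_apply[OF p nc])
qed

text \<open>The term \<open>g\<close> applied to the derivative of \<open>f s\<close> is subtracted
  and added. The connection on the middle bundle thus enters both summands on the right, but not the
  left-hand side.\<close>

lemma hom_connection_comp:
  assumes E: "hol_bundle U E" and F: "hol_bundle U F" and G: "hol_bundle U G"
    and DE: "hol_connection U E DE" and DF: "hol_connection U F DF" and DG: "hol_connection U G DG"
    and f: "f \<in> hol_bundle_maps U E F" and g: "g \<in> hol_bundle_maps U F G"
    and p: "x \<in> points U" and v: "v \<in> tangent U x" and e: "e \<in> carrier (fibre E x)"
  shows "hom_connection U (E, DE) (G, DG) (bundle_comp U E g f) x v e =
    hom_connection U (F, DF) (G, DG) g x v (f x e) \<oplus>\<^bsub>fibre G x\<^esub> g x (hom_connection U (E, DE) (F, DF) f x v e)"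
proof -
  interpret f: hom_conn U E F DE DF f
    by unfold_locales (rule E F DE DF f)+
  interpret g: hom_conn U F G DF DG g
    by unfold_locales (rule G F DG DF g)+
  interpret gf: hom_conn U E G DE DG "bundle_comp U E g f"
    by unfold_locales (rule G E DG DE bundle_comp_maps[OF E F G f g])+
  obtain D r t where T: "(D, r, t) \<in> trivs E" "x \<in> D" using points_triv[OF E p] .
  obtain D' r' t' where T': "(D', r', t') \<in> trivs G" "x \<in> D'" using points_triv[OF G p] .
  obtain s where s: "s \<in> sections U E D" "s x = e" using section_through[OF E T e] .
  have D: "openin (mtop U) D" by (rule triv_open[OF E T(1)])
  let ?fs = "\<lambda>y\<in>D. f y (s y)"
  have fs: "?fs \<in> sections U F D" by (rule bundle_map_section[OF E F f D s(1)])
  have fsx: "?fs x = f x e" using T(2) s(2) by simp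
  have gfs: "(\<lambda>y\<in>D. g y (?fs y)) \<in> sections U G D" by (rule bundle_map_section[OF F G g D fs])
  have eq: "(\<lambda>y\<in>D. bundle_comp U E g f y (s y)) = (\<lambda>y\<in>D. g y (?fs y))"
    by (rule restrict_ext) (use triv_points[OF E T(1)] sections_closed[OF s(1)] in \<open>auto simp: bundle_comp_apply\<close>)
  have nE: "DE D s x v \<in> carrier (fibre E x)" by (rule connection_closed[OF DE D s(1) T(2) v])
  have nF: "DF D ?fs x v \<in> carrier (fibre F x)" by (rule connection_closed[OF DF D fs T(2) v])
  have nG: "DG D (\<lambda>y\<in>D. g y (?fs y)) x v \<in> carrier (fibre G x)" by (rule connection_closed[OF DG D gfs T(2) v])
  note fl = bundle_maps_linear[OF f p] and gl = bundle_maps_linear[OF g p]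
  note M = fibre_module[OF F p] and N = fibre_module[OF G p]
  note iso = triv_iso[OF G T']
  obtain D'' r'' t'' where T'': "(D'', r'', t'') \<in> trivs F" "x \<in> D''" using points_triv[OF F p] .
  have fE: "f x (DE D s x v) \<in> carrier (fibre F x)" by (rule linear_on_closed[OF fl nE])
  have d: "DF D ?fs x v \<ominus>\<^bsub>fibre F x\<^esub> f x (DE D s x v) \<in> carrier (fibre F x)" by (rule module_minus_closed[OF M nF fE])
  \<comment> \<open>The derivative of \<open>f s\<close> is split before \<open>g\<close> is
    applied, so that additivity of \<open>g\<close> is enough.\<close>
  have "DF D ?fs x v = (DF D ?fs x v \<ominus>\<^bsub>fibre F x\<^esub> f x (DE D s x v)) \<oplus>\<^bsub>fibre F x\<^esub> f x (DE D s x v)"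
    by (rule coord_eqI[OF triv_iso[OF F T''] nF module_add_closed[OF M d fE]])
      (simp add: coord_add[OF triv_iso[OF F T''] d fE] coord_minus[OF triv_iso[OF F T''] M nF fE])
  then have gF: "g x (DF D ?fs x v) = g x (DF D ?fs x v \<ominus>\<^bsub>fibre F x\<^esub> f x (DE D s x v)) \<oplus>\<^bsub>fibre G x\<^esub> g x (f x (DE D s x v))"
    using linear_on_add[OF gl d fE] by simp
  note gc = linear_on_closed[OF gl]
  have "DG D (\<lambda>y\<in>D. g y (?fs y)) x v \<ominus>\<^bsub>fibre G x\<^esub> g x (f x (DE D s x v)) =
     (DG D (\<lambda>y\<in>D. g y (?fs y)) x v \<ominus>\<^bsub>fibre G x\<^esub> g x (DF D ?fs x v)) \<oplus>\<^bsub>fibre G x\<^esub>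
     g x (DF D ?fs x v \<ominus>\<^bsub>fibre F x\<^esub> f x (DE D s x v))"
    by (rule minus_telescope[OF N iso nG gc[OF nF] gc[OF fE] gc[OF d] gF])
  then show ?thesis
    using gf.nabla_section[OF D s(1) T(2) v] f.nabla_section[OF D s(1) T(2) v] g.nabla_section[OF D fs T(2) v]
    unfolding eq fsx s(2) bundle_comp_apply[OF p nE] by metis
qed

end

section \<open>Pullback of bundles and connections\<close>

lemma (in cmanifold) connection_lincomb:
  fixes m :: nat
  assumes E: "hol_bundle U E" and nab: "hol_connection U E nab" "openin (mtop U) W" "s \<in> sections U E W"
    and T: "(D, r, t) \<in> trivs E" "x \<in> D" and x: "x \<in> W" and w: "\<And>j. j < m \<Longrightarrow> w j \<in> tangent U x"
  shows "t x (nab W s x (\<lambda>h. \<Sum>j<m. c j * w j h)) k = (\<Sum>j<m. c j * t x (nab W s x (w j)) k)"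
proof -
  have p: "x \<in> points U" by (rule triv_points[OF E T])
  note iso = triv_iso[OF E T]
  note nc = connection_closed[OF nab x]
  have tl: "t x (nab W s x (tlin a v b u)) k = a * t x (nab W s x v) k + b * t x (nab W s x u) k"
    if "v \<in> tangent U x" "u \<in> tangent U x" for a v b u
    by (simp add: connection_tlin[OF nab x that] coord_add[OF iso] coord_smult[OF iso] nc that
        module_smult_closed[OF fibre_module[OF E p]])
  show ?thesis
    using w
  proof (induction m)
    case 0
    have "t x (nab W s x (\<lambda>h. 0)) k = 0"
      using tl[OF tangent_zero[OF p] tangent_zero[OF p], of 0 0] by (simp add: tlin_def)
    then show ?case by simp
  next
    case (Suc m)
    have "(\<lambda>h. \<Sum>j<Suc m. c j * w j h) = tlin 1 (\<lambda>h. \<Sum>j<m. c j * w j h) (c m) (w m)"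
      by (simp add: tlin_def)
    then show ?case
      using tl[OF tangent_lincomb[OF p], of m w "w m" 1 c "c m"] Suc by simp
  qed
qed

section \<open>Pullback of bundles, sections and bundle maps\<close>

context cman_map
begin

abbreviation pre :: "'b set \<Rightarrow> 'a set" where
  "pre D \<equiv> {x \<in> points U. g x \<in> D}"

abbreviation pb :: "('b, 'v) vbundle \<Rightarrow> ('a, 'v) vbundle" where
  "pb E \<equiv> pull_bundle U V g E"

abbreviation pt :: "'b set \<Rightarrow> ('b \<Rightarrow> 'c) \<Rightarrow> 'a \<Rightarrow> 'c" where
  "pt D t \<equiv> \<lambda>x\<in>pre D. t (g x)"

lemma pull_fibre: "x \<in> points U \<Longrightarrow> fibre (pb E) x = fibre E (g x)"
  by (simp add: pull_bundle_def)

lemma pull_trivs: "trivs (pb E) = (\<lambda>(D, r, t). (pre D, r, pt D t)) ` trivs E"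
  by (simp add: pull_bundle_def)

lemma pull_trivI: "(D, r, t) \<in> trivs E \<Longrightarrow> (pre D, r, pt D t) \<in> trivs (pb E)"
  unfolding pull_trivs by (rule image_eqI[of _ _ "(D, r, t)"]) simp_all

lemma pull_trivE:
  assumes "(D', r, t') \<in> trivs (pb E)"
  obtains D t where "(D, r, t) \<in> trivs E" "D' = pre D" "t' = pt D t"
  using assms unfolding pull_trivs by auto

lemma pull_frame: "x \<in> pre D \<Longrightarrow> frame (pb E) (pre D, r, pt D t) j x = frame E (D, r, t) j (g x)"
  by (simp add: frame.simps pull_fibre)

lemma pull_hol_bundle:
  assumes E: "hol_bundle V E"
  shows "hol_bundle U (pb E)"
  unfolding hol_bundle_def
proof (intro conjI ballI)
  show "fibre (pb E) \<in> extensional (points U)" by (simp add: pull_bundle_def)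
  show "module complex_ring (fibre (pb E) x)" if "x \<in> points U" for x
    using V.fibre_module[OF E g_points[OF that]] by (simp add: pull_fibre that)
  show "(\<Union>(D, r, t) \<in> trivs (pb E). D) = points U"
  proof (intro equalityI subsetI)
    fix x assume x: "x \<in> points U"
    obtain D r t where "(D, r, t) \<in> trivs E" "g x \<in> D" using V.points_triv[OF E g_points[OF x]] .
    then show "x \<in> (\<Union>(D, r, t) \<in> trivs (pb E). D)" using pull_trivI[of D r t E] x by blast
  qed (auto elim: pull_trivE)
next
  fix T assume "T \<in> trivs (pb E)"
  then obtain D r t where T: "(D, r, t) \<in> trivs E" "T = (pre D, r, pt D t)" unfolding pull_trivs by auto
  show "case T of (D, r, t) \<Rightarrow> openin (mtop U) D \<and> t \<in> extensional D \<and> (\<forall>x\<in>D. coord_iso (fibre (pb E) x) r (t x))"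
    unfolding T(2) case_prod_conv
    using preimage_open[OF V.triv_open[OF E T(1)]] V.triv_iso[OF E T(1)] by (auto simp: pull_fibre)
next
  fix T assume "T \<in> trivs (pb E)"
  then obtain D r t where T: "(D, r, t) \<in> trivs E" "T = (pre D, r, pt D t)"
    unfolding pull_trivs by auto
  show "case T of (D, r, t) \<Rightarrow> \<forall>(D', r', t') \<in> trivs (pb E). \<forall>j<r. \<forall>i<r'.
        hol_fun U (D \<inter> D') (\<lambda>x. t' x (frame (pb E) (D, r, t) j x) i)"
    unfolding T(2) case_prod_conv
  proof
    fix T' assume "T' \<in> trivs (pb E)"
    then obtain D' r' t' where
      T': "(D', r', t') \<in> trivs E" "T' = (pre D', r', pt D' t')" unfolding pull_trivs by auto
    have op: "openin (mtop V) (D \<inter> D')" by (intro openin_Int V.triv_open[OF E T(1)] V.triv_open[OF E T'(1)])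
    have eq: "pre D \<inter> pre D' = pre (D \<inter> D')" by auto
    have "hol_fun U (pre D \<inter> pre D') (\<lambda>x. pt D' t' x (frame (pb E) (pre D, r, pt D t) j x) i)"
      if "j < r" "i < r'" for j i
      unfolding eq
      by (rule U.hol_fun_cong[OF preimage_open[OF op] _ hol_fun_pull[OF op V.triv_transition[OF E T(1) T'(1) that]]])
        (simp add: pull_frame)
    then show "case T' of (D', r', t') \<Rightarrow> \<forall>j<r. \<forall>i<r'.
          hol_fun U (pre D \<inter> D') (\<lambda>x. t' x (frame (pb E) (pre D, r, pt D t) j x) i)"
      unfolding T'(2) case_prod_conv by blast
  qed
qed

lemma pull_section:
  assumes E: "hol_bundle V E" and W: "openin (mtop V) W" and s: "s \<in> sections V E W"
  shows "pt W s \<in> sections U (pb E) (pre W)"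
proof (rule sectionsI)
  fix D' r t' i assume T': "(D', r, t') \<in> trivs (pb E)" and i: "i < r"
  from T' obtain D t where T: "(D, r, t) \<in> trivs E" "D' = pre D" "t' = pt D t" by (rule pull_trivE)
  have op: "openin (mtop V) (D \<inter> W)" by (intro openin_Int V.triv_open[OF E T(1)] W)
  have eq: "pre D \<inter> pre W = pre (D \<inter> W)" by auto
  show "hol_fun U (D' \<inter> pre W) (\<lambda>x. t' x (pt W s x) i)"
    unfolding T(2,3) eq
    by (rule U.hol_fun_cong[OF preimage_open[OF op] _ hol_fun_pull[OF op sections_hol_fun[OF s T(1) i]]]) simp
qed (use sections_closed[OF s] in \<open>simp_all add: pull_fibre\<close>)

lemma pull_bundle_map:
  assumes E: "hol_bundle V E" and F: "hol_bundle V F" and f: "f \<in> hol_bundle_maps V E F"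
  shows "(\<lambda>x\<in>points U. f (g x)) \<in> hol_bundle_maps U (pb E) (pb F)"
proof (rule bundle_mapsI)
  fix D1 r t1 D1' r' t1' j i
  assume "(D1, r, t1) \<in> trivs (pb E)" "(D1', r', t1') \<in> trivs (pb F)" and ji: "j < r" "i < r'"
  then obtain D t D' t' where T: "(D, r, t) \<in> trivs E" "D1 = pre D" "t1 = pt D t"
    and T': "(D', r', t') \<in> trivs F" "D1' = pre D'" "t1' = pt D' t'" by (elim pull_trivE) blast
  have op: "openin (mtop V) (D \<inter> D')" by (intro openin_Int V.triv_open[OF E T(1)] V.triv_open[OF F T'(1)])
  have eq: "pre D \<inter> pre D' = pre (D \<inter> D')" by auto
  show "hol_fun U (D1 \<inter> D1') (\<lambda>x. t1' x ((\<lambda>x\<in>points U. f (g x)) x (frame (pb E) (D1, r, t1) j x)) i)"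
    unfolding T(2,3) T'(2,3) eq
    by (rule U.hol_fun_cong[OF preimage_open[OF op] _ hol_fun_pull[OF op bundle_maps_hol_fun[OF f T(1) T'(1) ji]]])
      (simp add: pull_frame)
qed (use bundle_maps_linear[OF f g_points] bundle_maps_fibre_extensional[OF f g_points] in \<open>simp_all add: pull_fibre\<close>)

lemma pull_bundle_comp:
  "(\<lambda>x\<in>points U. bundle_comp V E h f (g x)) =
    bundle_comp U (pb E) (\<lambda>x\<in>points U. h (g x)) (\<lambda>x\<in>points U. f (g x))"
  by (rule ext) (simp add: bundle_comp_def pull_fibre g_points)

lemma pull_bundle_id: "(\<lambda>x\<in>points U. bundle_id V E (g x)) = bundle_id U (pb E)"
  by (rule ext) (simp add: bundle_id_def pull_fibre g_points)

text \<open>The candidate for the derivative in one trivialisation, literally as in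
  \<open>pull_connection\<close>, so that different trivialisations can be compared before the
  description there is resolved.\<close>

definition pull_term where
  "pull_term E nab D r t s x v = (\<Oplus>\<^bsub>fibre E (g x)\<^esub>i\<in>{..<r}.
      v (\<lambda>y. t (g y) (s y) i) \<odot>\<^bsub>fibre E (g x)\<^esub> frame E (D, r, t) i (g x)
      \<oplus>\<^bsub>fibre E (g x)\<^esub>
      t (g x) (s x) i \<odot>\<^bsub>fibre E (g x)\<^esub> nab D (frame E (D, r, t) i) (g x) (push V g x v))"

section \<open>Independence of the pulled back connection from the frame\<close>

context
  fixes E :: "('b, 'v) vbundle" and nab :: "('b, 'v) connection"
  assumes E: "hol_bundle V E" and nab: "hol_connection V E nab"
begin

lemma pull_section_hol_fun:
  assumes "s \<in> sections U (pb E) W" "(D, r, t) \<in> trivs E" "i < r" "openin (mtop U) W"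
  shows "hol_fun U (pre D \<inter> W) (\<lambda>y. t (g y) (s y) i)"
  by (rule U.hol_fun_cong[OF _ _ sections_hol_fun[OF assms(1) pull_trivI[OF assms(2)] assms(3)]])
    (use preimage_open[OF V.triv_open[OF E assms(2)]] assms(4) in auto)

lemma pull_section_closed:
  assumes "s \<in> sections U (pb E) W" "x \<in> W" "openin (mtop U) W"
  shows "s x \<in> carrier (fibre E (g x))"
  using sections_closed[OF assms(1,2)] pull_fibre[of x E] U.open_subset_points[OF assms(3)] assms(2) by auto

text \<open>The second formula mentions only the trivialisation in which coordinates are taken;
  hence the term is the same for every \<open>T\<close>. Behind this lies the usual compensation:
  the derivative of the transition matrix along the pushed vector, produced by the product rule for
  the coordinates of \<open>s\<close>, is exactly the inhomogeneous part in the change of the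
  connection matrix.\<close>

lemma pull_term_coords:
  assumes T: "(D, r, t) \<in> trivs E" and T': "(D', r', t') \<in> trivs E"
    and W: "openin (mtop U) W" and s: "s \<in> sections U (pb E) W"
    and x: "x \<in> W" "g x \<in> D" "g x \<in> D'" and v: "v \<in> tangent U x"
  shows "pull_term E nab D r t s x v \<in> carrier (fibre E (g x))"
    and "k < r' \<Longrightarrow> t' (g x) (pull_term E nab D r t s x v) k = v (\<lambda>y. t' (g y) (s y) k) +
      (\<Sum>i<r'. t' (g x) (s x) i * t' (g x) (nab D' (frame E (D', r', t') i) (g x) (push V g x v)) k)"
proof -
  let ?e = "frame E (D, r, t)" and ?e' = "frame E (D', r', t')"
  let ?w = "push V g x v"
  let ?M = "fibre E (g x)"
  have xU: "x \<in> points U" by (rule U.tangent_point[OF v])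
  have w: "?w \<in> tangent V (g x)" by (rule push_tangent[OF v])
  note M = V.fibre_module[OF E g_points[OF xU]]
  note iso' = V.triv_iso[OF E T' x(3)]
  have D: "openin (mtop V) D" by (rule V.triv_open[OF E T])
  have ec: "?e i (g x) \<in> carrier ?M" if "i < r" for i by (rule V.frame_closed[OF E T x(2) that])
  have es: "?e i \<in> sections V E D" if "i < r" for i by (rule V.frame_section[OF E T that])
  have nc: "nab D (?e i) (g x) ?w \<in> carrier ?M" if "i < r" for i
    by (rule V.connection_closed[OF nab D es[OF that] x(2) w])
  have sc: "s x \<in> carrier ?M" by (rule pull_section_closed[OF s x(1) W])
  have tc: "v (\<lambda>y. t (g y) (s y) i) \<odot>\<^bsub>?M\<^esub> ?e i (g x) \<oplus>\<^bsub>?M\<^esub> t (g x) (s x) i \<odot>\<^bsub>?M\<^esub> nab D (?e i) (g x) ?w \<in> carrier ?M"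
    if "i < r" for i
    by (intro module_add_closed[OF M] module_smult_closed[OF M] ec nc that)
  show "pull_term E nab D r t s x v \<in> carrier ?M"
    unfolding pull_term_def
    by (rule abelian_monoid.finsum_closed[OF abelian_group.axioms(1)[OF module_abelian_group[OF M]]]) (use tc in auto)
  assume k: "k < r'"
  define A where "A = pre (D \<inter> D') \<inter> W"
  have "openin (mtop U) A" unfolding A_def
    by (rule openin_Int[OF preimage_open[OF openin_Int[OF V.triv_open[OF E T] V.triv_open[OF E T']]] W])
  then have A: "openin (mtop U) A" "x \<in> A"
    using x xU by (auto simp: A_def)
  have hc: "hol_near U x (\<lambda>y. t (g y) (s y) i)" if "i < r" for i
    by (rule U.hol_nearI[OF A hol_fun_subset[OF pull_section_hol_fun[OF s T that W]]]) (auto simp: A_def)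
  let ?m = "\<lambda>i y. t' y (?e i y) k"
  have DD': "openin (mtop V) (D \<inter> D')" using D V.triv_open[OF E T'] by auto
  have hm: "hol_near V (g x) (?m i)" if "i < r" for i
    by (rule V.hol_nearI[OF DD' _ V.triv_transition[OF E T T' that k]]) (use x in auto)
  have "v (\<lambda>y. t' (g y) (s y) k) = v (\<lambda>y. \<Sum>i<r. t (g y) (s y) i * ?m i (g y))"
  proof (rule U.tangent_cong[OF v A])
    fix y assume "y \<in> A"
    then show "t' (g y) (s y) k = (\<Sum>i<r. t (g y) (s y) i * ?m i (g y))"
      by (intro V.triv_change[OF E T T'] pull_section_closed[OF s _ W]) (auto simp: A_def)
  qed
  also have "\<dots> = (\<Sum>i<r. v (\<lambda>y. t (g y) (s y) i * ?m i (g y)))"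
    by (rule U.tangent_sum[OF v]) (simp add: U.hol_near_mult hc hol_near_pull[OF xU hm])
  also have "\<dots> = (\<Sum>i<r. v (\<lambda>y. t (g y) (s y) i) * ?m i (g x) + t (g x) (s x) i * ?w (?m i))"
  proof (rule sum.cong[OF refl])
    fix i assume "i \<in> {..<r}"
    then have i: "i < r" by simp
    show "v (\<lambda>y. t (g y) (s y) i * ?m i (g y)) = v (\<lambda>y. t (g y) (s y) i) * ?m i (g x) + t (g x) (s x) i * ?w (?m i)"
      unfolding push_eval[OF hm[OF i]] by (rule U.tangent_mult[OF v hc[OF i] hol_near_pull[OF xU hm[OF i]]])
  qed
  finally have 1: "v (\<lambda>y. t' (g y) (s y) k) =
      (\<Sum>i<r. v (\<lambda>y. t (g y) (s y) i) * ?m i (g x) + t (g x) (s x) i * ?w (?m i))" .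
  have 2: "t' (g x) (nab D (?e i) (g x) ?w) k = ?w (?m i) + (\<Sum>l<r'. t' (g x) (?e i (g x)) l * t' (g x) (nab D' (?e' l) (g x) ?w) k)"
    if "i < r" for i
    by (rule V.connection_frame_coord[OF E nab T' D es[OF that] x(2,3) w k])
  have "(\<Sum>l<r'. t' (g x) (s x) l * t' (g x) (nab D' (?e' l) (g x) ?w) k) =
     (\<Sum>l<r'. (\<Sum>i<r. t (g x) (s x) i * t' (g x) (?e i (g x)) l) * t' (g x) (nab D' (?e' l) (g x) ?w) k)"
    by (simp only: V.triv_change[OF E T T' x(2,3) sc])
  also have "\<dots> = (\<Sum>l<r'. \<Sum>i<r. t (g x) (s x) i * (t' (g x) (?e i (g x)) l * t' (g x) (nab D' (?e' l) (g x) ?w) k))"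
    by (simp only: sum_distrib_right mult.assoc)
  also have "\<dots> = (\<Sum>i<r. \<Sum>l<r'. t (g x) (s x) i * (t' (g x) (?e i (g x)) l * t' (g x) (nab D' (?e' l) (g x) ?w) k))"
    by (rule sum.swap)
  finally have 3: "(\<Sum>l<r'. t' (g x) (s x) l * t' (g x) (nab D' (?e' l) (g x) ?w) k) =
     (\<Sum>i<r. t (g x) (s x) i * (\<Sum>l<r'. t' (g x) (?e i (g x)) l * t' (g x) (nab D' (?e' l) (g x) ?w) k))"
    by (simp only: sum_distrib_left)
  have "t' (g x) (pull_term E nab D r t s x v) k = (\<Sum>i<r. t' (g x) (v (\<lambda>y. t (g y) (s y) i) \<odot>\<^bsub>?M\<^esub> ?e i (g x)
      \<oplus>\<^bsub>?M\<^esub> t (g x) (s x) i \<odot>\<^bsub>?M\<^esub> nab D (?e i) (g x) ?w) k)"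
    unfolding pull_term_def by (rule coord_finsum[OF iso' M]) (use tc in auto)
  also have "\<dots> = (\<Sum>i<r. v (\<lambda>y. t (g y) (s y) i) * ?m i (g x) + t (g x) (s x) i * t' (g x) (nab D (?e i) (g x) ?w) k)"
    by (rule sum.cong[OF refl])
      (simp add: coord_add[OF iso'] coord_smult[OF iso'] ec nc module_smult_closed[OF M])
  also have "\<dots> = (\<Sum>i<r. v (\<lambda>y. t (g y) (s y) i) * ?m i (g x) + t (g x) (s x) i * ?w (?m i)) +
     (\<Sum>i<r. t (g x) (s x) i * (\<Sum>l<r'. t' (g x) (?e i (g x)) l * t' (g x) (nab D' (?e' l) (g x) ?w) k))"
    unfolding sum.distrib[symmetric] by (rule sum.cong[OF refl]) (simp add: 2 distrib_left)
  finally show "t' (g x) (pull_term E nab D r t s x v) k = v (\<lambda>y. t' (g y) (s y) k) +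
      (\<Sum>i<r'. t' (g x) (s x) i * t' (g x) (nab D' (?e' i) (g x) ?w) k)"
    unfolding 1 3 .
qed

text \<open>Existence in the description is the agreement of all \<open>pull_term\<close>s, by
  \<open>pull_term_coords\<close>; uniqueness holds because the given trivialisation covers
  \<open>g x\<close>.\<close>

lemma pull_connection_eq:
  assumes T: "(D, r, t) \<in> trivs E" and W: "openin (mtop U) W" and s: "s \<in> sections U (pb E) W"
    and x: "x \<in> W" "g x \<in> D" and v: "v \<in> tangent U x"
  shows "pull_connection U V g E nab W s x v = pull_term E nab D r t s x v"
proof -
  have eq: "pull_term E nab D r t s x v = pull_term E nab D' r' t' s x v"
    if T': "(D', r', t') \<in> trivs E" "g x \<in> D'" for D' r' t'
  proof (rule coord_eqI[OF V.triv_iso[OF E T x(2)]])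
    note * = pull_term_coords[OF T T W s x(1) x(2) x(2) v] pull_term_coords[OF T'(1) T W s x(1) T'(2) x(2) v]
    show "pull_term E nab D r t s x v \<in> carrier (fibre E (g x))" by (rule *)
    show "pull_term E nab D' r' t' s x v \<in> carrier (fibre E (g x))" by (rule *)
    show "t (g x) (pull_term E nab D r t s x v) k = t (g x) (pull_term E nab D' r' t' s x v) k" if "k < r" for k
      using that by (simp only: *)
  qed
  have "(THE w. \<forall>(D, r, t) \<in> trivs E. g x \<in> D \<longrightarrow> w = pull_term E nab D r t s x v) = pull_term E nab D r t s x v"
  proof (rule the_equality)
    show "\<forall>(D', r', t') \<in> trivs E. g x \<in> D' \<longrightarrow> pull_term E nab D r t s x v = pull_term E nab D' r' t' s x v"
      using eq by blast
    fix w assume "\<forall>(D, r, t) \<in> trivs E. g x \<in> D \<longrightarrow> w = pull_term E nab D r t s x v"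
    from bspec[OF this T, unfolded case_prod_conv] x(2) show "w = pull_term E nab D r t s x v" by simp
  qed
  then show ?thesis using W s x v unfolding pull_connection_def pull_term_def by simp
qed

end

end

context cman_map
begin

lemma pull_connection_closed:
  assumes E: "hol_bundle V E" and nab: "hol_connection V E nab"
    and W: "openin (mtop U) W" and s: "s \<in> sections U (pb E) W" and x: "x \<in> W" and v: "v \<in> tangent U x"
  shows "pull_connection U V g E nab W s x v \<in> carrier (fibre E (g x))"
proof -
  obtain D r t where T: "(D, r, t) \<in> trivs E" "g x \<in> D"
    using V.points_triv[OF E g_points[OF U.tangent_point[OF v]]] .
  show ?thesis
    unfolding pull_connection_eq[OF E nab T(1) W s x T(2) v]
    by (rule pull_term_coords(1)[OF E nab T(1) T(1) W s x T(2) T(2) v])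
qed

lemma pull_connection_coord:
  assumes E: "hol_bundle V E" and nab: "hol_connection V E nab" and T: "(D, r, t) \<in> trivs E" "g x \<in> D"
    and W: "openin (mtop U) W" and s: "s \<in> sections U (pb E) W" and x: "x \<in> W" and v: "v \<in> tangent U x" and k: "k < r"
  shows "t (g x) (pull_connection U V g E nab W s x v) k = v (\<lambda>y. t (g y) (s y) k) +
      (\<Sum>i<r. t (g x) (s x) i * t (g x) (nab D (frame E (D, r, t) i) (g x) (push V g x v)) k)"
  unfolding pull_connection_eq[OF E nab T(1) W s x T(2) v]
  by (rule pull_term_coords(2)[OF E nab T(1) T(1) W s x T(2) T(2) v k])

text \<open>The derivative along \<open>v\<close> of pulled back coordinates is the derivative of
  the coordinates along the pushed vector, so both sides have the same expansion in the frame. This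
  characteristic property lets later computations be done with sections over
  \<open>V\<close>.\<close>

lemma pull_connection_section:
  assumes E: "hol_bundle V E" and nab: "hol_connection V E nab"
    and W: "openin (mtop V) W" and s: "s \<in> sections V E W" and x: "x \<in> pre W" and v: "v \<in> tangent U x"
  shows "pull_connection U V g E nab (pre W) (pt W s) x v = nab W s (g x) (push V g x v)"
proof -
  have gx: "g x \<in> W" using x by simp
  obtain D r t where T: "(D, r, t) \<in> trivs E" "g x \<in> D"
    using V.points_triv[OF E g_points[OF U.tangent_point[OF v]]] .
  note w = push_tangent[OF v]
  note pW = preimage_open[OF W]
  note ps = pull_section[OF E W s]
  show ?thesis
  proof (rule coord_eqI[OF V.triv_iso[OF E T] pull_connection_closed[OF E nab pW ps x v] V.connection_closed[OF nab W s gx w]])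
    fix k assume k: "k < r"
    have op: "openin (mtop V) (D \<inter> W)" by (intro openin_Int V.triv_open[OF E T(1)] W)
    have "push V g x v (\<lambda>y. t y (s y) k) = v (\<lambda>y. t (g y) (s (g y)) k)"
      by (rule push_eval[OF V.hol_nearI[OF op _ sections_hol_fun[OF s T(1) k]]]) (use T gx in simp)
    also have "\<dots> = v (\<lambda>y. t (g y) (pt W s y) k)"
      by (rule U.tangent_cong[OF v pW x]) simp
    finally show "t (g x) (pull_connection U V g E nab (pre W) (pt W s) x v) k = t (g x) (nab W s (g x) (push V g x v)) k"
      unfolding pull_connection_coord[OF E nab T pW ps x v k] V.connection_frame_coord[OF E nab T(1) W s gx T(2) w k]
      using x by simp
  qed
qed

text \<open>In a chart of \<open>V\<close> around the image point, the pulled back connection matrix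
  is the sum of the entries of the Jacobian matrix of \<open>g\<close> times the components of the
  connection matrix of \<open>V\<close>, composed with \<open>g\<close>.\<close>

lemma pull_christoffel_holo:
  assumes E: "hol_bundle V E" and nab: "hol_connection V E nab" and T: "(D, r, t) \<in> trivs E"
    and c: "(n, C, \<phi>) \<in> atlas U" and i: "i < n" and l: "l < r" and k: "k < r"
  shows "holo_on n (\<phi> ` (C \<inter> pre D)) (\<lambda>z. t (g (inv_into C \<phi> z)) (nab D (frame E (D, r, t) l) (g (inv_into C \<phi> z))
     (push V g (inv_into C \<phi> z) (coord_vec U (n, C, \<phi>) (inv_into C \<phi> z) i))) k)"
proof (rule holo_on_local)
  let ?x = "inv_into C \<phi>"
  let ?e = "frame E (D, r, t) l"
  let ?v = "\<lambda>x. coord_vec U (n, C, \<phi>) x i"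
  have D: "openin (mtop V) D" by (rule V.triv_open[OF E T])
  show "\<phi> ` (C \<inter> pre D) \<subseteq> Cn n" by (rule openin_imp_subset[OF U.chart_open_image[OF c preimage_open[OF D]]])
  fix z assume "z \<in> \<phi> ` (C \<inter> pre D)"
  then obtain x where x: "z = \<phi> x" "x \<in> C" "x \<in> points U" "g x \<in> D" by blast
  obtain m C' \<psi> where c': "(m, C', \<psi>) \<in> atlas V" "g x \<in> C'" using V.points_chart[OF g_points[OF x(3)]] .
  have CD: "openin (mtop V) (C' \<inter> D)" by (intro openin_Int D V.chart_open[OF c'(1)])
  define A where "A = pre (C' \<inter> D)"
  have A: "openin (mtop U) A" unfolding A_def by (rule preimage_open[OF CD])
  have op: "open_Cn n (\<phi> ` (C \<inter> A))" by (rule U.chart_open_image[OF c A])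
  have es: "?e \<in> sections V E D" by (rule V.frame_section[OF E T l])
  have "holo_on n (\<phi> ` (C \<inter> A)) (\<lambda>z. \<Sum>j<m. ?v (?x z) (\<lambda>y. \<psi> (g y) j) *
     t (inv_into C' \<psi> (\<psi> (g (?x z)))) (nab D ?e (inv_into C' \<psi> (\<psi> (g (?x z))))
       (coord_vec V (m, C', \<psi>) (inv_into C' \<psi> (\<psi> (g (?x z)))) j)) k)"
  proof (intro holo_on_sum holo_on_mult)
    fix j assume "j \<in> {..<m}"
    then have j: "j < m" by simp
    show "holo_on n (\<phi> ` (C \<inter> A)) (\<lambda>z. ?v (?x z) (\<lambda>y. \<psi> (g y) j))"
      by (rule holo_on_subset[OF push_coord_vec_holo[OF c c'(1) j i]]) (auto simp: A_def)
    have opV: "open_Cn m (\<psi> ` (C' \<inter> D \<inter> D))" using V.chart_open_image[OF c'(1) D] by (simp add: Int_assoc)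
    show "holo_on n (\<phi> ` (C \<inter> A)) (\<lambda>z. t (inv_into C' \<psi> (\<psi> (g (?x z)))) (nab D ?e (inv_into C' \<psi> (\<psi> (g (?x z))))
       (coord_vec V (m, C', \<psi>) (inv_into C' \<psi> (\<psi> (g (?x z)))) j)) k)"
    proof (rule holo_on_compose[OF opV V.connection_holo[OF nab D es c'(1) T j k] op])
      show "holo_on n (\<phi> ` (C \<inter> A)) (\<lambda>z. \<psi> (g (?x z)) j)" if "j < m" for j
        by (rule holo_on_subset[OF g_charts[OF c c'(1) that]]) (auto simp: A_def)
      show "(\<lambda>z. \<psi> (g (?x z))) ` \<phi> ` (C \<inter> A) \<subseteq> \<psi> ` (C' \<inter> D \<inter> D)"
        using c by (auto simp: A_def image_iff)
    qed
  qed
  moreover have "(\<Sum>j<m. ?v (?x z) (\<lambda>y. \<psi> (g y) j) *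
     t (inv_into C' \<psi> (\<psi> (g (?x z)))) (nab D ?e (inv_into C' \<psi> (\<psi> (g (?x z))))
       (coord_vec V (m, C', \<psi>) (inv_into C' \<psi> (\<psi> (g (?x z)))) j)) k) =
    t (g (?x z)) (nab D ?e (g (?x z)) (push V g (?x z) (?v (?x z)))) k"
    if zA: "z \<in> \<phi> ` (C \<inter> A)" for z
  proof -
    obtain y where y: "z = \<phi> y" "y \<in> C" "g y \<in> C'" "g y \<in> D" using zA by (auto simp: A_def)
    have xz: "?x z = y" using y c by simp
    have v: "?v y \<in> tangent U y" by (rule U.coord_vec_tangent[OF c y(2) i])
    have "t (g y) (nab D ?e (g y) (push V g y (?v y))) k =
        (\<Sum>j<m. ?v y (\<lambda>y. \<psi> (g y) j) * t (g y) (nab D ?e (g y) (coord_vec V (m, C', \<psi>) (g y) j)) k)"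
      unfolding push_coords[OF v c'(1) y(3)]
      by (rule V.connection_lincomb[OF E nab D es T y(4) y(4)]) (rule V.coord_vec_tangent[OF c'(1) y(3)])
    then show ?thesis unfolding xz using c'(1) y by simp
  qed
  ultimately have "holo_on n (\<phi> ` (C \<inter> A)) (\<lambda>z. t (g (?x z)) (nab D ?e (g (?x z)) (push V g (?x z) (?v (?x z)))) k)"
    by (subst (asm) holo_on_cong[OF op])
  moreover have "z \<in> \<phi> ` (C \<inter> A)" using x c' by (auto simp: A_def)
  ultimately show "\<exists>T. open_Cn n T \<and> z \<in> T \<and> holo_on n T (\<lambda>z. t (g (?x z)) (nab D ?e (g (?x z)) (push V g (?x z) (?v (?x z)))) k)"
    using op by blast
qed

lemma pull_connection_holo:
  assumes E: "hol_bundle V E" and nab: "hol_connection V E nab" and T: "(D, r, t) \<in> trivs E"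
    and W: "openin (mtop U) W" and s: "s \<in> sections U (pb E) W"
    and c: "(n, C, \<phi>) \<in> atlas U" and i: "i < n" and k: "k < r"
  shows "holo_on n (\<phi> ` (C \<inter> pre D \<inter> W)) (\<lambda>z. pt D t (inv_into C \<phi> z)
     (pull_connection U V g E nab W s (inv_into C \<phi> z) (coord_vec U (n, C, \<phi>) (inv_into C \<phi> z) i)) k)"
proof -
  let ?x = "inv_into C \<phi>"
  let ?e = "frame E (D, r, t)"
  let ?v = "\<lambda>x. coord_vec U (n, C, \<phi>) x i"
  have D: "openin (mtop V) D" by (rule V.triv_open[OF E T])
  have DW: "openin (mtop U) (pre D \<inter> W)" by (intro openin_Int preimage_open[OF D] W)
  have op: "open_Cn n (\<phi> ` (C \<inter> pre D \<inter> W))" using U.chart_open_image[OF c DW] by (simp add: Int_assoc)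
  have hc: "hol_fun U (pre D \<inter> W) (\<lambda>y. t (g y) (s y) j)" if "j < r" for j
    by (rule pull_section_hol_fun[OF E nab s T that W])
  have "holo_on n (\<phi> ` (C \<inter> pre D \<inter> W)) (\<lambda>z. ?v (?x z) (\<lambda>y. t (g y) (s y) k) +
     (\<Sum>l<r. t (g (?x z)) (s (?x z)) l * t (g (?x z)) (nab D (?e l) (g (?x z)) (push V g (?x z) (?v (?x z)))) k))"
  proof (intro holo_on_add holo_on_sum holo_on_mult)
    show "holo_on n (\<phi> ` (C \<inter> pre D \<inter> W)) (\<lambda>z. ?v (?x z) (\<lambda>y. t (g y) (s y) k))"
      using U.coord_vec_holo[OF c i DW hc[OF k]] by (simp add: Int_assoc)
    fix l assume "l \<in> {..<r}"
    then have l: "l < r" by simp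
    show "holo_on n (\<phi> ` (C \<inter> pre D \<inter> W)) (\<lambda>z. t (g (?x z)) (s (?x z)) l)"
      using U.hol_fun_chart[OF hc[OF l] c] by (simp add: Int_assoc)
    show "holo_on n (\<phi> ` (C \<inter> pre D \<inter> W)) (\<lambda>z. t (g (?x z)) (nab D (?e l) (g (?x z)) (push V g (?x z) (?v (?x z)))) k)"
      by (rule holo_on_subset[OF pull_christoffel_holo[OF E nab T c i l k]]) auto
  qed
  moreover have "?v (?x z) (\<lambda>y. t (g y) (s y) k) +
     (\<Sum>l<r. t (g (?x z)) (s (?x z)) l * t (g (?x z)) (nab D (?e l) (g (?x z)) (push V g (?x z) (?v (?x z)))) k) =
     pt D t (?x z) (pull_connection U V g E nab W s (?x z) (?v (?x z))) k"
    if zA: "z \<in> \<phi> ` (C \<inter> pre D \<inter> W)" for z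
  proof -
    obtain y where y: "z = \<phi> y" "y \<in> C" "y \<in> pre D" "y \<in> W" using zA by blast
    have xz: "?x z = y" using y c by simp
    have v: "?v y \<in> tangent U y" by (rule U.coord_vec_tangent[OF c y(2) i])
    have gy: "g y \<in> D" using y by simp
    show ?thesis unfolding xz
      using pull_connection_coord[OF E nab T gy W s y(4) v k] y(3) by simp
  qed
  ultimately show ?thesis by (subst (asm) holo_on_cong[OF op])
qed

text \<open>Each axiom is read in the coordinates of \<open>pull_connection_coord\<close>. There it
  reduces to a property of tangent vectors (locality for restriction, additivity for sums, the
  product rule for Leibniz) or, for linearity in the tangent vector, to that of the connection on
  \<open>V\<close>.\<close>

lemma pull_hol_connection:
  assumes E: "hol_bundle V E" and nab: "hol_connection V E nab"
  shows "hol_connection U (pb E) (pull_connection U V g E nab)"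
proof -
  let ?N = "pull_connection U V g E nab"
  note pE = pull_hol_bundle[OF E]
  note cl = pull_connection_closed[OF E nab]
  note co = pull_connection_coord[OF E nab]
  have sc: "s x \<in> carrier (fibre E (g x))" if "s \<in> sections U (pb E) W" "x \<in> W" "openin (mtop U) W" for s W x
    by (rule pull_section_closed[OF E nab that])
  have forms: "?N W s \<in> bundle_forms1 U (pb E) W" if W: "openin (mtop U) W" and s: "s \<in> sections U (pb E) W" for W s
    unfolding bundle_forms1_def mem_Collect_eq Let_def
  proof (intro conjI)
    show "\<forall>x\<in>W. \<forall>v \<in> tangent U x. ?N W s x v \<in> carrier (fibre (pb E) x)"
    proof (intro ballI)
      fix x v assume x: "x \<in> W" and v: "v \<in> tangent U x"
      have xU: "x \<in> points U" by (rule U.tangent_point[OF v])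
      show "?N W s x v \<in> carrier (fibre (pb E) x)" using cl[OF W s x v] by (simp add: pull_fibre xU)
    qed
  next
    show "\<forall>x\<in>W. \<forall>v \<in> tangent U x. \<forall>w \<in> tangent U x. \<forall>a b.
      ?N W s x (tlin a v b w) = a \<odot>\<^bsub>fibre (pb E) x\<^esub> ?N W s x v \<oplus>\<^bsub>fibre (pb E) x\<^esub> b \<odot>\<^bsub>fibre (pb E) x\<^esub> ?N W s x w"
    proof (intro ballI allI)
      fix x v assume x: "x \<in> W" and v: "v \<in> tangent U x"
      have xU: "x \<in> points U" by (rule U.tangent_point[OF v])
      fix w a b assume w: "w \<in> tangent U x"
      note vw = U.tangent_tlin[OF v w]
      obtain D r t where T: "(D, r, t) \<in> trivs E" "g x \<in> D" using V.points_triv[OF E g_points[OF xU]] .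
      note iso = V.triv_iso[OF E T]
      note M = V.fibre_module[OF E g_points[OF xU]]
      have D: "openin (mtop V) D" by (rule V.triv_open[OF E T(1)])
      note sm = module_smult_closed[OF M cl[OF W s x]]
      have "?N W s x (tlin a v b w) = a \<odot>\<^bsub>fibre E (g x)\<^esub> ?N W s x v \<oplus>\<^bsub>fibre E (g x)\<^esub> b \<odot>\<^bsub>fibre E (g x)\<^esub> ?N W s x w"
      proof (rule coord_eqI[OF iso cl[OF W s x vw] module_add_closed[OF M sm[OF v] sm[OF w]]])
        fix k assume k: "k < r"
        have nt: "t (g x) (nab D (frame E (D, r, t) i) (g x) (push V g x (tlin a v b w))) k =
            a * t (g x) (nab D (frame E (D, r, t) i) (g x) (push V g x v)) k +
            b * t (g x) (nab D (frame E (D, r, t) i) (g x) (push V g x w)) k" if "i < r" for i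
        proof -
          note es = V.frame_section[OF E T(1) that]
          note nc = V.connection_closed[OF nab D es T(2)]
          show ?thesis
            by (simp add: push_tlin V.connection_tlin[OF nab D es T(2) push_tangent[OF v] push_tangent[OF w]]
                coord_add[OF iso] coord_smult[OF iso] nc push_tangent v w module_smult_closed[OF M])
        qed
        have "(\<Sum>i<r. t (g x) (s x) i * t (g x) (nab D (frame E (D, r, t) i) (g x) (push V g x (tlin a v b w))) k) =
          a * (\<Sum>i<r. t (g x) (s x) i * t (g x) (nab D (frame E (D, r, t) i) (g x) (push V g x v)) k) +
          b * (\<Sum>i<r. t (g x) (s x) i * t (g x) (nab D (frame E (D, r, t) i) (g x) (push V g x w)) k)"
          unfolding sum_distrib_left sum.distrib[symmetric]
          by (rule sum.cong[OF refl]) (simp add: nt algebra_simps)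
        then show "t (g x) (?N W s x (tlin a v b w)) k =
           t (g x) (a \<odot>\<^bsub>fibre E (g x)\<^esub> ?N W s x v \<oplus>\<^bsub>fibre E (g x)\<^esub> b \<odot>\<^bsub>fibre E (g x)\<^esub> ?N W s x w) k"
          by (simp add: coord_add[OF iso] coord_smult[OF iso] cl[OF W s x] sm v w
              co[OF T W s x v k] co[OF T W s x w k] co[OF T W s x vw k] algebra_simps) (simp add: tlin_def)
      qed
      then show "?N W s x (tlin a v b w) = a \<odot>\<^bsub>fibre (pb E) x\<^esub> ?N W s x v \<oplus>\<^bsub>fibre (pb E) x\<^esub> b \<odot>\<^bsub>fibre (pb E) x\<^esub> ?N W s x w"
        by (simp add: pull_fibre xU)
    qed
  next
    show "\<forall>(n, D, \<phi>) \<in> atlas U. \<forall>(D', r, t) \<in> trivs (pb E). \<forall>i<n. \<forall>j<r.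
        holo_on n (\<phi> ` (D \<inter> D' \<inter> W)) (\<lambda>z. t (inv_into D \<phi> z) (?N W s (inv_into D \<phi> z) (coord_vec U (n, D, \<phi>) (inv_into D \<phi> z) i)) j)"
    proof (intro ballI case_prodI2 allI impI)
      fix c n p C \<phi> T D' q r t i j
      assume "c \<in> atlas U" "c = (n, p)" "p = (C, \<phi>)"
        and T: "T \<in> trivs (pb E)" "T = (D', q)" "q = (r, t)" and i: "i < n" and j: "j < r"
      then have c: "(n, C, \<phi>) \<in> atlas U" by simp
      obtain D t0 where T': "(D, r, t0) \<in> trivs E" "D' = pre D" "t = pt D t0"
        using T by (auto elim: pull_trivE)
      show "holo_on n (\<phi> ` (C \<inter> D' \<inter> W)) (\<lambda>z. t (inv_into C \<phi> z) (?N W s (inv_into C \<phi> z) (coord_vec U (n, C, \<phi>) (inv_into C \<phi> z) i)) j)"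
        unfolding T'(2,3) by (rule pull_connection_holo[OF E nab T'(1) W s c i j])
    qed
  qed
  have restr: "?N W' (restrict s W') x v = ?N W s x v"
    if W: "openin (mtop U) W" and s: "s \<in> sections U (pb E) W" and W': "openin (mtop U) W'" "W' \<subseteq> W"
      and x: "x \<in> W'" and v: "v \<in> tangent U x" for W s W' x v
  proof -
    have xW: "x \<in> W" using x W' by blast
    obtain D r t where T: "(D, r, t) \<in> trivs E" "g x \<in> D" using V.points_triv[OF E g_points[OF U.tangent_point[OF v]]] .
    note s' = U.section_restrict[OF pE s W']
    have "v (\<lambda>y. t (g y) (restrict s W' y) k) = v (\<lambda>y. t (g y) (s y) k)" for k
      by (rule U.tangent_cong[OF v W'(1) x]) simp
    then show ?thesis
      using x by (intro coord_eqI[OF V.triv_iso[OF E T] cl[OF W'(1) s' x v] cl[OF W s xW v]])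
        (simp add: co[OF T W'(1) s' x v] co[OF T W s xW v])
  qed
  have add: "?N W (\<lambda>y\<in>W. s y \<oplus>\<^bsub>fibre (pb E) y\<^esub> s' y) x v = ?N W s x v \<oplus>\<^bsub>fibre (pb E) x\<^esub> ?N W s' x v"
    if W: "openin (mtop U) W" and s: "s \<in> sections U (pb E) W" and s': "s' \<in> sections U (pb E) W"
      and x: "x \<in> W" and v: "v \<in> tangent U x" for W s s' x v
  proof -
    have xU: "x \<in> points U" by (rule U.tangent_point[OF v])
    obtain D r t where T: "(D, r, t) \<in> trivs E" "g x \<in> D" using V.points_triv[OF E g_points[OF xU]] .
    note iso = V.triv_iso[OF E T]
    note M = V.fibre_module[OF E g_points[OF xU]]
    let ?s = "\<lambda>y\<in>W. s y \<oplus>\<^bsub>fibre (pb E) y\<^esub> s' y"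
    note ss = U.section_add[OF pE W s s']
    have DW: "openin (mtop U) (pre D \<inter> W)" by (intro openin_Int preimage_open V.triv_open[OF E T(1)] W)
    have "?N W ?s x v = ?N W s x v \<oplus>\<^bsub>fibre E (g x)\<^esub> ?N W s' x v"
    proof (rule coord_eqI[OF iso cl[OF W ss x v] module_add_closed[OF M cl[OF W s x v] cl[OF W s' x v]]])
      fix k assume k: "k < r"
      have near: "hol_near U x (\<lambda>y. t (g y) (s y) k)" if "s \<in> sections U (pb E) W" for s
        by (rule U.hol_nearI[OF DW _ pull_section_hol_fun[OF E nab that T(1) k W]]) (use xU T x in simp)
      have "t (g y) (?s y) i = t (g y) (s y) i + t (g y) (s' y) i" if "y \<in> pre D \<inter> W" for y i
        using that coord_add[OF V.triv_iso[OF E T(1), of "g y"] sc[OF s _ W, of y] sc[OF s' _ W, of y]]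
        by (simp add: pull_fibre)
      note eq = this
      have "v (\<lambda>y. t (g y) (?s y) k) = v (\<lambda>y. t (g y) (s y) k + t (g y) (s' y) k)"
        by (rule U.tangent_cong[OF v DW]) (use eq xU T x in auto)
      also have "\<dots> = v (\<lambda>y. t (g y) (s y) k) + v (\<lambda>y. t (g y) (s' y) k)"
        by (rule U.tangent_add[OF v near[OF s] near[OF s']])
      finally have 1: "v (\<lambda>y. t (g y) (?s y) k) = v (\<lambda>y. t (g y) (s y) k) + v (\<lambda>y. t (g y) (s' y) k)" .
      have 2: "t (g x) (?s x) i = t (g x) (s x) i + t (g x) (s' x) i" for i
        by (rule eq) (use xU T x in simp)
      show "t (g x) (?N W ?s x v) k = t (g x) (?N W s x v \<oplus>\<^bsub>fibre E (g x)\<^esub> ?N W s' x v) k"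
        unfolding coord_add[OF iso cl[OF W s x v] cl[OF W s' x v]] co[OF T W s x v k] co[OF T W s' x v k] co[OF T W ss x v k] 1 2
        by (simp add: distrib_right sum.distrib)
    qed
    then show ?thesis by (simp add: pull_fibre xU)
  qed
  have leibniz: "?N W (\<lambda>y\<in>W. h y \<odot>\<^bsub>fibre (pb E) y\<^esub> s y) x v =
      v h \<odot>\<^bsub>fibre (pb E) x\<^esub> s x \<oplus>\<^bsub>fibre (pb E) x\<^esub> h x \<odot>\<^bsub>fibre (pb E) x\<^esub> ?N W s x v"
    if W: "openin (mtop U) W" and s: "s \<in> sections U (pb E) W" and h: "hol_fun U W h"
      and x: "x \<in> W" and v: "v \<in> tangent U x" for W s h x v
  proof -
    have xU: "x \<in> points U" by (rule U.tangent_point[OF v])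
    obtain D r t where T: "(D, r, t) \<in> trivs E" "g x \<in> D" using V.points_triv[OF E g_points[OF xU]] .
    note iso = V.triv_iso[OF E T]
    note M = V.fibre_module[OF E g_points[OF xU]]
    let ?s = "\<lambda>y\<in>W. h y \<odot>\<^bsub>fibre (pb E) y\<^esub> s y"
    note ss = U.section_smult[OF pE W s h]
    note sx = sc[OF s x W]
    note ms = module_smult_closed[OF M]
    have DW: "openin (mtop U) (pre D \<inter> W)" by (intro openin_Int preimage_open V.triv_open[OF E T(1)] W)
    have "?N W ?s x v = v h \<odot>\<^bsub>fibre E (g x)\<^esub> s x \<oplus>\<^bsub>fibre E (g x)\<^esub> h x \<odot>\<^bsub>fibre E (g x)\<^esub> ?N W s x v"
    proof (rule coord_eqI[OF iso cl[OF W ss x v] module_add_closed[OF M ms[OF sx] ms[OF cl[OF W s x v]]]])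
      fix k assume k: "k < r"
      have near: "hol_near U x (\<lambda>y. t (g y) (s y) k)"
        by (rule U.hol_nearI[OF DW _ pull_section_hol_fun[OF E nab s T(1) k W]]) (use xU T x in simp)
      have "t (g y) (?s y) i = h y * t (g y) (s y) i" if "y \<in> pre D \<inter> W" for y i
        using that coord_smult[OF V.triv_iso[OF E T(1), of "g y"] sc[OF s _ W, of y]]
        by (simp add: pull_fibre)
      note eq = this
      have "v (\<lambda>y. t (g y) (?s y) k) = v (\<lambda>y. h y * t (g y) (s y) k)"
        by (rule U.tangent_cong[OF v DW]) (use eq xU T x in auto)
      also have "\<dots> = v h * t (g x) (s x) k + h x * v (\<lambda>y. t (g y) (s y) k)"
        by (rule U.tangent_mult[OF v U.hol_nearI[OF W x h] near])
      finally have 1: "v (\<lambda>y. t (g y) (?s y) k) = v h * t (g x) (s x) k + h x * v (\<lambda>y. t (g y) (s y) k)" .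
      have 2: "t (g x) (?s x) i = h x * t (g x) (s x) i" for i
        by (rule eq) (use xU T x in simp)
      show "t (g x) (?N W ?s x v) k = t (g x) (v h \<odot>\<^bsub>fibre E (g x)\<^esub> s x \<oplus>\<^bsub>fibre E (g x)\<^esub> h x \<odot>\<^bsub>fibre E (g x)\<^esub> ?N W s x v) k"
        unfolding coord_add[OF iso ms[OF sx] ms[OF cl[OF W s x v]]] coord_smult[OF iso sx] coord_smult[OF iso cl[OF W s x v]]
          co[OF T W s x v k] co[OF T W ss x v k] 1 2
        by (simp add: distrib_left sum_distrib_left mult.assoc)
    qed
    then show ?thesis by (simp add: pull_fibre xU)
  qed
  have undef: "?N W s x v = undefined"
    if "\<not> (openin (mtop U) W \<and> s \<in> sections U (pb E) W \<and> x \<in> W \<and> v \<in> tangent U x)" for W s x v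
    unfolding pull_connection_def using that by (rule if_not_P)
  show ?thesis
    unfolding hol_connection_def
    by (intro conjI allI impI ballI)
      (assumption | rule undef forms add leibniz | (elim conjE, rule restr))+
qed

text \<open>The derivative may be computed with any local section through \<open>e\<close>. On a
  pulled back section both pulled back connections are known from
  \<open>pull_connection_section\<close>.\<close>

lemma pull_hom_connection:
  assumes E: "hol_bundle V E" and F: "hol_bundle V F"
    and DE: "hol_connection V E DE" and DF: "hol_connection V F DF" and f: "f \<in> hol_bundle_maps V E F"
    and v: "v \<in> tangent U x" and e: "e \<in> carrier (fibre E (g x))"
  shows "hom_connection U (pb E, pull_connection U V g E DE) (pb F, pull_connection U V g F DF)
      (\<lambda>x\<in>points U. f (g x)) x v e = hom_connection V (E, DE) (F, DF) f (g x) (push V g x v) e"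
proof -
  interpret h: hom_conn V E F DE DF f
    by unfold_locales (rule E F DE DF f)+
  interpret ph: hom_conn U "pb E" "pb F" "pull_connection U V g E DE" "pull_connection U V g F DF" "\<lambda>x\<in>points U. f (g x)"
    by unfold_locales (rule pull_hol_bundle pull_hol_connection pull_bundle_map E F DE DF f)+
  have xU: "x \<in> points U" by (rule U.tangent_point[OF v])
  obtain D r t where T: "(D, r, t) \<in> trivs E" "g x \<in> D" using V.points_triv[OF E g_points[OF xU]] .
  obtain s where s: "s \<in> sections V E D" "s (g x) = e" using V.section_through[OF E T e] .
  have D: "openin (mtop V) D" by (rule V.triv_open[OF E T(1)])
  have x: "x \<in> pre D" using xU T by simp
  have ps: "pt D s x = e" using x s by simp
  let ?fs = "\<lambda>y\<in>D. f y (s y)"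
  have eq: "(\<lambda>y\<in>pre D. (\<lambda>x\<in>points U. f (g x)) y (pt D s y)) = pt D ?fs"
    by (rule restrict_ext) simp
  have "hom_connection U (pb E, pull_connection U V g E DE) (pb F, pull_connection U V g F DF) (\<lambda>x\<in>points U. f (g x)) x v e
     = pull_connection U V g F DF (pre D) (pt D ?fs) x v \<ominus>\<^bsub>fibre (pb F) x\<^esub> (\<lambda>x\<in>points U. f (g x)) x (pull_connection U V g E DE (pre D) (pt D s) x v)"
    using ph.nabla_section[OF preimage_open[OF D] pull_section[OF E D s(1)] x v] unfolding ps eq .
  also have "\<dots> = DF D ?fs (g x) (push V g x v) \<ominus>\<^bsub>fibre F (g x)\<^esub> f (g x) (DE D s (g x) (push V g x v))"
    unfolding pull_connection_section[OF E DE D s(1) x v]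
      pull_connection_section[OF F DF D V.bundle_map_section[OF E F f D s(1)] x v] pull_fibre[OF xU]
    using xU by simp
  also have "\<dots> = hom_connection V (E, DE) (F, DF) f (g x) (push V g x v) e"
    using h.nabla_section[OF D s(1) T(2) push_tangent[OF v]] unfolding s(2) by simp
  finally show ?thesis .
qed

end

section \<open>Strict functoriality of the pullback\<close>

context cmanifold
begin

text \<open>An equality, not merely an isomorphism: the extensionality required in
  \<open>hol_bundle\<close> fixes fibres and trivialisations outside their domains, where the
  restricted functions on the left have the same default value.\<close>

lemma pull_bundle_identity:
  assumes E: "hol_bundle U E"
  shows "pull_bundle U U (restrict id (points U)) E = E"
proof -
  have "(\<lambda>(D, r, t). ({x \<in> points U. restrict id (points U) x \<in> D}, r,
      \<lambda>x\<in>{x \<in> points U. restrict id (points U) x \<in> D}. t (restrict id (points U) x))) T = T" if TE: "T \<in> trivs E" for T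
  proof -
    obtain D r t where T: "T = (D, r, t)" by (cases T)
    with TE have "(D, r, t) \<in> trivs E" by simp
    then have D: "D \<subseteq> points U" "t \<in> extensional D"
      by (rule open_subset_points[OF triv_open[OF E]], rule triv_extensional[OF E])
    then have eq: "{x \<in> points U. restrict id (points U) x \<in> D} = D" by auto
    have "(\<lambda>x\<in>D. t (restrict id (points U) x)) = t"
      by (rule extensionalityI[OF _ D(2)]) (use D in auto)
    then show ?thesis unfolding T case_prod_conv eq by simp
  qed
  then have "(\<lambda>(D, r, t). ({x \<in> points U. restrict id (points U) x \<in> D}, r,
      \<lambda>x\<in>{x \<in> points U. restrict id (points U) x \<in> D}. t (restrict id (points U) x))) ` trivs E = trivs E"
    by simp
  moreover have "(\<lambda>x\<in>points U. fibre E (restrict id (points U) x)) = fibre E"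
    by (rule extensionalityI[OF _ fibre_extensional[OF E]]) auto
  ultimately show ?thesis unfolding pull_bundle_def by simp
qed

lemma pull_connection_identity:
  assumes E: "hol_bundle U E" and nab: "hol_connection U E nab"
  shows "pull_connection U U (restrict id (points U)) E nab = nab"
proof (intro ext)
  interpret I: cman_map U U "restrict id (points U)"
    by unfold_locales (rule id_hol_map)
  fix W s x v
  note pE = pull_bundle_identity[OF E]
  show "pull_connection U U (restrict id (points U)) E nab W s x v = nab W s x v"
  proof (cases "openin (mtop U) W \<and> s \<in> sections U E W \<and> x \<in> W \<and> v \<in> tangent U x")
    case True
    then have W: "openin (mtop U) W" and s: "s \<in> sections U E W" and x: "x \<in> W" and v: "v \<in> tangent U x" by auto
    have xU: "x \<in> points U" by (rule tangent_point[OF v])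
    have ix: "restrict id (points U) x = x" using xU by simp
    obtain D r t where T: "(D, r, t) \<in> trivs E" "x \<in> D" using points_triv[OF E xU] .
    have s': "s \<in> sections U (pull_bundle U U (restrict id (points U)) E) W" using s pE by simp
    have T2: "restrict id (points U) x \<in> D" using T ix by simp
    note co = I.pull_connection_coord[OF E nab T(1) T2 W s' x v]
    note cl = I.pull_connection_closed[OF E nab W s' x v]
    have "v (\<lambda>y. t (restrict id (points U) y) (s y) k) = v (\<lambda>y. t y (s y) k)" for k
      by (rule tangent_cong[OF v open_points xU]) simp
    then show ?thesis
      by (intro coord_eqI[OF triv_iso[OF E T] cl[unfolded ix] connection_closed[OF nab W s x v]])
        (simp add: co[unfolded ix] connection_frame_coord[OF E nab T(1) W s x T(2) v] push_id[OF v])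
  next
    \<comment> \<open>Outside the proper arguments both connections are \<open>undefined\<close>;
      this uses that the pulled back bundle is \<open>E\<close> itself.\<close>
    case False
    show ?thesis
      unfolding connection_undefined[OF nab False] unfolding pull_connection_def pE
      using False by (rule if_not_P)
  qed
qed

end

lemma pull_bundle_compose:
  assumes "cman_map U V g" "cman_map V W h"
  shows "pull_bundle U W (compose (points U) h g) E = pull_bundle U V g (pull_bundle V W h E)"
proof -
  interpret G: cman_map U V g by fact
  have "{x \<in> points U. compose (points U) h g x \<in> D} = {x \<in> points U. g x \<in> {y \<in> points V. h y \<in> D}}" for D
    using G.g_points by (auto simp: compose_def)
  moreover have "(\<lambda>x\<in>{x \<in> points U. g x \<in> {y \<in> points V. h y \<in> D}}. t (compose (points U) h g x)) =
     (\<lambda>x\<in>{x \<in> points U. g x \<in> {y \<in> points V. h y \<in> D}}. (\<lambda>y\<in>{y \<in> points V. h y \<in> D}. t (h y)) (g x))"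
    for D and t :: "'c \<Rightarrow> 'd \<Rightarrow> nat \<Rightarrow> complex"
    by (rule restrict_ext) (simp add: compose_def)
  moreover have "(\<lambda>x\<in>points U. fibre E (compose (points U) h g x)) = (\<lambda>x\<in>points U. (\<lambda>y\<in>points V. fibre E (h y)) (g x))"
    by (rule restrict_ext) (simp add: compose_def G.g_points)
  ultimately show ?thesis
    unfolding pull_bundle_def by (simp only: vbundle.simps image_image case_prod_unfold fst_conv snd_conv)
qed

text \<open>Both sides are compared in coordinates of \<open>E\<close> over the image point. On the
  right the connection matrix belongs to a frame of the once pulled back bundle; this is a pulled
  back frame of \<open>E\<close>, and \<open>pull_connection_section\<close> identifies its
  derivative.\<close>

lemma pull_connection_compose:
  assumes g: "cman_map U V g" and h: "cman_map V W h" and E: "hol_bundle W E" and nab: "hol_connection W E nab"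
  shows "pull_connection U W (compose (points U) h g) E nab =
    pull_connection U V g (pull_bundle V W h E) (pull_connection V W h E nab)"
proof (intro ext)
  interpret G: cman_map U V g by fact
  interpret H: cman_map V W h by fact
  interpret C: cman_map U W "compose (points U) h g" by (rule hol_maps_compose[OF g h])
  note pE = pull_bundle_compose[OF g h]
  note hE = H.pull_hol_bundle[OF E] and hn = H.pull_hol_connection[OF E nab]
  fix Q s x v
  show "pull_connection U W (compose (points U) h g) E nab Q s x v =
    pull_connection U V g (pull_bundle V W h E) (pull_connection V W h E nab) Q s x v"
  proof (cases "openin (mtop U) Q \<and> s \<in> sections U (pull_bundle U W (compose (points U) h g) E) Q \<and> x \<in> Q \<and> v \<in> tangent U x")
    case True
    then have Q: "openin (mtop U) Q" and s: "s \<in> sections U (pull_bundle U W (compose (points U) h g) E) Q"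
      and x: "x \<in> Q" and v: "v \<in> tangent U x" by auto
    have s': "s \<in> sections U (pull_bundle U V g (pull_bundle V W h E)) Q" using s pE by metis
    have xU: "x \<in> points U" by (rule G.U.tangent_point[OF v])
    have gx: "g x \<in> points V" by (rule G.g_points[OF xU])
    have cx: "compose (points U) h g x = h (g x)" using xU by (simp add: compose_def)
    obtain D r t where T: "(D, r, t) \<in> trivs E" "h (g x) \<in> D" using H.V.points_triv[OF E H.g_points[OF gx]] .
    have gD: "g x \<in> H.pre D" using gx T by simp
    have D: "openin (mtop W) D" by (rule H.V.triv_open[OF E T(1)])
    note coC = C.pull_connection_coord[OF E nab T(1) T(2)[folded cx] Q s x v, unfolded cx push_compose[OF g h v]]
    note coG = G.pull_connection_coord[OF hE hn H.pull_trivI[OF T(1)] gD Q s' x v]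
    note w = G.push_tangent[OF v]
    show ?thesis
    proof (rule coord_eqI[OF H.V.triv_iso[OF E T]])
      show "pull_connection U W (compose (points U) h g) E nab Q s x v \<in> carrier (fibre E (h (g x)))"
        using C.pull_connection_closed[OF E nab Q s x v] unfolding cx .
      show "pull_connection U V g (pull_bundle V W h E) (pull_connection V W h E nab) Q s x v \<in> carrier (fibre E (h (g x)))"
        using G.pull_connection_closed[OF hE hn Q s' x v] unfolding H.pull_fibre[OF gx] .
      fix k assume k: "k < r"
      have op: "openin (mtop U) (G.pre (H.pre D))" by (rule G.preimage_open[OF H.preimage_open[OF D]])
      have "v (\<lambda>y. t (compose (points U) h g y) (s y) k) = v (\<lambda>y. H.pt D t (g y) (s y) k)"
        by (rule G.U.tangent_cong[OF v op]) (use xU gD in \<open>auto simp: compose_def\<close>)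
      moreover have "pull_connection V W h E nab (H.pre D) (frame (H.pb E) (H.pre D, r, H.pt D t) i) (g x) (push V g x v) =
          nab D (frame E (D, r, t) i) (h (g x)) (push W h (g x) (push V g x v))" if "i < r" for i
      proof -
        have "frame (H.pb E) (H.pre D, r, H.pt D t) i = H.pt D (frame E (D, r, t) i)"
          by (rule extensionalityI[of _ "H.pre D"]) (simp_all add: frame.simps H.pull_fibre)
        then show ?thesis
          using H.pull_connection_section[OF E nab D H.V.frame_section[OF E T(1) that] gD w] by simp
      qed
      ultimately show "t (h (g x)) (pull_connection U W (compose (points U) h g) E nab Q s x v) k =
          t (h (g x)) (pull_connection U V g (pull_bundle V W h E) (pull_connection V W h E nab) Q s x v) k"
        using coC[OF k] coG[OF k] gD by simp
    qed
  next
    case False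
    then show ?thesis unfolding pull_connection_def pE by (simp only: if_False)
  qed
qed

section \<open>Nerves\<close>

definition is_category :: "('o, 'm) category \<Rightarrow> bool" where
  "is_category C \<longleftrightarrow>
     (\<forall>X\<in>Obj C. Idt C X \<in> Hom C X X) \<and>
     (\<forall>X\<in>Obj C. \<forall>Y\<in>Obj C. \<forall>Z\<in>Obj C. \<forall>f\<in>Hom C X Y. \<forall>g\<in>Hom C Y Z. Comp C X Y Z g f \<in> Hom C X Z) \<and>
     (\<forall>X\<in>Obj C. \<forall>Y\<in>Obj C. \<forall>f\<in>Hom C X Y. Comp C X X Y f (Idt C X) = f \<and> Comp C X Y Y (Idt C Y) f = f) \<and>
     (\<forall>X\<in>Obj C. \<forall>Y\<in>Obj C. \<forall>Z\<in>Obj C. \<forall>W\<in>Obj C. \<forall>f\<in>Hom C X Y. \<forall>g\<in>Hom C Y Z. \<forall>h\<in>Hom C Z W.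
        Comp C X Y W (Comp C Y Z W h g) f = Comp C X Z W h (Comp C X Y Z g f))"

lemma ord_maps_le: "\<theta> \<in> ord_maps k m \<Longrightarrow> i \<le> k \<Longrightarrow> \<theta> i \<le> m"
  by (auto simp: ord_maps_def)

lemma ord_maps_mono: "\<theta> \<in> ord_maps k m \<Longrightarrow> i \<le> j \<Longrightarrow> j \<le> k \<Longrightarrow> \<theta> i \<le> \<theta> j"
  by (auto simp: ord_maps_def mono_on_def)

locale nerve_simplex =
  fixes C :: "('o, 'm) category" and m :: nat and Es :: "'o list" and fs :: "'m list"
  assumes C: "is_category C" and \<sigma>: "(Es, fs) \<in> simplices (nerve C) m"
begin

lemma length_Es: "length Es = Suc m" and length_fs: "length fs = m"
  and Es_Obj: "p \<le> m \<Longrightarrow> Es ! p \<in> Obj C"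
  and fs_Hom: "i < m \<Longrightarrow> fs ! i \<in> Hom C (Es ! i) (Es ! Suc i)"
  using \<sigma> by (auto simp: nerve_def subset_iff)

abbreviation path where "path \<equiv> nerve_path C (Es, fs)"

lemma Idt_Hom: "X \<in> Obj C \<Longrightarrow> Idt C X \<in> Hom C X X"
  using C unfolding is_category_def by (elim conjE) simp

lemma Comp_Hom: "X \<in> Obj C \<Longrightarrow> Y \<in> Obj C \<Longrightarrow> Z \<in> Obj C \<Longrightarrow> f \<in> Hom C X Y \<Longrightarrow> g \<in> Hom C Y Z \<Longrightarrow>
    Comp C X Y Z g f \<in> Hom C X Z"
  using C unfolding is_category_def by (elim conjE) simp

lemma Comp_Idt: "X \<in> Obj C \<Longrightarrow> Y \<in> Obj C \<Longrightarrow> f \<in> Hom C X Y \<Longrightarrow> Comp C X X Y f (Idt C X) = f"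
  and Idt_Comp: "X \<in> Obj C \<Longrightarrow> Y \<in> Obj C \<Longrightarrow> f \<in> Hom C X Y \<Longrightarrow> Comp C X Y Y (Idt C Y) f = f"
  using C unfolding is_category_def by (elim conjE; simp)+

lemma Comp_assoc: "X \<in> Obj C \<Longrightarrow> Y \<in> Obj C \<Longrightarrow> Z \<in> Obj C \<Longrightarrow> W \<in> Obj C \<Longrightarrow>
    f \<in> Hom C X Y \<Longrightarrow> g \<in> Hom C Y Z \<Longrightarrow> h \<in> Hom C Z W \<Longrightarrow>
    Comp C X Y W (Comp C Y Z W h g) f = Comp C X Z W h (Comp C X Y Z g f)"
  using C unfolding is_category_def by (elim conjE) simp

lemma path_Hom: "p + d \<le> m \<Longrightarrow> path p d \<in> Hom C (Es ! p) (Es ! (p + d))"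
proof (induction d)
  case 0
  then show ?case by (simp add: Idt_Hom Es_Obj)
next
  case (Suc d)
  then show ?case using Comp_Hom[OF Es_Obj Es_Obj Es_Obj Suc.IH fs_Hom] by simp
qed

lemma path_add: "p + d + e \<le> m \<Longrightarrow>
    path p (d + e) = Comp C (Es ! p) (Es ! (p + d)) (Es ! (p + d + e)) (path (p + d) e) (path p d)"
proof (induction e)
  case 0
  then show ?case by (simp add: Idt_Comp Es_Obj path_Hom)
next
  case (Suc e)
  have "Comp C (Es ! p) (Es ! (p + d)) (Es ! (p + d + Suc e))
      (Comp C (Es ! (p + d)) (Es ! (p + d + e)) (Es ! (p + d + Suc e)) (fs ! (p + d + e)) (path (p + d) e)) (path p d) =
    Comp C (Es ! p) (Es ! (p + d + e)) (Es ! (p + d + Suc e)) (fs ! (p + d + e))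
      (Comp C (Es ! p) (Es ! (p + d)) (Es ! (p + d + e)) (path (p + d) e) (path p d))"
    using Suc.prems path_Hom[of p d] path_Hom[of "p + d" e] fs_Hom[of "p + d + e"]
    by (intro Comp_assoc Es_Obj) auto
  then show ?case using Suc by (simp add: add.assoc)
qed

lemma path_one: "p < m \<Longrightarrow> path p (Suc 0) = fs ! p"
  using fs_Hom[of p] by (simp add: Comp_Idt Es_Obj)

lemma path_split:
  assumes "p \<le> q" "q \<le> r" "r \<le> m"
  shows "path p (r - p) = Comp C (Es ! p) (Es ! q) (Es ! r) (path q (r - q)) (path p (q - p))"
  using path_add[of p "q - p" "r - q"] assms by simp

lemma path_Hom': "p \<le> q \<Longrightarrow> q \<le> m \<Longrightarrow> path p (q - p) \<in> Hom C (Es ! p) (Es ! q)"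
  using path_Hom[of p "q - p"] by simp

lemma sact_simplex:
  assumes \<theta>: "\<theta> \<in> ord_maps k m"
  shows "sact (nerve C) k m \<theta> (Es, fs) \<in> simplices (nerve C) k"
  using ord_maps_le[OF \<theta>] ord_maps_mono[OF \<theta>]
  by (auto simp: nerve_def less_Suc_eq_le intro!: Es_Obj path_Hom' simp del: upt_Suc)

text \<open>Composites of composites: by \<open>path_split\<close> the consecutive arrows of the new
  simplex join to one path of the old. Where \<open>\<theta>\<close> repeats a value, the path has
  length 0 and is the identity.\<close>

lemma path_sact:
  assumes \<theta>: "\<theta> \<in> ord_maps k m"
  shows "p + d \<le> k \<Longrightarrow> nerve_path C (sact (nerve C) k m \<theta> (Es, fs)) p d = path (\<theta> p) (\<theta> (p + d) - \<theta> p)"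
proof (induction d)
  case 0
  then show ?case by (simp add: nerve_def less_Suc_eq_le del: upt_Suc)
next
  case (Suc d)
  have "path (\<theta> p) (\<theta> (Suc (p + d)) - \<theta> p) = Comp C (Es ! \<theta> p) (Es ! \<theta> (p + d)) (Es ! \<theta> (Suc (p + d)))
     (path (\<theta> (p + d)) (\<theta> (Suc (p + d)) - \<theta> (p + d))) (path (\<theta> p) (\<theta> (p + d) - \<theta> p))"
    using Suc.prems by (intro path_split ord_maps_mono[OF \<theta>] ord_maps_le[OF \<theta>]) auto
  then show ?case using Suc by (simp add: nerve_def del: upt_Suc)
qed

lemma sact_id: "sact (nerve C) m m (restrict id {..m}) (Es, fs) = (Es, fs)"
proof -
  have "map (\<lambda>j. Es ! restrict id {..m} j) [0..<Suc m] = Es"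
    by (rule nth_equalityI) (simp_all add: length_Es del: upt_Suc)
  moreover have "map (\<lambda>j. path (restrict id {..m} j) (restrict id {..m} (Suc j) - restrict id {..m} j)) [0..<m] = fs"
    by (rule nth_equalityI) (simp_all add: length_fs path_one Suc_diff_le del: nerve_path.simps(2))
  ultimately show ?thesis by (simp add: nerve_def del: upt_Suc)
qed

lemma sact_compose:
  assumes \<theta>: "\<theta> \<in> ord_maps k l" and \<eta>: "\<eta> \<in> ord_maps l m"
  shows "sact (nerve C) k m (compose {..k} \<eta> \<theta>) (Es, fs) =
    sact (nerve C) k l \<theta> (sact (nerve C) l m \<eta> (Es, fs))"
proof (rule prod_eqI)
  show "fst (sact (nerve C) k m (compose {..k} \<eta> \<theta>) (Es, fs)) =
      fst (sact (nerve C) k l \<theta> (sact (nerve C) l m \<eta> (Es, fs)))"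
    using ord_maps_le[OF \<theta>] by (auto simp: nerve_def compose_def less_Suc_eq_le simp del: upt_Suc)
  have "snd (sact (nerve C) k l \<theta> (sact (nerve C) l m \<eta> (Es, fs))) =
      map (\<lambda>j. nerve_path C (sact (nerve C) l m \<eta> (Es, fs)) (\<theta> j) (\<theta> (Suc j) - \<theta> j)) [0..<k]"
    by (simp add: nerve_def)
  also have "\<dots> = map (\<lambda>j. path (\<eta> (\<theta> j)) (\<eta> (\<theta> (Suc j)) - \<eta> (\<theta> j))) [0..<k]"
  proof (rule map_cong[OF refl])
    fix j assume "j \<in> set [0..<k]"
    then have "\<theta> j \<le> \<theta> (Suc j)" "\<theta> (Suc j) \<le> l"
      using ord_maps_mono[OF \<theta>, of j "Suc j"] ord_maps_le[OF \<theta>, of "Suc j"] by auto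
    then show "nerve_path C (sact (nerve C) l m \<eta> (Es, fs)) (\<theta> j) (\<theta> (Suc j) - \<theta> j) =
        path (\<eta> (\<theta> j)) (\<eta> (\<theta> (Suc j)) - \<eta> (\<theta> j))"
      using path_sact[OF \<eta>, of "\<theta> j" "\<theta> (Suc j) - \<theta> j"] by simp
  qed
  also have "\<dots> = snd (sact (nerve C) k m (compose {..k} \<eta> \<theta>) (Es, fs))"
    by (simp add: nerve_def compose_def)
  finally show "snd (sact (nerve C) k m (compose {..k} \<eta> \<theta>) (Es, fs)) =
      snd (sact (nerve C) k l \<theta> (sact (nerve C) l m \<eta> (Es, fs)))" by simp
qed

end

lemma simplicial_set_nerve:
  assumes C: "is_category C"
  shows "simplicial_set (nerve C)"
  unfolding simplicial_set_def
proof (intro conjI allI ballI funcsetI)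
  fix k m \<theta> \<sigma> assume \<theta>: "\<theta> \<in> ord_maps k m" and \<sigma>: "\<sigma> \<in> simplices (nerve C) m"
  obtain Es fs where s: "\<sigma> = (Es, fs)" by (cases \<sigma>)
  interpret nerve_simplex C m Es fs using C \<sigma> by unfold_locales (simp_all add: s)
  show "sact (nerve C) k m \<theta> \<sigma> \<in> simplices (nerve C) k" unfolding s by (rule sact_simplex[OF \<theta>])
next
  fix m \<sigma> assume \<sigma>: "\<sigma> \<in> simplices (nerve C) m"
  obtain Es fs where s: "\<sigma> = (Es, fs)" by (cases \<sigma>)
  interpret nerve_simplex C m Es fs using C \<sigma> by unfold_locales (simp_all add: s)
  show "sact (nerve C) m m (restrict id {..m}) \<sigma> = \<sigma>" unfolding s by (rule sact_id)
next
  fix k m n \<theta> \<eta> \<sigma>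
  assume \<theta>: "\<theta> \<in> ord_maps k m" and \<eta>: "\<eta> \<in> ord_maps m n" and \<sigma>: "\<sigma> \<in> simplices (nerve C) n"
  obtain Es fs where s: "\<sigma> = (Es, fs)" by (cases \<sigma>)
  interpret nerve_simplex C n Es fs using C \<sigma> by unfold_locales (simp_all add: s)
  show "sact (nerve C) k n (compose {..k} \<eta> \<theta>) \<sigma> = sact (nerve C) k m \<theta> (sact (nerve C) m n \<eta> \<sigma>)"
    unfolding s by (rule sact_compose[OF \<theta> \<eta>])
qed

text \<open>The morphism part \<open>M\<close> takes no objects as arguments: the pullback of a
  bundle map is precomposition, which does not mention the bundles.\<close>

definition is_functor ::
  "('o, 'm) category \<Rightarrow> ('p, 'n) category \<Rightarrow> ('o \<Rightarrow> 'p) \<Rightarrow> ('m \<Rightarrow> 'n) \<Rightarrow> bool" where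
  "is_functor C C' F M \<longleftrightarrow>
     (\<forall>X\<in>Obj C. F X \<in> Obj C' \<and> M (Idt C X) = Idt C' (F X)) \<and>
     (\<forall>X\<in>Obj C. \<forall>Y\<in>Obj C. \<forall>f\<in>Hom C X Y. M f \<in> Hom C' (F X) (F Y)) \<and>
     (\<forall>X\<in>Obj C. \<forall>Y\<in>Obj C. \<forall>Z\<in>Obj C. \<forall>f\<in>Hom C X Y. \<forall>g\<in>Hom C Y Z.
        M (Comp C X Y Z g f) = Comp C' (F X) (F Y) (F Z) (M g) (M f))"

lemma functor_nerve_path:
  assumes C: "is_category C" and F: "is_functor C C' F M" and \<sigma>: "(Es, fs) \<in> simplices (nerve C) m"
  shows "p + d \<le> m \<Longrightarrow> nerve_path C' (map F Es, map M fs) p d = M (nerve_path C (Es, fs) p d)"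
proof (induction d)
  interpret nerve_simplex C m Es fs using C \<sigma> by unfold_locales
  {
    case 0
    then show ?case using F Es_Obj[of p] length_Es by (simp add: is_functor_def)
  next
    case (Suc d)
    have "M (Comp C (Es ! p) (Es ! (p + d)) (Es ! (p + Suc d)) (fs ! (p + d)) (path p d)) =
        Comp C' (F (Es ! p)) (F (Es ! (p + d))) (F (Es ! (p + Suc d))) (M (fs ! (p + d))) (M (path p d))"
      using F Es_Obj[of p] Es_Obj[of "p + d"] Es_Obj[of "p + Suc d"] Suc.prems path_Hom[of p d] fs_Hom[of "p + d"]
      unfolding is_functor_def by (elim conjE) simp
    then show ?case using Suc length_Es length_fs by simp
  }
qed

lemma simplicial_map_nerve:
  assumes C: "is_category C" and F: "is_functor C C' F M"
  shows "simplicial_map (nerve C) (nerve C') (\<lambda>k (Es, fs). (map F Es, map M fs))"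
  unfolding simplicial_map_def
proof (intro conjI allI ballI funcsetI)
  fix m \<sigma> assume \<sigma>: "\<sigma> \<in> simplices (nerve C) m"
  obtain Es fs where s: "\<sigma> = (Es, fs)" by (cases \<sigma>)
  interpret nerve_simplex C m Es fs using C \<sigma> by unfold_locales (simp_all add: s)
  have "M (fs ! i) \<in> Hom C' (F (Es ! i)) (F (Es ! Suc i))" if "i < m" for i
    using F Es_Obj[of i] Es_Obj[of "Suc i"] fs_Hom[of i] that unfolding is_functor_def by simp
  moreover have "F X \<in> Obj C'" if "X \<in> set Es" for X
    using F Es_Obj that length_Es unfolding is_functor_def by (metis in_set_conv_nth less_Suc_eq_le)
  ultimately show "(case \<sigma> of (Es, fs) \<Rightarrow> (map F Es, map M fs)) \<in> simplices (nerve C') m"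
    using length_Es length_fs by (auto simp: s nerve_def)
next
  fix k m \<theta> \<sigma> assume \<theta>: "\<theta> \<in> ord_maps k m" and \<sigma>: "\<sigma> \<in> simplices (nerve C) m"
  obtain Es fs where s: "\<sigma> = (Es, fs)" by (cases \<sigma>)
  interpret nerve_simplex C m Es fs using C \<sigma> by unfold_locales (simp_all add: s)
  have "M (path (\<theta> j) (\<theta> (Suc j) - \<theta> j)) = nerve_path C' (map F Es, map M fs) (\<theta> j) (\<theta> (Suc j) - \<theta> j)"
    if "j < k" for j
    using functor_nerve_path[OF C F, of Es fs m "\<theta> j" "\<theta> (Suc j) - \<theta> j"] \<sigma> s
      ord_maps_mono[OF \<theta>, of j "Suc j"] ord_maps_le[OF \<theta>, of "Suc j"] that by simp
  moreover have "F (Es ! \<theta> j) = map F Es ! \<theta> j" if "j < Suc k" for j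
    using ord_maps_le[OF \<theta>, of j] length_Es that by simp
  ultimately show "(case sact (nerve C) k m \<theta> \<sigma> of (Es, fs) \<Rightarrow> (map F Es, map M fs)) =
      sact (nerve C') k m \<theta> (case \<sigma> of (Es, fs) \<Rightarrow> (map F Es, map M fs))"
    by (simp add: s nerve_def del: upt_Suc)
qed

section \<open>The presheaf of bundles with connections\<close>

lemma isos_maps: "f \<in> hol_bundle_isos U E F \<Longrightarrow> f \<in> hol_bundle_maps U E F"
  by (simp add: hol_bundle_isos_def)

lemma isos_inverse:
  assumes "f \<in> hol_bundle_isos U E F"
  obtains g where "g \<in> hol_bundle_maps U F E" "bundle_comp U E g f = bundle_id U E" "bundle_comp U F f g = bundle_id U F"
  using assms by (auto simp: hol_bundle_isos_def)

lemma isosI: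
  assumes "f \<in> hol_bundle_maps U E F" "g \<in> hol_bundle_maps U F E"
    "bundle_comp U E g f = bundle_id U E" "bundle_comp U F f g = bundle_id U F"
  shows "f \<in> hol_bundle_isos U E F"
  using assms by (auto simp: hol_bundle_isos_def)

lemma bundle_comp_assoc:
  assumes "f \<in> hol_bundle_maps U E F"
  shows "bundle_comp U E (bundle_comp U F h g) f = bundle_comp U E h (bundle_comp U E g f)"
proof (rule ext)
  fix x
  show "bundle_comp U E (bundle_comp U F h g) f x = bundle_comp U E h (bundle_comp U E g f) x"
    using linear_on_closed[OF bundle_maps_linear[OF assms, of x]]
    by (auto simp: bundle_comp_def compose_def restrict_def fun_eq_iff)
qed

lemma bundle_comp_id:
  assumes "f \<in> hol_bundle_maps U E F"
  shows "bundle_comp U E f (bundle_id U E) = f" "bundle_comp U E (bundle_id U F) f = f"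
proof -
  show "bundle_comp U E f (bundle_id U E) = f"
  proof (rule extensionalityI[OF _ bundle_maps_extensional[OF assms]])
    fix x assume "x \<in> points U"
    then show "bundle_comp U E f (bundle_id U E) x = f x"
      using bundle_maps_fibre_extensional[OF assms, of x]
      by (auto simp: bundle_comp_def bundle_id_def compose_def restrict_def fun_eq_iff extensional_def)
  qed (simp add: bundle_comp_def)
  show "bundle_comp U E (bundle_id U F) f = f"
  proof (rule extensionalityI[OF _ bundle_maps_extensional[OF assms]])
    fix x assume "x \<in> points U"
    then show "bundle_comp U E (bundle_id U F) f x = f x"
      using bundle_maps_fibre_extensional[OF assms, of x] linear_on_closed[OF bundle_maps_linear[OF assms, of x]]
      by (auto simp: bundle_comp_def bundle_id_def compose_def restrict_def fun_eq_iff extensional_def)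
  qed (simp add: bundle_comp_def)
qed

context cmanifold
begin

lemma bundle_comp_isos:
  assumes E: "hol_bundle U E" and F: "hol_bundle U F" and G: "hol_bundle U G"
    and f: "f \<in> hol_bundle_isos U E F" and g: "g \<in> hol_bundle_isos U F G"
  shows "bundle_comp U E g f \<in> hol_bundle_isos U E G"
proof -
  obtain f' where f': "f' \<in> hol_bundle_maps U F E" "bundle_comp U E f' f = bundle_id U E" "bundle_comp U F f f' = bundle_id U F"
    using f by (rule isos_inverse)
  obtain g' where g': "g' \<in> hol_bundle_maps U G F" "bundle_comp U F g' g = bundle_id U F" "bundle_comp U G g g' = bundle_id U G"
    using g by (rule isos_inverse)
  note fm = isos_maps[OF f] and gm = isos_maps[OF g]
  note gf = bundle_comp_maps[OF E F G fm gm] and fg' = bundle_comp_maps[OF G F E g'(1) f'(1)]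
  have "bundle_comp U E (bundle_comp U G f' g') (bundle_comp U E g f) =
      bundle_comp U E (bundle_comp U F (bundle_comp U G f' g') g) f"
    by (rule bundle_comp_assoc[OF fm, symmetric])
  also have "\<dots> = bundle_id U E"
    by (simp add: bundle_comp_assoc[OF gm] g'(2) bundle_comp_id(1)[OF f'(1)] f'(2))
  finally have 1: "bundle_comp U E (bundle_comp U G f' g') (bundle_comp U E g f) = bundle_id U E" .
  have "bundle_comp U G (bundle_comp U E g f) (bundle_comp U G f' g') =
      bundle_comp U G (bundle_comp U F (bundle_comp U E g f) f') g'"
    by (rule bundle_comp_assoc[OF g'(1), symmetric])
  also have "\<dots> = bundle_id U G"
    by (simp add: bundle_comp_assoc[OF f'(1)] f'(3) bundle_comp_id(1)[OF gm] g'(3))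
  finally show ?thesis using isosI[OF gf fg' 1] by simp
qed

lemma bundle_id_isos: "hol_bundle U E \<Longrightarrow> bundle_id U E \<in> hol_bundle_isos U E E"
  using bundle_comp_id(1)[OF bundle_id_maps] bundle_id_maps by (intro isosI) auto

lemma isos_bij:
  assumes f: "f \<in> hol_bundle_isos U E F" and x: "x \<in> points U"
  shows "bij_betw (f x) (carrier (fibre E x)) (carrier (fibre F x))"
proof -
  obtain g where g: "g \<in> hol_bundle_maps U F E" "bundle_comp U E g f = bundle_id U E" "bundle_comp U F f g = bundle_id U F"
    using f by (rule isos_inverse)
  note fc = linear_on_closed[OF bundle_maps_linear[OF isos_maps[OF f] x]]
  note gc = linear_on_closed[OF bundle_maps_linear[OF g(1) x]]
  have "g x (f x e) = e" if "e \<in> carrier (fibre E x)" for e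
    using fun_cong[OF g(2), of x] bundle_comp_apply[OF x that] bundle_id_apply[OF x that] by metis
  moreover have "f x (g x e) = e" if "e \<in> carrier (fibre F x)" for e
    using fun_cong[OF g(3), of x] bundle_comp_apply[OF x that] bundle_id_apply[OF x that] by metis
  ultimately show ?thesis
    by (intro bij_betwI[where g = "g x"]) (auto intro: fc gc)
qed

text \<open>The trace formula inverts an isomorphism by \<open>inv_into\<close> in each fibre, while
  holomorphy is known for the inverse bundle map contained in the notion of isomorphism. The two
  agree fibrewise because the isomorphism is a bijection there.\<close>

lemma isos_inv_into_hol_fun:
  assumes E: "hol_bundle U E" and F: "hol_bundle U F" and f: "f \<in> hol_bundle_isos U E F"
    and T: "(D, r, t) \<in> trivs F" and T': "(D', r', t') \<in> trivs E" and j: "j < r" and i: "i < r'"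
  shows "hol_fun U (D \<inter> D') (\<lambda>x. t' x (inv_into (carrier (fibre E x)) (f x) (frame F (D, r, t) j x)) i)"
proof -
  obtain g where g: "g \<in> hol_bundle_maps U F E" "bundle_comp U E g f = bundle_id U E" "bundle_comp U F f g = bundle_id U F"
    using f by (rule isos_inverse)
  show ?thesis
  proof (rule hol_fun_cong[OF _ _ bundle_maps_hol_fun[OF g(1) T T' j i]])
    show "openin (mtop U) (D \<inter> D')" by (intro openin_Int triv_open[OF F T] triv_open[OF E T'])
    fix x assume "x \<in> D \<inter> D'"
    then have x: "x \<in> D" "x \<in> points U" using triv_points[OF F T] by auto
    have e: "frame F (D, r, t) j x \<in> carrier (fibre F x)" by (rule frame_closed[OF F T x(1) j])
    have "f x (g x (frame F (D, r, t) j x)) = frame F (D, r, t) j x"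
      using fun_cong[OF g(3), of x] bundle_comp_apply[OF x(2) e] bundle_id_apply[OF x(2) e] by metis
    moreover have "g x (frame F (D, r, t) j x) \<in> carrier (fibre E x)"
      by (rule linear_on_closed[OF bundle_maps_linear[OF g(1) x(2)] e])
    ultimately have "inv_into (carrier (fibre E x)) (f x) (frame F (D, r, t) j x) = g x (frame F (D, r, t) j x)"
      using isos_bij[OF f x(2)] by (metis bij_betw_imp_inj_on inv_into_f_f)
    then show "t' x (g x (frame F (D, r, t) j x)) i = t' x (inv_into (carrier (fibre E x)) (f x) (frame F (D, r, t) j x)) i"
      by simp
  qed
qed

lemma hvb_category: "is_category (hvb_groupoid U)"
proof -
  have "\<forall>X\<in>Obj (hvb_groupoid U). Idt (hvb_groupoid U) X \<in> Hom (hvb_groupoid U) X X"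
    by (auto simp: hvb_groupoid_def bundle_id_isos)
  moreover have "\<forall>X\<in>Obj (hvb_groupoid U). \<forall>Y\<in>Obj (hvb_groupoid U). \<forall>Z\<in>Obj (hvb_groupoid U).
    \<forall>f\<in>Hom (hvb_groupoid U) X Y. \<forall>g\<in>Hom (hvb_groupoid U) Y Z. Comp (hvb_groupoid U) X Y Z g f \<in> Hom (hvb_groupoid U) X Z"
    using bundle_comp_isos by (auto simp: hvb_groupoid_def)
  ultimately show ?thesis
    unfolding is_category_def
    by (intro conjI) (auto simp: hvb_groupoid_def intro: bundle_comp_id bundle_comp_assoc dest!: isos_maps)
qed

end

lemma (in cman_map) pull_isos:
  assumes E: "hol_bundle V E" and F: "hol_bundle V F" and f: "f \<in> hol_bundle_isos V E F"
  shows "(\<lambda>x\<in>points U. f (g x)) \<in> hol_bundle_isos U (pb E) (pb F)"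
proof -
  obtain h where h: "h \<in> hol_bundle_maps V F E" "bundle_comp V E h f = bundle_id V E" "bundle_comp V F f h = bundle_id V F"
    using f by (rule isos_inverse)
  show ?thesis
  proof (rule isosI[OF pull_bundle_map[OF E F isos_maps[OF f]] pull_bundle_map[OF F E h(1)]])
    show "bundle_comp U (pb E) (\<lambda>x\<in>points U. h (g x)) (\<lambda>x\<in>points U. f (g x)) = bundle_id U (pb E)"
      unfolding pull_bundle_comp[symmetric] h(2) by (rule pull_bundle_id)
    show "bundle_comp U (pb F) (\<lambda>x\<in>points U. f (g x)) (\<lambda>x\<in>points U. h (g x)) = bundle_id U (pb F)"
      unfolding pull_bundle_comp[symmetric] h(3) by (rule pull_bundle_id)
  qed
qed

abbreviation pull_object :: "'a cman \<Rightarrow> 'b cman \<Rightarrow> ('a \<Rightarrow> 'b) \<Rightarrow> ('b, 'v) hvb_object \<Rightarrow> ('a, 'v) hvb_object" where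
  "pull_object U V g \<equiv> \<lambda>(E, nab). (pull_bundle U V g E, pull_connection U V g E nab)"

lemma (in cman_map) pull_functor:
  "is_functor (hvb_groupoid V) (hvb_groupoid U) (pull_object U V g) (\<lambda>f. \<lambda>x\<in>points U. f (g x))"
  unfolding is_functor_def hvb_groupoid_def
  by (auto simp: pull_hol_bundle pull_hol_connection pull_isos pull_bundle_id pull_bundle_comp)

lemma simplicial_presheaf_HVB: "simplicial_presheaf (HVB :: ('a, ('a, 'v) hvb_simplex) presheaf)"
  unfolding simplicial_presheaf_def
proof (intro conjI allI impI ballI)
  fix U :: "'a cman" assume "complex_manifold U"
  then interpret cmanifold U by unfold_locales
  show "simplicial_set (pobj (HVB :: ('a, ('a, 'v) hvb_simplex) presheaf) U)"
    unfolding HVB_def presheaf.simps by (rule simplicial_set_nerve[OF hvb_category])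
next
  fix U V :: "'a cman" and g assume "g \<in> hol_maps U V" "complex_manifold U \<and> complex_manifold V"
  then interpret cman_map U V g by unfold_locales auto
  show "simplicial_map (pobj (HVB :: ('a, ('a, 'v) hvb_simplex) presheaf) V) (pobj HVB U) (pmap HVB U V g)"
    using simplicial_map_nerve[OF V.hvb_category pull_functor] by (simp add: HVB_def)
next
  fix U :: "'a cman" and k and \<sigma> :: "('a, 'v) hvb_simplex"
  assume \<sigma>: "\<sigma> \<in> simplices (pobj HVB U) k" and "complex_manifold U"
  then interpret cmanifold U by unfold_locales
  obtain Es fs where s: "\<sigma> = (Es, fs)" by (cases \<sigma>)
  interpret nerve_simplex "hvb_groupoid U" k Es fs
    using hvb_category \<sigma> by unfold_locales (simp_all add: s HVB_def)
  have "map (pull_object U U (restrict id (points U))) Es = Es"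
  proof (rule nth_equalityI)
    fix i assume "i < length (map (pull_object U U (restrict id (points U))) Es)"
    then have "i < length Es" "Es ! i \<in> Obj (hvb_groupoid U)" using Es_Obj[of i] length_Es by auto
    then show "map (pull_object U U (restrict id (points U))) Es ! i = Es ! i"
      by (auto simp: hvb_groupoid_def pull_bundle_identity pull_connection_identity)
  qed simp
  moreover have "map (\<lambda>f. \<lambda>x\<in>points U. f (restrict id (points U) x)) fs = fs"
  proof (rule nth_equalityI)
    fix i assume "i < length (map (\<lambda>f. \<lambda>x\<in>points U. f (restrict id (points U) x)) fs)"
    then have i: "i < length fs" "fs ! i \<in> Hom (hvb_groupoid U) (Es ! i) (Es ! Suc i)"
      using fs_Hom[of i] length_fs by auto
    then have "fs ! i \<in> extensional (points U)"
      by (auto simp: hvb_groupoid_def dest!: isos_maps bundle_maps_extensional)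
    then have "(\<lambda>x\<in>points U. (fs ! i) (restrict id (points U) x)) = fs ! i"
      by (intro extensionalityI[where A = "points U"]) auto
    then show "map (\<lambda>f. \<lambda>x\<in>points U. f (restrict id (points U) x)) fs ! i = fs ! i" using i(1) by simp
  qed simp
  ultimately show "pmap HVB U U (restrict id (points U)) k \<sigma> = \<sigma>" by (simp add: HVB_def s)
next
  fix U V W :: "'a cman" and k g h and \<sigma> :: "('a, 'v) hvb_simplex"
  assume \<sigma>: "\<sigma> \<in> simplices (pobj HVB W) k" and g: "g \<in> hol_maps U V" and h: "h \<in> hol_maps V W"
    and man: "complex_manifold U \<and> complex_manifold V \<and> complex_manifold W"
  then interpret G: cman_map U V g by unfold_locales auto
  from man h interpret H: cman_map V W h by unfold_locales auto
  obtain Es fs where s: "\<sigma> = (Es, fs)" by (cases \<sigma>)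
  interpret nerve_simplex "hvb_groupoid W" k Es fs
    using H.V.hvb_category \<sigma> by unfold_locales (simp_all add: s HVB_def)
  have "pull_object U W (compose (points U) h g) X = pull_object U V g (pull_object V W h X)" if "X \<in> set Es" for X
  proof -
    have "X \<in> Obj (hvb_groupoid W)" using that Es_Obj length_Es by (metis in_set_conv_nth less_Suc_eq_le)
    then show ?thesis
      using pull_bundle_compose[OF G.cman_map_axioms H.cman_map_axioms]
        pull_connection_compose[OF G.cman_map_axioms H.cman_map_axioms]
      by (auto simp: hvb_groupoid_def)
  qed
  moreover have "(\<lambda>x\<in>points U. f (compose (points U) h g x)) = (\<lambda>x\<in>points U. (\<lambda>y\<in>points V. f (h y)) (g x))"
    for f :: "('a, 'v) bundle_map"
    by (rule restrict_ext) (simp add: compose_def G.g_points)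
  ultimately show "pmap HVB U W (compose (points U) h g) k \<sigma> = pmap HVB U V g k (pmap HVB V W h k \<sigma>)"
    by (simp add: HVB_def s)
qed

section \<open>Normalized chains of the simplex and the Dold-Kan construction\<close>

abbreviation face :: "nat list \<Rightarrow> nat \<Rightarrow> nat list" where
  "face I j \<equiv> take j I @ drop (Suc j) I"

lemma face_gens:
  assumes "I \<in> simplex_gens k (Suc l)" "j \<le> Suc l"
  shows "face I j \<in> simplex_gens k l"
proof -
  have "sorted_wrt (<) (take j I @ drop j I)" using assms by (simp add: simplex_gens_def)
  then have "sorted_wrt (<) (take j I @ drop (Suc j) I)"
    using assms(2) sorted_wrt_drop[of "(<)" "drop j I" 1]
    by (auto simp: sorted_wrt_append simp del: append_take_drop_id) (use in_set_dropD[of _ 1 "drop j I"] in \<open>auto\<close>)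
  then show ?thesis
    using assms by (auto simp: simplex_gens_def dest: in_set_takeD in_set_dropD)
qed

lemma map_face: "map \<theta> (face I j) = face (map \<theta> I) j"
  by (simp add: take_map drop_map)

text \<open>Two of the faces of a degenerate simplex agree, with opposite signs; the others are degenerate.\<close>

lemma degenerate_boundary:
  assumes len: "length L = Suc (Suc l)" and L: "sorted L" "\<not> distinct (L :: nat list)"
  shows "(\<Sum>j\<le>Suc l. frag_cmul ((-1) ^ j) (if distinct (face L j) then frag_of (face L j) else 0)) = 0"
proof -
  have "\<not> sorted_wrt (<) L" using L by (simp add: strict_sorted_iff)
  moreover have "transp ((<) :: nat \<Rightarrow> nat \<Rightarrow> bool)" by (auto simp: transp_def)
  \<comment> \<open>A repetition in a sorted list shows up at two neighbouring positions.\<close>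
  ultimately obtain i where i: "Suc i < length L" "\<not> L ! i < L ! Suc i"
    using sorted_wrt_iff_nth_Suc_transp by blast
  moreover have "L ! i \<le> L ! Suc i" using L(1) i(1) by (simp add: sorted_nth_mono)
  ultimately have eq: "L ! i = L ! Suc i" by simp
  let ?g = "\<lambda>j. frag_cmul ((-1) ^ j) (if distinct (face L j) then frag_of (face L j) else 0)"
  \<comment> \<open>If \<open>j\<close> lies before \<open>i\<close>, the two equal entries are both
    in the dropped part; if it lies after \<open>Suc i\<close>, both are in the taken part.\<close>
  have zero: "?g j = 0" if j: "j \<notin> {i, Suc i}" "j \<le> Suc l" for j
  proof (cases "j < i")
    case True
    obtain d where d: "i = Suc j + d" using True less_iff_Suc_add by auto
    have "drop (Suc j) L ! d = drop (Suc j) L ! Suc d" "Suc d < length (drop (Suc j) L)"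
      using i eq by (simp_all add: d)
    then have "\<not> distinct (drop (Suc j) L)"
      using nth_eq_iff_index_eq[of "drop (Suc j) L" d "Suc d"] by linarith
    then show ?thesis by simp
  next
    case False
    then have "Suc i < j" using j by auto
    then have "take j L ! i = take j L ! Suc i" "Suc i < length (take j L)"
      using i eq by simp_all
    then have "\<not> distinct (take j L)"
      using nth_eq_iff_index_eq[of "take j L" i "Suc i"] by linarith
    then show ?thesis by simp
  qed
  have "take (Suc i) L = take i L @ [L ! i]" using i by (simp add: take_Suc_conv_app_nth)
  moreover have "drop (Suc i) L = L ! Suc i # drop (Suc (Suc i)) L" using i by (simp add: Cons_nth_drop_Suc)
  ultimately have same: "face L i = face L (Suc i)" using eq by simp
  have "(\<Sum>j\<le>Suc l. ?g j) = (\<Sum>j\<in>{i, Suc i}. ?g j)"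
    using i len zero by (intro sum.mono_neutral_right) auto
  also have "\<dots> = ?g i + ?g (Suc i)" by simp
  also have "?g (Suc i) = - ?g i" unfolding same by simp
  finally show ?thesis by (simp only: right_minus)
qed

lemma sorted_map_ord:
  assumes \<theta>: "\<theta> \<in> ord_maps k m" and I: "I \<in> simplex_gens k l"
  shows "sorted (map \<theta> I)"
proof -
  have "mono_on (set I) \<theta>"
    using \<theta> I by (auto simp: ord_maps_def simplex_gens_def intro: mono_on_subset)
  moreover have "sorted I" using I by (simp add: simplex_gens_def strict_sorted_iff)
  ultimately show ?thesis by (auto simp: sorted_wrt_map sorted_wrt_iff_nth_less mono_on_def)
qed

lemma simplex_map_gens:
  assumes \<theta>: "\<theta> \<in> ord_maps k m" and I: "I \<in> simplex_gens k l" "distinct (map \<theta> I)"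
  shows "map \<theta> I \<in> simplex_gens m l"
  using sorted_map_ord[OF \<theta> I(1)] I ord_maps_le[OF \<theta>]
  by (auto simp: simplex_gens_def strict_sorted_iff simp del: sorted_map)

abbreviation boundary :: "nat \<Rightarrow> nat list \<Rightarrow> (nat list \<Rightarrow>\<^sub>0 int)" where
  "boundary l I \<equiv> \<Sum>j\<le>Suc l. frag_cmul ((-1) ^ j) (frag_of (face I j))"

lemma cgrp_simplex: "cgrp (simplex_complex k) l = free_Abelian_group (simplex_gens k l)"
  and cdiff_simplex: "cdiff (simplex_complex k) l = frag_extend (boundary l)"
  by (simp_all add: simplex_complex_def)

lemma keys_boundary:
  assumes "I \<in> simplex_gens k (Suc l)"
  shows "Poly_Mapping.keys (boundary l I) \<subseteq> simplex_gens k l"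
proof -
  have "boundary l I \<in> carrier (free_Abelian_group (simplex_gens k l))"
    by (rule sum_closed_free_Abelian_group) (use face_gens[OF assms] in \<open>auto simp: keys_frag_of\<close>)
  then show ?thesis by simp
qed

lemma cdiff_simplex_closed:
  assumes "c \<in> carrier (cgrp (simplex_complex k) (Suc l))"
  shows "cdiff (simplex_complex k) l c \<in> carrier (cgrp (simplex_complex k) l)"
proof -
  have "Poly_Mapping.keys (frag_extend (boundary l) c) \<subseteq> (\<Union>I\<in>Poly_Mapping.keys c. Poly_Mapping.keys (boundary l I))"
    by (rule keys_frag_extend)
  also have "\<dots> \<subseteq> simplex_gens k l"
  proof (rule UN_least)
    fix I assume "I \<in> Poly_Mapping.keys c"
    then have "I \<in> simplex_gens k (Suc l)" using assms by (auto simp: cgrp_simplex)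
    then show "Poly_Mapping.keys (boundary l I) \<subseteq> simplex_gens k l" by (rule keys_boundary)
  qed
  finally show ?thesis by (simp only: cgrp_simplex cdiff_simplex carrier_free_Abelian_group_iff)
qed

lemma simplex_complex_map_of:
  "simplex_complex_map \<theta> (frag_of I) = (if distinct (map \<theta> I) then frag_of (map \<theta> I) else 0)"
  unfolding simplex_complex_map_def frag_extend_of ..

lemma simplex_complex_map_add: "simplex_complex_map \<theta> (a + b) = simplex_complex_map \<theta> a + simplex_complex_map \<theta> b"
  and simplex_complex_map_diff: "simplex_complex_map \<theta> (a - b) = simplex_complex_map \<theta> a - simplex_complex_map \<theta> b"
  and simplex_complex_map_cmul: "simplex_complex_map \<theta> (frag_cmul n a) = frag_cmul n (simplex_complex_map \<theta> a)"
  and simplex_complex_map_zero: "simplex_complex_map \<theta> 0 = 0"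
  by (simp_all add: simplex_complex_map_def frag_extend_add frag_extend_diff frag_extend_cmul)

lemma simplex_complex_map_closed:
  assumes \<theta>: "\<theta> \<in> ord_maps k m" and c: "c \<in> carrier (cgrp (simplex_complex k) l)"
  shows "simplex_complex_map \<theta> c \<in> carrier (cgrp (simplex_complex m) l)"
proof -
  have "Poly_Mapping.keys (simplex_complex_map \<theta> c) \<subseteq>
      (\<Union>I\<in>Poly_Mapping.keys c. Poly_Mapping.keys (if distinct (map \<theta> I) then frag_of (map \<theta> I) else 0 :: nat list \<Rightarrow>\<^sub>0 int))"
    unfolding simplex_complex_map_def by (rule keys_frag_extend)
  also have "\<dots> \<subseteq> simplex_gens m l"
  proof (rule UN_least)
    fix I assume "I \<in> Poly_Mapping.keys c"
    then have "I \<in> simplex_gens k l" using c by (auto simp: cgrp_simplex)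
    then show "Poly_Mapping.keys (if distinct (map \<theta> I) then frag_of (map \<theta> I) else 0 :: nat list \<Rightarrow>\<^sub>0 int) \<subseteq> simplex_gens m l"
      using simplex_map_gens[OF \<theta>, of I l] by (simp add: keys_frag_of)
  qed
  finally show ?thesis by (simp add: cgrp_simplex)
qed

text \<open>If \<open>\<theta>\<close> is injective on \<open>I\<close>, then the faces of the image
  are images of faces, all nondegenerate. Otherwise the right-hand side is 0, and
  \<open>degenerate_boundary\<close> shows the same for the left-hand side.\<close>

lemma simplex_complex_map_boundary:
  assumes \<theta>: "\<theta> \<in> ord_maps k m" and I: "I \<in> simplex_gens k (Suc l)"
  shows "simplex_complex_map \<theta> (boundary l I) = frag_extend (boundary l) (simplex_complex_map \<theta> (frag_of I))"
proof -
  let ?L = "map \<theta> I"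
  have "simplex_complex_map \<theta> (boundary l I) =
      (\<Sum>j\<le>Suc l. simplex_complex_map \<theta> (frag_cmul ((-1) ^ j) (frag_of (face I j))))"
    unfolding simplex_complex_map_def by (simp only: frag_extend_sum[OF finite_atMost] comp_def)
  also have "\<dots> = (\<Sum>j\<le>Suc l. frag_cmul ((-1) ^ j) (if distinct (face ?L j) then frag_of (face ?L j) else 0))"
    by (simp only: simplex_complex_map_cmul simplex_complex_map_of map_face)
  also have "\<dots> = frag_extend (boundary l) (if distinct ?L then frag_of ?L else 0)"
  proof (cases "distinct ?L")
    case True
    then have "distinct (face ?L j)" for j
      using set_take_disj_set_drop_if_distinct[of ?L j "Suc j"] by (simp del: distinct_map)
    then show ?thesis using True by (simp only: if_True frag_extend_of)
  next
    case False
    have "length ?L = Suc (Suc l)" using I by (simp add: simplex_gens_def)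
    from degenerate_boundary[OF this sorted_map_ord[OF \<theta> I] False] False
    show ?thesis by (simp only: if_False frag_extend_0)
  qed
  finally show ?thesis by (simp only: simplex_complex_map_of)
qed

lemma simplex_complex_map_cdiff:
  assumes \<theta>: "\<theta> \<in> ord_maps k m" and c: "c \<in> carrier (cgrp (simplex_complex k) (Suc l))"
  shows "simplex_complex_map \<theta> (cdiff (simplex_complex k) l c) = cdiff (simplex_complex m) l (simplex_complex_map \<theta> c)"
proof -
  have "Poly_Mapping.keys c \<subseteq> simplex_gens k (Suc l)" using c by (simp add: cgrp_simplex)
  then show ?thesis
    unfolding cdiff_simplex
  proof (induction c rule: frag_induction)
    case (one I)
    then show ?case by (simp only: frag_extend_of simplex_complex_map_boundary[OF \<theta>])
  qed (simp_all only: frag_extend_0 simplex_complex_map_zero frag_extend_diff simplex_complex_map_diff)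
qed

lemma simplex_complex_map_id:
  assumes "c \<in> carrier (cgrp (simplex_complex k) l)"
  shows "simplex_complex_map (restrict id {..k}) c = c"
proof -
  have "frag_extend (\<lambda>I. if distinct (map (restrict id {..k}) I) then frag_of (map (restrict id {..k}) I) else 0) c
      = frag_extend frag_of c"
  proof (rule frag_extend_eq)
    fix I assume "I \<in> Poly_Mapping.keys c"
    then have I: "I \<in> simplex_gens k l" using assms by (auto simp: cgrp_simplex)
    then have "map (restrict id {..k}) I = I" by (intro map_idI) (auto simp: simplex_gens_def)
    moreover have "distinct I" using I by (simp add: simplex_gens_def strict_sorted_iff)
    ultimately show "(if distinct (map (restrict id {..k}) I) then frag_of (map (restrict id {..k}) I) else 0) = frag_of I"
      by simp
  qed
  then show ?thesis unfolding simplex_complex_map_def using frag_expansion by metis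
qed

lemma simplex_complex_map_compose:
  assumes \<theta>: "\<theta> \<in> ord_maps k m" and c: "c \<in> carrier (cgrp (simplex_complex k) l)"
  shows "simplex_complex_map (compose {..k} \<eta> \<theta>) c = simplex_complex_map \<eta> (simplex_complex_map \<theta> c)"
proof -
  have "Poly_Mapping.keys c \<subseteq> simplex_gens k l" using c by (simp add: cgrp_simplex)
  then show ?thesis
  proof (induction c rule: frag_induction)
    case (one I)
    then have eq: "map (compose {..k} \<eta> \<theta>) I = map \<eta> (map \<theta> I)"
      by (auto simp: simplex_gens_def compose_def)
    show ?case
    proof (cases "distinct (map \<theta> I)")
      case True
      then show ?thesis unfolding simplex_complex_map_of eq by (simp only: simplex_complex_map_of if_True)
    next
      case False
      \<comment> \<open>A repetition created by \<open>\<theta>\<close> persists under any further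
        map, so both sides are 0.\<close>
      then have "\<not> distinct (map \<eta> (map \<theta> I))" by (metis distinct_map)
      then show ?thesis unfolding simplex_complex_map_of eq
        using False by (simp only: if_False simplex_complex_map_zero)
    qed
  qed (simp_all only: simplex_complex_map_zero simplex_complex_map_diff)
qed

lemma chain_mapsI:
  assumes "\<And>l. \<phi> l \<in> extensional (carrier (cgrp B l))"
    and "\<And>l c. c \<in> carrier (cgrp B l) \<Longrightarrow> \<phi> l c \<in> carrier (cgrp C l)"
    and "\<And>l a b. a \<in> carrier (cgrp B l) \<Longrightarrow> b \<in> carrier (cgrp B l) \<Longrightarrow>
       \<phi> l (a \<otimes>\<^bsub>cgrp B l\<^esub> b) = \<phi> l a \<otimes>\<^bsub>cgrp C l\<^esub> \<phi> l b"
    and "\<And>l c. c \<in> carrier (cgrp B (Suc l)) \<Longrightarrow> \<phi> l (cdiff B l c) = cdiff C l (\<phi> (Suc l) c)"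
  shows "\<phi> \<in> chain_maps B C"
  using assms by (auto simp: chain_maps_def hom_def)

lemma chain_maps:
  assumes "\<phi> \<in> chain_maps B C"
  shows chain_maps_extensional: "\<phi> l \<in> extensional (carrier (cgrp B l))"
    and chain_maps_closed: "c \<in> carrier (cgrp B l) \<Longrightarrow> \<phi> l c \<in> carrier (cgrp C l)"
    and chain_maps_mult: "a \<in> carrier (cgrp B l) \<Longrightarrow> b \<in> carrier (cgrp B l) \<Longrightarrow>
       \<phi> l (a \<otimes>\<^bsub>cgrp B l\<^esub> b) = \<phi> l a \<otimes>\<^bsub>cgrp C l\<^esub> \<phi> l b"
    and chain_maps_cdiff: "c \<in> carrier (cgrp B (Suc l)) \<Longrightarrow> \<phi> l (cdiff B l c) = cdiff C l (\<phi> (Suc l) c)"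
  using assms by (auto simp: chain_maps_def hom_def)

lemma simplex_mult_closed:
  assumes "a \<in> carrier (cgrp (simplex_complex k) l)" "b \<in> carrier (cgrp (simplex_complex k) l)"
  shows "a + b \<in> carrier (cgrp (simplex_complex k) l)"
proof -
  have "Poly_Mapping.keys (a + b) \<subseteq> Poly_Mapping.keys a \<union> Poly_Mapping.keys b" by (rule Poly_Mapping.keys_add)
  then show ?thesis using assms unfolding cgrp_simplex carrier_free_Abelian_group_iff by blast
qed

lemma DK_sact_chain_map:
  assumes \<theta>: "\<theta> \<in> ord_maps k m" and \<phi>: "\<phi> \<in> chain_maps (simplex_complex m) C"
  shows "sact (DK C) k m \<theta> \<phi> \<in> chain_maps (simplex_complex k) C"
proof (rule chain_mapsI)
  fix l
  note cl = simplex_complex_map_closed[OF \<theta>]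
  let ?S = "\<lambda>l. carrier (cgrp (simplex_complex k) l)"
  show "sact (DK C) k m \<theta> \<phi> l \<in> extensional (?S l)" by (simp add: DK_def)
  show "sact (DK C) k m \<theta> \<phi> l c \<in> carrier (cgrp C l)" if "c \<in> ?S l" for c
    using chain_maps_closed[OF \<phi> cl[OF that]] that by (simp add: DK_def)
  show "sact (DK C) k m \<theta> \<phi> l (a \<otimes>\<^bsub>cgrp (simplex_complex k) l\<^esub> b) =
      sact (DK C) k m \<theta> \<phi> l a \<otimes>\<^bsub>cgrp C l\<^esub> sact (DK C) k m \<theta> \<phi> l b" if ab: "a \<in> ?S l" "b \<in> ?S l" for a b
  proof -
    have "\<phi> l (simplex_complex_map \<theta> a + simplex_complex_map \<theta> b) =
        \<phi> l (simplex_complex_map \<theta> a) \<otimes>\<^bsub>cgrp C l\<^esub> \<phi> l (simplex_complex_map \<theta> b)"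
      using chain_maps_mult[OF \<phi> cl[OF ab(1)] cl[OF ab(2)]] by (simp add: cgrp_simplex)
    moreover have "a \<otimes>\<^bsub>cgrp (simplex_complex k) l\<^esub> b = a + b" by (simp add: cgrp_simplex)
    ultimately show ?thesis using ab simplex_mult_closed[OF ab] by (simp add: DK_def simplex_complex_map_add)
  qed
  show "sact (DK C) k m \<theta> \<phi> l (cdiff (simplex_complex k) l c) = cdiff C l (sact (DK C) k m \<theta> \<phi> (Suc l) c)"
    if c: "c \<in> ?S (Suc l)" for c
    using chain_maps_cdiff[OF \<phi> cl[OF c]] c cdiff_simplex_closed[OF c]
    by (simp add: DK_def simplex_complex_map_cdiff[OF \<theta> c])
qed

lemma simplicial_set_DK: "simplicial_set (DK C)"
  unfolding simplicial_set_def
proof (intro conjI allI ballI funcsetI)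
  fix k m \<theta> \<phi> assume "\<theta> \<in> ord_maps k m" "\<phi> \<in> simplices (DK C) m"
  then show "sact (DK C) k m \<theta> \<phi> \<in> simplices (DK C) k"
    using DK_sact_chain_map[of \<theta> k m \<phi> C] by (simp add: DK_def)
next
  fix k \<phi> assume "\<phi> \<in> simplices (DK C) k"
  then have \<phi>: "\<phi> \<in> chain_maps (simplex_complex k) C" by (simp add: DK_def)
  show "sact (DK C) k k (restrict id {..k}) \<phi> = \<phi>"
  proof (rule ext)
    fix l
    show "sact (DK C) k k (restrict id {..k}) \<phi> l = \<phi> l"
      by (rule extensionalityI[OF _ chain_maps_extensional[OF \<phi>]]) (simp_all add: DK_def simplex_complex_map_id)
  qed
next
  fix k m n \<theta> \<eta> \<phi> assume \<theta>: "\<theta> \<in> ord_maps k m"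
  show "sact (DK C) k n (compose {..k} \<eta> \<theta>) \<phi> = sact (DK C) k m \<theta> (sact (DK C) m n \<eta> \<phi>)"
    by (auto simp: DK_def fun_eq_iff restrict_def simplex_complex_map_compose[OF \<theta>] simplex_complex_map_closed[OF \<theta>])
qed

section \<open>The presheaf of forms\<close>

definition pull_uform :: "'a cman \<Rightarrow> 'b cman \<Rightarrow> ('a \<Rightarrow> 'b) \<Rightarrow> 'b uform \<Rightarrow> 'a uform" where
  "pull_uform U V g a = (\<lambda>q p. pull_form U V g (a q p))"

lemma carrier_uform: "carrier (cgrp (uform_complex U) l) = uforms U (- int l)"
  and mult_uform: "a \<otimes>\<^bsub>cgrp (uform_complex U) l\<^esub> b = (\<lambda>q p x vs. a q p x vs + b q p x vs)"
  and cdiff_uform: "cdiff (uform_complex U) l a = (\<lambda>q p x vs. 0)"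
  by (simp_all add: uform_complex_def)

lemma uforms_hol_forms: "a \<in> uforms U d \<Longrightarrow> a q p \<in> hol_forms U p"
  by (simp add: uforms_def)

lemma (in cman_map) pull_uform_closed:
  assumes a: "a \<in> uforms V d"
  shows "pull_uform U V g a \<in> uforms U d"
proof -
  have "{(q, p). pull_form U V g (a q p) \<noteq> (\<lambda>x vs. 0)} \<subseteq> {(q, p). a q p \<noteq> (\<lambda>x vs. 0)}"
    by (auto simp: pull_form_zero)
  moreover have "finite {(q, p). a q p \<noteq> (\<lambda>x vs. 0)}" using a by (simp add: uforms_def)
  ultimately have "finite {(q, p). pull_form U V g (a q p) \<noteq> (\<lambda>x vs. 0)}" by (rule finite_subset)
  moreover have "pull_form U V g (a q p) = (\<lambda>x vs. 0)" if "int p - 2 * int q \<noteq> d" for q p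
    using a that by (simp add: uforms_def pull_form_zero)
  ultimately show ?thesis
    using pull_form_hol_forms[OF uforms_hol_forms[OF a]] by (simp add: uforms_def pull_uform_def)
qed

lemma pull_uform_add: "pull_uform U V g (\<lambda>q p x vs. a q p x vs + b q p x vs) =
    (\<lambda>q p x vs. pull_uform U V g a q p x vs + pull_uform U V g b q p x vs)"
  by (simp add: pull_uform_def pull_form_add)

lemma pull_uform_zero: "pull_uform U V g (\<lambda>q p x vs. 0) = (\<lambda>q p x vs. 0)"
  by (simp add: pull_uform_def pull_form_zero)

lemma Omega_pmap: "pmap Omega U V g k \<phi> = (\<lambda>l. \<lambda>c \<in> carrier (cgrp (simplex_complex k) l). pull_uform U V g (\<phi> l c))"
  by (simp add: Omega_def pull_uform_def)

lemma Omega_simplices: "simplices (pobj Omega U) k = chain_maps (simplex_complex k) (uform_complex U)"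
  and Omega_sact: "sact (pobj Omega U) = sact (DK (uform_complex U))"
  by (simp_all add: Omega_def DK_def)

lemma Omega_pmap_chain_map:
  fixes U V :: "'a cman"
  assumes "cman_map U V g" and \<phi>: "\<phi> \<in> chain_maps (simplex_complex k) (uform_complex V)"
  shows "pmap Omega U V g k \<phi> \<in> chain_maps (simplex_complex k) (uform_complex U)"
proof (rule chain_mapsI)
  interpret cman_map U V g by fact
  fix l
  let ?S = "\<lambda>l. carrier (cgrp (simplex_complex k) l)"
  show "pmap Omega U V g k \<phi> l \<in> extensional (?S l)" by (simp add: Omega_pmap)
  show "pmap Omega U V g k \<phi> l c \<in> carrier (cgrp (uform_complex U) l)" if c: "c \<in> ?S l" for c
    using pull_uform_closed chain_maps_closed[OF \<phi> c] c by (simp add: Omega_pmap carrier_uform)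
  show "pmap Omega U V g k \<phi> l (a \<otimes>\<^bsub>cgrp (simplex_complex k) l\<^esub> b) =
      pmap Omega U V g k \<phi> l a \<otimes>\<^bsub>cgrp (uform_complex U) l\<^esub> pmap Omega U V g k \<phi> l b"
    if ab: "a \<in> ?S l" "b \<in> ?S l" for a b
  proof -
    have eq: "a \<otimes>\<^bsub>cgrp (simplex_complex k) l\<^esub> b = a + b" by (simp add: cgrp_simplex)
    show ?thesis
      using ab simplex_mult_closed[OF ab] chain_maps_mult[OF \<phi> ab]
      by (simp add: Omega_pmap mult_uform eq pull_uform_add)
  qed
  show "pmap Omega U V g k \<phi> l (cdiff (simplex_complex k) l c) =
      cdiff (uform_complex U) l (pmap Omega U V g k \<phi> (Suc l) c)" if c: "c \<in> ?S (Suc l)" for c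
    using chain_maps_cdiff[OF \<phi> c] cdiff_simplex_closed[OF c]
    by (simp add: Omega_pmap cdiff_uform pull_uform_zero)
qed

lemma simplicial_presheaf_Omega: "simplicial_presheaf Omega"
  unfolding simplicial_presheaf_def
proof (intro conjI allI impI ballI)
  fix U :: "'a cman"
  show "simplicial_set (pobj Omega U)" by (simp add: Omega_def simplicial_set_DK)
next
  fix U V :: "'a cman" and g assume "g \<in> hol_maps U V" "complex_manifold U \<and> complex_manifold V"
  then interpret cman_map U V g by unfold_locales auto
  show "simplicial_map (pobj Omega V) (pobj Omega U) (pmap Omega U V g)"
    unfolding simplicial_map_def Omega_simplices Omega_sact
  proof (intro conjI allI ballI funcsetI Omega_pmap_chain_map[OF cman_map_axioms])
    fix k m \<theta> \<phi> assume \<theta>: "\<theta> \<in> ord_maps k m"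
    show "pmap Omega U V g k (sact (DK (uform_complex V)) k m \<theta> \<phi>) = sact (DK (uform_complex U)) k m \<theta> (pmap Omega U V g m \<phi>)"
      by (auto simp: DK_def Omega_pmap fun_eq_iff restrict_def simplex_complex_map_closed[OF \<theta>])
  qed
next
  fix U :: "'a cman" and k \<phi> assume \<phi>: "\<phi> \<in> simplices (pobj Omega U) k" and "complex_manifold U"
  then interpret cmanifold U by unfold_locales
  note \<phi> = \<phi>[unfolded Omega_simplices]
  show "pmap Omega U U (restrict id (points U)) k \<phi> = \<phi>"
  proof (rule ext)
    fix l
    show "pmap Omega U U (restrict id (points U)) k \<phi> l = \<phi> l"
    proof (rule extensionalityI[OF _ chain_maps_extensional[OF \<phi>]])
      fix c assume c: "c \<in> carrier (cgrp (simplex_complex k) l)"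
      then have "\<phi> l c \<in> uforms U (- int l)" using chain_maps_closed[OF \<phi> c] by (simp add: carrier_uform)
      then have "pull_uform U U (restrict id (points U)) (\<phi> l c) = \<phi> l c"
        unfolding pull_uform_def by (intro ext fun_cong[OF fun_cong[OF pull_form_id[OF uforms_hol_forms]]])
      then show "pmap Omega U U (restrict id (points U)) k \<phi> l c = \<phi> l c" using c by (simp add: Omega_pmap)
    qed (simp add: Omega_pmap)
  qed
next
  fix U V W :: "'a cman" and k g h \<phi>
  assume g: "g \<in> hol_maps U V" and h: "h \<in> hol_maps V W"
    and man: "complex_manifold U \<and> complex_manifold V \<and> complex_manifold W"
  then have G: "cman_map U V g" and H: "cman_map V W h" by (auto intro!: cman_map.intro cmanifold.intro cman_map_axioms.intro)
  show "pmap Omega U W (compose (points U) h g) k \<phi> = pmap Omega U V g k (pmap Omega V W h k \<phi>)"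
    by (auto simp: Omega_pmap pull_uform_def pull_form_compose[OF G H] fun_eq_iff restrict_def)
qed

section \<open>Integral extension of complex-valued functions on generators\<close>

text \<open>The value of \<open>Ch\<close> at a fixed point and fixed tangent vectors has this
  shape. Extending scalar functions instead of forms keeps the computations with chains inside the
  complex numbers.\<close>

definition lin_ext :: "('b \<Rightarrow> complex) \<Rightarrow> ('b \<Rightarrow>\<^sub>0 int) \<Rightarrow> complex" where
  "lin_ext F c = (\<Sum>I\<in>Poly_Mapping.keys c. of_int (Poly_Mapping.lookup c I) * F I)"

lemma lin_ext_superset:
  assumes "finite S" "Poly_Mapping.keys c \<subseteq> S"
  shows "lin_ext F c = (\<Sum>I\<in>S. of_int (Poly_Mapping.lookup c I) * F I)"
  unfolding lin_ext_def using assms by (intro sum.mono_neutral_left) (auto simp: in_keys_iff)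

lemma lin_ext_diff: "lin_ext F (a - b) = lin_ext F a - lin_ext F b"
proof -
  let ?S = "Poly_Mapping.keys a \<union> Poly_Mapping.keys b"
  have "Poly_Mapping.keys (a - b) \<subseteq> ?S" by (rule keys_diff)
  then show ?thesis
    using lin_ext_superset[of ?S "a - b" F] lin_ext_superset[of ?S a F] lin_ext_superset[of ?S b F]
    by (simp add: lookup_minus left_diff_distrib sum_subtractf)
qed

lemma lin_ext_add: "lin_ext F (a + b) = lin_ext F a + lin_ext F b"
  using lin_ext_diff[of F "a + b" b] by simp

lemma lin_ext_0: "lin_ext F 0 = 0"
  by (simp add: lin_ext_def)

lemma lin_ext_of: "lin_ext F (frag_of I) = F I"
  by (simp add: lin_ext_def)

lemma lin_ext_cmul: "lin_ext F (frag_cmul n c) = of_int n * lin_ext F c"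
  using lin_ext_superset[of "Poly_Mapping.keys c" "frag_cmul n c" F] keys_cmul[of n c]
  by (simp add: lin_ext_def sum_distrib_left mult.assoc)

lemma lin_ext_sum: "lin_ext F (\<Sum>i\<in>A. c i) = (\<Sum>i\<in>A. lin_ext F (c i))"
  by (induction A rule: infinite_finite_induct) (simp_all add: lin_ext_0 lin_ext_add)

text \<open>The differential of the simplex and the maps induced by \<open>\<theta>\<close> both
  have the form \<open>frag_extend h\<close>; identities for them are thereby reduced to
  generators.\<close>

lemma lin_ext_frag_extend:
  assumes "Poly_Mapping.keys c \<subseteq> S" "\<And>I. I \<in> S \<Longrightarrow> lin_ext F (h I) = G I"
  shows "lin_ext F (frag_extend h c) = lin_ext G c"
  using assms(1)
  by (induction c rule: frag_induction) (simp_all add: lin_ext_0 lin_ext_of lin_ext_diff frag_extend_diff assms(2))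

section \<open>The Chern character map\<close>

text \<open>The composite of the derivatives along an index list, with the tangent vectors in their
  order of application. The recursion removes the factor applied first, which is where the
  inductions below start; keeping \<open>D\<close> a parameter allows composites for different
  simplices to be compared.\<close>

fun chain_comp :: "(nat \<Rightarrow> nat \<Rightarrow> 'w \<Rightarrow> 'v \<Rightarrow> 'v) \<Rightarrow> nat list \<Rightarrow> 'w list \<Rightarrow> 'v \<Rightarrow> 'v" where
  "chain_comp D (p # q # I) (w # ws) e = chain_comp D (q # I) ws (D q p w e)"
| "chain_comp D _ _ e = e"

text \<open>Links the indexed product in \<open>ch_trace\<close> to the recursion. The indices start
  at 1 and factor \<open>j\<close> also refers to \<open>j - 1\<close>, so removing the head of the
  list shifts all positions by one.\<close>

lemma fold_chain_comp:
  "length I = Suc l \<Longrightarrow>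
    fold (\<lambda>j. D (I ! j) (I ! (j - 1)) (w j)) [1..<Suc l] e = chain_comp D I (map w [1..<Suc l]) e"
proof (induction l arbitrary: I w e)
  case 0
  then show ?case by (cases I) auto
next
  case (Suc l)
  then obtain p q J where I: "I = p # q # J" "length (q # J) = Suc l" by (cases I; cases "tl I") auto
  have upt: "[1..<Suc (Suc l)] = 1 # map Suc [1..<Suc l]"
    by (simp add: upt_conv_Cons map_Suc_upt del: upt_Suc)
  have "fold (\<lambda>j. D (I ! j) (I ! (j - 1)) (w j)) [1..<Suc (Suc l)] e =
      fold (\<lambda>j. D (I ! Suc j) (I ! j) (w (Suc j))) [1..<Suc l] (D q p (w 1) e)"
    unfolding upt by (simp add: fold_map comp_def I(1) del: upt_Suc)
  also have "\<dots> = fold (\<lambda>j. D ((q # J) ! j) ((q # J) ! (j - 1)) (w (Suc j))) [1..<Suc l] (D q p (w 1) e)"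
    by (rule fold_cong[OF refl refl]) (auto simp: I(1) nth_Cons')
  also have "\<dots> = chain_comp D (q # J) (map (\<lambda>j. w (Suc j)) [1..<Suc l]) (D q p (w 1) e)"
    by (rule Suc.IH[OF I(2)])
  finally show ?case unfolding upt I(1) by (simp add: comp_def del: upt_Suc)
qed

text \<open>Entry \<open>k\<close> of the permuted list is \<open>vs ! \<pi> k\<close>, so slot
  \<open>i\<close> of \<open>vs\<close> is found at the preimage of \<open>i\<close>.\<close>

lemma permute_list_update:
  assumes "\<pi> permutes {..<length vs}" "i < length vs"
  shows "permute_list \<pi> (vs[i := u]) = (permute_list \<pi> vs)[inv_into UNIV \<pi> i := u]"
proof (rule nth_equalityI)
  fix k assume "k < length (permute_list \<pi> (vs[i := u]))"
  then have k: "k < length vs" by simp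
  have "\<pi> k = i \<longleftrightarrow> k = inv_into UNIV \<pi> i" using assms(1) by (metis permutes_inverses)
  moreover have "\<pi> k < length vs" using permutes_in_image[OF assms(1)] k by auto
  ultimately show "permute_list \<pi> (vs[i := u]) ! k = (permute_list \<pi> vs)[inv_into UNIV \<pi> i := u] ! k"
    using k assms by (auto simp: permute_list_nth nth_list_update)
qed simp

text \<open>Composing every permutation with the transposition of \<open>i\<close> and
  \<open>j\<close> reverses all signs but leaves the permuted lists unchanged, since the two entries
  are equal. The sum is therefore its own negative.\<close>

lemma alternating_sum_zero:
  fixes T :: "'w list \<Rightarrow> complex"
  assumes ij: "i < length vs" "j < length vs" "i \<noteq> j" "vs ! i = vs ! j"
  shows "(\<Sum>\<pi> | \<pi> permutes {..<length vs}. of_int (sign \<pi>) * T (permute_list \<pi> vs)) = 0" (is "?S = 0")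
proof -
  let ?t = "Transposition.transpose i j"
  have t: "?t permutes {..<length vs}" using ij by (intro permutes_swap_id) auto
  \<comment> \<open>The transposition acts from the left because \<open>\<pi>\<close> produces
    positions in \<open>vs\<close>, and it is there that the two entries are exchanged.\<close>
  have "?S = (\<Sum>\<pi> | \<pi> permutes {..<length vs}. of_int (sign (?t \<circ> \<pi>)) * T (permute_list (?t \<circ> \<pi>) vs))"
    by (rule setum_permutations_compose_left[OF t])
  also have "\<dots> = (\<Sum>\<pi> | \<pi> permutes {..<length vs}. - (of_int (sign \<pi>) * T (permute_list \<pi> vs)))"
  proof (rule sum.cong[OF refl])
    fix \<pi> assume "\<pi> \<in> {\<pi>. \<pi> permutes {..<length vs}}"
    then have \<pi>: "\<pi> permutes {..<length vs}" by simp
    have "permutation ?t" "permutation \<pi>"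
      using t \<pi> by (auto simp: permutation_permutes)
    then have "sign (?t \<circ> \<pi>) = - sign \<pi>" using ij(3) by (simp add: sign_compose sign_swap_id)
    moreover have "permute_list (?t \<circ> \<pi>) vs = permute_list \<pi> vs"
      using ij(4) by (auto simp: permute_list_def Transposition.transpose_def)
    ultimately show "of_int (sign (?t \<circ> \<pi>)) * T (permute_list (?t \<circ> \<pi>) vs) = - (of_int (sign \<pi>) * T (permute_list \<pi> vs))"
      by simp
  qed
  also have "\<dots> = - ?S" by (simp add: sum_negf)
  finally show ?thesis by simp
qed

locale hvb_chain = cmanifold U + nerve_simplex "hvb_groupoid U" m Es fs
  for U :: "'a cman" and m :: nat and Es :: "('a, 'v) hvb_object list" and fs :: "('a, 'v) bundle_map list"
begin

abbreviation B where "B i \<equiv> fst (Es ! i)"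
abbreviation K where "K i \<equiv> snd (Es ! i)"
text \<open>The composite isomorphism with the target index first. The natural number
  \<open>q - p\<close> is the length of the path, so this is meaningful only for
  \<open>p \<le> q\<close>.\<close>

abbreviation f where "f q p \<equiv> path p (q - p)"
abbreviation Fb where "Fb p x \<equiv> fibre (B p) x"

definition D where "D x q p v = hom_connection U (Es ! p) (Es ! q) (f q p) x v"

lemma B: "i \<le> m \<Longrightarrow> hol_bundle U (B i)" and K: "i \<le> m \<Longrightarrow> hol_connection U (B i) (K i)"
  using Es_Obj[of i] by (auto simp: hvb_groupoid_def)

lemma f_iso: "p \<le> q \<Longrightarrow> q \<le> m \<Longrightarrow> f q p \<in> hol_bundle_isos U (B p) (B q)"
  using path_Hom'[of p q] by (simp add: hvb_groupoid_def)

lemma f_maps: "p \<le> q \<Longrightarrow> q \<le> m \<Longrightarrow> f q p \<in> hol_bundle_maps U (B p) (B q)"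
  using f_iso isos_maps by blast

lemma f_self: "f p p = bundle_id U (B p)"
  by (simp add: hvb_groupoid_def)

lemma f_trans: "p \<le> q \<Longrightarrow> q \<le> r \<Longrightarrow> r \<le> m \<Longrightarrow> f r p = bundle_comp U (B p) (f r q) (f q p)"
  using path_split[of p q r] by (simp add: hvb_groupoid_def)

lemma f_linear: "p \<le> q \<Longrightarrow> q \<le> m \<Longrightarrow> x \<in> points U \<Longrightarrow> linear_on (Fb p x) (Fb q x) (f q p x)"
  by (rule bundle_maps_linear[OF f_maps])

lemma f_closed: "p \<le> q \<Longrightarrow> q \<le> m \<Longrightarrow> x \<in> points U \<Longrightarrow> e \<in> carrier (Fb p x) \<Longrightarrow> f q p x e \<in> carrier (Fb q x)"
  by (rule linear_on_closed[OF f_linear])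

lemma f_bij: "p \<le> q \<Longrightarrow> q \<le> m \<Longrightarrow> x \<in> points U \<Longrightarrow> bij_betw (f q p x) (carrier (Fb p x)) (carrier (Fb q x))"
  by (rule isos_bij[OF f_iso])

lemma f_trans_apply: "p \<le> q \<Longrightarrow> q \<le> r \<Longrightarrow> r \<le> m \<Longrightarrow> x \<in> points U \<Longrightarrow> e \<in> carrier (Fb p x) \<Longrightarrow>
    f r p x e = f r q x (f q p x e)"
  by (simp only: f_trans[of p q r] bundle_comp_apply)

lemma M: "p \<le> m \<Longrightarrow> x \<in> points U \<Longrightarrow> module complex_ring (Fb p x)"
  by (rule fibre_module[OF B])

abbreviation finv where "finv q p x \<equiv> inv_into (carrier (Fb p x)) (f q p x)"

lemma finv_linear: "p \<le> q \<Longrightarrow> q \<le> m \<Longrightarrow> x \<in> points U \<Longrightarrow> linear_on (Fb q x) (Fb p x) (finv q p x)"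
  by (intro linear_on_inverse M f_linear f_bij) auto

lemma finv_f: "p \<le> q \<Longrightarrow> q \<le> m \<Longrightarrow> x \<in> points U \<Longrightarrow> e \<in> carrier (Fb p x) \<Longrightarrow> finv q p x (f q p x e) = e"
  using f_bij[of p q x] by (simp add: bij_betw_def)

lemma f_finv: "p \<le> q \<Longrightarrow> q \<le> m \<Longrightarrow> x \<in> points U \<Longrightarrow> e \<in> carrier (Fb q x) \<Longrightarrow> f q p x (finv q p x e) = e"
  using f_bij[of p q x] by (simp add: bij_betw_def f_inv_into_f)

lemma finv_closed: "p \<le> q \<Longrightarrow> q \<le> m \<Longrightarrow> x \<in> points U \<Longrightarrow> e \<in> carrier (Fb q x) \<Longrightarrow> finv q p x e \<in> carrier (Fb p x)"
  by (rule linear_on_closed[OF finv_linear])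

lemma finv_trans:
  assumes "p \<le> q" "q \<le> r" "r \<le> m" "x \<in> points U" "e \<in> carrier (Fb r x)"
  shows "finv r p x e = finv q p x (finv r q x e)"
proof -
  have c: "finv r q x e \<in> carrier (Fb q x)" "finv q p x (finv r q x e) \<in> carrier (Fb p x)"
    using assms by (auto intro!: finv_closed)
  then have "f r p x (finv q p x (finv r q x e)) = e"
    using assms by (simp add: f_trans_apply[of p q r] f_finv)
  then show ?thesis using finv_f[of p r x "finv q p x (finv r q x e)"] assms c by simp
qed

text \<open>Allows the end of a path to be moved: going on from \<open>q\<close> to \<open>r\<close>
  before returning to \<open>p\<close> has the same effect as returning from \<open>q\<close>
  directly. The trace over the last face is compared with the others in this way.\<close>

lemma finv_f_trans:
  assumes "p \<le> q" "q \<le> r" "r \<le> m" "x \<in> points U" "e \<in> carrier (Fb q x)"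
  shows "finv r p x (f r q x e) = finv q p x e"
  using assms by (simp add: finv_trans[of p q r] f_closed finv_f)

lemma hom_conn: "p \<le> q \<Longrightarrow> q \<le> m \<Longrightarrow> hom_conn U (B p) (B q) (K p) (K q) (f q p)"
  by unfold_locales (auto intro: B K f_maps)

lemma D_eq: "D x q p v = hom_connection U (B p, K p) (B q, K q) (f q p) x v"
  by (simp add: D_def)

lemma D_linear: "p \<le> q \<Longrightarrow> q \<le> m \<Longrightarrow> v \<in> tangent U x \<Longrightarrow> linear_on (Fb p x) (Fb q x) (D x q p v)"
  unfolding D_eq by (rule hom_conn.nabla_linear[OF hom_conn]) (auto intro: tangent_point)

lemma D_closed: "p \<le> q \<Longrightarrow> q \<le> m \<Longrightarrow> v \<in> tangent U x \<Longrightarrow> e \<in> carrier (Fb p x) \<Longrightarrow> D x q p v e \<in> carrier (Fb q x)"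
  by (rule linear_on_closed[OF D_linear])

lemma D_tlin: "p \<le> q \<Longrightarrow> q \<le> m \<Longrightarrow> v \<in> tangent U x \<Longrightarrow> w \<in> tangent U x \<Longrightarrow> e \<in> carrier (Fb p x) \<Longrightarrow>
    D x q p (tlin a v b w) e = a \<odot>\<^bsub>Fb q x\<^esub> D x q p v e \<oplus>\<^bsub>Fb q x\<^esub> b \<odot>\<^bsub>Fb q x\<^esub> D x q p w e"
  unfolding D_eq by (rule hom_conn.nabla_tlin[OF hom_conn]) (auto intro: tangent_point)

lemma D_self: "p \<le> m \<Longrightarrow> v \<in> tangent U x \<Longrightarrow> e \<in> carrier (Fb p x) \<Longrightarrow> D x p p v e = \<zero>\<^bsub>Fb p x\<^esub>"
  unfolding D_eq f_self by (rule hom_connection_id) (auto intro: tangent_point B K)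

lemma D_trans: "p \<le> q \<Longrightarrow> q \<le> r \<Longrightarrow> r \<le> m \<Longrightarrow> v \<in> tangent U x \<Longrightarrow> e \<in> carrier (Fb p x) \<Longrightarrow>
    D x r p v e = D x r q v (f q p x e) \<oplus>\<^bsub>Fb r x\<^esub> f r q x (D x q p v e)"
  unfolding D_eq f_trans[of p q r]
  by (rule hom_connection_comp) (auto intro: tangent_point B K f_maps)

abbreviation C where "C x \<equiv> chain_comp (D x)"

text \<open>Weakly increasing, whereas generators increase strictly: the lists
  \<open>map \<theta> I\<close> produced by simplicial operators may have repetitions.\<close>

definition index_list where "index_list I \<longleftrightarrow> I \<noteq> [] \<and> sorted I \<and> set I \<subseteq> {..m}"

lemma index_list_Cons:
  "index_list (p # q # I) \<longleftrightarrow> p \<le> q \<and> q \<le> m \<and> index_list (q # I)"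
  by (auto simp: index_list_def)

lemma index_list_le: "index_list I \<Longrightarrow> p \<in> set I \<Longrightarrow> p \<le> m"
  by (auto simp: index_list_def)

lemma index_list_hd_last: "index_list I \<Longrightarrow> hd I \<le> last I"
  by (cases I) (auto simp: index_list_def)

lemma index_list_bounds: "index_list I \<Longrightarrow> hd I \<le> m \<and> last I \<le> m"
  using hd_in_set[of I] last_in_set[of I] by (auto simp: index_list_def simp del: hd_in_set last_in_set)

lemma C_linear:
  assumes "index_list I" "length I = Suc (length ws)" "set ws \<subseteq> tangent U x"
  shows "linear_on (Fb (hd I) x) (Fb (last I) x) (C x I ws)"
  using assms
proof (induction ws arbitrary: I)
  case Nil
  then obtain p where "I = [p]" by (cases I) auto
  then show ?case by (simp add: linear_on_id)
next
  case (Cons w ws)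
  then obtain p q J where I: "I = p # q # J" by (cases I; cases "tl I") auto
  with Cons.prems have pq: "p \<le> q" "q \<le> m" "index_list (q # J)" by (auto simp: index_list_Cons)
  have "linear_on (Fb q x) (Fb (last I) x) (C x (q # J) ws)"
    using Cons.IH[OF pq(3)] Cons.prems I by simp
  from linear_on_compose[OF D_linear[OF pq(1,2), of w x] this] Cons.prems show ?case by (simp add: I)
qed

lemma C_closed:
  assumes "index_list I" "length I = Suc (length ws)" "set ws \<subseteq> tangent U x" "e \<in> carrier (Fb (hd I) x)"
  shows "C x I ws e \<in> carrier (Fb (last I) x)"
  by (rule linear_on_closed[OF C_linear[OF assms(1-3)] assms(4)])

text \<open>The factors before slot \<open>k\<close> are applied unchanged. At the slot itself the
  derivative is linear in its tangent vector, and the remaining factors, being linear on the fibre,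
  carry the combination to the end.\<close>

lemma C_tlin:
  assumes "index_list I" "length I = Suc (length ws)" "set ws \<subseteq> tangent U x" "e \<in> carrier (Fb (hd I) x)"
    "k < length ws" "v \<in> tangent U x" "w \<in> tangent U x"
  shows "C x I (ws[k := tlin a v b w]) e =
    a \<odot>\<^bsub>Fb (last I) x\<^esub> C x I (ws[k := v]) e \<oplus>\<^bsub>Fb (last I) x\<^esub> b \<odot>\<^bsub>Fb (last I) x\<^esub> C x I (ws[k := w]) e"
  using assms
proof (induction ws arbitrary: I k e)
  case (Cons u ws)
  then obtain p q J where I: "I = p # q # J" by (cases I; cases "tl I") auto
  with Cons.prems have pq: "p \<le> q" "q \<le> m" "index_list (q # J)" by (auto simp: index_list_Cons)
  have x: "x \<in> points U" using tangent_point Cons.prems by blast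
  note lin = C_linear[OF pq(3), of ws x]
  have len: "length (q # J) = Suc (length ws)" using Cons.prems I by simp
  have ws: "set ws \<subseteq> tangent U x" and u: "u \<in> tangent U x" using Cons.prems by auto
  have e: "e \<in> carrier (Fb p x)" using Cons.prems I by simp
  show ?case
  proof (cases k)
    case 0
    note cl = D_closed[OF pq(1,2) _ e]
    have "C x I ((u # ws)[k := tlin a v b w]) e = C x (q # J) ws (a \<odot>\<^bsub>Fb q x\<^esub> D x q p v e \<oplus>\<^bsub>Fb q x\<^esub> b \<odot>\<^bsub>Fb q x\<^esub> D x q p w e)"
      using D_tlin[OF pq(1,2) Cons.prems(6,7) e] by (simp add: 0 I)
    then show ?thesis
      using linear_on_add[OF lin[OF len ws]] linear_on_smult[OF lin[OF len ws]] cl Cons.prems(6,7)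
        module_smult_closed[OF M[OF pq(2) x]]
      by (simp add: 0 I)
  next
    case (Suc k')
    have "D x q p u e \<in> carrier (Fb (hd (q # J)) x)" using D_closed[OF pq(1,2) u e] by simp
    from Cons.IH[OF pq(3) len ws this, of k'] Cons.prems show ?thesis by (simp add: Suc I)
  qed
qed simp

lemma B_iso:
  assumes "p \<le> m" "x \<in> points U"
  obtains r t where "coord_iso (Fb p x) r t"
proof -
  obtain Dp r t where "(Dp, r, t) \<in> trivs (B p)" "x \<in> Dp" using points_triv[OF B[OF assms(1)] assms(2)] .
  then show ?thesis using triv_iso[OF B[OF assms(1)]] that by blast
qed

lemma fibre_linear_zero:
  assumes "p \<le> m" "q \<le> m" "x \<in> points U" "linear_on (Fb p x) (Fb q x) L"
  shows "L \<zero>\<^bsub>Fb p x\<^esub> = \<zero>\<^bsub>Fb q x\<^esub>"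
proof -
  obtain r t where "coord_iso (Fb q x) r t" using B_iso[OF assms(2,3)] .
  then show ?thesis using linear_on_zero[OF M[OF assms(1,3)] M[OF assms(2,3)] assms(4)] by blast
qed

text \<open>Since the list is sorted, a repetition of its head is visible at the very next entry.
  Then the first factor gives 0, which the later linear factors preserve; otherwise the repetition
  lies in the tail.\<close>

lemma C_degenerate:
  assumes "index_list I" "\<not> distinct I" "length I = Suc (length ws)" "set ws \<subseteq> tangent U x" "e \<in> carrier (Fb (hd I) x)"
  shows "C x I ws e = \<zero>\<^bsub>Fb (last I) x\<^esub>"
  using assms
proof (induction ws arbitrary: I e)
  case Nil
  then show ?case by (cases I) auto
next
  case (Cons u ws)
  then obtain p q J where I: "I = p # q # J" by (cases I; cases "tl I") auto
  with Cons.prems have pq: "p \<le> q" "q \<le> m" "index_list (q # J)" by (auto simp: index_list_Cons)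
  have len: "length (q # J) = Suc (length ws)" using Cons.prems I by simp
  have ws: "set ws \<subseteq> tangent U x" and u: "u \<in> tangent U x" using Cons.prems by auto
  have e: "e \<in> carrier (Fb p x)" using Cons.prems I by simp
  have x: "x \<in> points U" by (rule tangent_point[OF u])
  show ?case
  proof (cases "p = q")
    case True
    have "last (q # J) \<le> m" by (rule index_list_le[OF pq(3)]) simp
    then have "C x (q # J) ws \<zero>\<^bsub>Fb q x\<^esub> = \<zero>\<^bsub>Fb (last (q # J)) x\<^esub>"
      using fibre_linear_zero[OF pq(2) _ x] C_linear[OF pq(3) len ws] by simp
    moreover have "D x q p u e = \<zero>\<^bsub>Fb q x\<^esub>" using D_self[OF pq(2) u, of e] e True by simp
    ultimately show ?thesis by (simp add: I)
  next
    case False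
    then have "\<not> distinct (q # J)"
    proof -
      have "p \<notin> set (q # J)" using False pq Cons.prems(1) by (auto simp: I index_list_def)
      then show ?thesis using Cons.prems(2) I by simp
    qed
    moreover have "D x q p u e \<in> carrier (Fb (hd (q # J)) x)" using D_closed[OF pq(1,2) u e] by simp
    ultimately show ?thesis using Cons.IH[OF pq(3) _ len ws] by (simp add: I)
  qed
qed

text \<open>One summand of \<open>ch_trace\<close>, without its sign; \<open>ws\<close> lists the
  tangent vectors in the order in which the factors are applied.\<close>

definition Tr where
  "Tr x I ws = vtrace (Fb (hd I) x) (\<lambda>e. finv (last I) (hd I) x (C x I ws e))"

lemma Tr_linear:
  assumes "index_list I" "length I = Suc (length ws)" "set ws \<subseteq> tangent U x" "x \<in> points U"
  shows "linear_on (Fb (hd I) x) (Fb (hd I) x) (\<lambda>e. finv (last I) (hd I) x (C x I ws e))"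
  using assms index_list_hd_last[OF assms(1)] index_list_bounds[OF assms(1)]
  by (intro linear_on_compose[OF C_linear finv_linear]) auto

lemma Tr_coords:
  assumes "index_list I" "length I = Suc (length ws)" "set ws \<subseteq> tangent U x" "x \<in> points U"
    "coord_iso (Fb (hd I) x) r t"
  shows "Tr x I ws = (\<Sum>k<r. t (finv (last I) (hd I) x (C x I ws (basis_vec (Fb (hd I) x) t k))) k)"
proof -
  have "hd I \<le> m" using index_list_bounds[OF assms(1)] by simp
  then show ?thesis unfolding Tr_def by (rule vtrace_eq[OF M[OF _ assms(4)] assms(5) Tr_linear[OF assms(1-4)]])
qed

lemma Tr_tlin:
  assumes I: "index_list I" "length I = Suc (length ws)" "set ws \<subseteq> tangent U x"
    and k: "k < length ws" and v: "v \<in> tangent U x" and w: "w \<in> tangent U x"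
  shows "Tr x I (ws[k := tlin a v b w]) = a * Tr x I (ws[k := v]) + b * Tr x I (ws[k := w])"
proof -
  have x: "x \<in> points U" by (rule tangent_point[OF v])
  have hl: "hd I \<le> last I" "last I \<le> m" "hd I \<le> m"
    using index_list_hd_last[OF I(1)] index_list_bounds[OF I(1)] by auto
  obtain r t where t: "coord_iso (Fb (hd I) x) r t" using B_iso[OF hl(3) x] .
  have ws: "set (ws[k := u]) \<subseteq> tangent U x" if "u \<in> tangent U x" for u
    using I(3) that set_update_subset_insert[of ws k u] by blast
  have len: "length I = Suc (length (ws[k := u]))" for u using I(2) by simp
  note co = Tr_coords[OF I(1) len ws x t]
  note fl = finv_linear[OF hl(1,2) x]
  note Ml = M[OF hl(2) x] and Mh = M[OF hl(3) x]
  have "t (finv (last I) (hd I) x (C x I (ws[k := tlin a v b w]) e)) i =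
     a * t (finv (last I) (hd I) x (C x I (ws[k := v]) e)) i + b * t (finv (last I) (hd I) x (C x I (ws[k := w]) e)) i"
    if e: "e \<in> carrier (Fb (hd I) x)" for e i
  proof -
    note cv = C_closed[OF I(1) len ws[OF v] e] and cw = C_closed[OF I(1) len ws[OF w] e]
    note sv = module_smult_closed[OF Ml cv] and sw = module_smult_closed[OF Ml cw]
    note fv = linear_on_closed[OF fl cv] and fw = linear_on_closed[OF fl cw]
    show ?thesis
      unfolding C_tlin[OF I e k v w] linear_on_add[OF fl sv sw] linear_on_smult[OF fl cv] linear_on_smult[OF fl cw]
        coord_add[OF t module_smult_closed[OF Mh fv] module_smult_closed[OF Mh fw]] coord_smult[OF t fv] coord_smult[OF t fw] ..
  qed
  then show ?thesis
    unfolding co[OF tangent_tlin[OF v w]] co[OF v] co[OF w]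
    by (simp add: basis_vec_closed[OF t] sum.distrib sum_distrib_left)
qed

lemma Tr_degenerate:
  assumes I: "index_list I" "\<not> distinct I" "length I = Suc (length ws)" "set ws \<subseteq> tangent U x" and x: "x \<in> points U"
  shows "Tr x I ws = 0"
proof -
  have hl: "hd I \<le> last I" "last I \<le> m" "hd I \<le> m"
    using index_list_hd_last[OF I(1)] index_list_bounds[OF I(1)] by auto
  obtain r t where t: "coord_iso (Fb (hd I) x) r t" using B_iso[OF hl(3) x] .
  have "t (finv (last I) (hd I) x (C x I ws (basis_vec (Fb (hd I) x) t k))) k = 0" if "k < r" for k
    unfolding C_degenerate[OF I basis_vec_closed[OF t that]] fibre_linear_zero[OF hl(2,3) x finv_linear[OF hl(1,2) x]]
    by (rule coord_zero[OF t M[OF hl(3) x]])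
  then show ?thesis unfolding Tr_coords[OF I(1,3,4) x t] by simp
qed

end

section \<open>The boundary relation and the trace forms\<close>

context hvb_chain
begin

lemma index_list_face:
  assumes "index_list I" "1 < length I"
  shows "index_list (face I j)"
proof -
  have "sorted (take j I @ drop j I)" using assms by (simp add: index_list_def)
  then have "sorted (take j I @ drop (Suc j) I)"
    using sorted_wrt_drop[of "(\<le>)" "drop j I" 1] in_set_dropD[of _ 1 "drop j I"]
    by (auto simp: sorted_append simp del: append_take_drop_id)
  moreover have "face I j \<noteq> []"
    using assms(2) by (cases j) auto
  moreover have "set (face I j) \<subseteq> {..m}"
    using assms(1) by (auto simp: index_list_def dest: in_set_takeD in_set_dropD)
  ultimately show ?thesis by (simp add: index_list_def)
qed

lemma alternating_sum_shift:
  "(\<Sum>j=1..Suc n. (-1) ^ j * g j) = - g 1 - (\<Sum>j=1..n. (-1) ^ j * (g (Suc j) :: complex))"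
  by (induction n) simp_all

text \<open>The terms of the boundary telescope: the derivative of a composite of two consecutive maps is a sum
  of two terms, each of which leaves one of the two maps underived.\<close>

lemma C_boundary:
  assumes I: "index_list I" "length I = Suc (Suc (length ws))" and ws: "set ws \<subseteq> tangent U x" and x: "x \<in> points U"
    and e: "e \<in> carrier (Fb (hd I) x)"
    and \<Lambda>: "\<And>a b. a \<in> carrier (Fb (last I) x) \<Longrightarrow> b \<in> carrier (Fb (last I) x) \<Longrightarrow>
       \<Lambda> (a \<oplus>\<^bsub>Fb (last I) x\<^esub> b) = \<Lambda> a + (\<Lambda> b :: complex)"
  shows "(\<Sum>j=1..length ws. (-1) ^ j * \<Lambda> (C x (face I j) ws e)) =
    - \<Lambda> (C x (tl I) ws (f (hd (tl I)) (hd I) x e)) +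
    (-1) ^ length ws * \<Lambda> (f (last I) (last (butlast I)) x (C x (butlast I) ws e))"
  using I ws e \<Lambda>
proof (induction ws arbitrary: I e)
  case Nil
  then obtain p q where "I = [p, q]" by (cases I; cases "tl I") auto
  \<comment> \<open>With a single arrow there is no inner face, and both outer terms are
    \<open>\<Lambda>\<close> of \<open>f q p\<close> applied to \<open>e\<close>.\<close>
  then show ?case by simp
next
  case (Cons w ws)
  then obtain p q r J where Ieq: "I = p # q # r # J" by (cases I; cases "tl I"; cases "tl (tl I)") auto
  let ?n = "length ws"
  let ?e = "D x q p w e"
  have idx: "p \<le> q" "q \<le> r" "q \<le> m" "r \<le> m" "index_list (q # r # J)" "index_list (r # J)" "p \<le> r"
    using Cons.prems(1) by (auto simp: Ieq index_list_def)
  have w: "w \<in> tangent U x" and ws: "set ws \<subseteq> tangent U x" using Cons.prems(3) by auto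
  have ep: "e \<in> carrier (Fb p x)" using Cons.prems(4) by (simp add: Ieq)
  have e': "?e \<in> carrier (Fb q x)" by (rule D_closed[OF idx(1,3) w ep])
  have fe: "f q p x e \<in> carrier (Fb q x)" by (rule f_closed[OF idx(1,3) x ep])
  have len: "length (r # J) = Suc ?n" using Cons.prems(2) by (simp add: Ieq)
  \<comment> \<open>The tail ends at the same bundle, so one functional \<open>\<Lambda>\<close>
    serves throughout the induction.\<close>
  have last: "last I = last (r # J)" by (simp add: Ieq)
  note lin = C_linear[OF idx(6) len ws, unfolded list.sel]
  note a = D_closed[OF idx(2,4) w fe] and b = f_closed[OF idx(2,4) x e']
  have "C x (face I 1) (w # ws) e = C x (r # J) ws (D x r p w e)" by (simp add: Ieq)
  also have "D x r p w e = D x r q w (f q p x e) \<oplus>\<^bsub>Fb r x\<^esub> f r q x ?e"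
    by (rule D_trans[OF idx(1,2,4) w ep])
  also have "C x (r # J) ws \<dots> = C x (r # J) ws (D x r q w (f q p x e)) \<oplus>\<^bsub>Fb (last I) x\<^esub> C x (r # J) ws (f r q x ?e)"
    unfolding last by (rule linear_on_add[OF lin a b])
  finally have 1: "\<Lambda> (C x (face I 1) (w # ws) e) = \<Lambda> (C x (r # J) ws (D x r q w (f q p x e))) + \<Lambda> (C x (r # J) ws (f r q x ?e))"
    using Cons.prems(5) linear_on_closed[OF lin a] linear_on_closed[OF lin b] by (simp only: last)
  \<comment> \<open>The faces after the first keep \<open>p\<close> and \<open>q\<close>; their
    first factor is always the derivative that sends \<open>e\<close> to \<open>?e\<close>.\<close>
  have shift: "C x (face I (Suc j)) (w # ws) e = C x (face (q # r # J) j) ws ?e" if "j \<in> {1..?n}" for j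
    using that by (cases j) (auto simp: Ieq)
  have "(\<Sum>j=1..Suc ?n. (-1) ^ j * \<Lambda> (C x (face I j) (w # ws) e)) =
      - \<Lambda> (C x (face I 1) (w # ws) e) - (\<Sum>j=1..?n. (-1) ^ j * \<Lambda> (C x (face I (Suc j)) (w # ws) e))"
    by (rule alternating_sum_shift)
  also have "(\<Sum>j=1..?n. (-1) ^ j * \<Lambda> (C x (face I (Suc j)) (w # ws) e)) =
      (\<Sum>j=1..?n. (-1) ^ j * \<Lambda> (C x (face (q # r # J) j) ws ?e))"
    by (rule sum.cong[OF refl]) (simp only: shift)
  \<comment> \<open>The induction hypothesis for the tail, started at the vector \<open>?e\<close>.
    Its leading term cancels the second half of the first face, as split in fact
    \<open>1\<close>.\<close>
  also have "(\<Sum>j=1..?n. (-1) ^ j * \<Lambda> (C x (face (q # r # J) j) ws ?e)) =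
      - \<Lambda> (C x (r # J) ws (f r q x ?e)) +
      (-1) ^ ?n * \<Lambda> (f (last I) (last (butlast (q # r # J))) x (C x (butlast (q # r # J)) ws ?e))"
    using Cons.IH[OF idx(5) _ ws, of ?e] len e' Cons.prems(5) by (simp add: Ieq)
  finally show ?case unfolding 1 by (simp add: Ieq)
qed

lemma Tr_boundary:
  assumes I: "index_list I" "length I = Suc (Suc (length ws))" and ws: "set ws \<subseteq> tangent U x" and x: "x \<in> points U"
  shows "(\<Sum>j\<le>Suc (length ws). (-1) ^ j * Tr x (face I j) ws) = 0"
proof -
  obtain p q J where Ieq: "I = p # q # J" using I(2) by (cases I; cases "tl I") auto
  let ?n = "length ws"
  define z where "z = last I"
  define s where "s = last (butlast I)"
  have idx: "p \<le> q" "q \<le> m" "p \<le> m" "index_list (q # J)" "z \<le> m" "q \<le> z" "p \<le> z"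
    using I(1) index_list_bounds[OF I(1)] by (auto simp: Ieq index_list_def z_def)
  have lenJ: "length (q # J) = Suc ?n" using I(2) by (simp add: Ieq)
  have lastJ: "last (q # J) = z" by (simp add: z_def Ieq)
  obtain r t where t: "coord_iso (Fb p x) r t" using B_iso[OF idx(3) x] .
  let ?b = "basis_vec (Fb p x) t"
  note bc = basis_vec_closed[OF t]
  \<comment> \<open>The \<open>k\<close>-th coordinate after the return to the fibre at
    \<open>p\<close>. Summed over \<open>k\<close> and applied to the images of the basis vectors,
    these functionals give the trace.\<close>
  define \<Lambda> where "\<Lambda> = (\<lambda>k a. t (finv z p x a) k)"
  note fz = finv_linear[OF idx(7,5) x]
  have \<Lambda>: "\<Lambda> k (a \<oplus>\<^bsub>Fb z x\<^esub> b) = \<Lambda> k a + \<Lambda> k b" if "a \<in> carrier (Fb z x)" "b \<in> carrier (Fb z x)" for k a b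
    using that unfolding \<Lambda>_def linear_on_add[OF fz that]
    by (intro coord_add[OF t] linear_on_closed[OF fz])
  have butlast: "face I (Suc ?n) = butlast I" "butlast I \<noteq> []" "hd (butlast I) = p"
    using I(2) by (auto simp: butlast_conv_take Ieq take_Cons')
  have ib: "index_list (butlast I)" using index_list_face[OF I(1), of "Suc ?n"] I(2) butlast by simp
  have lenb: "length (butlast I) = Suc ?n" using I(2) by simp
  have sz: "s \<le> z" "p \<le> s"
  proof -
    have "I = butlast I @ [z]" unfolding z_def by (rule append_butlast_last_id[symmetric]) (simp add: Ieq)
    then have "sorted (butlast I @ [z])" using I(1) by (simp add: index_list_def)
    then show "s \<le> z" using butlast(2) by (auto simp: sorted_append s_def)
    show "p \<le> s" using index_list_hd_last[OF ib] butlast(3) by (simp add: s_def)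
  qed
  \<comment> \<open>Inner faces keep both ends \<open>p\<close> and \<open>z\<close>, so their
    traces are sums of the functionals \<open>\<Lambda> k\<close> as they stand.\<close>
  have mid: "Tr x (face I j) ws = (\<Sum>k<r. \<Lambda> k (C x (face I j) ws (?b k)))" if j: "j \<in> {1..?n}" for j
  proof -
    have hd: "hd (face I j) = p" using j by (cases j) (auto simp: Ieq)
    have "drop (Suc j) I \<noteq> []" using j I(2) by simp
    then have last: "last (face I j) = z" by (simp add: z_def)
    have "length (face I j) = Suc ?n" using j I(2) by simp
    from Tr_coords[OF index_list_face[OF I(1)] this ws x, of r t] t I(2) show ?thesis
      by (simp only: hd last \<Lambda>_def)
  qed
  \<comment> \<open>This face starts at \<open>q\<close>, so its trace is taken over another fibre.
    It is moved to the fibre at \<open>p\<close> by \<open>vtrace_conjugate\<close>, after which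
    \<open>finv_trans\<close> merges the two inverses.\<close>
  have first: "Tr x (face I 0) ws = (\<Sum>k<r. \<Lambda> k (C x (tl I) ws (f q p x (?b k))))"
  proof -
    note lin = C_linear[OF idx(4) lenJ ws, unfolded list.sel lastJ]
    have linq: "linear_on (Fb q x) (Fb q x) (\<lambda>e. finv z q x (C x (q # J) ws e))"
      by (rule linear_on_compose[OF lin finv_linear[OF idx(6,5) x]])
    obtain r' t' where t': "coord_iso (Fb q x) r' t'" using B_iso[OF idx(2) x] .
    have "Tr x (face I 0) ws = vtrace (Fb q x) (\<lambda>e. finv z q x (C x (q # J) ws e))"
      unfolding Tr_def by (simp add: Ieq lastJ[symmetric])
    also have "\<dots> = vtrace (Fb p x) (\<lambda>a. finv q p x (finv z q x (C x (q # J) ws (f q p x a))))"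
      by (rule vtrace_conjugate[OF M[OF idx(3) x] M[OF idx(2) x] t' f_linear[OF idx(1,2) x] f_bij[OF idx(1,2) x] linq, symmetric])
    also have "\<dots> = vtrace (Fb p x) (\<lambda>a. finv z p x (C x (q # J) ws (f q p x a)))"
      by (rule vtrace_cong, rule finv_trans[OF idx(1,6,5) x, symmetric])
        (rule linear_on_closed[OF lin f_closed[OF idx(1,2) x]])
    also have "\<dots> = (\<Sum>k<r. \<Lambda> k (C x (q # J) ws (f q p x (?b k))))"
      unfolding \<Lambda>_def
      by (rule vtrace_eq[OF M[OF idx(3) x] t linear_on_compose[OF linear_on_compose[OF f_linear[OF idx(1,2) x] lin] fz]])
    finally show ?thesis by (simp add: Ieq)
  qed
  \<comment> \<open>This face ends at \<open>s\<close> instead of \<open>z\<close>;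
    \<open>finv_f_trans\<close> continues it to \<open>z\<close> without changing the return to
    \<open>p\<close>.\<close>
  have final: "Tr x (face I (Suc ?n)) ws = (\<Sum>k<r. \<Lambda> k (f z s x (C x (butlast I) ws (?b k))))"
  proof -
    have "Tr x (butlast I) ws = (\<Sum>k<r. t (finv s p x (C x (butlast I) ws (?b k))) k)"
      using Tr_coords[OF ib lenb ws x, of r t] t by (simp only: butlast(3) s_def)
    also have "\<dots> = (\<Sum>k<r. \<Lambda> k (f z s x (C x (butlast I) ws (?b k))))"
    proof (rule sum.cong[OF refl])
      fix k assume "k \<in> {..<r}"
      then have "?b k \<in> carrier (Fb (hd (butlast I)) x)" using bc by (simp only: butlast(3)) simp
      from C_closed[OF ib lenb ws this] have "C x (butlast I) ws (?b k) \<in> carrier (Fb s x)" by (simp only: s_def)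
      then show "t (finv s p x (C x (butlast I) ws (?b k))) k = \<Lambda> k (f z s x (C x (butlast I) ws (?b k)))"
        unfolding \<Lambda>_def by (simp only: finv_f_trans[OF sz(2,1) idx(5) x])
    qed
    finally show ?thesis unfolding butlast(1) .
  qed
  have "(\<Sum>j=1..?n. (-1) ^ j * Tr x (face I j) ws) = (\<Sum>j=1..?n. \<Sum>k<r. (-1) ^ j * \<Lambda> k (C x (face I j) ws (?b k)))"
    by (rule sum.cong[OF refl]) (simp only: mid sum_distrib_left)
  also have "\<dots> = (\<Sum>k<r. \<Sum>j=1..?n. (-1) ^ j * \<Lambda> k (C x (face I j) ws (?b k)))"
    by (rule sum.swap)
  also have "\<dots> = (\<Sum>k<r. - \<Lambda> k (C x (tl I) ws (f q p x (?b k))) + (-1) ^ ?n * \<Lambda> k (f z s x (C x (butlast I) ws (?b k))))"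
  proof (rule sum.cong[OF refl])
    fix k assume "k \<in> {..<r}"
    then have "?b k \<in> carrier (Fb (hd I) x)" using bc by (simp add: Ieq)
    from C_boundary[OF I ws x this, of "\<Lambda> k"] \<Lambda>
    show "(\<Sum>j=1..?n. (-1) ^ j * \<Lambda> k (C x (face I j) ws (?b k))) =
        - \<Lambda> k (C x (tl I) ws (f q p x (?b k))) + (-1) ^ ?n * \<Lambda> k (f z s x (C x (butlast I) ws (?b k)))"
      unfolding z_def[symmetric] s_def[symmetric] by (simp add: Ieq)
  qed
  also have "\<dots> = - Tr x (face I 0) ws + (-1) ^ ?n * Tr x (face I (Suc ?n)) ws"
    unfolding first final by (simp add: sum.distrib sum_subtractf sum_negf sum_distrib_left)
  finally have "(\<Sum>j=1..?n. (-1) ^ j * Tr x (face I j) ws) = - Tr x (face I 0) ws + (-1) ^ ?n * Tr x (face I (Suc ?n)) ws" .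
  moreover have "(\<Sum>j\<le>?n. (-1) ^ j * Tr x (face I j) ws) = Tr x (face I 0) ws + (\<Sum>j=1..?n. (-1) ^ j * Tr x (face I j) ws)"
    unfolding atLeast0AtMost[symmetric] by (subst sum.atLeast_Suc_atMost) simp_all
  ultimately show ?thesis by simp
qed

text \<open>The composite over a single index is the identity, whose trace is the rank. Generators
  of degree 0 thus follow the same formula as all others, and the boundary relation includes the
  equality of ranks of isomorphic bundles.\<close>

lemma Tr_singleton:
  assumes p: "p \<le> m" and x: "x \<in> points U"
  shows "Tr x [p] [] = of_nat (vdim (Fb p x))"
proof -
  obtain r t where t: "coord_iso (Fb p x) r t" using B_iso[OF p x] .
  have idx: "index_list [p]" using p by (simp add: index_list_def)
  have "finv p p x e = e" if "e \<in> carrier (Fb p x)" for e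
    using finv_f[OF order_refl p x that] unfolding f_self bundle_id_apply[OF x that] .
  then have "Tr x [p] [] = (\<Sum>k<r. t (basis_vec (Fb p x) t k) k)"
    using Tr_coords[OF idx _ _ x, of "[]" r t] t basis_vec_closed[OF t] by simp
  also have "\<dots> = of_nat r" by (simp add: coord_basis_vec[OF t])
  finally show ?thesis using vdim_eq[OF M[OF p x] t] by simp
qed

lemma gens_index_list: "I \<in> simplex_gens m l \<Longrightarrow> index_list I"
  by (auto simp: simplex_gens_def index_list_def strict_sorted_iff)

text \<open>Also valid for \<open>l = 0\<close>, where only the empty permutation is summed. The
  reversal is due to the convention of \<open>ch_trace\<close>: the factor applied first takes the
  last entry of the permuted list.\<close>

lemma ch_form_eq:
  assumes I: "I \<in> simplex_gens m l" and x: "x \<in> points U" and vs: "length vs = l" "set vs \<subseteq> tangent U x"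
  shows "ch_form U (Es, fs) I x vs =
    (\<Sum>\<pi> | \<pi> permutes {..<l}. of_int (sign \<pi>) * Tr x I (rev (permute_list \<pi> vs)))"
proof (cases "l = 0")
  case True
  then obtain p where "I = [p]" using I by (auto simp: simplex_gens_def length_Suc_conv)
  then show ?thesis using True I x vs Tr_singleton[of p x]
    by (simp add: ch_form_def simplex_gens_def)
next
  case False
  have len: "length I = Suc l" using I by (simp add: simplex_gens_def)
  then have "I \<noteq> []" by auto
  then have ends: "I ! 0 = hd I" "I ! l = last I" using len by (simp_all add: hd_conv_nth last_conv_nth)
  \<comment> \<open>For \<open>j\<close> from 1 to \<open>l\<close> the position
    \<open>l - j\<close> runs from \<open>l - 1\<close> down to 0.\<close>
  have "map (\<lambda>j. vs ! \<pi> (l - j)) [1..<Suc l] = rev (permute_list \<pi> vs)" for \<pi>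
    by (rule nth_equalityI) (simp_all add: vs(1) rev_nth permute_list_def del: upt_Suc)
  then have "fold (\<lambda>j. D x (I ! j) (I ! (j - 1)) (vs ! \<pi> (l - j))) [1..<Suc l] e = C x I (rev (permute_list \<pi> vs)) e" for \<pi> e
    using fold_chain_comp[OF len, of "D x" "\<lambda>j. vs ! \<pi> (l - j)" e] by (simp del: upt_Suc)
  then have "ch_trace U (Es, fs) I x vs =
    (\<Sum>\<pi> | \<pi> permutes {..<l}. of_int (sign \<pi>) * Tr x I (rev (permute_list \<pi> vs)))"
    unfolding ch_trace_def Tr_def Let_def len diff_Suc_1 fst_conv D_def[symmetric] ends[symmetric]
    by (simp only:)
  then show ?thesis using x vs len False by (simp add: ch_form_def)
qed

text \<open>All faces of \<open>I\<close> have the same length and consume the same tangent vectors,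
  so the sums over faces and over permutations can be interchanged.\<close>

lemma ch_form_boundary:
  assumes I: "I \<in> simplex_gens m (Suc l)"
  shows "(\<Sum>j\<le>Suc l. (-1) ^ j * ch_form U (Es, fs) (face I j) x vs) = 0"
proof (cases "x \<in> points U \<and> length vs = l \<and> set vs \<subseteq> tangent U x")
  case True
  then have x: "x \<in> points U" and vs: "length vs = l" "set vs \<subseteq> tangent U x" by auto
  have "(\<Sum>j\<le>Suc l. (-1) ^ j * ch_form U (Es, fs) (face I j) x vs) =
     (\<Sum>j\<le>Suc l. \<Sum>\<pi> | \<pi> permutes {..<l}. of_int (sign \<pi>) * ((-1) ^ j * Tr x (face I j) (rev (permute_list \<pi> vs))))"
    by (rule sum.cong[OF refl]) (simp only: ch_form_eq[OF face_gens[OF I] x vs] atMost_iff sum_distrib_left mult_ac)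
  also have "\<dots> = (\<Sum>\<pi> | \<pi> permutes {..<l}. \<Sum>j\<le>Suc l. of_int (sign \<pi>) * ((-1) ^ j * Tr x (face I j) (rev (permute_list \<pi> vs))))"
    by (rule sum.swap)
  also have "\<dots> = 0"
  proof (rule sum.neutral, rule ballI)
    fix \<pi> assume "\<pi> \<in> {\<pi>. \<pi> permutes {..<l}}"
    then have \<pi>: "\<pi> permutes {..<length vs}" using vs by simp
    have ws: "set (rev (permute_list \<pi> vs)) \<subseteq> tangent U x" "length (rev (permute_list \<pi> vs)) = l"
      using vs set_permute_list[OF \<pi>] by auto
    have "(\<Sum>j\<le>Suc l. (-1) ^ j * Tr x (face I j) (rev (permute_list \<pi> vs))) = 0"
      using Tr_boundary[OF gens_index_list[OF I] _ ws(1) x] I ws(2) by (simp only: simplex_gens_def mem_Collect_eq)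
    then show "(\<Sum>j\<le>Suc l. of_int (sign \<pi>) * ((-1) ^ j * Tr x (face I j) (rev (permute_list \<pi> vs)))) = 0"
      by (simp only: sum_distrib_left[symmetric] mult_zero_right)
  qed
  finally show ?thesis .
next
  case False
  \<comment> \<open>Off tuples of \<open>l\<close> tangent vectors every face contributes the
    default value 0.\<close>
  have "length (face I j) = Suc l" if "j \<le> Suc l" for j
    using face_gens[OF I that] by (simp add: simplex_gens_def)
  then have "ch_form U (Es, fs) (face I j) x vs = 0" if "j \<le> Suc l" for j
    using False that unfolding ch_form_def by (metis diff_Suc_1)
  then show ?thesis by (intro sum.neutral) simp
qed

text \<open>One trivialisation is fixed for each of the finitely many bundles, and everything
  happens over the intersection of their domains. There the composite is a product of matrices with
  holomorphic entries by \<open>nabla_holo\<close>; the induction multiplies in the factor applied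
  first.\<close>

lemma C_holo:
  assumes c: "(n, Q, \<phi>) \<in> atlas U"
    and T: "\<And>p. p \<le> m \<Longrightarrow> (Dm p, rk p, tr p) \<in> trivs (B p)"
    and I: "index_list I" "length I = Suc (length js)" and js: "set js \<subseteq> {..<n}"
    and k: "k < rk (hd I)" and i: "i < rk (last I)"
  shows "holo_on n (\<phi> ` (Q \<inter> (\<Inter>p\<le>m. Dm p))) (\<lambda>z. tr (last I) (inv_into Q \<phi> z)
     (C (inv_into Q \<phi> z) I (map (coord_vec U (n, Q, \<phi>) (inv_into Q \<phi> z)) js)
       (frame (B (hd I)) (Dm (hd I), rk (hd I), tr (hd I)) k (inv_into Q \<phi> z))) i)"
  using I js k i
proof (induction js arbitrary: I k)
  let ?x = "inv_into Q \<phi>"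
  let ?A = "\<Inter>p\<le>m. Dm p"
  let ?e = "\<lambda>p. frame (B p) (Dm p, rk p, tr p)"
  let ?v = "\<lambda>x. coord_vec U (n, Q, \<phi>) x"
  have A: "openin (mtop U) ?A"
    by (rule openin_INT2) (use triv_open[OF B T] in auto)
  have op: "open_Cn n (\<phi> ` (Q \<inter> ?A))" by (rule chart_open_image[OF c A])
  {
    case Nil
    then obtain p where I: "I = [p]" by (cases I) auto
    have p: "p \<le> m" using Nil.prems(1) by (simp add: I index_list_def)
    show ?case
    proof (subst holo_on_cong[OF op])
      show "holo_on n (\<phi> ` (Q \<inter> ?A)) (\<lambda>z. if i = k then 1 else 0)" by (rule holo_on_const)
      fix z assume "z \<in> \<phi> ` (Q \<inter> ?A)"
      then have "?x z \<in> Dm p" using p c by auto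
      then show "tr (last I) (?x z) (C (?x z) I (map (?v (?x z)) []) (?e (hd I) k (?x z))) i = (if i = k then 1 else 0)"
        using triv_frame[OF B[OF p] T[OF p]] Nil.prems(4) by (simp add: I)
    qed
  next
    case (Cons j js)
    then obtain p q J where I: "I = p # q # J" by (cases I; cases "tl I") auto
    with Cons.prems have pq: "p \<le> q" "q \<le> m" "p \<le> m" "index_list (q # J)" by (auto simp: index_list_Cons)
    have last: "last (q # J) = last I" by (simp add: I)
    have len: "length (q # J) = Suc (length js)" using Cons.prems(2) by (simp add: I)
    have j: "j < n" "set js \<subseteq> {..<n}" using Cons.prems(3) by auto
    have k: "k < rk p" using Cons.prems(4) by (simp add: I)
    have lm: "last I \<le> m" using index_list_bounds[OF Cons.prems(1)] by simp
    have "holo_on n (\<phi> ` (Q \<inter> ?A)) (\<lambda>z. \<Sum>a<rk q. tr q (?x z) (D (?x z) q p (?v (?x z) j) (?e p k (?x z))) a *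
        tr (last I) (?x z) (C (?x z) (q # J) (map (?v (?x z)) js) (?e q a (?x z))) i)"
    proof (intro holo_on_sum holo_on_mult)
      fix a assume "a \<in> {..<rk q}"
      then have a: "a < rk q" by simp
      show "holo_on n (\<phi> ` (Q \<inter> ?A)) (\<lambda>z. tr q (?x z) (D (?x z) q p (?v (?x z) j) (?e p k (?x z))) a)"
        unfolding D_eq
        by (rule holo_on_subset[OF hom_conn.nabla_holo[OF hom_conn[OF pq(1,2)] c T[OF pq(3)] T[OF pq(2)] j(1) k a]])
          (use pq in auto)
      show "holo_on n (\<phi> ` (Q \<inter> ?A)) (\<lambda>z. tr (last I) (?x z) (C (?x z) (q # J) (map (?v (?x z)) js) (?e q a (?x z))) i)"
        using Cons.IH[OF pq(4) len j(2), of a] a Cons.prems(5) unfolding last by simp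
    qed
    moreover have "(\<Sum>a<rk q. tr q (?x z) (D (?x z) q p (?v (?x z) j) (?e p k (?x z))) a *
        tr (last I) (?x z) (C (?x z) (q # J) (map (?v (?x z)) js) (?e q a (?x z))) i) =
        tr (last I) (?x z) (C (?x z) I (map (?v (?x z)) (j # js)) (?e (hd I) k (?x z))) i"
      if z: "z \<in> \<phi> ` (Q \<inter> ?A)" for z
    proof -
      obtain x where x: "?x z = x" "x \<in> Q" "x \<in> Dm p" "x \<in> Dm q" "x \<in> Dm (last I)"
        using z c pq lm by auto
      have xU: "x \<in> points U" by (rule triv_points[OF B[OF pq(3)] T[OF pq(3)] x(3)])
      have v: "?v x l \<in> tangent U x" if "l < n" for l by (rule coord_vec_tangent[OF c x(2) that])
      have ws: "set (map (?v x) js) \<subseteq> tangent U x" using j(2) v by auto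
      have lin: "linear_on (Fb q x) (Fb (last I) x) (C x (q # J) (map (?v x) js))"
        using C_linear[OF pq(4) _ ws] len unfolding last by simp
      have de: "D x q p (?v x j) (?e p k x) \<in> carrier (Fb q x)"
        by (rule D_closed[OF pq(1,2) v[OF j(1)] frame_closed[OF B[OF pq(3)] T[OF pq(3)] x(3) k]])
      have "tr (last I) x (C x (q # J) (map (?v x) js) (D x q p (?v x j) (?e p k x))) i =
          (\<Sum>a<rk q. tr q x (D x q p (?v x j) (?e p k x)) a *
             tr (last I) x (C x (q # J) (map (?v x) js) (basis_vec (Fb q x) (tr q x) a)) i)"
        by (rule linear_coords[OF M[OF pq(2) xU] lin triv_iso[OF B[OF pq(2)] T[OF pq(2)] x(4)]
              triv_iso[OF B[OF lm] T[OF lm] x(5)] de])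
      then show ?thesis unfolding x(1) by (simp add: I frame_eq[OF x(4)])
    qed
    ultimately show ?case by (subst (asm) holo_on_cong[OF op])
  }
qed

text \<open>Two matrices are involved: that of the composite, from \<open>C_holo\<close>, and that
  of the inverse isomorphism, from \<open>isos_inv_into_hol_fun\<close>. The trace is the double sum
  of products of their entries.\<close>

lemma Tr_holo:
  assumes c: "(n, Q, \<phi>) \<in> atlas U"
    and T: "\<And>p. p \<le> m \<Longrightarrow> (Dm p, rk p, tr p) \<in> trivs (B p)"
    and I: "index_list I" "length I = Suc (length js)" and js: "set js \<subseteq> {..<n}"
  shows "holo_on n (\<phi> ` (Q \<inter> (\<Inter>p\<le>m. Dm p)))
    (\<lambda>z. Tr (inv_into Q \<phi> z) I (map (coord_vec U (n, Q, \<phi>) (inv_into Q \<phi> z)) js))"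
proof -
  let ?x = "inv_into Q \<phi>"
  let ?A = "\<Inter>p\<le>m. Dm p"
  let ?e = "\<lambda>p. frame (B p) (Dm p, rk p, tr p)"
  let ?v = "\<lambda>x. coord_vec U (n, Q, \<phi>) x"
  have A: "openin (mtop U) ?A"
    by (rule openin_INT2) (use triv_open[OF B T] in auto)
  have op: "open_Cn n (\<phi> ` (Q \<inter> ?A))" by (rule chart_open_image[OF c A])
  define p where "p = hd I"
  define q where "q = last I"
  have pq: "p \<le> q" "q \<le> m" "p \<le> m"
    using index_list_hd_last[OF I(1)] index_list_bounds[OF I(1)] by (auto simp: p_def q_def)
  have "holo_on n (\<phi> ` (Q \<inter> ?A)) (\<lambda>z. \<Sum>k<rk p. \<Sum>a<rk q.
      tr q (?x z) (C (?x z) I (map (?v (?x z)) js) (?e p k (?x z))) a * tr p (?x z) (finv q p (?x z) (?e q a (?x z))) k)"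
  proof (intro holo_on_sum holo_on_mult)
    fix k a assume "k \<in> {..<rk p}" "a \<in> {..<rk q}"
    then have ka: "k < rk p" "a < rk q" by auto
    show "holo_on n (\<phi> ` (Q \<inter> ?A)) (\<lambda>z. tr q (?x z) (C (?x z) I (map (?v (?x z)) js) (?e p k (?x z))) a)"
      using C_holo[where Dm = Dm and rk = rk and tr = tr, OF c T I js] ka by (simp add: p_def q_def)
    have "hol_fun U (Dm q \<inter> Dm p) (\<lambda>x. tr p x (finv q p x (?e q a x)) k)"
      by (rule isos_inv_into_hol_fun[OF B B f_iso T T]) (use pq ka in auto)
    from hol_fun_chart[OF this c]
    show "holo_on n (\<phi> ` (Q \<inter> ?A)) (\<lambda>z. tr p (?x z) (finv q p (?x z) (?e q a (?x z))) k)"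
      by (rule holo_on_subset) (use pq in auto)
  qed
  moreover have "(\<Sum>k<rk p. \<Sum>a<rk q.
      tr q (?x z) (C (?x z) I (map (?v (?x z)) js) (?e p k (?x z))) a * tr p (?x z) (finv q p (?x z) (?e q a (?x z))) k) =
      Tr (?x z) I (map (?v (?x z)) js)" if z: "z \<in> \<phi> ` (Q \<inter> ?A)" for z
  proof -
    obtain x where x: "?x z = x" "x \<in> Q" "x \<in> Dm p" "x \<in> Dm q" using z c pq by auto
    have xU: "x \<in> points U" by (rule triv_points[OF B[OF pq(3)] T[OF pq(3)] x(3)])
    have "?v x l \<in> tangent U x" if "l < n" for l by (rule coord_vec_tangent[OF c x(2) that])
    then have ws: "set (map (?v x) js) \<subseteq> tangent U x" using js by auto
    have len: "length I = Suc (length (map (?v x) js))" using I(2) by simp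
    note isop = triv_iso[OF B[OF pq(3)] T[OF pq(3)] x(3)] and isoq = triv_iso[OF B[OF pq(2)] T[OF pq(2)] x(4)]
    have "Tr x I (map (?v x) js) = (\<Sum>k<rk p. tr p x (finv q p x (C x I (map (?v x) js) (?e p k x))) k)"
      using Tr_coords[OF I(1) len ws xU, of "rk p" "tr p x"] isop
      unfolding p_def[symmetric] q_def[symmetric] by (simp add: frame_eq[OF x(3)])
    also have "\<dots> = (\<Sum>k<rk p. \<Sum>a<rk q. tr q x (C x I (map (?v x) js) (?e p k x)) a * tr p x (finv q p x (?e q a x)) k)"
    proof (rule sum.cong[OF refl])
      fix k assume "k \<in> {..<rk p}"
      then have "?e p k x \<in> carrier (Fb (hd I) x)"
        using frame_closed[OF B[OF pq(3)] T[OF pq(3)] x(3)] by (simp add: p_def)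
      from C_closed[OF I(1) len ws this] have "C x I (map (?v x) js) (?e p k x) \<in> carrier (Fb q x)" by (simp only: q_def)
      from linear_coords[OF M[OF pq(2) xU] finv_linear[OF pq(1,2) xU] isoq isop this]
      show "tr p x (finv q p x (C x I (map (?v x) js) (?e p k x))) k =
          (\<Sum>a<rk q. tr q x (C x I (map (?v x) js) (?e p k x)) a * tr p x (finv q p x (?e q a x)) k)"
        by (simp add: frame_eq[OF x(4)])
    qed
    finally show ?thesis unfolding x(1) by simp
  qed
  ultimately show ?thesis by (subst (asm) holo_on_cong[OF op])
qed

text \<open>Linearity and holomorphy hold for each permutation separately, whereas alternation is a
  property of the signed sum.\<close>

lemma ch_form_hol_forms:
  assumes I: "I \<in> simplex_gens m l"
  shows "ch_form U (Es, fs) I \<in> hol_forms U l"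
proof (rule hol_formsI)
  have len: "length I = Suc l" using I by (simp add: simplex_gens_def)
  note idx = gens_index_list[OF I]
  {
    fix x vs assume "\<not> (x \<in> points U \<and> length vs = l \<and> set vs \<subseteq> tangent U x)"
    then show "ch_form U (Es, fs) I x vs = 0" using len unfolding ch_form_def by (metis diff_Suc_1)
  next
    fix x vs i v w a b
    assume x: "x \<in> points U" and vs: "length vs = l" "set vs \<subseteq> tangent U x" and i: "i < l"
      and v: "v \<in> tangent U x" and w: "w \<in> tangent U x"
    have upd: "length (vs[i := u]) = l" "set (vs[i := u]) \<subseteq> tangent U x" if "u \<in> tangent U x" for u
      using vs that set_update_subset_insert[of vs i u] by auto
    have lin: "Tr x I (rev (permute_list \<pi> (vs[i := tlin a v b w]))) =
        a * Tr x I (rev (permute_list \<pi> (vs[i := v]))) + b * Tr x I (rev (permute_list \<pi> (vs[i := w])))"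
      if \<pi>: "\<pi> permutes {..<l}" for \<pi>
    proof -
      have \<pi>': "\<pi> permutes {..<length vs}" using \<pi> vs by simp
      \<comment> \<open>The slot of \<open>i\<close> in the permuted list, counted from the other
        end because of the reversal.\<close>
      let ?k = "l - inv_into UNIV \<pi> i - 1"
      have "inv_into UNIV \<pi> i < l" using permutes_in_image[OF permutes_inv[OF \<pi>], of i] i by simp
      then have "rev (permute_list \<pi> (vs[i := u])) = (rev (permute_list \<pi> vs))[?k := u]" for u
        using i vs(1) by (simp add: permute_list_update[OF \<pi>'] rev_update)
      moreover have "set (rev (permute_list \<pi> vs)) \<subseteq> tangent U x" using vs set_permute_list[OF \<pi>'] by simp
      moreover have "?k < length (rev (permute_list \<pi> vs))" using i vs(1) by simp
      ultimately show ?thesis using Tr_tlin[OF idx _ _ _ v w] len vs(1) by simp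
    qed
    show "ch_form U (Es, fs) I x (vs[i := tlin a v b w]) =
        a * ch_form U (Es, fs) I x (vs[i := v]) + b * ch_form U (Es, fs) I x (vs[i := w])"
      unfolding ch_form_eq[OF I x upd[OF tangent_tlin[OF v w]]] ch_form_eq[OF I x upd[OF v]] ch_form_eq[OF I x upd[OF w]]
        sum_distrib_left sum.distrib[symmetric]
      by (rule sum.cong[OF refl]) (simp add: lin algebra_simps)
  next
    fix x vs i j
    assume x: "x \<in> points U" and vs: "length vs = l" "set vs \<subseteq> tangent U x" and "i < l" "j < l" "i \<noteq> j" "vs ! i = vs ! j"
    then show "ch_form U (Es, fs) I x vs = 0"
      unfolding ch_form_eq[OF I x vs]
      using alternating_sum_zero[of i vs j "\<lambda>ws. Tr x I (rev ws)"] by simp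
  next
    fix n Q \<phi> js assume c: "(n, Q, \<phi>) \<in> atlas U" and js: "length js = l" "set js \<subseteq> {..<n}"
    show "holo_on n (\<phi> ` Q) (\<lambda>z. ch_form U (Es, fs) I (inv_into Q \<phi> z) (map (coord_vec U (n, Q, \<phi>) (inv_into Q \<phi> z)) js))"
    proof (rule holo_on_local)
      show "\<phi> ` Q \<subseteq> Cn n" by (rule openin_imp_subset[OF chart_image_open[OF c]])
      fix z assume "z \<in> \<phi> ` Q"
      then obtain x where x: "z = \<phi> x" "x \<in> Q" by blast
      then have xU: "x \<in> points U" using open_subset_points[OF chart_open[OF c]] by blast
      \<comment> \<open>Only finitely many bundles occur, so trivialisations around \<open>x\<close>
        can be chosen for all of them and intersected to an open set.\<close>
      have "\<forall>p. \<exists>D r t. p \<le> m \<longrightarrow> (D, r, t) \<in> trivs (B p) \<and> x \<in> D"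
        using points_triv[OF B xU] by metis
      then obtain Dm rk tr where T: "\<And>p. p \<le> m \<Longrightarrow> (Dm p, rk p, tr p) \<in> trivs (B p)" "\<And>p. p \<le> m \<Longrightarrow> x \<in> Dm p"
        by metis
      let ?A = "\<Inter>p\<le>m. Dm p"
      have A: "openin (mtop U) ?A"
        by (rule openin_INT2) (use triv_open[OF B T(1)] in auto)
      have op: "open_Cn n (\<phi> ` (Q \<inter> ?A))" by (rule chart_open_image[OF c A])
      let ?x = "inv_into Q \<phi>"
      let ?v = "\<lambda>x. coord_vec U (n, Q, \<phi>) x"
      have "holo_on n (\<phi> ` (Q \<inter> ?A)) (\<lambda>z. \<Sum>\<pi> | \<pi> permutes {..<l}. of_int (sign \<pi>) *
          Tr (?x z) I (map (?v (?x z)) (rev (permute_list \<pi> js))))"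
      proof (intro holo_on_sum holo_on_mult holo_on_const)
        fix \<pi> assume "\<pi> \<in> {\<pi>. \<pi> permutes {..<l}}"
        then have "\<pi> permutes {..<length js}" using js by simp
        then have "set (rev (permute_list \<pi> js)) \<subseteq> {..<n}" using js by simp
        then show "holo_on n (\<phi> ` (Q \<inter> ?A)) (\<lambda>z. Tr (?x z) I (map (?v (?x z)) (rev (permute_list \<pi> js))))"
          using Tr_holo[where Dm = Dm and rk = rk and tr = tr, OF c T(1) idx] len js by simp
      qed
      moreover have "(\<Sum>\<pi> | \<pi> permutes {..<l}. of_int (sign \<pi>) * Tr (?x z) I (map (?v (?x z)) (rev (permute_list \<pi> js)))) =
          ch_form U (Es, fs) I (?x z) (map (?v (?x z)) js)" if z: "z \<in> \<phi> ` (Q \<inter> ?A)" for z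
      proof -
        obtain y where y: "?x z = y" "y \<in> Q" using z c by auto
        have yU: "y \<in> points U" using y open_subset_points[OF chart_open[OF c]] by blast
        have "?v y i \<in> tangent U y" if "i < n" for i by (rule coord_vec_tangent[OF c y(2) that])
        then have ws: "set (map (?v y) js) \<subseteq> tangent U y" "length (map (?v y) js) = l" using js by auto
        show ?thesis unfolding y(1) ch_form_eq[OF I yU ws(2,1)]
          by (rule sum.cong[OF refl]) (simp add: permute_list_map rev_map js(1))
      qed
      ultimately have "holo_on n (\<phi> ` (Q \<inter> ?A)) (\<lambda>z. ch_form U (Es, fs) I (?x z) (map (?v (?x z)) js))"
        by (subst (asm) holo_on_cong[OF op])
      moreover have "z \<in> \<phi> ` (Q \<inter> ?A)" using x T(2) by auto
      ultimately show "\<exists>T. open_Cn n T \<and> z \<in> T \<and> holo_on n T (\<lambda>z. ch_form U (Es, fs) I (?x z) (map (?v (?x z)) js))"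
        using op by blast
    qed
  }
qed

end

section \<open>Chain maps and simplicial operators\<close>

context hvb_chain
begin

lemma Ch_apply:
  assumes "c \<in> carrier (cgrp (simplex_complex m) l)"
  shows "Ch U m (Es, fs) l c =
    (\<lambda>q p x vs. if q = l \<and> p = l then lin_ext (\<lambda>I. ch_form U (Es, fs) I x vs) c else 0)"
  using assms by (auto simp: Ch_def lin_ext_def fun_eq_iff)

lemma Ch_chain_map: "Ch U m (Es, fs) \<in> chain_maps (simplex_complex m) (uform_complex U)"
proof (rule chain_mapsI)
  fix l
  let ?S = "\<lambda>l. carrier (cgrp (simplex_complex m) l)"
  show "Ch U m (Es, fs) l \<in> extensional (?S l)" by (simp add: Ch_def)
  show "Ch U m (Es, fs) l c \<in> carrier (cgrp (uform_complex U) l)" if c: "c \<in> ?S l" for c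
  proof -
    have "(\<lambda>x vs. lin_ext (\<lambda>I. ch_form U (Es, fs) I x vs) c) \<in> hol_forms U l"
      unfolding lin_ext_def
      by (intro hol_forms_sum hol_forms_scale ch_form_hol_forms) (use c in \<open>auto simp: cgrp_simplex\<close>)
    moreover have "finite {(q, p). (\<lambda>x vs. if q = l \<and> p = l then lin_ext (\<lambda>I. ch_form U (Es, fs) I x vs) c else 0) \<noteq> (\<lambda>x vs. 0)}"
      by (rule finite_subset[of _ "{(l, l)}"]) auto
    moreover have "(\<lambda>x vs. if q = l \<and> p = l then F x vs else 0) = (if q = l \<and> p = l then F else (\<lambda>x vs. 0))"
      for q p and F :: "'a form"
      by auto
    \<comment> \<open>The only component that can be nonzero has \<open>q = p = l\<close>; its
      degree is \<open>l - 2 * l\<close>, the required \<open>- l\<close>.\<close>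
    ultimately show ?thesis
      unfolding carrier_uform Ch_apply[OF c] uforms_def by (auto simp: hol_forms_zero)
  qed
  show "Ch U m (Es, fs) l (a \<otimes>\<^bsub>cgrp (simplex_complex m) l\<^esub> b) =
      Ch U m (Es, fs) l a \<otimes>\<^bsub>cgrp (uform_complex U) l\<^esub> Ch U m (Es, fs) l b" if ab: "a \<in> ?S l" "b \<in> ?S l" for a b
  proof -
    have eq: "a \<otimes>\<^bsub>cgrp (simplex_complex m) l\<^esub> b = a + b" by (simp add: cgrp_simplex)
    show ?thesis
      unfolding eq mult_uform Ch_apply[OF simplex_mult_closed[OF ab]] Ch_apply[OF ab(1)] Ch_apply[OF ab(2)]
      by (auto simp: fun_eq_iff lin_ext_add)
  qed
  show "Ch U m (Es, fs) l (cdiff (simplex_complex m) l c) = cdiff (uform_complex U) l (Ch U m (Es, fs) (Suc l) c)"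
    if c: "c \<in> ?S (Suc l)" for c
  proof -
    \<comment> \<open>At a fixed point and fixed tangent vectors the condition is one about scalars,
      and it may be checked on generators, where it is \<open>ch_form_boundary\<close>.\<close>
    have "lin_ext (\<lambda>I. ch_form U (Es, fs) I x vs) (frag_extend (boundary l) c) = lin_ext (\<lambda>I. 0) c" for x vs
    proof (rule lin_ext_frag_extend)
      show "Poly_Mapping.keys c \<subseteq> simplex_gens m (Suc l)" using c by (simp add: cgrp_simplex)
      fix I assume I: "I \<in> simplex_gens m (Suc l)"
      show "lin_ext (\<lambda>I. ch_form U (Es, fs) I x vs) (boundary l I) = 0"
        using ch_form_boundary[OF I, of x vs] by (simp only: lin_ext_sum lin_ext_cmul lin_ext_of of_int_power of_int_minus of_int_1)
    qed
    moreover have "lin_ext (\<lambda>I. 0) c = 0" by (simp add: lin_ext_def)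
    ultimately show ?thesis
      unfolding Ch_apply[OF cdiff_simplex_closed[OF c]] cdiff_uform
      unfolding cdiff_simplex by (simp only: if_cancel cong: if_cong)
  qed
qed

text \<open>Objects and paths of the new simplex at the indices of \<open>I\<close> are those of the
  old one at the indices of \<open>map \<theta> I\<close>, hence the traces agree. The normalised
  chains send collapsed generators to 0, so what remains is the vanishing of the corresponding
  traces.\<close>

lemma Ch_sact:
  assumes \<theta>: "\<theta> \<in> ord_maps k m"
  shows "Ch U k (sact (nerve (hvb_groupoid U)) k m \<theta> (Es, fs)) = sact (DK (uform_complex U)) k m \<theta> (Ch U m (Es, fs))"
proof -
  obtain Es' fs' where s: "sact (nerve (hvb_groupoid U)) k m \<theta> (Es, fs) = (Es', fs')" by (cases "sact (nerve (hvb_groupoid U)) k m \<theta> (Es, fs)")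
  have "(Es', fs') \<in> simplices (nerve (hvb_groupoid U)) k"
    using sact_simplex[OF \<theta>] s by simp
  then interpret S: hvb_chain U k Es' fs'
    using C by unfold_locales
  have E: "Es' ! p = Es ! \<theta> p" if "p \<le> k" for p
  proof -
    have "Es' = map (\<lambda>j. Es ! \<theta> j) [0..<Suc k]" using s by (simp add: nerve_def del: upt_Suc)
    then show ?thesis using that by (simp add: less_Suc_eq_le del: upt_Suc)
  qed
  have path: "S.f q p = f (\<theta> q) (\<theta> p)" if "p \<le> q" "q \<le> k" for p q
    using path_sact[OF \<theta>, of p "q - p"] that unfolding s by simp
  have D: "S.D x q p v = D x (\<theta> q) (\<theta> p) v" if "p \<le> q" "q \<le> k" for x q p v
    using E[of p] E[of q] path[OF that] that by (simp add: S.D_def D_def)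
  have Ceq: "S.C x I ws e = C x (map \<theta> I) ws e" if "S.index_list I" for x I ws e
    using that
  proof (induction ws arbitrary: I e)
    case Nil
    then show ?case by (cases I; cases "tl I") auto
  next
    case (Cons w ws)
    then obtain p J where I: "I = p # J" by (cases I) (auto simp: S.index_list_def)
    show ?case
    proof (cases J)
      case (Cons q J')
      then have "p \<le> q" "q \<le> k" "S.index_list (q # J')" using Cons.prems I by (auto simp: S.index_list_Cons)
      then show ?thesis using Cons.IH by (simp add: I Cons D)
    qed (simp add: I)
  qed
  have Tr: "S.Tr x I ws = Tr x (map \<theta> I) ws" if I: "S.index_list I" for x I ws
  proof -
    have ne: "I \<noteq> []" using I by (simp add: S.index_list_def)
    have b: "hd I \<le> last I" "last I \<le> k" "hd I \<le> k" using S.index_list_hd_last[OF I] S.index_list_bounds[OF I] by auto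
    show ?thesis
      unfolding S.Tr_def Tr_def hd_map[OF ne] last_map[OF ne]
      by (simp only: Ceq[OF I] path[OF b(1,2)] E[OF b(3)])
  qed
  \<comment> \<open>The comparison on one generator: the extension evaluates either the image
    generator or, if \<open>\<theta>\<close> identifies two indices, the chain 0, where
    \<open>Tr_degenerate\<close> applies.\<close>
  have form: "lin_ext (\<lambda>I. ch_form U (Es, fs) I x vs) (if distinct (map \<theta> I) then frag_of (map \<theta> I) else 0) =
      ch_form U (Es', fs') I x vs" if I: "I \<in> simplex_gens k l" for I l x vs
  proof (cases "x \<in> points U \<and> length vs = l \<and> set vs \<subseteq> tangent U x")
    case True
    then have x: "x \<in> points U" and vs: "length vs = l" "set vs \<subseteq> tangent U x" by auto
    have cf: "ch_form U (Es', fs') I x vs = (\<Sum>\<pi> | \<pi> permutes {..<l}. of_int (sign \<pi>) * Tr x (map \<theta> I) (rev (permute_list \<pi> vs)))"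
      unfolding S.ch_form_eq[OF I x vs] Tr[OF S.gens_index_list[OF I]] ..
    show ?thesis
    proof (cases "distinct (map \<theta> I)")
      case True
      then show ?thesis
        by (simp only: if_True lin_ext_of cf ch_form_eq[OF simplex_map_gens[OF \<theta> I True] x vs])
    next
      case False
      have "index_list (map \<theta> I)"
        using sorted_map_ord[OF \<theta> I] I ord_maps_le[OF \<theta>]
        by (auto simp: index_list_def simplex_gens_def simp del: sorted_map)
      then have "Tr x (map \<theta> I) (rev (permute_list \<pi> vs)) = 0" if "\<pi> permutes {..<l}" for \<pi>
        using Tr_degenerate[OF _ False _ _ x] I vs that set_permute_list[of \<pi> vs]
        by (simp add: simplex_gens_def)
      then show ?thesis using False by (simp add: cf lin_ext_0)
    qed
  next
    case False
    have "length I = Suc l" using I by (simp add: simplex_gens_def)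
    then have "ch_form U (Es', fs') I x vs = 0" "ch_form U (Es, fs) (map \<theta> I) x vs = 0"
      using False by (auto simp: ch_form_def)
    then show ?thesis by (simp add: lin_ext_of lin_ext_0)
  qed
  show ?thesis
    unfolding s
  proof (rule ext)
    fix l
    show "Ch U k (Es', fs') l = sact (DK (uform_complex U)) k m \<theta> (Ch U m (Es, fs)) l"
    proof (rule extensionalityI)
      fix c assume c: "c \<in> carrier (cgrp (simplex_complex k) l)"
      have "lin_ext (\<lambda>I. ch_form U (Es, fs) I x vs) (simplex_complex_map \<theta> c) = lin_ext (\<lambda>I. ch_form U (Es', fs') I x vs) c" for x vs
        unfolding simplex_complex_map_def
        by (rule lin_ext_frag_extend[OF _ form]) (use c in \<open>simp_all add: cgrp_simplex\<close>)
      then show "Ch U k (Es', fs') l c = sact (DK (uform_complex U)) k m \<theta> (Ch U m (Es, fs)) l c"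
        unfolding S.Ch_apply[OF c] using c
        by (auto simp: DK_def Ch_apply[OF simplex_complex_map_closed[OF \<theta> c]] fun_eq_iff)
    qed (simp_all add: Ch_def DK_def)
  qed
qed

end

text \<open>The fibre of a pulled back bundle over \<open>x\<close> is the fibre over
  \<open>g x\<close>, so both traces are taken on the same vector space. The derivatives correspond
  by \<open>pull_hom_connection\<close>, with pushed tangent vectors, which are the arguments that
  \<open>pull_form\<close> supplies.\<close>

lemma Ch_pull:
  fixes U V :: "'a cman" and Es :: "('a, 'v) hvb_object list"
  assumes "cman_map U V g" "hvb_chain V m Es fs"
  shows "Ch U m (pmap HVB U V g m (Es, fs)) = pmap Omega U V g m (Ch V m (Es, fs))"
proof -
  interpret cman_map U V g by fact
  interpret N: hvb_chain V m Es fs by fact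
  define Es' where "Es' = map (pull_object U V g) Es"
  define fs' where "fs' = map (\<lambda>f. \<lambda>x\<in>points U. f (g x)) fs"
  have s: "pmap HVB U V g m (Es, fs) = (Es', fs')" by (simp add: HVB_def Es'_def fs'_def)
  have "(Es', fs') \<in> simplices (nerve (hvb_groupoid U)) m"
    using simplicial_map_nerve[OF V.hvb_category pull_functor] N.\<sigma>
    unfolding simplicial_map_def Es'_def fs'_def by (auto simp: Pi_iff)
  then interpret P: hvb_chain U m Es' fs'
    using U.hvb_category by unfold_locales
  have E: "Es' ! p = (pb (N.B p), pull_connection U V g (N.B p) (N.K p))" if "p \<le> m" for p
    using that N.length_Es by (simp add: Es'_def case_prod_beta)
  have path: "P.f q p = (\<lambda>x\<in>points U. N.f q p (g x))" if "p \<le> q" "q \<le> m" for p q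
    using functor_nerve_path[OF V.hvb_category pull_functor N.\<sigma>, of p "q - p"] that
    by (simp add: Es'_def fs'_def)
  have fib: "P.Fb p x = N.Fb p (g x)" if "p \<le> m" "x \<in> points U" for p x
    using that by (simp add: E pull_fibre)
  have D: "P.D x q p v e = N.D (g x) q p (push V g x v) e"
    if "p \<le> q" "q \<le> m" "v \<in> tangent U x" "e \<in> carrier (N.Fb p (g x))" for x q p v e
    unfolding P.D_def N.D_eq path[OF that(1,2)] E[OF le_trans[OF that(1,2)]] E[OF that(2)]
    by (rule pull_hom_connection) (use that in \<open>auto intro: N.B N.K N.f_maps\<close>)
  \<comment> \<open>The derivatives are known to agree only on elements of the fibre and tangent
    vectors, so the induction carries both memberships along.\<close>
  have Ceq: "P.C x I ws e = N.C (g x) I (map (push V g x) ws) e"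
    if "N.index_list I" "length I = Suc (length ws)" "set ws \<subseteq> tangent U x" "e \<in> carrier (N.Fb (hd I) (g x))" for x I ws e
    using that
  proof (induction ws arbitrary: I e)
    case Nil
    then show ?case by (cases I; cases "tl I") auto
  next
    case (Cons w ws)
    then obtain p q J where I: "I = p # q # J" by (cases I; cases "tl I") auto
    with Cons.prems have pq: "p \<le> q" "q \<le> m" "N.index_list (q # J)" by (auto simp: N.index_list_Cons)
    have w: "w \<in> tangent U x" using Cons.prems(3) by simp
    have e: "e \<in> carrier (N.Fb p (g x))" using Cons.prems(4) I by simp
    have "N.D (g x) q p (push V g x w) e \<in> carrier (N.Fb q (g x))"
      by (rule N.D_closed[OF pq(1,2) push_tangent[OF w] e])
    then show ?case
      using Cons.IH[OF pq(3), of "N.D (g x) q p (push V g x w) e"] Cons.prems by (simp add: I D[OF pq(1,2) w e])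
  qed
  have idx: "P.index_list I \<longleftrightarrow> N.index_list I" for I
    by (simp add: P.index_list_def N.index_list_def)
  have Tr: "P.Tr x I ws = N.Tr (g x) I (map (push V g x) ws)"
    if I: "N.index_list I" "length I = Suc (length ws)" "set ws \<subseteq> tangent U x" and x: "x \<in> points U" for x I ws
  proof -
    have b: "hd I \<le> last I" "last I \<le> m" "hd I \<le> m" using N.index_list_hd_last[OF I(1)] N.index_list_bounds[OF I(1)] by auto
    show ?thesis
      unfolding P.Tr_def N.Tr_def fib[OF b(3) x] path[OF b(1,2)] restrict_apply'[OF x]
      by (rule vtrace_cong) (simp only: Ceq[OF I])
  qed
  have form: "ch_form U (Es', fs') I x vs = pull_form U V g (ch_form V (Es, fs) I) x vs"
    if I: "I \<in> simplex_gens m l" for I l x vs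
  proof (cases "x \<in> points U \<and> length vs = l \<and> set vs \<subseteq> tangent U x")
    case True
    then have x: "x \<in> points U" and vs: "length vs = l" "set vs \<subseteq> tangent U x" by auto
    have pv: "length (map (push V g x) vs) = l" "set (map (push V g x) vs) \<subseteq> tangent V (g x)"
      using vs push_tangent by auto
    have "ch_form U (Es', fs') I x vs = (\<Sum>\<pi> | \<pi> permutes {..<l}. of_int (sign \<pi>) * P.Tr x I (rev (permute_list \<pi> vs)))"
      by (rule P.ch_form_eq[OF I x vs])
    also have "\<dots> = (\<Sum>\<pi> | \<pi> permutes {..<l}. of_int (sign \<pi>) * N.Tr (g x) I (rev (permute_list \<pi> (map (push V g x) vs))))"
    proof (rule sum.cong[OF refl])
      fix \<pi> assume "\<pi> \<in> {\<pi>. \<pi> permutes {..<l}}"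
      then have \<pi>: "\<pi> permutes {..<length vs}" using vs by simp
      have "P.Tr x I (rev (permute_list \<pi> vs)) = N.Tr (g x) I (map (push V g x) (rev (permute_list \<pi> vs)))"
        by (rule Tr[OF N.gens_index_list[OF I] _ _ x]) (use I vs set_permute_list[OF \<pi>] in \<open>auto simp: simplex_gens_def\<close>)
      then show "of_int (sign \<pi>) * P.Tr x I (rev (permute_list \<pi> vs)) =
          of_int (sign \<pi>) * N.Tr (g x) I (rev (permute_list \<pi> (map (push V g x) vs)))"
        by (simp add: permute_list_map[OF \<pi>] rev_map)
    qed
    also have "\<dots> = ch_form V (Es, fs) I (g x) (map (push V g x) vs)"
      by (rule N.ch_form_eq[OF I g_points[OF x] pv, symmetric])
    finally show ?thesis using x vs by (simp add: pull_form_def)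
  next
    case False
    have "length I = Suc l" using I by (simp add: simplex_gens_def)
    then show ?thesis using False by (auto simp: ch_form_def pull_form_def)
  qed
  show ?thesis
    unfolding s
  proof (rule ext)
    fix l
    show "Ch U m (Es', fs') l = pmap Omega U V g m (Ch V m (Es, fs)) l"
    proof (rule extensionalityI)
      fix c assume c: "c \<in> carrier (cgrp (simplex_complex m) l)"
      have "lin_ext (\<lambda>I. ch_form U (Es', fs') I x vs) c = lin_ext (\<lambda>I. pull_form U V g (ch_form V (Es, fs) I) x vs) c" for x vs
        unfolding lin_ext_def
        by (rule sum.cong[OF refl]) (use c form in \<open>auto simp: cgrp_simplex subset_iff\<close>)
      \<comment> \<open>The case distinction in \<open>pull_form\<close> does not involve the
        generator, hence it commutes with integral combinations.\<close>
      then have "lin_ext (\<lambda>I. ch_form U (Es', fs') I x vs) c =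
          pull_form U V g (\<lambda>x vs. lin_ext (\<lambda>I. ch_form V (Es, fs) I x vs) c) x vs" for x vs
        by (cases "x \<in> points U \<and> set vs \<subseteq> tangent U x")
          (simp_all only: pull_form_def lin_ext_def if_True if_False mult_zero_right sum.neutral_const simp_thms)
      then show "Ch U m (Es', fs') l c = pmap Omega U V g m (Ch V m (Es, fs)) l c"
        using c unfolding P.Ch_apply[OF c] Omega_pmap
        by (auto simp: N.Ch_apply[OF c] pull_uform_def fun_eq_iff pull_form_zero)
    qed (simp_all add: Ch_def Omega_pmap)
  qed
qed

lemma HVB_simplex_chain:
  fixes \<sigma> :: "('a, 'v) hvb_simplex"
  assumes "complex_manifold U" "\<sigma> \<in> simplices (pobj HVB U) k"
  obtains Es fs where "\<sigma> = (Es, fs)" "hvb_chain U k Es fs"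
proof -
  interpret cmanifold U using assms(1) by unfold_locales
  obtain Es fs where s: "\<sigma> = (Es, fs)" by (cases \<sigma>)
  have "hvb_chain U k Es fs"
    using hvb_category assms(2) by unfold_locales (simp_all add: s HVB_def)
  then show ?thesis using s that by blast
qed

theorem theorem2p4:
  shows "(\<forall>(U :: 'a cman) k. \<forall>\<sigma> \<in> simplices (pobj (HVB :: ('a, ('a, 'v) hvb_simplex) presheaf) U) k.
            complex_manifold U \<longrightarrow>
            Ch U k \<sigma> \<in> chain_maps (simplex_complex k) (uform_complex U)) \<and>
         simplicial_presheaf_map (HVB :: ('a, ('a, 'v) hvb_simplex) presheaf) Omega Ch"
proof -
  have chain: "Ch U k \<sigma> \<in> chain_maps (simplex_complex k) (uform_complex U)"
    if U: "complex_manifold U" and \<sigma>: "\<sigma> \<in> simplices (pobj HVB U) k" for U :: "'a cman" and k and \<sigma> :: "('a, 'v) hvb_simplex"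
  proof -
    obtain Es fs where s: "\<sigma> = (Es, fs)" "hvb_chain U k Es fs" using HVB_simplex_chain[OF U \<sigma>] .
    then show ?thesis using hvb_chain.Ch_chain_map by blast
  qed
  have simplicial: "simplicial_map (pobj HVB U) (pobj Omega U) (Ch U :: nat \<Rightarrow> ('a, 'v) hvb_simplex \<Rightarrow> _)"
    if U: "complex_manifold U" for U :: "'a cman"
    unfolding simplicial_map_def
  proof (intro conjI allI ballI funcsetI)
    show "Ch U k \<sigma> \<in> simplices (pobj Omega U) k" if "\<sigma> \<in> simplices (pobj HVB U) k" for k and \<sigma> :: "('a, 'v) hvb_simplex"
      using chain[OF U that] by (simp only: Omega_simplices)
    fix k m \<theta> and \<sigma> :: "('a, 'v) hvb_simplex"
    assume \<theta>: "\<theta> \<in> ord_maps k m" and \<sigma>: "\<sigma> \<in> simplices (pobj HVB U) m"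
    obtain Es fs where s: "\<sigma> = (Es, fs)" "hvb_chain U m Es fs" using HVB_simplex_chain[OF U \<sigma>] .
    show "Ch U k (sact (pobj HVB U) k m \<theta> \<sigma>) = sact (pobj Omega U) k m \<theta> (Ch U m \<sigma>)"
      using hvb_chain.Ch_sact[OF s(2) \<theta>] by (simp add: HVB_def Omega_sact s(1))
  qed
  have natural: "Ch U k (pmap HVB U V g k \<sigma>) = pmap Omega U V g k (Ch V k \<sigma>)"
    if g: "g \<in> hol_maps U V" and UV: "complex_manifold U" "complex_manifold V" and \<sigma>: "\<sigma> \<in> simplices (pobj HVB V) k"
    for U V :: "'a cman" and g k and \<sigma> :: "('a, 'v) hvb_simplex"
  proof -
    obtain Es fs where s: "\<sigma> = (Es, fs)" "hvb_chain V k Es fs" using HVB_simplex_chain[OF UV(2) \<sigma>] .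
    have "cman_map U V g" using g UV by unfold_locales
    from Ch_pull[OF this s(2)] show ?thesis by (simp only: s(1))
  qed
  show ?thesis
    unfolding simplicial_presheaf_map_def
    using chain simplicial natural simplicial_presheaf_HVB simplicial_presheaf_Omega by blast
qed

end
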